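(* Let $f\in L^1(\mathbb{R}^N)\cap L^\infty(\mathbb{R}^N)$. For $\varepsilon>0$ let $J_\varepsilon=\varepsilon^{-N}J(\cdot/\varepsilon)$ and let $u^\varepsilon$ be the solution of $$\partial_t u^\varepsilon=\frac1{\varepsilon^2}\big(J_\varepsilon*v^\varepsilon-v^\varepsilon\big),\qquad v^\varepsilon=(u^\varepsilon-1)_+,\qquad u^\varepsilon(\cdot,0)=f .$$ Then $u^\varepsilon$ converges, as $\varepsilon\to0$, in $L^1_{\rm loc}(\mathbb{R}^N\times[0,\infty))$ to the unique weak solution $u$ of the local Stefan problem $$\partial_t u=\frac{m_2}{2}\,\Delta (u-1)_+,\qquad u(\cdot,0)=f,\qquad\text{where } m_2=\int_{\mathbb{R}^N}|z|^2J(z)\,dz .$$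
   Context: Standing assumptions: $J:\mathbb{R}^N\to[0,\infty)$ is continuous, compactly supported, radially symmetric, and $\int_{\mathbb{R}^N}J=1$. Here $*$ is convolution in space and $s_+=\max\{s,0\}$. The solution $u^\varepsilon$ is understood as the $L^1$-solution, i.e. the unique $u^\varepsilon\in C([0,\infty);L^1(\mathbb{R}^N))$ such that for every $t>0$, $u^\varepsilon(t)=f+\varepsilon^{-2}\int_0^t(J_\varepsilon*v^\varepsilon(s)-v^\varepsilon(s))\,ds$ with $v^\varepsilon=(u^\varepsilon-1)_+$ a.e. That $u$ is a weak solution of the local problem means that for every test function $\phi\in C_c^\infty(\mathbb{R}^N\times[0,\infty))$, $$\int_{\mathbb{R}^N}u(t)\phi(t)=\int_{\mathbb{R}^N}f\phi(0)+\int_0^t\!\int_{\mathbb{R}^N}\phi_t\,u+\frac{m_2}{2}\int_0^t\!\int_{\mathbb{R}^N}(\Delta\phi)\,(u-1)_+ .$$ Uniqueness of the weak solution is a known result.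
   Formalization: The coefficient m_2/2 of the local Stefan problem is replaced by m_2/(2N), with m_2 the integral of |z|^2 J(z); the two agree for N=1, while for N≥2 the coefficient m_2/2 is false as soon as f>1 on a set of positive measure. *)

theory Defs
  imports "HOL-Analysis.Analysis"
begin

section \<open>Nonlocal and local Stefan problems\<close>

text \<open>The space \<open>\<real>\<^sup>N\<close> is an arbitrary type \<open>'a\<close> of class \<open>euclidean_space\<close>, with
  \<open>N = DIM('a)\<close>. A function of space and time is written \<open>u t x\<close>; only times \<open>t \<ge> 0\<close> matter.
  Elements of \<open>L\<^sup>1\<close> are given by Borel representatives, with equality almost everywhere.\<close>

definition radial_kernel :: "('a::euclidean_space \<Rightarrow> real) \<Rightarrow> bool" where
  "radial_kernel J \<longleftrightarrow>
     (\<forall>x. 0 \<le> J x) \<and>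
     continuous_on UNIV J \<and>
     compact (closure {x. J x \<noteq> 0}) \<and>
     (\<forall>x y. norm x = norm y \<longrightarrow> J x = J y) \<and>
     (\<integral>x. J x \<partial>lborel) = 1"

definition rescale :: "real \<Rightarrow> ('a::euclidean_space \<Rightarrow> real) \<Rightarrow> 'a \<Rightarrow> real" where
  "rescale \<epsilon> J = (\<lambda>x. J (x /\<^sub>R \<epsilon>) / \<epsilon> ^ DIM('a))"

definition second_moment :: "('a::euclidean_space \<Rightarrow> real) \<Rightarrow> real" where
  "second_moment J = (\<integral>z. (norm z)\<^sup>2 * J z \<partial>lborel)"

definition convolution ::
    "('a::euclidean_space \<Rightarrow> real) \<Rightarrow> ('a \<Rightarrow> real) \<Rightarrow> 'a \<Rightarrow> real" where
  "convolution J g = (\<lambda>x. \<integral>y. J (x - y) * g y \<partial>lborel)"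

definition stefan_pos :: "real \<Rightarrow> real" where
  "stefan_pos s = max (s - 1) 0"

definition ess_bounded :: "('a::euclidean_space \<Rightarrow> real) \<Rightarrow> bool" where
  "ess_bounded g \<longleftrightarrow> g \<in> borel_measurable lborel \<and> (\<exists>M. AE x in lborel. \<bar>g x\<bar> \<le> M)"

text \<open>\<open>u \<in> C([0,\<infinity>); L\<^sup>1)\<close>. The representatives \<open>u t\<close> are chosen jointly measurable in space and
  time, which is always possible and is needed for the space-time integrals below.\<close>

definition continuous_L1 :: "(real \<Rightarrow> 'a::euclidean_space \<Rightarrow> real) \<Rightarrow> bool" where
  "continuous_L1 u \<longleftrightarrow>
     set_borel_measurable lborel (UNIV \<times> {0..}) (\<lambda>(x, t). u t x) \<and>
     (\<forall>t\<ge>0. integrable lborel (u t)) \<and>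
     (\<forall>s\<ge>0. ((\<lambda>t. \<integral>x. \<bar>u t x - u s x\<bar> \<partial>lborel) \<longlongrightarrow> 0) (at s within {0..}))"

text \<open>The \<open>L\<^sup>1\<close>-valued time integral is evaluated pointwise; for almost every \<open>x\<close> the integrand is
  integrable on \<open>[0,t]\<close> by Fubini, and the value agrees a.e. with the Bochner integral in \<open>L\<^sup>1\<close>.\<close>

definition nonlocal_stefan_solution ::
    "('a::euclidean_space \<Rightarrow> real) \<Rightarrow> real \<Rightarrow> ('a \<Rightarrow> real) \<Rightarrow> (real \<Rightarrow> 'a \<Rightarrow> real) \<Rightarrow> bool" where
  "nonlocal_stefan_solution J \<epsilon> f u \<longleftrightarrow>
     continuous_L1 u \<and>
     (\<forall>t>0. AE x in lborel.
        u t x = f x + (1 / \<epsilon>\<^sup>2) *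
          (LBINT s:{0..t}. convolution (rescale \<epsilon> J) (\<lambda>y. stefan_pos (u s y)) x
                             - stefan_pos (u s x)))"

definition dir_deriv ::
    "'b::euclidean_space \<Rightarrow> ('b \<Rightarrow> real) \<Rightarrow> 'b \<Rightarrow> real" where
  "dir_deriv b \<phi> = (\<lambda>z. frechet_derivative \<phi> (at z) b)"

primrec C_k :: "nat \<Rightarrow> ('b::euclidean_space \<Rightarrow> real) \<Rightarrow> bool" where
  "C_k 0 \<phi> \<longleftrightarrow> continuous_on UNIV \<phi>"
| "C_k (Suc k) \<phi> \<longleftrightarrow> (\<forall>z. \<phi> differentiable (at z)) \<and> (\<forall>b\<in>Basis. C_k k (dir_deriv b \<phi>))"

text \<open>Test functions in \<open>C\<^sub>c\<^sup>\<infinity>(\<real>\<^sup>N \<times> [0,\<infinity>))\<close> are the restrictions to \<open>t \<ge> 0\<close> of functions in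
  \<open>C\<^sub>c\<^sup>\<infinity>(\<real>\<^sup>N \<times> \<real>)\<close>; in particular they need not vanish at \<open>t = 0\<close>.\<close>

definition test_function :: "('b::euclidean_space \<Rightarrow> real) \<Rightarrow> bool" where
  "test_function \<phi> \<longleftrightarrow> (\<forall>k. C_k k \<phi>) \<and> compact (closure {z. \<phi> z \<noteq> 0})"

definition time_deriv :: "('a::euclidean_space \<times> real \<Rightarrow> real) \<Rightarrow> 'a \<times> real \<Rightarrow> real" where
  "time_deriv \<phi> = dir_deriv (0, 1) \<phi>"

definition laplacian :: "('a::euclidean_space \<times> real \<Rightarrow> real) \<Rightarrow> 'a \<times> real \<Rightarrow> real" where
  "laplacian \<phi> = (\<lambda>z. \<Sum>b\<in>Basis. dir_deriv (b, 0) (dir_deriv (b, 0) \<phi>) z)"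

text \<open>Weak solutions of \<open>\<partial>\<^sub>t u = c \<Delta> (u - 1)\<^sub>+\<close>, \<open>u(\<cdot>,0) = f\<close>, in the class
  \<open>C([0,\<infinity>); L\<^sup>1(\<real>\<^sup>N)) \<inter> L\<^sup>\<infinity>(\<real>\<^sup>N \<times> (0,T))\<close> for all \<open>T\<close>.\<close>

definition weak_stefan_solution ::
    "real \<Rightarrow> ('a::euclidean_space \<Rightarrow> real) \<Rightarrow> (real \<Rightarrow> 'a \<Rightarrow> real) \<Rightarrow> bool" where
  "weak_stefan_solution c f u \<longleftrightarrow>
     continuous_L1 u \<and>
     (\<forall>T>0. \<exists>M. \<forall>t\<in>{0..T}. AE x in lborel. \<bar>u t x\<bar> \<le> M) \<and>
     (\<forall>\<phi>. test_function \<phi> \<longrightarrow> (\<forall>t\<ge>0.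
        (\<integral>x. u t x * \<phi> (x, t) \<partial>lborel) =
          (\<integral>x. f x * \<phi> (x, 0) \<partial>lborel)
          + (LBINT s:{0..t}. \<integral>x. time_deriv \<phi> (x, s) * u s x \<partial>lborel)
          + c * (LBINT s:{0..t}. \<integral>x. laplacian \<phi> (x, s) * stefan_pos (u s x) \<partial>lborel)))"

text \<open>Convergence in \<open>L\<^sup>1\<^sub>l\<^sub>o\<^sub>c(\<real>\<^sup>N \<times> [0,\<infinity>))\<close> as \<open>\<epsilon> \<rightarrow> 0\<^sup>+\<close>. Compact sets may touch \<open>t = 0\<close>. The
  nonnegative integral is used because it is not \<open>0\<close> on non-integrable functions.\<close>

definition converges_L1_loc ::
    "(real \<Rightarrow> real \<Rightarrow> 'a::euclidean_space \<Rightarrow> real) \<Rightarrow> (real \<Rightarrow> 'a \<Rightarrow> real) \<Rightarrow> bool" where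
  "converges_L1_loc U u \<longleftrightarrow>
     (\<forall>K. compact K \<and> K \<subseteq> UNIV \<times> {0..} \<longrightarrow>
        ((\<lambda>\<epsilon>. \<integral>\<^sup>+z\<in>K. ennreal \<bar>U \<epsilon> (snd z) (fst z) - u (snd z) (fst z)\<bar> \<partial>lborel) \<longlongrightarrow> 0)
          (at_right 0))"

text \<open>The diffusivity. For radial \<open>J\<close> one has
  \<open>\<integral> z\<^sub>i z\<^sub>j J(z) dz = \<delta>\<^sub>i\<^sub>j m\<^sub>2 / N\<close> with \<open>m\<^sub>2 = \<integral> |z|\<^sup>2 J(z) dz\<close>, so Taylor expansion gives
  \<open>\<epsilon>\<^sup>-\<^sup>2 (J\<^sub>\<epsilon> * \<phi> - \<phi>) \<rightarrow> (m\<^sub>2 / (2 N)) \<Delta>\<phi>\<close>. The coefficient is often quoted as \<open>m\<^sub>2 / 2\<close>; this is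
  the same number for \<open>N = 1\<close>, while for \<open>N \<ge> 2\<close> it requires reading \<open>m\<^sub>2\<close> as the second moment
  \<open>\<integral> z\<^sub>i\<^sup>2 J(z) dz\<close> in one coordinate direction.\<close>

definition diffusivity :: "('a::euclidean_space \<Rightarrow> real) \<Rightarrow> real" where
  "diffusivity J = second_moment J / (2 * real DIM('a))"

end

theory Submission
  imports Defs
begin

text \<open>
  Write \<open>v = (u - 1)\<^sub>+\<close> and let \<open>A\<^sub>\<epsilon>\<close> be the nonlocal diffusion operator. Two solutions with generators
  \<open>A\<close> and \<open>A'\<close> and the same initial datum satisfy \<open>u - u' = A (V - V') + (A - A') V'\<close>, where \<open>V\<close> and \<open>V'\<close>
  are the time primitives of \<open>v\<close> and \<open>v'\<close>. Testing with \<open>v - v'\<close>, the time derivative of \<open>V - V'\<close>, makes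
  the first term nonpositive, because \<open>A\<^sub>\<epsilon>\<close> is symmetric and negative, while
  \<open>(u - u') (v - v') \<ge> (v - v')\<^sup>2\<close>. The second term is small after mollification in space: on a fixed
  mollifier \<open>A\<^sub>\<epsilon>\<close> converges in \<open>L\<^sup>1\<close> to a multiple of the Laplacian, and the error of mollifying is uniform
  in \<open>\<epsilon>\<close>, because the \<open>L\<^sup>1\<close> contraction bounds the translates of \<open>u\<^sup>\<epsilon>\<close> by those of \<open>f\<close>. Taking for both
  solutions members of the family shows that it is Cauchy, which gives existence and convergence;
  taking one of them to be an arbitrary weak solution of the local problem gives uniqueness.
\<close>

text \<open>The energy argument controls only \<open>v - v'\<close>, which does not see
  \<open>u\<close> below the level 1. Closeness of \<open>u\<close> comes back from the equation:
  mollified at a scale \<open>d2\<close>, \<open>u - u'\<close> is the time integral of a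
  square-integrable kernel convolved with \<open>v - v'\<close>, plus a small remainder. It is
  therefore small at every point once \<open>v - v'\<close> is small in \<open>L^2\<close> of
  space-time. The norm of this kernel depends on \<open>d2\<close>, so two scales are needed:
  \<open>d2\<close> is fixed by the wanted accuracy, and only then is the scale \<open>d1\<close> of
  the energy estimate chosen. The pointwise bound cannot be integrated over the whole space, hence
  local convergence.

  Mollification is forced because \<open>v'\<close> is merely bounded and integrable, so that
  \<open>(A - A') v'\<close> need not be small; moved onto the mollifier, the difference of the
  operators acts on a smooth function. An arbitrary weak solution comes with no contraction
  estimate; its mollification error is controlled by continuity of translations in
  \<open>L^1\<close> and dominated convergence in time.\<close>

lemma nn_integral_lborel_affine:
  fixes g :: "'a::euclidean_space \<Rightarrow> ennreal"
  assumes [measurable]: "g \<in> borel_measurable borel" and "c \<noteq> 0"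
  shows "(\<integral>\<^sup>+x. g x \<partial>lborel) = ennreal (\<bar>c\<bar> ^ DIM('a)) * (\<integral>\<^sup>+x. g (t + c *\<^sub>R x) \<partial>lborel)"
  by (subst lborel_affine[OF \<open>c \<noteq> 0\<close>, of t])
     (simp add: nn_integral_density nn_integral_distr nn_integral_cmult)

lemma integrable_lborel_affine:
  fixes g :: "'a::euclidean_space \<Rightarrow> real"
  assumes "integrable lborel g" and "c \<noteq> 0"
  shows "integrable lborel (\<lambda>x. g (t + c *\<^sub>R x))"
proof -
  have [measurable]: "g \<in> borel_measurable borel" using assms(1) by simp
  have "(\<integral>\<^sup>+x. norm (g x) \<partial>lborel) < \<infinity>"
    using assms by (simp add: integrable_iff_bounded)
  then have "(\<integral>\<^sup>+x. norm (g (t + c *\<^sub>R x)) \<partial>lborel) < \<infinity>"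
    using nn_integral_lborel_affine[of "\<lambda>x. ennreal (norm (g x))" c t] assms(2)
    by (auto simp: ennreal_mult_less_top less_top[symmetric] ennreal_mult_eq_top_iff)
  then show ?thesis by (simp add: integrable_iff_bounded)
qed

lemma integral_lborel_affine:
  fixes g :: "'a::euclidean_space \<Rightarrow> real"
  assumes [measurable]: "g \<in> borel_measurable borel" and "c \<noteq> 0"
  shows "(\<integral>x. g x \<partial>lborel) = \<bar>c\<bar> ^ DIM('a) * (\<integral>x. g (t + c *\<^sub>R x) \<partial>lborel)"
  by (subst lborel_affine[OF \<open>c \<noteq> 0\<close>, of t])
     (simp add: integral_density integral_distr)

lemma AE_lborel_affine:
  fixes P :: "'a::euclidean_space \<Rightarrow> bool"
  assumes "AE x in lborel. P x" and "c \<noteq> 0"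
  shows "AE x in lborel. P (t + c *\<^sub>R x)"
proof -
  obtain N where N: "{x \<in> space lborel. \<not> P x} \<subseteq> N" "N \<in> null_sets lborel"
    by (rule AE_E3[OF assms(1)]) (rule that, auto)
  then have [measurable]: "N \<in> sets borel" by auto
  have "0 = (\<integral>\<^sup>+x. indicator N x \<partial>lborel)" using N by auto
  also have "\<dots> = ennreal (\<bar>c\<bar> ^ DIM('a)) * (\<integral>\<^sup>+x. indicator N (t + c *\<^sub>R x) \<partial>lborel)"
    by (rule nn_integral_lborel_affine) (use assms in auto)
  finally have "(\<integral>\<^sup>+x. indicator N (t + c *\<^sub>R x) \<partial>(lborel::'a measure)) = 0"
    using assms(2) by auto
  then have "AE x in lborel. indicator N (t + c *\<^sub>R x) = (0::ennreal)"
    by (subst (asm) nn_integral_0_iff_AE) auto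
  then show ?thesis
    by eventually_elim (use N(1) in \<open>auto simp: indicator_def split: if_splits\<close>)
qed

lemma nn_integral_lborel_shift:
  fixes g :: "'a::euclidean_space \<Rightarrow> ennreal"
  assumes "g \<in> borel_measurable borel"
  shows "(\<integral>\<^sup>+x. g (x + c) \<partial>lborel) = (\<integral>\<^sup>+x. g x \<partial>lborel)"
    and "(\<integral>\<^sup>+x. g (x - c) \<partial>lborel) = (\<integral>\<^sup>+x. g x \<partial>lborel)"
    and "(\<integral>\<^sup>+x. g (c - x) \<partial>lborel) = (\<integral>\<^sup>+x. g x \<partial>lborel)"
  using nn_integral_lborel_affine[OF assms, of 1 c] nn_integral_lborel_affine[OF assms, of 1 "-c"]
    nn_integral_lborel_affine[OF assms, of "-1" c] by (auto simp: add.commute)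

lemma integral_lborel_shift:
  fixes g :: "'a::euclidean_space \<Rightarrow> real"
  assumes "g \<in> borel_measurable borel"
  shows "(\<integral>x. g (x + c) \<partial>lborel) = (\<integral>x. g x \<partial>lborel)"
    and "(\<integral>x. g (x - c) \<partial>lborel) = (\<integral>x. g x \<partial>lborel)"
    and "(\<integral>x. g (c - x) \<partial>lborel) = (\<integral>x. g x \<partial>lborel)"
  using integral_lborel_affine[OF assms, of 1 c] integral_lborel_affine[OF assms, of 1 "-c"]
    integral_lborel_affine[OF assms, of "-1" c] by (auto simp: add.commute)

lemma integrable_lborel_shift:
  fixes g :: "'a::euclidean_space \<Rightarrow> real"
  assumes "integrable lborel g"
  shows "integrable lborel (\<lambda>x. g (x + c))"
    and "integrable lborel (\<lambda>x. g (x - c))"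
    and "integrable lborel (\<lambda>x. g (c - x))"
  using integrable_lborel_affine[OF assms, of 1 c] integrable_lborel_affine[OF assms, of 1 "-c"]
    integrable_lborel_affine[OF assms, of "-1" c] by (auto simp: add.commute)

lemma AE_lborel_shift:
  fixes P :: "'a::euclidean_space \<Rightarrow> bool"
  assumes "AE x in lborel. P x"
  shows "AE x in lborel. P (x + c)" and "AE x in lborel. P (x - c)" and "AE x in lborel. P (c - x)"
  using AE_lborel_affine[OF assms, of 1 c] AE_lborel_affine[OF assms, of 1 "-c"]
    AE_lborel_affine[OF assms, of "-1" c] by (auto simp: add.commute)

lemma (in pair_sigma_finite) pair_integrableI:
  fixes f :: "'a \<Rightarrow> 'b \<Rightarrow> real"
  assumes [measurable]: "case_prod f \<in> borel_measurable (M1 \<Otimes>\<^sub>M M2)"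
    and "(\<integral>\<^sup>+x. \<integral>\<^sup>+y. ennreal \<bar>f x y\<bar> \<partial>M2 \<partial>M1) < \<infinity>"
  shows "integrable (M1 \<Otimes>\<^sub>M M2) (case_prod f)"
proof (rule integrableI_bounded)
  have "(\<integral>\<^sup>+z. norm (case_prod f z) \<partial>(M1 \<Otimes>\<^sub>M M2)) = (\<integral>\<^sup>+x. \<integral>\<^sup>+y. ennreal \<bar>f x y\<bar> \<partial>M2 \<partial>M1)"
    by (subst M2.nn_integral_fst[symmetric]) (auto simp: split_beta')
  then show "(\<integral>\<^sup>+z. norm (case_prod f z) \<partial>(M1 \<Otimes>\<^sub>M M2)) < \<infinity>" using assms(2) by simp
qed simp

lemma abs_integral_le_nn_integral:
  fixes f :: "'a \<Rightarrow> real"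
  shows "ennreal \<bar>\<integral>x. f x \<partial>M\<bar> \<le> (\<integral>\<^sup>+x. ennreal \<bar>f x\<bar> \<partial>M)"
  using integral_norm_bound_ennreal[of M f]
  by (cases "integrable M f") (auto simp: not_integrable_integral_eq)

lemma abs_integral_le_bound:
  fixes f :: "'a \<Rightarrow> real"
  assumes "(\<integral>\<^sup>+x. ennreal \<bar>f x\<bar> \<partial>M) \<le> ennreal B" "0 \<le> B"
  shows "\<bar>\<integral>x. f x \<partial>M\<bar> \<le> B"
  using order_trans[OF abs_integral_le_nn_integral assms(1)] assms(2) by simp

lemma nn_integral_abs_eq:
  fixes f :: "'a \<Rightarrow> real"
  assumes "integrable M f"
  shows "(\<integral>\<^sup>+x. ennreal \<bar>f x\<bar> \<partial>M) = ennreal (\<integral>x. \<bar>f x\<bar> \<partial>M)"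
  using assms by (intro nn_integral_eq_integral) auto

lemma integrable_real_iff:
  fixes f :: "'a \<Rightarrow> real"
  shows "integrable M f \<longleftrightarrow> f \<in> borel_measurable M \<and> (\<integral>\<^sup>+x. ennreal \<bar>f x\<bar> \<partial>M) < \<infinity>"
  by (simp add: integrable_iff_bounded)

lemma integrable_mult_AE_bounded:
  fixes f g :: "'a \<Rightarrow> real"
  assumes "integrable M f" and [measurable]: "g \<in> borel_measurable M" and "AE x in M. \<bar>g x\<bar> \<le> B"
  shows "integrable M (\<lambda>x. f x * g x)" "integrable M (\<lambda>x. g x * f x)"
proof -
  have [measurable]: "f \<in> borel_measurable M" using assms by simp
  show "integrable M (\<lambda>x. f x * g x)"
  proof (rule Bochner_Integration.integrable_bound)
    show "integrable M (\<lambda>x. B * f x)" using assms by simp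
    show "AE x in M. norm (f x * g x) \<le> norm (B * f x)"
      using assms(3)
    proof eventually_elim
      case (elim x)
      then show ?case using mult_mono[of "\<bar>g x\<bar>" "\<bar>B\<bar>" "\<bar>f x\<bar>" "\<bar>f x\<bar>"] by (auto simp: abs_mult mult.commute)
    qed
  qed simp
  then show "integrable M (\<lambda>x. g x * f x)" by (simp add: mult.commute)
qed

subsection \<open>Convolution\<close>

text \<open>Both the section \<open>u (t z)\<close> and the point \<open>g z\<close> move with
  \<open>z\<close>, so that a single rule covers fluxes in space-time as well as sections at a fixed
  time or point.\<close>

lemma convolution_measurable [measurable]:
  fixes K :: "'a::euclidean_space \<Rightarrow> real" and u :: "'b \<Rightarrow> 'a \<Rightarrow> real"
  assumes [measurable]: "K \<in> borel_measurable borel" "case_prod u \<in> borel_measurable (M \<Otimes>\<^sub>M borel)"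
    "g \<in> measurable N borel" "t \<in> measurable N M"
  shows "(\<lambda>z. convolution K (u (t z)) (g z)) \<in> borel_measurable N"
  unfolding convolution_def by measurable

lemma convolution_measurable' [measurable]:
  fixes K g :: "'a::euclidean_space \<Rightarrow> real"
  assumes [measurable]: "K \<in> borel_measurable borel" "g \<in> borel_measurable borel"
  shows "convolution K g \<in> borel_measurable borel"
  unfolding convolution_def by measurable

lemma convolution_alt:
  fixes K g :: "'a::euclidean_space \<Rightarrow> real"
  assumes [measurable]: "K \<in> borel_measurable borel" "g \<in> borel_measurable borel"
  shows "convolution K g x = (\<integral>y. K y * g (x - y) \<partial>lborel)"
proof -
  have "convolution K g x = (\<integral>y. (\<lambda>y. K (x - y) * g y) (x - y) \<partial>lborel)"
    unfolding convolution_def by (subst integral_lborel_shift) auto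
  then show ?thesis by simp
qed

text \<open>Tonelli and translation invariance. Working in \<open>ennreal\<close> yields
  integrability of the two-variable integrand together with Young's inequality in
  \<open>L^1\<close>.\<close>

lemma nn_integral_convolution_le:
  fixes K g :: "'a::euclidean_space \<Rightarrow> real"
  assumes [measurable]: "K \<in> borel_measurable borel" "g \<in> borel_measurable borel"
  shows "(\<integral>\<^sup>+x. \<integral>\<^sup>+y. ennreal \<bar>K (x - y) * g y\<bar> \<partial>lborel \<partial>lborel) = (\<integral>\<^sup>+x. ennreal \<bar>K x\<bar> \<partial>lborel) * (\<integral>\<^sup>+x. ennreal \<bar>g x\<bar> \<partial>lborel)"
    and "(\<integral>\<^sup>+x. ennreal \<bar>convolution K g x\<bar> \<partial>lborel) \<le> (\<integral>\<^sup>+x. ennreal \<bar>K x\<bar> \<partial>lborel) * (\<integral>\<^sup>+x. ennreal \<bar>g x\<bar> \<partial>lborel)"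
proof -
  have "(\<integral>\<^sup>+x. \<integral>\<^sup>+y. ennreal \<bar>K (x - y) * g y\<bar> \<partial>lborel \<partial>lborel) = (\<integral>\<^sup>+y. \<integral>\<^sup>+x. ennreal \<bar>K (x - y)\<bar> * ennreal \<bar>g y\<bar> \<partial>lborel \<partial>lborel)"
    by (subst lborel_pair.Fubini') (auto simp: abs_mult ennreal_mult)
  also have "\<dots> = (\<integral>\<^sup>+y. (\<integral>\<^sup>+x. ennreal \<bar>K x\<bar> \<partial>lborel) * ennreal \<bar>g y\<bar> \<partial>lborel)"
    using nn_integral_lborel_shift(2)[of "\<lambda>x. ennreal \<bar>K x\<bar>"] by (simp add: nn_integral_multc)
  also have "\<dots> = (\<integral>\<^sup>+x. ennreal \<bar>K x\<bar> \<partial>lborel) * (\<integral>\<^sup>+x. ennreal \<bar>g x\<bar> \<partial>lborel)"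
    by (simp add: nn_integral_cmult)
  finally show *: "(\<integral>\<^sup>+x. \<integral>\<^sup>+y. ennreal \<bar>K (x - y) * g y\<bar> \<partial>lborel \<partial>lborel) = (\<integral>\<^sup>+x. ennreal \<bar>K x\<bar> \<partial>lborel) * (\<integral>\<^sup>+x. ennreal \<bar>g x\<bar> \<partial>lborel)" .
  have "(\<integral>\<^sup>+x. ennreal \<bar>convolution K g x\<bar> \<partial>lborel) \<le> (\<integral>\<^sup>+x. \<integral>\<^sup>+y. ennreal \<bar>K (x - y) * g y\<bar> \<partial>lborel \<partial>lborel)"
    unfolding convolution_def by (intro nn_integral_mono abs_integral_le_nn_integral)
  then show "(\<integral>\<^sup>+x. ennreal \<bar>convolution K g x\<bar> \<partial>lborel) \<le> (\<integral>\<^sup>+x. ennreal \<bar>K x\<bar> \<partial>lborel) * (\<integral>\<^sup>+x. ennreal \<bar>g x\<bar> \<partial>lborel)"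
    using * by simp
qed

lemma integrable_convolution_pair:
  fixes K g :: "'a::euclidean_space \<Rightarrow> real"
  assumes "integrable lborel K" "integrable lborel g"
  shows "integrable (lborel \<Otimes>\<^sub>M lborel) (\<lambda>(x, y). K (x - y) * g y)"
proof -
  have [measurable]: "K \<in> borel_measurable borel" "g \<in> borel_measurable borel" using assms by auto
  show ?thesis
    by (rule lborel_pair.pair_integrableI)
       (use assms in \<open>auto simp: nn_integral_convolution_le integrable_real_iff ennreal_mult_less_top\<close>)
qed

lemma convolution_integrable [intro]:
  fixes K g :: "'a::euclidean_space \<Rightarrow> real"
  assumes "integrable lborel K" "integrable lborel g"
  shows "integrable lborel (convolution K g)"
  using lborel_pair.integrable_fst'[OF integrable_convolution_pair[OF assms]]
  unfolding convolution_def by simp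

lemma convolution_L1_le:
  fixes K g :: "'a::euclidean_space \<Rightarrow> real"
  assumes "integrable lborel K" "integrable lborel g"
  shows "(\<integral>x. \<bar>convolution K g x\<bar> \<partial>lborel) \<le> (\<integral>x. \<bar>K x\<bar> \<partial>lborel) * (\<integral>x. \<bar>g x\<bar> \<partial>lborel)"
proof -
  have [measurable]: "K \<in> borel_measurable borel" "g \<in> borel_measurable borel" using assms by auto
  have "ennreal (\<integral>x. \<bar>convolution K g x\<bar> \<partial>lborel) \<le> ennreal ((\<integral>x. \<bar>K x\<bar> \<partial>lborel) * (\<integral>x. \<bar>g x\<bar> \<partial>lborel))"
    using nn_integral_convolution_le(2)[of K g] convolution_integrable[OF assms] assms
    by (simp add: nn_integral_abs_eq ennreal_mult)
  then show ?thesis by (subst (asm) ennreal_le_iff) auto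
qed

lemma convolution_integral:
  fixes K g :: "'a::euclidean_space \<Rightarrow> real"
  assumes "integrable lborel K" "integrable lborel g"
  shows "(\<integral>x. convolution K g x \<partial>lborel) = (\<integral>x. K x \<partial>lborel) * (\<integral>x. g x \<partial>lborel)"
proof -
  have "(\<integral>x. convolution K g x \<partial>lborel) = (\<integral>y. \<integral>x. K (x - y) * g y \<partial>lborel \<partial>lborel)"
    unfolding convolution_def using lborel_pair.Fubini_integral[OF integrable_convolution_pair[OF assms]] by simp
  also have "\<dots> = (\<integral>y. (\<integral>x. K x \<partial>lborel) * g y \<partial>lborel)"
    using integral_lborel_shift(2)[of K] assms by simp
  finally show ?thesis by simp
qed

lemma integrable_convolution_section:
  fixes K g :: "'a::euclidean_space \<Rightarrow> real"
  assumes "integrable lborel g" and [measurable]: "K \<in> borel_measurable borel" and "\<And>x. \<bar>K x\<bar> \<le> B"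
  shows "integrable lborel (\<lambda>y. K (x - y) * g y)"
  using integrable_mult_AE_bounded(2)[OF assms(1), of "\<lambda>y. K (x - y)" B] assms(3) by auto

lemma integrable_convolution_section':
  fixes K g :: "'a::euclidean_space \<Rightarrow> real"
  assumes "integrable lborel K" and [measurable]: "g \<in> borel_measurable borel" and "AE x in lborel. \<bar>g x\<bar> \<le> B"
  shows "integrable lborel (\<lambda>y. K (x - y) * g y)"
  using integrable_mult_AE_bounded(1)[OF integrable_lborel_shift(3)[OF assms(1)], of g B] assms(3) by auto

lemma convolution_abs_le_sup_kernel:
  fixes K g :: "'a::euclidean_space \<Rightarrow> real"
  assumes "integrable lborel g" and [measurable]: "K \<in> borel_measurable borel" and "\<And>x. \<bar>K x\<bar> \<le> B"
  shows "\<bar>convolution K g x\<bar> \<le> B * (\<integral>y. \<bar>g y\<bar> \<partial>lborel)"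
proof -
  have "\<bar>convolution K g x\<bar> \<le> (\<integral>y. \<bar>K (x - y) * g y\<bar> \<partial>lborel)"
    unfolding convolution_def using integral_norm_bound[of lborel "\<lambda>y. K (x - y) * g y"] by simp
  also have "\<dots> \<le> (\<integral>y. B * \<bar>g y\<bar> \<partial>lborel)"
    using integrable_abs[OF integrable_convolution_section[OF assms]] assms(1)
    by (intro integral_mono) (auto simp: abs_mult assms(3) mult_right_mono)
  finally show ?thesis by simp
qed

lemma convolution_abs_le_sup:
  fixes K g :: "'a::euclidean_space \<Rightarrow> real"
  assumes "integrable lborel K" and [measurable]: "g \<in> borel_measurable borel" and "AE x in lborel. \<bar>g x\<bar> \<le> B"
  shows "\<bar>convolution K g x\<bar> \<le> (\<integral>y. \<bar>K y\<bar> \<partial>lborel) * B"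
proof -
  have [measurable]: "K \<in> borel_measurable borel" using assms by auto
  have "\<bar>convolution K g x\<bar> \<le> (\<integral>y. \<bar>K (x - y) * g y\<bar> \<partial>lborel)"
    unfolding convolution_def using integral_norm_bound[of lborel "\<lambda>y. K (x - y) * g y"] by simp
  also have "\<dots> \<le> (\<integral>y. \<bar>K (x - y)\<bar> * B \<partial>lborel)"
  proof (rule integral_mono_AE)
    show "integrable lborel (\<lambda>y. \<bar>K (x - y) * g y\<bar>)"
      using integrable_convolution_section'[OF assms] by simp
    show "integrable lborel (\<lambda>y. \<bar>K (x - y)\<bar> * B)"
      using integrable_lborel_shift(3)[OF assms(1)] by auto
    show "AE y in lborel. \<bar>K (x - y) * g y\<bar> \<le> \<bar>K (x - y)\<bar> * B"
      using assms(3) by eventually_elim (auto simp: abs_mult mult_left_mono)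
  qed
  also have "\<dots> = (\<integral>y. \<bar>K y\<bar> \<partial>lborel) * B"
    using integral_lborel_shift(3)[of "\<lambda>y. \<bar>K y\<bar>" x] by simp
  finally show ?thesis .
qed

lemma convolution_diff_right:
  fixes K g h :: "'a::euclidean_space \<Rightarrow> real"
  assumes "integrable lborel (\<lambda>y. K (x - y) * g y)" "integrable lborel (\<lambda>y. K (x - y) * h y)"
  shows "convolution K (\<lambda>y. g y - h y) x = convolution K g x - convolution K h x"
  unfolding convolution_def by (simp add: right_diff_distrib Bochner_Integration.integral_diff[OF assms])

lemma convolution_diff_left:
  fixes K L g :: "'a::euclidean_space \<Rightarrow> real"
  assumes "integrable lborel (\<lambda>y. K (x - y) * g y)" "integrable lborel (\<lambda>y. L (x - y) * g y)"
  shows "convolution (\<lambda>z. K z - L z) g x = convolution K g x - convolution L g x"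
  unfolding convolution_def by (simp add: left_diff_distrib Bochner_Integration.integral_diff[OF assms])

text \<open>Fubini moves the kernel to the other factor with reflected argument, and evenness undoes
  the reflection. The pairing of an integrable with a bounded function covers both test functions
  and the energy form.\<close>

lemma convolution_adjoint:
  fixes K g h :: "'a::euclidean_space \<Rightarrow> real"
  assumes K: "integrable lborel K" "\<And>x. K (- x) = K x" and g: "integrable lborel g"
    and [measurable]: "h \<in> borel_measurable borel" and h: "AE x in lborel. \<bar>h x\<bar> \<le> B"
  shows "(\<integral>x. convolution K g x * h x \<partial>lborel) = (\<integral>x. g x * convolution K h x \<partial>lborel)"
proof -
  have [measurable]: "K \<in> borel_measurable borel" "g \<in> borel_measurable borel" using assms by auto
  have AE2: "AE z in lborel \<Otimes>\<^sub>M lborel. \<bar>h (fst z)\<bar> \<le> B"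
  proof (rule lborel_pair.AE_pair_measure)
    show "{z \<in> space (lborel \<Otimes>\<^sub>M lborel). \<bar>h (fst z)\<bar> \<le> B} \<in> sets (lborel \<Otimes>\<^sub>M lborel)" by measurable
  qed (use h in auto)
  have i: "integrable (lborel \<Otimes>\<^sub>M lborel) (\<lambda>(x, y). K (x - y) * g y * h x)"
    using integrable_mult_AE_bounded(1)[OF integrable_convolution_pair[OF K(1) g], of "\<lambda>z. h (fst z)" B] AE2
    by (simp add: split_beta')
  have "(\<integral>x. convolution K g x * h x \<partial>lborel) = (\<integral>x. \<integral>y. K (x - y) * g y * h x \<partial>lborel \<partial>lborel)"
    unfolding convolution_def by simp
  also have "\<dots> = (\<integral>y. \<integral>x. K (x - y) * g y * h x \<partial>lborel \<partial>lborel)"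
    using lborel_pair.Fubini_integral[OF i] by simp
  also have "\<dots> = (\<integral>y. \<integral>x. g y * (K (y - x) * h x) \<partial>lborel \<partial>lborel)"
  proof -
    have "K (x - y) = K (y - x)" for x y using K(2)[of "x - y"] by simp
    then show ?thesis by (simp add: mult_ac)
  qed
  finally show ?thesis unfolding convolution_def by simp
qed

text \<open>With \<open>L\<close> bounded, the triple product is dominated by the integrable
  \<open>g y * K z\<close>, so Fubini applies at every point \<open>x\<close> and not only almost
  everywhere.\<close>

lemma convolution_assoc:
  fixes K L g :: "'a::euclidean_space \<Rightarrow> real"
  assumes K: "integrable lborel K" and g: "integrable lborel g"
    and [measurable]: "L \<in> borel_measurable borel" and L: "\<And>x. \<bar>L x\<bar> \<le> B"
  shows "convolution (convolution K L) g x = convolution K (convolution L g) x"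
proof -
  have [measurable]: "K \<in> borel_measurable borel" "g \<in> borel_measurable borel" using assms by auto
  have 0: "integrable (lborel \<Otimes>\<^sub>M lborel) (\<lambda>(y, z). g y * K z)"
    by (rule lborel_pair.pair_integrableI)
       (use K g in \<open>auto simp: abs_mult ennreal_mult nn_integral_cmult nn_integral_multc integrable_real_iff ennreal_mult_less_top\<close>)
  have i: "integrable (lborel \<Otimes>\<^sub>M lborel) (\<lambda>(y, z). g y * K z * L (x - y - z))"
    using integrable_mult_AE_bounded(1)[OF 0, of "\<lambda>z. L (x - fst z - snd z)" B] L
    by (simp add: split_beta')
  have "convolution (convolution K L) g x = (\<integral>y. \<integral>z. g y * K z * L (x - y - z) \<partial>lborel \<partial>lborel)"
  proof -
    have "convolution K L (x - y) * g y = (\<integral>z. g y * K z * L (x - y - z) \<partial>lborel)" for y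
      by (simp add: convolution_alt[of K L] mult.assoc)
    then show ?thesis unfolding convolution_def[of "convolution K L"] by simp
  qed
  also have "\<dots> = (\<integral>z. \<integral>y. g y * K z * L (x - y - z) \<partial>lborel \<partial>lborel)"
    using lborel_pair.Fubini_integral[OF i] by simp
  also have "\<dots> = (\<integral>z. K z * (\<integral>y. L (x - z - y) * g y \<partial>lborel) \<partial>lborel)"
  proof -
    have "(\<integral>y. g y * K z * L (x - y - z) \<partial>lborel) = (\<integral>y. K z * (L (x - z - y) * g y) \<partial>lborel)" for z
      by (intro Bochner_Integration.integral_cong) (auto simp: mult_ac diff_diff_eq add.commute)
    then show ?thesis by simp
  qed
  also have "\<dots> = convolution K (convolution L g) x"
    by (subst convolution_alt) (auto simp: convolution_def)
  finally show ?thesis .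
qed

subsection \<open>Continuity of translations in $L^1$\<close>

text \<open>A point of an open set stays inside under small shifts, so the positive part of
  \<open>indicator U x - indicator U (x + X n)\<close> tends to 0 pointwise and is dominated by the
  indicator. Both indicators have the same integral, hence the absolute difference integrates to
  twice that positive part.\<close>

lemma tendsto_translation_open:
  fixes U :: "'a::euclidean_space set" and X :: "nat \<Rightarrow> 'a"
  assumes "open U" "emeasure lborel U < \<infinity>" and X: "X \<longlonglongrightarrow> 0"
  shows "(\<lambda>n. \<integral>\<^sup>+x. ennreal \<bar>indicator U (x + X n) - indicator U x\<bar> \<partial>lborel) \<longlonglongrightarrow> 0"
proof -
  let ?i = "indicator U :: 'a \<Rightarrow> real"
  have [measurable]: "U \<in> sets borel" using assms by auto
  have i: "integrable lborel ?i" using assms by (auto simp: integrable_indicator_iff)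
  note ish = integrable_lborel_shift(1)[OF i]
  have eq: "(\<integral>\<^sup>+x. ennreal \<bar>?i (x + X n) - ?i x\<bar> \<partial>lborel) = ennreal (2 * (\<integral>x. max (?i x - ?i (x + X n)) 0 \<partial>lborel))" for n
  proof -
    have "(\<integral>\<^sup>+x. ennreal \<bar>?i (x + X n) - ?i x\<bar> \<partial>lborel) = ennreal (\<integral>x. \<bar>?i (x + X n) - ?i x\<bar> \<partial>lborel)"
      using i ish by (intro nn_integral_abs_eq) auto
    also have "(\<integral>x. \<bar>?i (x + X n) - ?i x\<bar> \<partial>lborel)
        = (\<integral>x. 2 * max (?i x - ?i (x + X n)) 0 + (?i (x + X n) - ?i x) \<partial>lborel)"
      by (intro Bochner_Integration.integral_cong) (auto simp: indicator_def)
    also have "\<dots> = 2 * (\<integral>x. max (?i x - ?i (x + X n)) 0 \<partial>lborel)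
        + ((\<integral>x. ?i (x + X n) \<partial>lborel) - (\<integral>x. ?i x \<partial>lborel))"
      using i ish by (subst Bochner_Integration.integral_add) auto
    also have "(\<integral>x. ?i (x + X n) \<partial>lborel) = (\<integral>x. ?i x \<partial>lborel)"
      by (intro integral_lborel_shift) auto
    finally show ?thesis by simp
  qed
  have "(\<lambda>n. \<integral>x. max (?i x - ?i (x + X n)) 0 \<partial>lborel) \<longlonglongrightarrow> (\<integral>x. 0 \<partial>(lborel :: 'a measure))"
  proof (rule integral_dominated_convergence[where w="?i"])
    show "AE x in lborel. (\<lambda>n. max (?i x - ?i (x + X n)) 0) \<longlonglongrightarrow> 0"
    proof (rule AE_I2)
      fix x :: 'a
      have *: "(\<lambda>n. x + X n) \<longlonglongrightarrow> x" using tendsto_add[OF tendsto_const X, of x] by simp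
      show "(\<lambda>n. max (?i x - ?i (x + X n)) 0) \<longlonglongrightarrow> 0"
      proof (cases "x \<in> U")
        case True
        have "\<forall>\<^sub>F n in sequentially. x + X n \<in> U"
          using topological_tendstoD[OF * \<open>open U\<close> True] .
        then have "\<forall>\<^sub>F n in sequentially. max (?i x - ?i (x + X n)) 0 = 0"
          by eventually_elim (use True in auto)
        then show ?thesis by (rule tendsto_eventually)
      qed (auto simp: indicator_def intro!: tendsto_eventually)
    qed
  qed (use i in \<open>auto simp: indicator_def\<close>)
  then have "(\<lambda>n. ennreal (2 * (\<integral>x. max (?i x - ?i (x + X n)) 0 \<partial>lborel))) \<longlonglongrightarrow> ennreal (2 * 0)"
    by (intro tendsto_ennrealI tendsto_mult tendsto_const) simp
  then show ?thesis by (simp only: eq mult_zero_right ennreal_0)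
qed

lemma ennreal_abs_triangle3:
  fixes a b c d :: real
  shows "ennreal \<bar>a - d\<bar> \<le> ennreal \<bar>a - b\<bar> + ennreal \<bar>b - c\<bar> + ennreal \<bar>c - d\<bar>"
  by (simp flip: ennreal_plus)

lemma translation_approx:
  fixes f g :: "'a::euclidean_space \<Rightarrow> real"
  assumes [measurable]: "f \<in> borel_measurable borel" "g \<in> borel_measurable borel"
  shows "(\<integral>\<^sup>+x. ennreal \<bar>f (x + c) - f x\<bar> \<partial>lborel)
    \<le> (\<integral>\<^sup>+x. ennreal \<bar>g (x + c) - g x\<bar> \<partial>lborel) + 2 * (\<integral>\<^sup>+x. ennreal \<bar>g x - f x\<bar> \<partial>lborel)"
proof -
  have "(\<integral>\<^sup>+x. ennreal \<bar>f (x + c) - f x\<bar> \<partial>lborel)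
    \<le> (\<integral>\<^sup>+x. ennreal \<bar>f (x + c) - g (x + c)\<bar> + ennreal \<bar>g (x + c) - g x\<bar> + ennreal \<bar>g x - f x\<bar> \<partial>lborel)"
    by (intro nn_integral_mono ennreal_abs_triangle3)
  also have "\<dots> = (\<integral>\<^sup>+x. ennreal \<bar>f (x + c) - g (x + c)\<bar> \<partial>lborel) + (\<integral>\<^sup>+x. ennreal \<bar>g (x + c) - g x\<bar> \<partial>lborel)
      + (\<integral>\<^sup>+x. ennreal \<bar>g x - f x\<bar> \<partial>lborel)"
    by (simp add: nn_integral_add)
  also have "(\<integral>\<^sup>+x. ennreal \<bar>f (x + c) - g (x + c)\<bar> \<partial>lborel) = (\<integral>\<^sup>+x. ennreal \<bar>g x - f x\<bar> \<partial>lborel)"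
    using nn_integral_lborel_shift(1)[of "\<lambda>x. ennreal \<bar>f x - g x\<bar>" c] by (simp add: abs_minus_commute)
  finally show ?thesis by (simp add: mult_2 add_ac)
qed

text \<open>The comparison sequence \<open>G\<close> may depend on the tolerance \<open>e\<close>,
  as it does when a function is first approximated to accuracy \<open>e\<close> and then
  translated.\<close>

lemma tendsto_zero_by_approx:
  fixes F :: "nat \<Rightarrow> ennreal"
  assumes "\<And>e. e > 0 \<Longrightarrow> \<exists>G. G \<longlonglongrightarrow> 0 \<and> (\<forall>\<^sub>F n in sequentially. F n \<le> G n + ennreal e)"
  shows "F \<longlonglongrightarrow> 0"
proof (rule order_tendstoI)
  fix a :: ennreal assume "0 < a"
  then obtain e where e: "e > 0" "ennreal (2 * e) < a"
  proof -
    obtain y where y: "0 < y" "y < a" using \<open>0 < a\<close> dense by blast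
    then obtain r where r: "y = ennreal r" "0 \<le> r" by (cases y) auto
    show ?thesis by (rule that[of "r / 2"]) (use y r in auto)
  qed
  obtain G where G: "G \<longlonglongrightarrow> 0" "\<forall>\<^sub>F n in sequentially. F n \<le> G n + ennreal e" using assms[OF e(1)] by auto
  have "\<forall>\<^sub>F n in sequentially. G n < ennreal e" using order_tendstoD(2)[OF G(1)] e by simp
  then show "\<forall>\<^sub>F n in sequentially. F n < a"
    using G(2)
  proof eventually_elim
    case (elim n)
    have "F n \<le> ennreal e + ennreal e" using elim by (meson add_mono le_less order_trans)
    also have "\<dots> < a" using e by (simp flip: ennreal_plus)
    finally show ?case .
  qed
qed auto

text \<open>Induction over integrable functions instead of density of continuous ones: Borel sets
  are approximated from outside by open sets, and the limit step approximates in \<open>L^1\<close>.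
  Translation invariance makes each approximation error independent of the shift.\<close>

lemma tendsto_translation_L1:
  fixes f :: "'a::euclidean_space \<Rightarrow> real" and X :: "nat \<Rightarrow> 'a"
  assumes "integrable lborel f" and X: "X \<longlonglongrightarrow> 0"
  shows "(\<lambda>n. \<integral>\<^sup>+x. ennreal \<bar>f (x + X n) - f x\<bar> \<partial>lborel) \<longlonglongrightarrow> 0"
  using assms(1)
proof induction
  case (base A c)
  have [measurable]: "A \<in> sets borel" using base by auto
  have "(\<lambda>n. \<integral>\<^sup>+x. ennreal \<bar>(indicator A (x + X n) :: real) - indicator A x\<bar> \<partial>lborel) \<longlonglongrightarrow> 0"
  proof (rule tendsto_zero_by_approx)
    fix e :: real assume "e > 0"
    \<comment> \<open>Outer regularity; the error is \<open>e / 2\<close> because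
      \<open>translation_approx\<close> counts it twice.\<close>
    then obtain U where U: "open U" "A \<subseteq> U" "U - A \<in> lmeasurable" "emeasure lebesgue (U - A) < ennreal (e / 2)"
      using sets_lebesgue_outer_open[of A "e / 2"] by auto
    have [measurable]: "U \<in> sets borel" using U by auto
    have m: "emeasure lborel (U - A) < ennreal (e / 2)" using U(4) by simp
    have "emeasure lborel U = emeasure lborel A + emeasure lborel (U - A)"
      using U(2) by (subst plus_emeasure) (auto simp: Un_absorb1)
    then have fin: "emeasure lborel U < \<infinity>" using base m by (auto simp: less_top dest!: order.strict_trans[OF _ ennreal_less_top])
    have "(\<integral>\<^sup>+x. ennreal \<bar>(indicator U x :: real) - indicator A x\<bar> \<partial>lborel) = (\<integral>\<^sup>+x. indicator (U - A) x \<partial>lborel)"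
      using U(2) by (intro nn_integral_cong) (auto simp: indicator_def)
    also have "\<dots> \<le> ennreal (e / 2)" using m by simp
    finally have d: "2 * (\<integral>\<^sup>+x. ennreal \<bar>(indicator U x :: real) - indicator A x\<bar> \<partial>lborel) \<le> 2 * ennreal (e / 2)"
      by (intro mult_left_mono) auto
    also have "2 * ennreal (e / 2) = ennreal e" using \<open>e > 0\<close> by (simp add: mult_2 flip: ennreal_plus)
    finally show "\<exists>G. G \<longlonglongrightarrow> 0 \<and> (\<forall>\<^sub>F n in sequentially.
        (\<integral>\<^sup>+x. ennreal \<bar>(indicator A (x + X n) :: real) - indicator A x\<bar> \<partial>lborel) \<le> G n + ennreal e)"
      by (intro exI[of _ "\<lambda>n. \<integral>\<^sup>+x. ennreal \<bar>(indicator U (x + X n) :: real) - indicator U x\<bar> \<partial>lborel"] conjI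
          tendsto_translation_open U(1) fin X always_eventually allI
          order_trans[OF translation_approx[of "indicator A" "indicator U"] add_left_mono]) auto
  qed
  then have "(\<lambda>n. ennreal \<bar>c\<bar> * (\<integral>\<^sup>+x. ennreal \<bar>(indicator A (x + X n) :: real) - indicator A x\<bar> \<partial>lborel)) \<longlonglongrightarrow> ennreal \<bar>c\<bar> * 0"
    by (intro ennreal_tendsto_cmult) auto
  moreover have "(\<integral>\<^sup>+x. ennreal \<bar>indicator A (x + X n) *\<^sub>R c - indicator A x *\<^sub>R c\<bar> \<partial>lborel)
      = ennreal \<bar>c\<bar> * (\<integral>\<^sup>+x. ennreal \<bar>(indicator A (x + X n) :: real) - indicator A x\<bar> \<partial>lborel)" for n
    by (simp add: nn_integral_cmult[symmetric] ennreal_mult[symmetric] abs_mult[symmetric] algebra_simps)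
  ultimately show ?case by simp
next
  case (add f g)
  have [measurable]: "f \<in> borel_measurable borel" "g \<in> borel_measurable borel" using add by auto
  show ?case
  proof (rule tendsto_sandwich[OF _ _ tendsto_const])
    show "(\<lambda>n. (\<integral>\<^sup>+x. ennreal \<bar>f (x + X n) - f x\<bar> \<partial>lborel) + (\<integral>\<^sup>+x. ennreal \<bar>g (x + X n) - g x\<bar> \<partial>lborel)) \<longlonglongrightarrow> 0"
      using tendsto_add[OF add.IH] by simp
    show "\<forall>\<^sub>F n in sequentially. (\<integral>\<^sup>+x. ennreal \<bar>f (x + X n) + g (x + X n) - (f x + g x)\<bar> \<partial>lborel)
        \<le> (\<integral>\<^sup>+x. ennreal \<bar>f (x + X n) - f x\<bar> \<partial>lborel) + (\<integral>\<^sup>+x. ennreal \<bar>g (x + X n) - g x\<bar> \<partial>lborel)"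
      by (intro always_eventually allI, subst nn_integral_add[symmetric])
         (auto intro!: nn_integral_mono simp flip: ennreal_plus)
  qed auto
next
  case (lim f s)
  have [measurable]: "f \<in> borel_measurable borel" "\<And>i. s i \<in> borel_measurable borel" using lim by auto
  have L: "(\<lambda>i. \<integral>\<^sup>+x. norm (f x - s i x) \<partial>lborel) \<longlonglongrightarrow> 0"
  proof (rule nn_integral_dominated_convergence_norm[where w="\<lambda>x. 2 * norm (f x)"])
    show "(\<integral>\<^sup>+x. ennreal (2 * norm (f x)) \<partial>lborel) < \<infinity>"
      using lim(4) by (simp add: ennreal_mult nn_integral_cmult integrable_iff_bounded ennreal_mult_less_top)
  qed (use lim in auto)
  show ?case
  proof (rule tendsto_zero_by_approx)
    fix e :: real assume "e > 0"
    then have "\<forall>\<^sub>F i in sequentially. (\<integral>\<^sup>+x. norm (f x - s i x) \<partial>lborel) < ennreal (e / 2)"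
      using order_tendstoD(2)[OF L] by simp
    then obtain i where i: "(\<integral>\<^sup>+x. norm (f x - s i x) \<partial>lborel) < ennreal (e / 2)"
      by (auto simp: eventually_sequentially)
    then have "2 * (\<integral>\<^sup>+x. ennreal \<bar>s i x - f x\<bar> \<partial>lborel) \<le> 2 * ennreal (e / 2)"
      by (intro mult_left_mono) (auto simp: abs_minus_commute)
    also have "2 * ennreal (e / 2) = ennreal e" using \<open>e > 0\<close> by (simp add: mult_2 flip: ennreal_plus)
    finally show "\<exists>G. G \<longlonglongrightarrow> 0 \<and> (\<forall>\<^sub>F n in sequentially.
        (\<integral>\<^sup>+x. ennreal \<bar>f (x + X n) - f x\<bar> \<partial>lborel) \<le> G n + ennreal e)"
      by (intro exI[of _ "\<lambda>n. \<integral>\<^sup>+x. ennreal \<bar>s i (x + X n) - s i x\<bar> \<partial>lborel"] conjI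
          lim(2) always_eventually allI order_trans[OF translation_approx[of f "s i"] add_left_mono]) (use lim in auto)
  qed
qed

subsection \<open>Lebesgue measure on a time interval\<close>

text \<open>A density rather than a restricted space: the sigma-algebra stays that of all Borel
  sets, so measurability needs no restriction to the interval. For \<open>b < a\<close> this is the
  zero measure.\<close>

definition time_measure :: "real \<Rightarrow> real \<Rightarrow> real measure" where
  "time_measure a b = density lborel (indicator {a..b})"

lemma sets_time_measure [simp, measurable_cong]: "sets (time_measure a b) = sets borel"
  and space_time_measure [simp]: "space (time_measure a b) = UNIV"
  by (auto simp: time_measure_def)

lemma nn_integral_time_measure:
  "f \<in> borel_measurable borel \<Longrightarrow> (\<integral>\<^sup>+s. f s \<partial>time_measure a b) = (\<integral>\<^sup>+s. indicator {a..b} s * f s \<partial>lborel)"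
  by (auto simp: time_measure_def nn_integral_density)

lemma integral_time_measure:
  fixes f :: "real \<Rightarrow> real"
  shows "f \<in> borel_measurable borel \<Longrightarrow> (\<integral>s. f s \<partial>time_measure a b) = (\<integral>s. indicator {a..b} s * f s \<partial>lborel)"
  unfolding time_measure_def
  using integral_density[of f lborel "indicator {a..b}"] by (auto simp: ennreal_indicator)

lemma integrable_time_measure:
  fixes f :: "real \<Rightarrow> real"
  shows "f \<in> borel_measurable borel \<Longrightarrow> integrable (time_measure a b) f \<longleftrightarrow> integrable lborel (\<lambda>s. indicator {a..b} s * f s)"
  unfolding time_measure_def
  using integrable_density[of f lborel "indicator {a..b}"] by (auto simp: ennreal_indicator)

lemma AE_time_measure: "(AE s in time_measure a b. P s) \<longleftrightarrow> (AE s in lborel. s \<in> {a..b} \<longrightarrow> P s)"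
  unfolding time_measure_def by (subst AE_density) (auto simp: indicator_def)

lemma AE_time_measureI: "(\<And>s. a \<le> s \<Longrightarrow> s \<le> b \<Longrightarrow> P s) \<Longrightarrow> AE s in time_measure a b. P s"
  by (simp add: AE_time_measure)

lemma emeasure_time_measure: "a \<le> b \<Longrightarrow> emeasure (time_measure a b) UNIV = ennreal (b - a)"
  by (simp add: time_measure_def emeasure_density)

lemma finite_time_measure: "finite_measure (time_measure a b)"
proof
  have "emeasure (time_measure a b) UNIV = emeasure lborel {a..b}"
    by (simp add: time_measure_def emeasure_density)
  then show "emeasure (time_measure a b) (space (time_measure a b)) \<noteq> \<infinity>"
    using emeasure_lborel_cbox_finite[of a b] by (cases "a \<le> b") auto
qed

interpretation tm: finite_measure "time_measure a b" for a b by (rule finite_time_measure)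
interpretation tmp: pair_sigma_finite "time_measure a b" lborel for a b ..
interpretation tmt: pair_sigma_finite "time_measure a b" "time_measure c d" for a b c d ..

lemma measure_time_measure: "a \<le> b \<Longrightarrow> measure (time_measure a b) UNIV = b - a"
  by (simp add: measure_def emeasure_time_measure)

lemma nn_integral_time_measure_le:
  assumes "a \<le> b" "\<And>s. a \<le> s \<Longrightarrow> s \<le> b \<Longrightarrow> f s \<le> ennreal c" "0 \<le> c"
  shows "(\<integral>\<^sup>+s. f s \<partial>time_measure a b) \<le> ennreal ((b - a) * c)"
proof -
  have "(\<integral>\<^sup>+s. f s \<partial>time_measure a b) \<le> (\<integral>\<^sup>+s. ennreal c \<partial>time_measure a b)"
    by (intro nn_integral_mono_AE AE_time_measureI assms)
  also have "\<dots> = ennreal ((b - a) * c)"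
    using assms by (simp add: emeasure_time_measure ennreal_mult' mult.commute)
  finally show ?thesis .
qed

lemma integral_time_measure_le:
  fixes f :: "real \<Rightarrow> real"
  assumes "a \<le> b" "\<And>s. a \<le> s \<Longrightarrow> s \<le> b \<Longrightarrow> f s \<le> c" "0 \<le> c"
  shows "(\<integral>s. f s \<partial>time_measure a b) \<le> (b - a) * c"
proof (cases "integrable (time_measure a b) f")
  case True
  then have "(\<integral>s. f s \<partial>time_measure a b) \<le> (\<integral>s. c \<partial>time_measure a b)"
    by (intro integral_mono_AE AE_time_measureI assms) auto
  then show ?thesis using assms by (simp add: measure_time_measure)
next
  case False
  then show ?thesis using assms by (simp add: not_integrable_integral_eq)
qed

lemma integral_time_measure_point: "(\<integral>s. F s \<partial>time_measure a a) = (0 :: real)"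
proof (rule integral_eq_zero_AE)
  show "AE s in time_measure a a. F s = 0"
    unfolding AE_time_measure using AE_lborel_singleton[of a] by eventually_elim auto
qed

lemma integral_time_measure_split:
  fixes F :: "real \<Rightarrow> real"
  assumes F: "integrable (time_measure a c) F" and "a \<le> b" "b \<le> c"
  shows "integrable (time_measure a b) F" "integrable (time_measure b c) F"
    and "(\<integral>s. F s \<partial>time_measure a c) = (\<integral>s. F s \<partial>time_measure a b) + (\<integral>s. F s \<partial>time_measure b c)"
proof -
  have [measurable]: "F \<in> borel_measurable borel" using F by (simp add: integrable_iff_bounded cong: measurable_cong_sets)
  have i: "integrable lborel (\<lambda>s. indicator {a..c} s * F s)" using F by (simp add: integrable_time_measure)
  have 1: "integrable lborel (\<lambda>s. indicator {a..b} s * F s)"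
    by (rule Bochner_Integration.integrable_bound[OF i]) (use assms in \<open>auto simp: indicator_def\<close>)
  have 2: "integrable lborel (\<lambda>s. indicator {b..c} s * F s)"
    by (rule Bochner_Integration.integrable_bound[OF i]) (use assms in \<open>auto simp: indicator_def\<close>)
  show "integrable (time_measure a b) F" "integrable (time_measure b c) F"
    using 1 2 by (auto simp: integrable_time_measure)
  \<comment> \<open>The two closed intervals overlap in \<open>b\<close>, which is a null
    set.\<close>
  have "(\<integral>s. indicator {a..c} s * F s \<partial>lborel) = (\<integral>s. indicator {a..b} s * F s + indicator {b..c} s * F s \<partial>lborel)"
    using AE_lborel_singleton[of b] by (intro integral_cong_AE) (use assms in \<open>auto simp: indicator_def\<close>)
  then show "(\<integral>s. F s \<partial>time_measure a c) = (\<integral>s. F s \<partial>time_measure a b) + (\<integral>s. F s \<partial>time_measure b c)"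
    using 1 2 by (simp add: integral_time_measure)
qed

subsection \<open>Monotonicity of the positive part along an evolution\<close>

text \<open>An implicit Euler step. On \<open>w t > 0\<close> the positive part grows by at most
  \<open>w t - w s\<close>, elsewhere it does not grow. Freezing \<open>g\<close> at the final time
  \<open>t\<close>, where \<open>dec\<close> gives its sign on exactly this set, costs an error
  quadratic in the step, by the Lipschitz bound.\<close>

lemma pos_part_step:
  fixes w g :: "real \<Rightarrow> 'a::euclidean_space \<Rightarrow> real"
  assumes st: "s \<le> t" and C: "0 \<le> C"
    and [measurable]: "case_prod g \<in> borel_measurable (borel \<Otimes>\<^sub>M borel)" "\<And>t. w t \<in> borel_measurable borel"
    and g: "\<And>r. s \<le> r \<Longrightarrow> r \<le> t \<Longrightarrow> integrable lborel (g r)"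
    and lip: "\<And>r. s \<le> r \<Longrightarrow> r \<le> t \<Longrightarrow> (\<integral>x. \<bar>g r x - g t x\<bar> \<partial>lborel) \<le> C * (t - r)"
    and w: "integrable lborel (\<lambda>x. max (w s x) 0)" "integrable lborel (\<lambda>x. max (w t x) 0)"
    and eq: "AE x in lborel. w t x = w s x + (\<integral>r. g r x \<partial>time_measure s t)"
    and dec: "(\<integral>x. indicator {x. w t x > 0} x * g t x \<partial>lborel) \<le> 0"
  shows "(\<integral>x. max (w t x) 0 \<partial>lborel) \<le> (\<integral>x. max (w s x) 0 \<partial>lborel) + C * (t - s)\<^sup>2"
proof -
  define A where "A = {x. w t x > 0}"
  have [measurable]: "A \<in> sets borel" unfolding A_def by measurable
  define E where "E = (\<lambda>x. \<integral>r. g r x - g t x \<partial>time_measure s t)"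
  have lip': "(\<integral>\<^sup>+x. ennreal \<bar>g r x - g t x\<bar> \<partial>lborel) \<le> ennreal (C * (t - s))" if "s \<le> r" "r \<le> t" for r
  proof -
    have "(\<integral>\<^sup>+x. ennreal \<bar>g r x - g t x\<bar> \<partial>lborel) = ennreal (\<integral>x. \<bar>g r x - g t x\<bar> \<partial>lborel)"
      using g[OF that] g[OF st order_refl] by (intro nn_integral_abs_eq) auto
    also have "\<dots> \<le> ennreal (C * (t - s))"
      using lip[OF that] mult_left_mono[OF _ C, of "t - r" "t - s"] that by (intro ennreal_leI) linarith
    finally show ?thesis .
  qed
  have nn: "(\<integral>\<^sup>+r. \<integral>\<^sup>+x. ennreal \<bar>g r x - g t x\<bar> \<partial>lborel \<partial>time_measure s t) \<le> ennreal ((t - s) * (C * (t - s)))"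
    by (rule nn_integral_time_measure_le[OF st lip']) (use C st in auto)
  have i: "integrable (time_measure s t \<Otimes>\<^sub>M lborel) (\<lambda>(r, x). g r x - g t x)"
    by (rule tmp.pair_integrableI) (auto intro!: order.strict_trans1[OF nn])
  have nnE: "(\<integral>\<^sup>+x. ennreal \<bar>E x\<bar> \<partial>lborel) \<le> ennreal ((t - s) * (C * (t - s)))"
  proof -
    have "(\<integral>\<^sup>+x. ennreal \<bar>E x\<bar> \<partial>lborel) \<le> (\<integral>\<^sup>+x. \<integral>\<^sup>+r. ennreal \<bar>g r x - g t x\<bar> \<partial>time_measure s t \<partial>lborel)"
      unfolding E_def by (intro nn_integral_mono abs_integral_le_nn_integral)
    also have "\<dots> = (\<integral>\<^sup>+r. \<integral>\<^sup>+x. ennreal \<bar>g r x - g t x\<bar> \<partial>lborel \<partial>time_measure s t)"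
      by (rule tmp.Fubini') measurable
    finally show ?thesis using nn by simp
  qed
  have Em [measurable]: "E \<in> borel_measurable borel" unfolding E_def by measurable
  have iE: "integrable lborel E" using nnE by (auto simp: integrable_real_iff intro: order.strict_trans1)
  have bE: "(\<integral>x. \<bar>E x\<bar> \<partial>lborel) \<le> C * (t - s)\<^sup>2"
  proof -
    have "ennreal (\<integral>x. \<bar>E x\<bar> \<partial>lborel) \<le> ennreal ((t - s) * (C * (t - s)))"
      using nnE by (simp add: nn_integral_abs_eq[OF iE])
    then have "(\<integral>x. \<bar>E x\<bar> \<partial>lborel) \<le> (t - s) * (C * (t - s))"
      using C st by (subst (asm) ennreal_le_iff) auto
    then show ?thesis by (simp add: power2_eq_square mult_ac)
  qed
  have ae: "AE x in lborel. integrable (time_measure s t) (\<lambda>r. g r x - g t x)"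
  proof -
    interpret Q: pair_sigma_finite lborel "time_measure s t" ..
    show ?thesis using Q.AE_integrable_fst'[OF tmp.integrable_product_swap[OF i]] by simp
  qed
  have ig: "integrable lborel (\<lambda>x. indicator A x * g t x)"
    using integrable_mult_indicator[of A lborel "g t"] g[OF st order_refl] by simp
  have iEA: "integrable lborel (\<lambda>x. indicator A x * E x)"
    using integrable_mult_indicator[of A lborel E] iE by simp
  have "(\<integral>x. max (w t x) 0 - max (w s x) 0 \<partial>lborel) \<le> (\<integral>x. (t - s) * (indicator A x * g t x) + \<bar>E x\<bar> \<partial>lborel)"
  proof (rule integral_mono_AE)
    show "AE x in lborel. max (w t x) 0 - max (w s x) 0 \<le> (t - s) * (indicator A x * g t x) + \<bar>E x\<bar>"
      using eq ae
    proof eventually_elim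
      case (elim x)
      have "(\<integral>r. g r x \<partial>time_measure s t) = (\<integral>r. (g r x - g t x) + g t x \<partial>time_measure s t)" by simp
      also have "\<dots> = E x + (t - s) * g t x"
        unfolding E_def using elim(2) st by (subst Bochner_Integration.integral_add) (auto simp: measure_time_measure)
      finally show ?case using elim(1) by (auto simp: A_def indicator_def)
    qed
  qed (use w ig iE in auto)
  also have "\<dots> = (t - s) * (\<integral>x. indicator A x * g t x \<partial>lborel) + (\<integral>x. \<bar>E x\<bar> \<partial>lborel)"
    using ig iE by (subst Bochner_Integration.integral_add) auto
  also have "\<dots> \<le> 0 + C * (t - s)\<^sup>2"
    using dec st bE unfolding A_def by (intro add_mono mult_nonneg_nonpos) auto
  finally show ?thesis using w by (simp add: Bochner_Integration.integral_diff)
qed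

text \<open>With \<open>n + 1\<close> equal steps the quadratic errors of
  \<open>pos_part_step\<close> add up to \<open>C * T^2 / (n + 1)\<close>, which vanishes in the
  limit. This replaces differentiating the integral of a positive part in time.\<close>

lemma pos_part_decreasing:
  fixes w g :: "real \<Rightarrow> 'a::euclidean_space \<Rightarrow> real"
  assumes T: "0 \<le> T" and C: "0 \<le> C"
    and meas: "case_prod g \<in> borel_measurable (borel \<Otimes>\<^sub>M borel)" "\<And>t. w t \<in> borel_measurable borel"
    and g: "\<And>r. 0 \<le> r \<Longrightarrow> r \<le> T \<Longrightarrow> integrable lborel (g r)"
    and lip: "\<And>r t. 0 \<le> r \<Longrightarrow> r \<le> t \<Longrightarrow> t \<le> T \<Longrightarrow> (\<integral>x. \<bar>g r x - g t x\<bar> \<partial>lborel) \<le> C * (t - r)"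
    and w: "\<And>t. 0 \<le> t \<Longrightarrow> t \<le> T \<Longrightarrow> integrable lborel (\<lambda>x. max (w t x) 0)"
    and eq: "\<And>s t. 0 \<le> s \<Longrightarrow> s \<le> t \<Longrightarrow> t \<le> T \<Longrightarrow> AE x in lborel. w t x = w s x + (\<integral>r. g r x \<partial>time_measure s t)"
    and dec: "\<And>t. 0 \<le> t \<Longrightarrow> t \<le> T \<Longrightarrow> (\<integral>x. indicator {x. w t x > 0} x * g t x \<partial>lborel) \<le> 0"
  shows "(\<integral>x. max (w T x) 0 \<partial>lborel) \<le> (\<integral>x. max (w 0 x) 0 \<partial>lborel)"
proof -
  define P where "P t = (\<integral>x. max (w t x) 0 \<partial>lborel)" for t
  have step: "P t \<le> P s + C * (t - s)\<^sup>2" if "0 \<le> s" "s \<le> t" "t \<le> T" for s t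
    unfolding P_def by (rule pos_part_step[where g=g]) (use that assms in auto)
  have "P T \<le> P 0 + C * T\<^sup>2 / real (Suc n)" for n
  proof -
    define N where "N = real (Suc n)"
    have N: "N > 0" by (simp add: N_def)
    have "P (real j * T / N) \<le> P 0 + real j * (C * (T / N)\<^sup>2)" if "j \<le> Suc n" for j
      using that
    proof (induction j)
      case (Suc j)
      have "real (Suc j) * T / N \<le> T"
        using Suc.prems mult_left_mono[of "real (Suc j)" N T] T N by (simp add: N_def field_simps)
      moreover have "real j * T / N \<le> real (Suc j) * T / N" using T N by (simp add: field_simps)
      ultimately have "P (real (Suc j) * T / N) \<le> P (real j * T / N) + C * (real (Suc j) * T / N - real j * T / N)\<^sup>2"
        using T N by (intro step) auto
      also have "real (Suc j) * T / N - real j * T / N = T / N" by (simp add: algebra_simps add_divide_distrib)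
      finally show ?case using Suc by (simp add: algebra_simps)
    qed simp
    from this[of "Suc n"] have "P (N * T / N) \<le> P 0 + N * (C * (T / N)\<^sup>2)" by (simp add: N_def)
    then show ?thesis using N unfolding N_def[symmetric] by (simp add: power2_eq_square)
  qed
  moreover have "(\<lambda>n. P 0 + C * T\<^sup>2 / real (Suc n)) \<longlonglongrightarrow> P 0 + 0"
    by (intro tendsto_add tendsto_const LIMSEQ_Suc[OF lim_const_over_n])
  ultimately have "P T \<le> P 0 + 0" by (intro LIMSEQ_le_const) auto
  then show ?thesis by (simp add: P_def)
qed

subsection \<open>The nonlocal operator\<close>

lemma stefan_pos_nonneg [simp]: "0 \<le> stefan_pos s"
  and stefan_pos_le: "stefan_pos s \<le> \<bar>s\<bar>"
  and stefan_pos_diff_le: "\<bar>stefan_pos a - stefan_pos b\<bar> \<le> \<bar>a - b\<bar>"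
  by (auto simp: stefan_pos_def)

lemma stefan_pos_measurable [measurable]: "stefan_pos \<in> borel_measurable borel"
  unfolding stefan_pos_def[abs_def] by measurable

lemma stefan_pos_integrable [intro]:
  assumes "integrable M g" shows "integrable M (\<lambda>x. stefan_pos (g x))"
proof -
  have [measurable]: "g \<in> borel_measurable M" using assms by simp
  show ?thesis by (rule Bochner_Integration.integrable_bound[OF assms]) (auto simp: stefan_pos_le)
qed

lemma stefan_pos_L1_le: "integrable M g \<Longrightarrow> (\<integral>x. \<bar>stefan_pos (g x)\<bar> \<partial>M) \<le> (\<integral>x. \<bar>g x\<bar> \<partial>M)"
  by (intro integral_mono integrable_abs stefan_pos_integrable) (auto simp: stefan_pos_le)

lemma stefan_pos_diff_L1_le:
  "integrable M g \<Longrightarrow> integrable M h \<Longrightarrow> (\<integral>x. \<bar>stefan_pos (g x) - stefan_pos (h x)\<bar> \<partial>M) \<le> (\<integral>x. \<bar>g x - h x\<bar> \<partial>M)"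
  by (intro integral_mono integrable_abs Bochner_Integration.integrable_diff stefan_pos_integrable) (auto simp: stefan_pos_diff_le)

definition diffuse :: "('a::euclidean_space \<Rightarrow> real) \<Rightarrow> real \<Rightarrow> ('a \<Rightarrow> real) \<Rightarrow> 'a \<Rightarrow> real" where
  "diffuse k l g x = l * (convolution k g x - g x)"

text \<open>Collects what the estimates at fixed \<open>e\<close> take from the kernel; the instance
  is \<open>k = rescale e J\<close>, \<open>l = 1 / e\<^sup>2\<close>. Full radial symmetry enters
  later, through the second moments.\<close>

locale prob_kernel =
  fixes k :: "'a::euclidean_space \<Rightarrow> real" and l B :: real
  assumes k_integrable: "integrable lborel k" and k_integral: "(\<integral>x. k x \<partial>lborel) = 1"
    and k_nonneg: "\<And>x. 0 \<le> k x" and k_even: "\<And>x. k (- x) = k x" and k_bounded: "\<And>x. k x \<le> B"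
    and l_pos: "0 < l"
begin

lemma k_measurable [measurable]: "k \<in> borel_measurable borel"
  using k_integrable by simp

lemma k_abs_integral: "(\<integral>x. \<bar>k x\<bar> \<partial>lborel) = 1"
  using k_integral k_nonneg by simp

lemma k_section: "integrable lborel g \<Longrightarrow> integrable lborel (\<lambda>y. k (x - y) * g y)"
  by (rule integrable_convolution_section[where B=B]) (auto simp: k_nonneg k_bounded)

lemma conv_integrable: "integrable lborel g \<Longrightarrow> integrable lborel (convolution k g)"
  by (intro convolution_integrable k_integrable)

lemma conv_integral: "integrable lborel g \<Longrightarrow> (\<integral>x. convolution k g x \<partial>lborel) = (\<integral>x. g x \<partial>lborel)"
  using convolution_integral[OF k_integrable] k_integral by simp

lemma conv_L1_le: "integrable lborel g \<Longrightarrow> (\<integral>x. \<bar>convolution k g x\<bar> \<partial>lborel) \<le> (\<integral>x. \<bar>g x\<bar> \<partial>lborel)"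
  using convolution_L1_le[OF k_integrable] k_abs_integral by simp

lemma conv_mono:
  assumes "integrable lborel g" "integrable lborel h" "AE x in lborel. g x \<le> h x"
  shows "convolution k g x \<le> convolution k h x"
  unfolding convolution_def using assms(3)
  by (intro integral_mono_AE k_section assms) (auto elim!: eventually_mono intro!: mult_left_mono k_nonneg)

lemma conv_nonneg: "(\<And>x. 0 \<le> g x) \<Longrightarrow> 0 \<le> convolution k g x"
  unfolding convolution_def by (intro integral_nonneg_AE AE_I2 mult_nonneg_nonneg k_nonneg) auto

lemma diffuse_integrable: "integrable lborel g \<Longrightarrow> integrable lborel (diffuse k l g)"
  unfolding diffuse_def[abs_def] using conv_integrable by auto

lemma diffuse_measurable [measurable]:
  assumes [measurable]: "case_prod u \<in> borel_measurable (M \<Otimes>\<^sub>M borel)" "g \<in> measurable N borel" "t \<in> measurable N M"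
  shows "(\<lambda>z. diffuse k l (u (t z)) (g z)) \<in> borel_measurable N"
  unfolding diffuse_def by measurable

lemma diffuse_L1_le:
  assumes "integrable lborel g"
  shows "(\<integral>x. \<bar>diffuse k l g x\<bar> \<partial>lborel) \<le> 2 * l * (\<integral>x. \<bar>g x\<bar> \<partial>lborel)"
proof -
  have "(\<integral>x. \<bar>diffuse k l g x\<bar> \<partial>lborel) \<le> (\<integral>x. l * (\<bar>convolution k g x\<bar> + \<bar>g x\<bar>) \<partial>lborel)"
    using assms conv_integrable[OF assms] diffuse_integrable[OF assms] l_pos
    by (intro integral_mono) (auto simp: diffuse_def abs_mult)
  also have "\<dots> = l * ((\<integral>x. \<bar>convolution k g x\<bar> \<partial>lborel) + (\<integral>x. \<bar>g x\<bar> \<partial>lborel))"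
    using assms conv_integrable[OF assms] by simp
  also have "\<dots> \<le> l * ((\<integral>x. \<bar>g x\<bar> \<partial>lborel) + (\<integral>x. \<bar>g x\<bar> \<partial>lborel))"
    using conv_L1_le[OF assms] l_pos by (intro mult_left_mono) auto
  finally show ?thesis by (simp add: algebra_simps)
qed

lemma diffuse_diff:
  assumes "integrable lborel g" "integrable lborel h"
  shows "diffuse k l (\<lambda>y. g y - h y) x = diffuse k l g x - diffuse k l h x"
  unfolding diffuse_def using convolution_diff_right[of k x g h, OF k_section k_section] assms
  by (simp add: right_diff_distrib)

text \<open>With \<open>A = {w > 0}\<close> this is the sign condition under which the positive part of \<open>w\<close> decreases.\<close>

lemma diffuse_on_positive_le:
  assumes q: "integrable lborel q" "\<And>x. 0 \<le> q x" "AE x in lborel. x \<notin> A \<longrightarrow> q x = 0"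
    and g: "integrable lborel g" "AE x in lborel. x \<in> A \<longrightarrow> g x \<le> diffuse k l q x"
    and [measurable]: "A \<in> sets borel"
  shows "(\<integral>x. indicator A x * g x \<partial>lborel) \<le> 0"
proof -
  have ic: "integrable lborel (convolution k q)" using q by (intro conv_integrable)
  \<comment> \<open>Off \<open>A\<close> the upper bound is nonnegative because \<open>q\<close>
    vanishes there while its convolution does not become negative; its total integral is 0 since
    \<open>k\<close> has mass one.\<close>
  have "(\<integral>x. indicator A x * g x \<partial>lborel) \<le> (\<integral>x. l * (convolution k q x - q x) \<partial>lborel)"
  proof (rule integral_mono_AE)
    show "integrable lborel (\<lambda>x. indicator A x * g x)"
      using integrable_mult_indicator[of A lborel g] g by simp
    show "AE x in lborel. indicator A x * g x \<le> l * (convolution k q x - q x)"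
      using g(2) q(3)
    proof eventually_elim
      case (elim x)
      then show ?case using l_pos conv_nonneg[of q x, OF q(2)] by (auto simp: indicator_def diffuse_def)
    qed
  qed (use ic q in auto)
  also have "\<dots> = l * ((\<integral>x. convolution k q x \<partial>lborel) - (\<integral>x. q x \<partial>lborel))"
    using ic q by simp
  finally show ?thesis using conv_integral q by simp
qed

end

section \<open>Time integrals of curves in \<open>L^1\<close>\<close>

lemma L1_bounded_of_continuous:
  fixes u :: "real \<Rightarrow> 'a::euclidean_space \<Rightarrow> real"
  assumes int: "\<And>t. 0 \<le> t \<Longrightarrow> integrable lborel (u t)"
    and cont: "\<And>s. 0 \<le> s \<Longrightarrow> ((\<lambda>t. \<integral>x. \<bar>u t x - u s x\<bar> \<partial>lborel) \<longlongrightarrow> 0) (at s within {0..})"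
  obtains C where "0 \<le> C" "\<And>t. 0 \<le> t \<Longrightarrow> t \<le> T \<Longrightarrow> (\<integral>x. \<bar>u t x\<bar> \<partial>lborel) \<le> C"
proof -
  let ?n = "\<lambda>t. \<integral>x. \<bar>u t x\<bar> \<partial>lborel"
  have "continuous_on {0..T} ?n"
    unfolding continuous_on_def
  proof
    fix s assume s: "s \<in> {0..T}"
    have "((\<lambda>t. ?n t - ?n s) \<longlongrightarrow> 0) (at s within {0..T})"
    proof (rule Lim_null_comparison)
      show "((\<lambda>t. \<integral>x. \<bar>u t x - u s x\<bar> \<partial>lborel) \<longlongrightarrow> 0) (at s within {0..T})"
        by (rule tendsto_within_subset[OF cont]) (use s in auto)
      have *: "\<bar>?n t - ?n s\<bar> \<le> (\<integral>x. \<bar>u t x - u s x\<bar> \<partial>lborel)" if "t \<in> {0..T}" for t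
      proof -
        have i: "integrable lborel (u t)" "integrable lborel (u s)" using int s that by auto
        have "?n t - ?n s = (\<integral>x. \<bar>u t x\<bar> - \<bar>u s x\<bar> \<partial>lborel)" using i by simp
        also have "\<bar>\<dots>\<bar> \<le> (\<integral>x. \<bar>\<bar>u t x\<bar> - \<bar>u s x\<bar>\<bar> \<partial>lborel)"
          using integral_norm_bound[of lborel "\<lambda>x. \<bar>u t x\<bar> - \<bar>u s x\<bar>"] by simp
        also have "\<dots> \<le> (\<integral>x. \<bar>u t x - u s x\<bar> \<partial>lborel)"
          using i by (intro integral_mono) auto
        finally show ?thesis .
      qed
      show "\<forall>\<^sub>F t in at s within {0..T}. norm (?n t - ?n s) \<le> (\<integral>x. \<bar>u t x - u s x\<bar> \<partial>lborel)"
        using * by (auto simp: eventually_at_filter)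
    qed
    then show "(?n \<longlongrightarrow> ?n s) (at s within {0..T})" by (simp add: LIM_zero_iff)
  qed
  then have "bounded (?n ` {0..T})" by (intro compact_imp_bounded compact_continuous_image) auto
  then obtain C where C: "\<And>t. t \<in> {0..T} \<Longrightarrow> norm (?n t) \<le> C" unfolding bounded_iff by blast
  show thesis
  proof (rule that[of "max C 0"])
    show "?n t \<le> max C 0" if "0 \<le> t" "t \<le> T" for t using C[of t] that by auto
  qed simp
qed

lemma AE_integrable_time_section:
  fixes g :: "real \<Rightarrow> 'a::euclidean_space \<Rightarrow> real"
  assumes "integrable (time_measure a b \<Otimes>\<^sub>M lborel) (case_prod g)"
  shows "AE x in lborel. integrable (time_measure a b) (\<lambda>r. g r x)"
proof -
  interpret Q: pair_sigma_finite lborel "time_measure a b" ..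
  show ?thesis using Q.AE_integrable_fst'[OF tmp.integrable_product_swap[OF assms]] by simp
qed

lemma integrable_time_space:
  fixes g :: "real \<Rightarrow> 'a::euclidean_space \<Rightarrow> real"
  assumes [measurable]: "case_prod g \<in> borel_measurable (borel \<Otimes>\<^sub>M borel)" and "a \<le> b" "0 \<le> C"
    and g: "\<And>r. a \<le> r \<Longrightarrow> r \<le> b \<Longrightarrow> integrable lborel (g r)"
    and C: "\<And>r. a \<le> r \<Longrightarrow> r \<le> b \<Longrightarrow> (\<integral>x. \<bar>g r x\<bar> \<partial>lborel) \<le> C"
  shows "integrable (time_measure a b \<Otimes>\<^sub>M lborel) (case_prod g)"
    and "(\<integral>\<^sup>+r. \<integral>\<^sup>+x. ennreal \<bar>g r x\<bar> \<partial>lborel \<partial>time_measure a b) \<le> ennreal ((b - a) * C)"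
proof -
  show *: "(\<integral>\<^sup>+r. \<integral>\<^sup>+x. ennreal \<bar>g r x\<bar> \<partial>lborel \<partial>time_measure a b) \<le> ennreal ((b - a) * C)"
    using assms by (intro nn_integral_time_measure_le) (auto simp: nn_integral_abs_eq ennreal_leI)
  show "integrable (time_measure a b \<Otimes>\<^sub>M lborel) (case_prod g)"
    by (rule tmp.pair_integrableI) (auto intro!: order.strict_trans1[OF *])
qed

lemma time_integral_L1_le:
  fixes g :: "real \<Rightarrow> 'a::euclidean_space \<Rightarrow> real"
  assumes [measurable]: "case_prod g \<in> borel_measurable (borel \<Otimes>\<^sub>M borel)" and "a \<le> b" "0 \<le> C"
    and g: "\<And>r. a \<le> r \<Longrightarrow> r \<le> b \<Longrightarrow> integrable lborel (g r)"
    and C: "\<And>r. a \<le> r \<Longrightarrow> r \<le> b \<Longrightarrow> (\<integral>x. \<bar>g r x\<bar> \<partial>lborel) \<le> C"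
  shows "integrable lborel (\<lambda>x. \<integral>r. g r x \<partial>time_measure a b)"
    and "(\<integral>x. \<bar>\<integral>r. g r x \<partial>time_measure a b\<bar> \<partial>lborel) \<le> (b - a) * C"
proof -
  have "(\<integral>\<^sup>+x. ennreal \<bar>\<integral>r. g r x \<partial>time_measure a b\<bar> \<partial>lborel) \<le> (\<integral>\<^sup>+x. \<integral>\<^sup>+r. ennreal \<bar>g r x\<bar> \<partial>time_measure a b \<partial>lborel)"
    by (intro nn_integral_mono abs_integral_le_nn_integral)
  also have "\<dots> = (\<integral>\<^sup>+r. \<integral>\<^sup>+x. ennreal \<bar>g r x\<bar> \<partial>lborel \<partial>time_measure a b)"
    by (rule tmp.Fubini') measurable
  also have "\<dots> \<le> ennreal ((b - a) * C)"
    by (rule integrable_time_space(2)) (use assms in auto)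
  finally have *: "(\<integral>\<^sup>+x. ennreal \<bar>\<integral>r. g r x \<partial>time_measure a b\<bar> \<partial>lborel) \<le> ennreal ((b - a) * C)" .
  show i: "integrable lborel (\<lambda>x. \<integral>r. g r x \<partial>time_measure a b)"
    using * by (auto simp: integrable_real_iff intro: order.strict_trans1)
  show "(\<integral>x. \<bar>\<integral>r. g r x \<partial>time_measure a b\<bar> \<partial>lborel) \<le> (b - a) * C"
    using * assms(2,3) unfolding nn_integral_abs_eq[OF i] by (subst (asm) ennreal_le_iff) auto
qed

lemma integral_pos_part_zero_AE:
  fixes w :: "'a \<Rightarrow> real"
  assumes "integrable M (\<lambda>x. max (w x) 0)" "(\<integral>x. max (w x) 0 \<partial>M) \<le> 0"
  shows "AE x in M. w x \<le> 0"
proof -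
  have "(\<integral>x. max (w x) 0 \<partial>M) = 0" using assms(2) by (intro antisym integral_nonneg_AE) auto
  then have "AE x in M. max (w x) 0 = 0" using assms(1) by (subst (asm) integral_nonneg_eq_0_iff_AE) auto
  then show ?thesis by eventually_elim auto
qed

subsection \<open>Estimates for the nonlocal problem\<close>

context prob_kernel
begin

text \<open>The working form of \<open>nonlocal_stefan_solution\<close>: jointly measurable at all
  times, and with the equation imposed also at \<open>t = 0\<close>, where it says that
  \<open>u 0 = f\<close> almost everywhere.\<close>

definition sol :: "('a \<Rightarrow> real) \<Rightarrow> (real \<Rightarrow> 'a \<Rightarrow> real) \<Rightarrow> bool" where
  "sol f u \<longleftrightarrow> case_prod u \<in> borel_measurable (borel \<Otimes>\<^sub>M borel) \<and> (\<forall>t\<ge>0. integrable lborel (u t)) \<and>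
    (\<forall>s\<ge>0. ((\<lambda>t. \<integral>x. \<bar>u t x - u s x\<bar> \<partial>lborel) \<longlongrightarrow> 0) (at s within {0..})) \<and>
    (\<forall>t\<ge>0. AE x in lborel. u t x = f x + (\<integral>s. diffuse k l (\<lambda>y. stefan_pos (u s y)) x \<partial>time_measure 0 t))"

lemma solD:
  assumes "sol f u"
  shows "case_prod u \<in> borel_measurable (borel \<Otimes>\<^sub>M borel)" "0 \<le> t \<Longrightarrow> integrable lborel (u t)"
    "0 \<le> s \<Longrightarrow> ((\<lambda>t. \<integral>x. \<bar>u t x - u s x\<bar> \<partial>lborel) \<longlongrightarrow> 0) (at s within {0..})"
    "0 \<le> t \<Longrightarrow> AE x in lborel. u t x = f x + (\<integral>s. diffuse k l (\<lambda>y. stefan_pos (u s y)) x \<partial>time_measure 0 t)"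
  using assms unfolding sol_def by auto

lemma sol_flux_measurable:
  assumes [measurable]: "case_prod u \<in> borel_measurable (borel \<Otimes>\<^sub>M borel)"
  shows "(\<lambda>(r, x). diffuse k l (\<lambda>y. stefan_pos (u r y)) x) \<in> borel_measurable (borel \<Otimes>\<^sub>M borel)"
proof -
  have [measurable]: "case_prod (\<lambda>r y. stefan_pos (u r y)) \<in> borel_measurable (borel \<Otimes>\<^sub>M borel)" by measurable
  show ?thesis unfolding split_beta' by measurable
qed

lemma sol_flux_bound:
  assumes u: "sol f u" and "0 \<le> T"
  obtains C where "0 \<le> C" "\<And>t. 0 \<le> t \<Longrightarrow> t \<le> T \<Longrightarrow> (\<integral>x. \<bar>diffuse k l (\<lambda>y. stefan_pos (u t y)) x\<bar> \<partial>lborel) \<le> C"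
proof -
  obtain C where C: "0 \<le> C" "\<And>t. 0 \<le> t \<Longrightarrow> t \<le> T \<Longrightarrow> (\<integral>x. \<bar>u t x\<bar> \<partial>lborel) \<le> C"
    using L1_bounded_of_continuous[OF solD(2,3)[OF u]] by metis
  show thesis
  proof (rule that[of "2 * l * C"])
    show "(\<integral>x. \<bar>diffuse k l (\<lambda>y. stefan_pos (u t y)) x\<bar> \<partial>lborel) \<le> 2 * l * C" if "0 \<le> t" "t \<le> T" for t
    proof -
      have i: "integrable lborel (u t)" using solD(2)[OF u] that by auto
      have "(\<integral>x. \<bar>diffuse k l (\<lambda>y. stefan_pos (u t y)) x\<bar> \<partial>lborel) \<le> 2 * l * (\<integral>x. \<bar>stefan_pos (u t x)\<bar> \<partial>lborel)"
        by (intro diffuse_L1_le stefan_pos_integrable i)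
      also have "\<dots> \<le> 2 * l * C"
        using C(2)[OF that] stefan_pos_L1_le[OF i] l_pos by (intro mult_left_mono) auto
      finally show ?thesis .
    qed
  qed (use C l_pos in auto)
qed

lemma sol_flux_integrable:
  assumes u: "sol f u" and "0 \<le> t"
  shows "integrable lborel (diffuse k l (\<lambda>y. stefan_pos (u t y)))"
  by (intro diffuse_integrable stefan_pos_integrable solD[OF u] assms)

lemma sol_increment:
  assumes u: "sol f u" and st: "0 \<le> s" "s \<le> t"
  shows "AE x in lborel. u t x = u s x + (\<integral>r. diffuse k l (\<lambda>y. stefan_pos (u r y)) x \<partial>time_measure s t)"
proof -
  have t: "0 \<le> t" using st by simp
  obtain C where C: "0 \<le> C" "\<And>r. 0 \<le> r \<Longrightarrow> r \<le> t \<Longrightarrow> (\<integral>x. \<bar>diffuse k l (\<lambda>y. stefan_pos (u r y)) x\<bar> \<partial>lborel) \<le> C"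
    using sol_flux_bound[OF u t] by metis
  have "integrable (time_measure 0 t \<Otimes>\<^sub>M lborel) (\<lambda>(r, x). diffuse k l (\<lambda>y. stefan_pos (u r y)) x)"
    by (rule integrable_time_space(1)[OF sol_flux_measurable[OF solD(1)[OF u]] t C(1) _ C(2)])
       (use sol_flux_integrable[OF u] in auto)
  from AE_integrable_time_section[OF this]
  have "AE x in lborel. integrable (time_measure 0 t) (\<lambda>r. diffuse k l (\<lambda>y. stefan_pos (u r y)) x)" .
  with solD(4)[OF u t] solD(4)[OF u st(1)] show ?thesis
  proof eventually_elim
    case (elim x)
    then show ?case using integral_time_measure_split(3)[OF elim(3) st] by simp
  qed
qed

text \<open>A bounded flux makes \<open>u\<close> Lipschitz in time with values in
  \<open>L^1\<close>; since \<open>stefan_pos\<close> is 1-Lipschitz and the operator has norm at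
  most \<open>2 * l\<close> on \<open>L^1\<close>, the flux is Lipschitz as well. The constant
  depends on \<open>l\<close>, which is harmless because \<open>pos_part_decreasing\<close> lets it
  disappear.\<close>

lemma sol_lipschitz:
  assumes u: "sol f u" and T: "0 \<le> T"
  obtains C where "0 \<le> C" "\<And>r t. 0 \<le> r \<Longrightarrow> r \<le> t \<Longrightarrow> t \<le> T \<Longrightarrow>
    (\<integral>x. \<bar>diffuse k l (\<lambda>y. stefan_pos (u r y)) x - diffuse k l (\<lambda>y. stefan_pos (u t y)) x\<bar> \<partial>lborel) \<le> C * (t - r)"
proof -
  obtain C where C: "0 \<le> C" "\<And>r. 0 \<le> r \<Longrightarrow> r \<le> T \<Longrightarrow> (\<integral>x. \<bar>diffuse k l (\<lambda>y. stefan_pos (u r y)) x\<bar> \<partial>lborel) \<le> C"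
    using sol_flux_bound[OF u T] by metis
  show thesis
  proof (rule that[of "2 * l * C"])
    fix r t assume rt: "0 \<le> r" "r \<le> t" "t \<le> T"
    have i: "integrable lborel (u r)" "integrable lborel (u t)" using solD(2)[OF u] rt by auto
    have "AE x in lborel. \<bar>u r x - u t x\<bar> = \<bar>\<integral>q. diffuse k l (\<lambda>y. stefan_pos (u q y)) x \<partial>time_measure r t\<bar>"
      using sol_increment[OF u rt(1,2)] by eventually_elim simp
    moreover have iI: "integrable lborel (\<lambda>x. \<integral>q. diffuse k l (\<lambda>y. stefan_pos (u q y)) x \<partial>time_measure r t)"
      by (rule time_integral_L1_le(1)[OF sol_flux_measurable[OF solD(1)[OF u]] rt(2) C(1)])
         (use rt C sol_flux_integrable[OF u] in auto)
    ultimately have "(\<integral>x. \<bar>u r x - u t x\<bar> \<partial>lborel) = (\<integral>x. \<bar>\<integral>q. diffuse k l (\<lambda>y. stefan_pos (u q y)) x \<partial>time_measure r t\<bar> \<partial>lborel)"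
      using i iI by (intro integral_cong_AE) auto
    also have "\<dots> \<le> (t - r) * C"
      by (rule time_integral_L1_le(2)[OF sol_flux_measurable[OF solD(1)[OF u]] rt(2) C(1)])
         (use rt C sol_flux_integrable[OF u] in auto)
    finally have d: "(\<integral>x. \<bar>u r x - u t x\<bar> \<partial>lborel) \<le> (t - r) * C" .
    have "(\<integral>x. \<bar>diffuse k l (\<lambda>y. stefan_pos (u r y)) x - diffuse k l (\<lambda>y. stefan_pos (u t y)) x\<bar> \<partial>lborel)
      = (\<integral>x. \<bar>diffuse k l (\<lambda>y. stefan_pos (u r y) - stefan_pos (u t y)) x\<bar> \<partial>lborel)"
      by (subst diffuse_diff) (use i in auto)
    also have "\<dots> \<le> 2 * l * (\<integral>x. \<bar>stefan_pos (u r x) - stefan_pos (u t x)\<bar> \<partial>lborel)"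
      by (rule diffuse_L1_le) (use i in auto)
    also have "\<dots> \<le> 2 * l * ((t - r) * C)"
      using stefan_pos_diff_L1_le[OF i] d l_pos by (intro mult_left_mono) auto
    finally show "(\<integral>x. \<bar>diffuse k l (\<lambda>y. stefan_pos (u r y)) x - diffuse k l (\<lambda>y. stefan_pos (u t y)) x\<bar> \<partial>lborel) \<le> 2 * l * C * (t - r)"
      by (simp add: mult_ac)
  qed (use C l_pos in auto)
qed

lemma sol_initial:
  assumes "sol f u" shows "AE x in lborel. u 0 x = f x"
  using solD(4)[OF assms, of 0] by (simp add: integral_time_measure_point)

text \<open>Apply \<open>pos_part_decreasing\<close> to \<open>u - w\<close>. Let \<open>q\<close>
  be the positive part of the difference of the two \<open>stefan_pos\<close> terms. Where
  \<open>u > w\<close>, monotonicity makes \<open>q\<close> equal to that difference, so replacing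
  the difference by \<open>q\<close> can only raise the convolution term; where
  \<open>u <= w\<close>, \<open>q\<close> vanishes. This is the situation of
  \<open>diffuse_on_positive_le\<close>.\<close>

lemma sol_order_contraction:
  assumes u: "sol f u" and w: "sol h w" and f: "integrable lborel f" "integrable lborel h" and T: "0 \<le> T"
  shows "(\<integral>x. max (u T x - w T x) 0 \<partial>lborel) \<le> (\<integral>x. max (f x - h x) 0 \<partial>lborel)"
proof -
  obtain C1 where C1: "0 \<le> C1" "\<And>r t. 0 \<le> r \<Longrightarrow> r \<le> t \<Longrightarrow> t \<le> T \<Longrightarrow>
    (\<integral>x. \<bar>diffuse k l (\<lambda>y. stefan_pos (u r y)) x - diffuse k l (\<lambda>y. stefan_pos (u t y)) x\<bar> \<partial>lborel) \<le> C1 * (t - r)"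
    using sol_lipschitz[OF u T] by metis
  obtain C2 where C2: "0 \<le> C2" "\<And>r t. 0 \<le> r \<Longrightarrow> r \<le> t \<Longrightarrow> t \<le> T \<Longrightarrow>
    (\<integral>x. \<bar>diffuse k l (\<lambda>y. stefan_pos (w r y)) x - diffuse k l (\<lambda>y. stefan_pos (w t y)) x\<bar> \<partial>lborel) \<le> C2 * (t - r)"
    using sol_lipschitz[OF w T] by metis
  define g where "g r = (\<lambda>x. diffuse k l (\<lambda>y. stefan_pos (u r y)) x - diffuse k l (\<lambda>y. stefan_pos (w r y)) x)" for r
  have [measurable]: "case_prod u \<in> borel_measurable (borel \<Otimes>\<^sub>M borel)" "case_prod w \<in> borel_measurable (borel \<Otimes>\<^sub>M borel)"
    using solD(1) u w by auto
  note fm [measurable] = sol_flux_measurable[OF solD(1)[OF u]] sol_flux_measurable[OF solD(1)[OF w]]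
  note fi = sol_flux_integrable[OF u] sol_flux_integrable[OF w]
  have "(\<integral>x. max (u T x - w T x) 0 \<partial>lborel) \<le> (\<integral>x. max (u 0 x - w 0 x) 0 \<partial>lborel)"
  proof (rule pos_part_decreasing[where g=g and C="C1 + C2" and w="\<lambda>t x. u t x - w t x"])
    show "case_prod g \<in> borel_measurable (borel \<Otimes>\<^sub>M borel)"
      using fm unfolding g_def split_beta' by measurable
    show "integrable lborel (g r)" if "0 \<le> r" for r
      unfolding g_def using fi that by auto
    show "integrable lborel (\<lambda>x. max (u t x - w t x) 0)" if "0 \<le> t" for t
      using solD(2)[OF u] solD(2)[OF w] that by auto
    show "(\<integral>x. \<bar>g r x - g t x\<bar> \<partial>lborel) \<le> (C1 + C2) * (t - r)" if "0 \<le> r" "r \<le> t" "t \<le> T" for r t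
    proof -
      have t: "0 \<le> t" using that by simp
      have "(\<integral>x. \<bar>g r x - g t x\<bar> \<partial>lborel) \<le> (\<integral>x.
         \<bar>diffuse k l (\<lambda>y. stefan_pos (u r y)) x - diffuse k l (\<lambda>y. stefan_pos (u t y)) x\<bar> +
         \<bar>diffuse k l (\<lambda>y. stefan_pos (w r y)) x - diffuse k l (\<lambda>y. stefan_pos (w t y)) x\<bar> \<partial>lborel)"
        unfolding g_def using fi[OF that(1)] fi[OF t]
        by (intro integral_mono integrable_abs Bochner_Integration.integrable_diff Bochner_Integration.integrable_add) auto
      also have "\<dots> \<le> C1 * (t - r) + C2 * (t - r)"
        using C1(2)[OF that] C2(2)[OF that] fi[OF that(1)] fi[OF t] by simp
      finally show ?thesis by (simp add: algebra_simps)
    qed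
    show "AE x in lborel. u t x - w t x = u s x - w s x + (\<integral>r. g r x \<partial>time_measure s t)"
      if "0 \<le> s" "s \<le> t" "t \<le> T" for s t
    proof -
      have t: "0 \<le> t" using that by simp
      have I: "AE x in lborel. integrable (time_measure s t) (\<lambda>r. diffuse k l (\<lambda>y. stefan_pos (z r y)) x)" if z: "sol h' z" for h' z
      proof -
        obtain C where C: "0 \<le> C" "\<And>r. 0 \<le> r \<Longrightarrow> r \<le> t \<Longrightarrow> (\<integral>x. \<bar>diffuse k l (\<lambda>y. stefan_pos (z r y)) x\<bar> \<partial>lborel) \<le> C"
          using sol_flux_bound[OF z t] by metis
        show ?thesis
          by (rule AE_integrable_time_section, rule integrable_time_space(1)[OF sol_flux_measurable[OF solD(1)[OF z]] \<open>s \<le> t\<close> C(1)])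
             (use \<open>0 \<le> s\<close> C sol_flux_integrable[OF z] in auto)
      qed
      show ?thesis
        using sol_increment[OF u that(1,2)] sol_increment[OF w that(1,2)] I[OF u] I[OF w]
        by eventually_elim (simp add: g_def)
    qed
    show "(\<integral>x. indicator {x. 0 < u t x - w t x} x * g t x \<partial>lborel) \<le> 0" if t: "0 \<le> t" "t \<le> T" for t
    proof -
      have i: "integrable lborel (\<lambda>x. stefan_pos (u t x))" "integrable lborel (\<lambda>x. stefan_pos (w t x))"
        using solD(2)[OF u t(1)] solD(2)[OF w t(1)] by auto
      let ?q = "\<lambda>x. max (stefan_pos (u t x) - stefan_pos (w t x)) 0"
      have iq: "integrable lborel ?q" using i by auto
      show ?thesis
      proof (rule diffuse_on_positive_le[where q="?q"])
        show "AE x in lborel. x \<in> {x. 0 < u t x - w t x} \<longrightarrow> g t x \<le> diffuse k l ?q x"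
        proof (intro AE_I2 impI)
          fix x assume x: "x \<in> {x. 0 < u t x - w t x}"
          have "g t x = diffuse k l (\<lambda>y. stefan_pos (u t y) - stefan_pos (w t y)) x"
            unfolding g_def using i by (subst diffuse_diff) auto
          also have "\<dots> \<le> diffuse k l ?q x"
            unfolding diffuse_def
          proof (intro mult_left_mono diff_mono)
            show "convolution k (\<lambda>y. stefan_pos (u t y) - stefan_pos (w t y)) x \<le> convolution k ?q x"
              using i iq by (intro conv_mono) auto
            show "?q x \<le> stefan_pos (u t x) - stefan_pos (w t x)" using x by (auto simp: stefan_pos_def)
          qed (use l_pos in auto)
          finally show "g t x \<le> diffuse k l ?q x" .
        qed
        show "integrable lborel (g t)" unfolding g_def using fi t by auto
      qed (use iq in \<open>auto simp: stefan_pos_def\<close>)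
    qed
  qed (use T C1 C2 in auto)
  also have "\<dots> = (\<integral>x. max (f x - h x) 0 \<partial>lborel)"
    using sol_initial[OF u] sol_initial[OF w] f by (intro integral_cong_AE) (auto elim: eventually_elim2)
  finally show ?thesis .
qed

lemma sol_contraction:
  assumes u: "sol f u" and w: "sol h w" and f: "integrable lborel f" "integrable lborel h" and T: "0 \<le> T"
  shows "(\<integral>x. \<bar>u T x - w T x\<bar> \<partial>lborel) \<le> (\<integral>x. \<bar>f x - h x\<bar> \<partial>lborel)"
proof -
  have e: "(\<integral>x. \<bar>a x - b x\<bar> \<partial>lborel) = (\<integral>x. max (a x - b x) 0 \<partial>lborel) + (\<integral>x. max (b x - a x) 0 \<partial>lborel)"
    if "integrable lborel a" "integrable lborel b" for a b :: "'a \<Rightarrow> real"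
  proof -
    have "(\<integral>x. \<bar>a x - b x\<bar> \<partial>lborel) = (\<integral>x. max (a x - b x) 0 + max (b x - a x) 0 \<partial>lborel)"
      by (intro Bochner_Integration.integral_cong) auto
    then show ?thesis using that by simp
  qed
  show ?thesis
    using sol_order_contraction[OF u w f T] sol_order_contraction[OF w u f(2,1) T]
      e[OF f] e[OF solD(2)[OF u T] solD(2)[OF w T]] by simp
qed

lemma sol_zero: "sol (\<lambda>_. 0) (\<lambda>_ _. 0)"
  unfolding sol_def by (auto simp: diffuse_def convolution_def stefan_pos_def)

lemma sol_L1_le:
  assumes "sol f u" "integrable lborel f" "0 \<le> T"
  shows "(\<integral>x. \<bar>u T x\<bar> \<partial>lborel) \<le> (\<integral>x. \<bar>f x\<bar> \<partial>lborel)"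
  using sol_contraction[OF assms(1) sol_zero assms(2) _ assms(3)] by simp

lemma sol_translate:
  assumes u: "sol f u"
  shows "sol (\<lambda>x. f (x + c)) (\<lambda>t x. u t (x + c))"
  unfolding sol_def
proof (intro conjI allI impI)
  have um [measurable]: "case_prod u \<in> borel_measurable (borel \<Otimes>\<^sub>M borel)" using solD(1)[OF u] .
  show "(\<lambda>(t, x). u t (x + c)) \<in> borel_measurable (borel \<Otimes>\<^sub>M borel)" by measurable
  show "integrable lborel (\<lambda>x. u t (x + c))" if "0 \<le> t" for t
    using integrable_lborel_shift(1) solD(2)[OF u that] by blast
  show "((\<lambda>t. \<integral>x. \<bar>u t (x + c) - u s (x + c)\<bar> \<partial>lborel) \<longlongrightarrow> 0) (at s within {0..})" if "0 \<le> s" for s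
  proof -
    have "(\<integral>x. \<bar>u t (x + c) - u s (x + c)\<bar> \<partial>lborel) = (\<integral>x. \<bar>u t x - u s x\<bar> \<partial>lborel)" for t
      by (rule integral_lborel_shift(1)[of "\<lambda>x. \<bar>u t x - u s x\<bar>"]) measurable
    then show ?thesis using solD(3)[OF u that] by simp
  qed
  fix t :: real assume t: "0 \<le> t"
  have "diffuse k l (\<lambda>y. stefan_pos (u s (y + c))) x = diffuse k l (\<lambda>y. stefan_pos (u s y)) (x + c)" for s x
    using integral_lborel_shift(1)[of "\<lambda>y. k (x + c - y) * stefan_pos (u s y)" c]
    by (simp add: diffuse_def convolution_def)
  then show "AE x in lborel. u t (x + c) = f (x + c) + (\<integral>s. diffuse k l (\<lambda>y. stefan_pos (u s (y + c))) x \<partial>time_measure 0 t)"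
    using AE_lborel_shift(1)[OF solD(4)[OF u t], of c] by simp
qed

lemma sol_translation_le:
  assumes u: "sol f u" and f: "integrable lborel f" and T: "0 \<le> T"
  shows "(\<integral>x. \<bar>u T (x + c) - u T x\<bar> \<partial>lborel) \<le> (\<integral>x. \<bar>f (x + c) - f x\<bar> \<partial>lborel)"
  using sol_contraction[OF sol_translate[OF u] u integrable_lborel_shift(1)[OF f] f T] .

text \<open>A constant is not integrable, so the contraction cannot be used; the argument is
  repeated against the stationary state \<open>M\<close>. For \<open>1 <= M\<close> one has
  \<open>(u - 1)\<^sub>+ \<le> (u - M)\<^sub>+ + (M - 1)\<close> with equality where
  \<open>u > M\<close>, and convolution with \<open>k\<close> reproduces the constant
  \<open>M - 1\<close>.\<close>

lemma sol_le:
  assumes u: "sol f u" and M: "1 \<le> M" "AE x in lborel. f x \<le> M" and T: "0 \<le> T"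
  shows "AE x in lborel. u T x \<le> M"
proof -
  obtain C where C: "0 \<le> C" "\<And>r t. 0 \<le> r \<Longrightarrow> r \<le> t \<Longrightarrow> t \<le> T \<Longrightarrow>
    (\<integral>x. \<bar>diffuse k l (\<lambda>y. stefan_pos (u r y)) x - diffuse k l (\<lambda>y. stefan_pos (u t y)) x\<bar> \<partial>lborel) \<le> C * (t - r)"
    using sol_lipschitz[OF u T] by metis
  have [measurable]: "case_prod u \<in> borel_measurable (borel \<Otimes>\<^sub>M borel)" using solD(1) u by auto
  have ip: "integrable lborel (\<lambda>x. max (u t x - M) 0)" if "0 \<le> t" for t
    by (rule Bochner_Integration.integrable_bound[OF solD(2)[OF u that]]) (use M in auto)
  have "(\<integral>x. max (u T x - M) 0 \<partial>lborel) \<le> (\<integral>x. max (u 0 x - M) 0 \<partial>lborel)"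
  proof (rule pos_part_decreasing[where g="\<lambda>r. diffuse k l (\<lambda>y. stefan_pos (u r y))" and C=C and w="\<lambda>t x. u t x - M"])
    show "AE x in lborel. u t x - M = u s x - M + (\<integral>r. diffuse k l (\<lambda>y. stefan_pos (u r y)) x \<partial>time_measure s t)"
      if "0 \<le> s" "s \<le> t" "t \<le> T" for s t
      using sol_increment[OF u that(1,2)] by eventually_elim simp
    show "(\<integral>x. indicator {x. 0 < u t x - M} x * diffuse k l (\<lambda>y. stefan_pos (u t y)) x \<partial>lborel) \<le> 0" if t: "0 \<le> t" "t \<le> T" for t
    proof (rule diffuse_on_positive_le[where q="\<lambda>x. max (u t x - M) 0"])
      show "AE x in lborel. x \<in> {x. 0 < u t x - M} \<longrightarrow>
          diffuse k l (\<lambda>y. stefan_pos (u t y)) x \<le> diffuse k l (\<lambda>x. max (u t x - M) 0) x"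
      proof (intro AE_I2 impI)
        fix x assume x: "x \<in> {x. 0 < u t x - M}"
        have ik: "integrable lborel (\<lambda>y. k (x - y))" by (intro integrable_lborel_shift k_integrable)
        have "convolution k (\<lambda>y. stefan_pos (u t y)) x \<le> (\<integral>y. k (x - y) * max (u t y - M) 0 + k (x - y) * (M - 1) \<partial>lborel)"
          unfolding convolution_def
        proof (rule integral_mono)
          show "integrable lborel (\<lambda>y. k (x - y) * max (u t y - M) 0 + k (x - y) * (M - 1))"
            using ik k_section[OF ip[OF t(1)], of x] by auto
          show "k (x - y) * stefan_pos (u t y) \<le> k (x - y) * max (u t y - M) 0 + k (x - y) * (M - 1)" for y
            using M by (auto simp: stefan_pos_def distrib_left[symmetric] intro!: mult_left_mono k_nonneg)
        qed (intro k_section stefan_pos_integrable solD(2)[OF u] t)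
        also have "\<dots> = convolution k (\<lambda>x. max (u t x - M) 0) x + (M - 1)"
          unfolding convolution_def using ik k_section[OF ip[OF t(1)]] integral_lborel_shift(3)[of k x] k_integral
          by (subst Bochner_Integration.integral_add) auto
        finally show "diffuse k l (\<lambda>y. stefan_pos (u t y)) x \<le> diffuse k l (\<lambda>x. max (u t x - M) 0) x"
          using x l_pos M unfolding diffuse_def by (intro mult_left_mono) (auto simp: stefan_pos_def)
      qed
    qed (use ip sol_flux_integrable[OF u] t in auto)
  qed (use T C sol_flux_measurable[OF solD(1)[OF u]] sol_flux_integrable[OF u] ip in auto)
  also have "\<dots> = (\<integral>x. 0 \<partial>(lborel :: 'a measure))"
    using sol_initial[OF u] M(2) by (intro integral_cong_AE) (auto elim: eventually_elim2)
  finally have "AE x in lborel. u T x - M \<le> 0" by (intro integral_pos_part_zero_AE ip T) simp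
  then show ?thesis by eventually_elim simp
qed

text \<open>Where \<open>u < - M <= 0\<close> the term \<open>stefan_pos u\<close> vanishes, while
  its convolution is nonnegative: the flux there can only push \<open>u\<close> up. Hence
  \<open>q = 0\<close> suffices in \<open>diffuse_on_positive_le\<close>.\<close>

lemma sol_ge:
  assumes u: "sol f u" and M: "0 \<le> M" "AE x in lborel. - M \<le> f x" and T: "0 \<le> T"
  shows "AE x in lborel. - M \<le> u T x"
proof -
  obtain C where C: "0 \<le> C" "\<And>r t. 0 \<le> r \<Longrightarrow> r \<le> t \<Longrightarrow> t \<le> T \<Longrightarrow>
    (\<integral>x. \<bar>diffuse k l (\<lambda>y. stefan_pos (u r y)) x - diffuse k l (\<lambda>y. stefan_pos (u t y)) x\<bar> \<partial>lborel) \<le> C * (t - r)"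
    using sol_lipschitz[OF u T] by metis
  have [measurable]: "case_prod u \<in> borel_measurable (borel \<Otimes>\<^sub>M borel)" using solD(1) u by auto
  note fm [measurable] = sol_flux_measurable[OF solD(1)[OF u]]
  have ip: "integrable lborel (\<lambda>x. max (- M - u t x) 0)" if "0 \<le> t" for t
    by (rule Bochner_Integration.integrable_bound[OF solD(2)[OF u that]]) (use M in auto)
  have "(\<integral>x. max (- M - u T x) 0 \<partial>lborel) \<le> (\<integral>x. max (- M - u 0 x) 0 \<partial>lborel)"
  proof (rule pos_part_decreasing[where g="\<lambda>r x. - diffuse k l (\<lambda>y. stefan_pos (u r y)) x" and C=C and w="\<lambda>t x. - M - u t x"])
    show "(\<lambda>(r, x). - diffuse k l (\<lambda>y. stefan_pos (u r y)) x) \<in> borel_measurable (borel \<Otimes>\<^sub>M borel)"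
      using borel_measurable_uminus[OF fm] by (simp add: split_beta')
    show "AE x in lborel. - M - u t x = - M - u s x + (\<integral>r. - diffuse k l (\<lambda>y. stefan_pos (u r y)) x \<partial>time_measure s t)"
      if "0 \<le> s" "s \<le> t" "t \<le> T" for s t
      using sol_increment[OF u that(1,2)] by eventually_elim simp
    show "(\<integral>x. indicator {x. 0 < - M - u t x} x * - diffuse k l (\<lambda>y. stefan_pos (u t y)) x \<partial>lborel) \<le> 0" if t: "0 \<le> t" "t \<le> T" for t
    proof (rule diffuse_on_positive_le[where q="\<lambda>x. 0"])
      show "AE x in lborel. x \<in> {x. 0 < - M - u t x} \<longrightarrow>
          - diffuse k l (\<lambda>y. stefan_pos (u t y)) x \<le> diffuse k l (\<lambda>x. 0) x"
        using M(1) conv_nonneg[of "\<lambda>y. stefan_pos (u t y)"] l_pos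
        by (auto simp: diffuse_def convolution_def[of _ "\<lambda>x. 0"] stefan_pos_def)
    qed (use ip sol_flux_integrable[OF u] t in auto)
    show "(\<integral>x. \<bar>- diffuse k l (\<lambda>y. stefan_pos (u r y)) x - - diffuse k l (\<lambda>y. stefan_pos (u t y)) x\<bar> \<partial>lborel) \<le> C * (t - r)"
      if "0 \<le> r" "r \<le> t" "t \<le> T" for r t
      using C(2)[OF that] by (simp add: abs_minus_commute)
  qed (use T C sol_flux_integrable[OF u] ip in auto)
  also have "\<dots> = (\<integral>x. 0 \<partial>(lborel :: 'a measure))"
    using sol_initial[OF u] M(2) by (intro integral_cong_AE) (auto elim: eventually_elim2)
  finally have "AE x in lborel. - M - u T x \<le> 0" by (intro integral_pos_part_zero_AE ip T) simp
  then show ?thesis by eventually_elim simp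
qed

end

subsection \<open>Calculus of $C^k$ functions\<close>

lemma dir_deriv_eqI:
  assumes "\<And>z. (\<phi> has_derivative D z) (at z)"
  shows "dir_deriv b \<phi> = (\<lambda>z. D z b)"
  unfolding dir_deriv_def using frechet_derivative_at[OF assms] by metis

lemma dir_deriv_has_derivative:
  assumes "\<phi> differentiable (at z)"
  shows "(\<phi> has_derivative (\<lambda>b. dir_deriv b \<phi> z)) (at z)"
  using assms unfolding dir_deriv_def frechet_derivative_works by simp

lemma C_k_SucD: "C_k (Suc k) \<phi> \<Longrightarrow> C_k k \<phi>"
proof (induction k arbitrary: \<phi>)
  case 0
  then show ?case by (auto intro!: differentiable_imp_continuous_on simp: differentiable_on_def differentiable_at_withinI)
qed auto

lemma C_k_const: "C_k k (\<lambda>_. c)"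
proof (induction k arbitrary: c)
  case (Suc k)
  have "dir_deriv b (\<lambda>_. c) = (\<lambda>_. 0)" for b :: 'a by (rule dir_deriv_eqI) auto
  then show ?case using Suc by auto
qed auto

lemma C_k_bounded_linear:
  assumes "bounded_linear f" shows "C_k k f"
proof (cases k)
  case 0 then show ?thesis using assms by (simp add: linear_continuous_on)
next
  case (Suc j)
  have "dir_deriv b f = (\<lambda>_. f b)" for b
    by (rule dir_deriv_eqI) (rule bounded_linear_imp_has_derivative[OF assms])
  then show ?thesis using Suc C_k_const assms by (auto simp: bounded_linear_imp_differentiable)
qed

lemma C_k_add: "C_k k f \<Longrightarrow> C_k k g \<Longrightarrow> C_k k (\<lambda>z. f z + g z)"
proof (induction k arbitrary: f g)
  case 0 then show ?case by (auto intro: continuous_on_add)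
next
  case (Suc k)
  have "dir_deriv b (\<lambda>z. f z + g z) = (\<lambda>z. dir_deriv b f z + dir_deriv b g z)" for b
    using Suc.prems by (intro dir_deriv_eqI derivative_intros dir_deriv_has_derivative) auto
  then show ?case using Suc by auto
qed

lemma C_k_mult: "C_k k f \<Longrightarrow> C_k k g \<Longrightarrow> C_k k (\<lambda>z. f z * g z)"
proof (induction k arbitrary: f g)
  case 0 then show ?case by (auto intro: continuous_on_mult)
next
  case (Suc k)
  have "dir_deriv b (\<lambda>z. f z * g z) = (\<lambda>z. f z * dir_deriv b g z + dir_deriv b f z * g z)" for b
    using Suc.prems by (intro dir_deriv_eqI derivative_intros dir_deriv_has_derivative) auto
  moreover have "C_k k f" "C_k k g" using C_k_SucD[OF Suc.prems(1)] C_k_SucD[OF Suc.prems(2)] by auto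
  ultimately show ?case using Suc by (auto intro!: C_k_add)
qed

lemma C_k_sum: "(\<And>i. i \<in> I \<Longrightarrow> C_k k (f i)) \<Longrightarrow> C_k k (\<lambda>z. \<Sum>i\<in>I. f i z)"
  by (induction I rule: infinite_finite_induct) (auto intro: C_k_const C_k_add)

text \<open>Indexing all derivatives of the outer function by \<open>n\<close> lets the induction on
  \<open>k\<close> pass from \<open>h n\<close> to \<open>h (Suc n)\<close> without a separate
  notion of smoothness on the line.\<close>

lemma C_k_compose:
  assumes h: "\<And>n x. (h n has_real_derivative h (Suc n) x) (at x)"
  shows "C_k k \<phi> \<Longrightarrow> C_k k (\<lambda>z. h n (\<phi> z))"
proof (induction k arbitrary: n)
  case 0
  have "continuous_on UNIV (h n)" using h by (intro DERIV_continuous_on) (auto intro: has_field_derivative_at_within)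
  then show ?case using 0 continuous_on_compose2 by force
next
  case (Suc k)
  have d: "((\<lambda>z. h n (\<phi> z)) has_derivative (\<lambda>b. h (Suc n) (\<phi> z) * dir_deriv b \<phi> z)) (at z)" for z
  proof -
    have "(h n has_derivative (\<lambda>y. h (Suc n) (\<phi> z) * y)) (at (\<phi> z))"
      using h by (simp add: has_field_derivative_def)
    moreover have "(\<phi> has_derivative (\<lambda>b. dir_deriv b \<phi> z)) (at z)"
      using Suc.prems by (intro dir_deriv_has_derivative) auto
    ultimately show ?thesis using has_derivative_compose by force
  qed
  have "dir_deriv b (\<lambda>z. h n (\<phi> z)) = (\<lambda>z. h (Suc n) (\<phi> z) * dir_deriv b \<phi> z)" for b
    by (rule dir_deriv_eqI[OF d])
  moreover have "C_k k \<phi>" using Suc.prems C_k_SucD by blast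
  ultimately show ?case using Suc d by (auto intro!: C_k_mult simp: differentiable_def)
qed

subsection \<open>Smooth cutoff functions\<close>

text \<open>The polynomial is a parameter because the functions \<open>p(1/s) exp(-1/s)\<close>,
  extended by 0, are closed under differentiation: they contain all derivatives of the standard flat
  function.\<close>

definition flat :: "real poly \<Rightarrow> real \<Rightarrow> real" where
  "flat p s = (if s > 0 then poly p (1 / s) * exp (- (1 / s)) else 0)"

lemma poly_exp_tendsto_0: "((\<lambda>y. poly p y * exp (- y)) \<longlongrightarrow> 0) at_top" for p :: "real poly"
proof -
  have "((\<lambda>y. \<Sum>i\<le>degree p. coeff p i * (y ^ i / exp y)) \<longlongrightarrow> (\<Sum>i\<le>degree p. coeff p i * 0)) at_top"
    by (intro tendsto_sum tendsto_mult tendsto_const tendsto_power_div_exp_0)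
  moreover have "poly p y * exp (- y) = (\<Sum>i\<le>degree p. coeff p i * (y ^ i / exp y))" for y
    by (simp add: poly_altdef exp_minus sum_distrib_right divide_simps)
  ultimately show ?thesis by simp
qed

lemma flat_tendsto_0: "(flat p \<longlongrightarrow> 0) (at_right 0)"
proof -
  have "((\<lambda>s. poly p (inverse s) * exp (- inverse s)) \<longlongrightarrow> 0) (at_right 0)"
    by (rule filterlim_compose[OF poly_exp_tendsto_0 filterlim_inverse_at_top_right])
  moreover have "\<forall>\<^sub>F s in at_right 0. poly p (inverse s) * exp (- inverse s) = flat p s"
    by (auto simp: eventually_at_filter flat_def inverse_eq_divide)
  ultimately show ?thesis by (rule Lim_transform_eventually)
qed

text \<open>In the variable \<open>y = 1 / s\<close> the derivative replaces \<open>p\<close> by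
  \<open>y^2 (p - p')\<close>. At 0 the difference quotient from the right is again such a function,
  for the polynomial \<open>y p\<close>, and hence tends to 0.\<close>

lemma flat_has_derivative:
  "(flat p has_real_derivative flat ([:0, 0, 1:] * (p - pderiv p)) s) (at s)"
proof (cases "s = 0")
  case False
  show ?thesis
  proof (cases "s > 0")
    case True
    have "((\<lambda>s. poly p (1 / s) * exp (- (1 / s))) has_real_derivative flat ([:0, 0, 1:] * (p - pderiv p)) s) (at s)"
      unfolding flat_def using True
      by (auto intro!: derivative_eq_intros DERIV_chain2[OF poly_DERIV] simp: field_simps power2_eq_square)
    moreover have "\<forall>\<^sub>F r in nhds s. poly p (1 / r) * exp (- (1 / r)) = flat p r"
      using True eventually_nhds_in_open[of "{0<..}" s] by (auto simp: flat_def elim!: eventually_mono)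
    ultimately show ?thesis by (subst (asm) DERIV_cong_ev[OF refl _ refl])
  next
    case neg: False
    have "((\<lambda>s. 0) has_real_derivative flat ([:0, 0, 1:] * (p - pderiv p)) s) (at s)"
      unfolding flat_def using neg by auto
    moreover have "\<forall>\<^sub>F r in nhds s. 0 = flat p r"
      using neg False eventually_nhds_in_open[of "{..<0}" s] by (auto simp: flat_def elim!: eventually_mono)
    ultimately show ?thesis by (subst (asm) DERIV_cong_ev[OF refl _ refl])
  qed
next
  case True
  have "((\<lambda>s. flat p s / s) \<longlongrightarrow> 0) (at 0)"
  proof (rule filterlim_split_at)
    have "\<forall>\<^sub>F s in at_left 0. (0::real) = flat p s / s"
      by (auto simp: eventually_at_filter flat_def)
    then show "((\<lambda>s. flat p s / s) \<longlongrightarrow> 0) (at_left 0)" by (rule Lim_transform_eventually[OF tendsto_const])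
    have "\<forall>\<^sub>F s in at_right 0. flat (pCons 0 p) s = flat p s / s"
      by (auto simp: eventually_at_filter flat_def)
    then show "((\<lambda>s. flat p s / s) \<longlongrightarrow> 0) (at_right 0)" by (rule Lim_transform_eventually[OF flat_tendsto_0])
  qed
  then show ?thesis using True by (simp add: has_field_derivative_iff flat_def)
qed

definition flat_exp :: "real \<Rightarrow> real" where "flat_exp = flat 1"

lemma flat_exp_eq: "flat_exp s = (if s > 0 then exp (- (1 / s)) else 0)"
  by (simp add: flat_exp_def flat_def)

lemma C_k_flat_exp: "C_k k \<phi> \<Longrightarrow> C_k k (\<lambda>z. flat_exp (\<phi> z))"
  using C_k_compose[of "\<lambda>n. flat (((\<lambda>p. [:0, 0, 1:] * (p - pderiv p)) ^^ n) 1)" k \<phi> 0] flat_has_derivative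
  by (simp add: flat_exp_def)

lemma flat_exp_nonneg: "0 \<le> flat_exp s"
  by (simp add: flat_exp_eq)

lemma flat_exp_ge: "1 \<le> s \<Longrightarrow> exp (- 1) \<le> flat_exp s"
  by (auto simp: flat_exp_eq divide_simps)

lemma continuous_flat_exp: "continuous_on A flat_exp"
  unfolding flat_exp_def
  by (intro DERIV_continuous_on) (rule has_field_derivative_at_within[OF flat_has_derivative])

text \<open>On \<open>[-1, T + 1]\<close> both inner terms vanish and the outer factor
  \<open>exp 1\<close> normalises \<open>flat_exp 1 = exp (- 1)\<close> to 1. At distance one beyond
  this interval an inner term is at least \<open>exp (- 1)\<close>, so the inner factor
  \<open>exp 1\<close> makes the outer argument nonpositive.\<close>

definition time_cutoff :: "real \<Rightarrow> real \<Rightarrow> real" where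
  "time_cutoff T s = exp 1 * flat_exp (1 - exp 1 * (flat_exp (s - T - 1) + flat_exp (- 1 - s)))"

lemma time_cutoff_eq_1: "- 1 \<le> s \<Longrightarrow> s \<le> T + 1 \<Longrightarrow> time_cutoff T s = 1"
  by (simp add: time_cutoff_def flat_exp_eq flip: exp_add)

lemma time_cutoff_eq_0:
  assumes "s \<le> - 2 \<or> T + 2 \<le> s" shows "time_cutoff T s = 0"
proof -
  have "exp (- 1) \<le> flat_exp (s - T - 1) + flat_exp (- 1 - s)"
    using assms flat_exp_ge[of "s - T - 1"] flat_exp_ge[of "- 1 - s"] flat_exp_nonneg[of "s - T - 1"] flat_exp_nonneg[of "- 1 - s"]
    by auto
  then have "exp 1 * exp (- 1) \<le> exp 1 * (flat_exp (s - T - 1) + flat_exp (- 1 - s))"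
    by (intro mult_left_mono) auto
  then have "1 - exp 1 * (flat_exp (s - T - 1) + flat_exp (- 1 - s)) \<le> 0" by (simp flip: exp_add)
  then show ?thesis by (simp add: time_cutoff_def flat_exp_eq)
qed

definition bump :: "'a::euclidean_space \<Rightarrow> real" where
  "bump x = flat_exp (1 - (norm x)\<^sup>2)"

lemma bump_nonneg: "0 \<le> bump x"
  by (simp add: bump_def flat_exp_nonneg)

lemma bump_eq_0: "1 \<le> norm x \<Longrightarrow> bump x = 0"
proof -
  assume "1 \<le> norm x"
  then have "1 \<le> (norm x)\<^sup>2" by (rule one_le_power)
  then show ?thesis by (simp add: bump_def flat_exp_eq)
qed

lemma bump_pos: "norm x < 1 \<Longrightarrow> 0 < bump x"
  using power_strict_mono[of "norm x" 1 2] by (auto simp: bump_def flat_exp_eq)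

lemma continuous_bump: "continuous_on A bump"
  unfolding bump_def[abs_def]
  by (rule continuous_on_compose2[OF continuous_flat_exp[of UNIV]]) (auto intro!: continuous_intros)

lemma integrable_compact_support:
  fixes g :: "'a::euclidean_space \<Rightarrow> real"
  assumes "continuous_on UNIV g" "\<And>x. R < norm x \<Longrightarrow> g x = 0"
  shows "integrable lborel g"
proof -
  have "integrable lborel (\<lambda>x. indicator (cball 0 R) x *\<^sub>R g x)"
    by (rule borel_integrable_compact) (auto intro: continuous_on_subset[OF assms(1)])
  moreover have "(\<lambda>x. indicator (cball 0 R) x *\<^sub>R g x) = g"
    using assms(2) by (force simp: indicator_def)
  ultimately show ?thesis by simp
qed

lemma bump_integrable: "integrable lborel bump"
  by (rule integrable_compact_support[OF continuous_bump, of 1]) (auto intro: bump_eq_0)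

lemma bump_integral_pos: "0 < (\<integral>x. bump x \<partial>(lborel :: 'a::euclidean_space measure))"
proof (rule ccontr)
  assume "\<not> ?thesis"
  then have "(\<integral>x. bump x \<partial>(lborel :: 'a measure)) = 0"
    using bump_nonneg by (intro antisym integral_nonneg_AE) auto
  then have "AE x in (lborel :: 'a measure). bump x = 0"
    using bump_integrable bump_nonneg by (subst (asm) integral_nonneg_eq_0_iff_AE) auto
  then have "AE x in (lborel :: 'a measure). x \<notin> ball 0 1"
    by eventually_elim (use bump_pos in force)
  then have "emeasure lborel (ball (0::'a) 1) = 0"
    by (subst (asm) AE_iff_measurable[OF _ refl]) (auto simp: ball_def)
  then have "negligible (ball (0::'a) 1)"
    by (simp add: negligible_iff_null_sets null_setsI)
  then show False using open_not_negligible[of "ball (0::'a) 1"] by simp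
qed

definition mollifier :: "'a::euclidean_space \<Rightarrow> real" where
  "mollifier x = bump x / (\<integral>y. bump y \<partial>(lborel :: 'a measure))"

lemma continuous_mollifier: "continuous_on A (mollifier :: 'a::euclidean_space \<Rightarrow> real)"
  unfolding mollifier_def[abs_def] using bump_integral_pos[where 'a='a]
  by (intro continuous_intros continuous_bump) auto

lemma compact_closure_support:
  fixes g :: "'a::euclidean_space \<Rightarrow> real"
  assumes "\<And>x. R < norm x \<Longrightarrow> g x = 0"
  shows "compact (closure {x. g x \<noteq> 0})"
proof -
  have "{x. g x \<noteq> 0} \<subseteq> cball 0 R" using assms by force
  then have "bounded {x. g x \<noteq> 0}" using bounded_cball bounded_subset by blast
  then show ?thesis using compact_closure by blast
qed

lemma mollifier_nonneg: "0 \<le> mollifier (x :: 'a::euclidean_space)"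
  unfolding mollifier_def using bump_integral_pos[where 'a='a] bump_nonneg[of x] by simp

lemma radial_kernel_mollifier: "radial_kernel (mollifier :: 'a::euclidean_space \<Rightarrow> real)"
  unfolding radial_kernel_def
proof (intro conjI allI impI)
  show "compact (closure {x. (mollifier x :: real) \<noteq> 0})"
    by (rule compact_closure_support[of 1]) (auto simp: mollifier_def bump_eq_0)
  show "(\<integral>x. mollifier x \<partial>(lborel :: 'a measure)) = 1"
    unfolding mollifier_def using bump_integral_pos[where 'a='a] by simp
qed (use mollifier_nonneg continuous_mollifier in \<open>auto simp: mollifier_def bump_def\<close>)

text \<open>The test function that turns the weak formulation into the mollified equation at the
  point \<open>x\<close>: a mollifier centred at \<open>x\<close> in space, constant in time on a
  neighbourhood of \<open>[0, T]\<close>.\<close>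

definition space_time_bump :: "real \<Rightarrow> real \<Rightarrow> 'a::euclidean_space \<Rightarrow> 'a \<times> real \<Rightarrow> real" where
  "space_time_bump T d x z = rescale d mollifier (x - fst z) * time_cutoff T (snd z)"

lemma test_function_space_time_bump:
  assumes "0 < d" shows "test_function (space_time_bump T d x)"
  unfolding test_function_def
proof (intro conjI allI)
  fix k
  have l: "C_k k (\<lambda>z::'a \<times> real. fst z \<bullet> b)" for b
    by (intro C_k_bounded_linear bounded_linear_compose[OF bounded_linear_inner_left bounded_linear_fst])
  have t: "C_k k (\<lambda>z::'a \<times> real. snd z)" by (intro C_k_bounded_linear bounded_linear_snd)
  \<comment> \<open>In coordinates the squared norm is a polynomial in linear functions, so the
    closure properties of \<open>C_k\<close> apply.\<close>
  have n: "(norm ((x - fst z) /\<^sub>R d))\<^sup>2 = (\<Sum>b\<in>Basis. (x \<bullet> b / d + (- 1 / d) * (fst z \<bullet> b)) * (x \<bullet> b / d + (- 1 / d) * (fst z \<bullet> b)))" for z :: "'a \<times> real"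
    unfolding power2_norm_eq_inner
    by (subst euclidean_inner) (simp add: inner_diff_left divide_inverse right_diff_distrib mult.commute)
  have b: "C_k k (\<lambda>z::'a \<times> real. bump ((x - fst z) /\<^sub>R d))"
  proof -
    have "C_k k (\<lambda>z::'a \<times> real. 1 + (- 1) * (\<Sum>b\<in>Basis. (x \<bullet> b / d + (- 1 / d) * (fst z \<bullet> b)) * (x \<bullet> b / d + (- 1 / d) * (fst z \<bullet> b))))"
      by (intro C_k_add C_k_const C_k_mult C_k_sum l)
    then show ?thesis unfolding bump_def n by (intro C_k_flat_exp) simp
  qed
  have c: "C_k k (\<lambda>z::'a \<times> real. time_cutoff T (snd z))"
  proof -
    have "C_k k (\<lambda>z::'a \<times> real. exp 1 * flat_exp (1 + (- exp 1) * (flat_exp (snd z + (- T - 1)) + flat_exp (- 1 + (- 1) * snd z))))"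
      by (intro C_k_add C_k_const C_k_mult C_k_flat_exp t)
    moreover have "time_cutoff T s = exp 1 * flat_exp (1 + (- exp 1) * (flat_exp (s + (- T - 1)) + flat_exp (- 1 + (- 1) * s)))" for s
    proof -
      have "s - T - 1 = s + (- T - 1)" "- 1 - s = - 1 + (- 1) * s" by auto
      then show ?thesis unfolding time_cutoff_def by (simp only: mult_minus_left add_uminus_conv_diff)
    qed
    ultimately show ?thesis by simp
  qed
  have "C_k k (\<lambda>z::'a \<times> real. (1 / ((\<integral>y. bump y \<partial>(lborel :: 'a measure)) * d ^ DIM('a))) * bump ((x - fst z) /\<^sub>R d) * time_cutoff T (snd z))"
    by (intro C_k_mult C_k_const b c)
  moreover have "space_time_bump T d x = (\<lambda>z::'a \<times> real. (1 / ((\<integral>y. bump y \<partial>(lborel :: 'a measure)) * d ^ DIM('a))) * bump ((x - fst z) /\<^sub>R d) * time_cutoff T (snd z))"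
    by (auto simp: space_time_bump_def rescale_def mollifier_def)
  ultimately show "C_k k (space_time_bump T d x)" by simp
next
  show "compact (closure {z. space_time_bump T d x z \<noteq> 0})"
  proof (rule compact_closure_support)
    fix z :: "'a \<times> real"
    assume z: "(norm x + d) + (\<bar>T\<bar> + 2) < norm z"
    have "norm z \<le> norm (fst z) + norm (snd z)" using norm_Pair_le[of "fst z" "snd z"] by simp
    then consider "norm x + d < norm (fst z)" | "\<bar>T\<bar> + 2 < \<bar>snd z\<bar>" using z by fastforce
    then show "space_time_bump T d x z = 0"
    proof cases
      case 1
      have "d \<le> norm (x - fst z)" using 1 norm_triangle_ineq2[of "fst z" x] by (simp add: norm_minus_commute)
      then have "1 \<le> norm ((x - fst z) /\<^sub>R d)" using assms unfolding norm_scaleR by (simp add: field_simps)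
      then show ?thesis by (simp add: space_time_bump_def rescale_def mollifier_def bump_eq_0)
    next
      case 2 then show ?thesis by (auto simp: space_time_bump_def intro!: time_cutoff_eq_0)
    qed
  qed
qed

subsection \<open>Second moments of radial kernels\<close>

lemma compact_support_radius:
  fixes g :: "'a::euclidean_space \<Rightarrow> real"
  assumes "compact (closure {x. g x \<noteq> 0})"
  obtains R where "0 < R" "\<And>x. R < norm x \<Longrightarrow> g x = 0"
proof -
  have "bounded {x. g x \<noteq> 0}"
    using compact_imp_bounded[OF assms] bounded_subset closure_subset by blast
  then obtain R where "0 < R" "\<forall>x\<in>{x. g x \<noteq> 0}. norm x \<le> R" using bounded_pos by blast
  then show thesis using that by force
qed

lemma compact_support_bounded:
  fixes g :: "'a::euclidean_space \<Rightarrow> real"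
  assumes "continuous_on UNIV g" "compact (closure {x. g x \<noteq> 0})"
  obtains B where "0 < B" "\<And>x. \<bar>g x\<bar> \<le> B"
proof -
  have "bounded (g ` closure {x. g x \<noteq> 0})"
    by (intro compact_imp_bounded compact_continuous_image assms continuous_on_subset[OF assms(1)]) auto
  then obtain B where B: "0 < B" "\<forall>y\<in>g ` closure {x. g x \<noteq> 0}. norm y \<le> B" using bounded_pos by blast
  have "\<bar>g x\<bar> \<le> B" for x
  proof (cases "g x = 0")
    case False
    then have "x \<in> closure {x. g x \<noteq> 0}" using closure_subset by force
    then show ?thesis using B(2) by force
  qed (use B in auto)
  then show thesis using that B by blast
qed

lemma radial_kernelD:
  assumes "radial_kernel J"
  shows "0 \<le> J x" "continuous_on A J" "compact (closure {x. J x \<noteq> 0})" "norm x = norm y \<Longrightarrow> J x = J y"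
    "(\<integral>x. J x \<partial>lborel) = 1" "J (- x) = J x" "J \<in> borel_measurable borel" "integrable lborel J"
proof -
  show "0 \<le> J x" "compact (closure {x. J x \<noteq> 0})" "(\<integral>x. J x \<partial>lborel) = 1"
    and n: "norm x = norm y \<Longrightarrow> J x = J y" for x y
    using assms unfolding radial_kernel_def by blast+
  have c: "continuous_on UNIV J" using assms unfolding radial_kernel_def by blast
  then show "continuous_on A J" "J \<in> borel_measurable borel"
    by (auto intro: continuous_on_subset borel_measurable_continuous_onI)
  show "J (- x) = J x" by (rule n) simp
  show "integrable lborel J" using \<open>(\<integral>x. J x \<partial>lborel) = 1\<close> not_integrable_integral_eq by fastforce
qed

lemma integral_reflect_coordinate:
  fixes g :: "'a::euclidean_space \<Rightarrow> real"
  assumes [measurable]: "g \<in> borel_measurable borel" and b: "b \<in> Basis"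
  shows "(\<integral>z. g (z - (2 * (z \<bullet> b)) *\<^sub>R b) \<partial>lborel) = (\<integral>z. g z \<partial>lborel)"
proof -
  define c :: "'a \<Rightarrow> real" where "c j = (if j = b then - 1 else 1)" for j
  have T: "0 + (\<Sum>j\<in>Basis. (c j * (z \<bullet> j)) *\<^sub>R j) = z - (2 * (z \<bullet> b)) *\<^sub>R b" for z
    by (rule euclidean_eqI) (use b in \<open>auto simp: inner_diff_left inner_Basis c_def\<close>)
  have "lborel = density (distr lborel borel (\<lambda>z::'a. z - (2 * (z \<bullet> b)) *\<^sub>R b)) (\<lambda>_. (\<Prod>j\<in>Basis. \<bar>c j\<bar>))"
    unfolding T[symmetric] by (rule lborel_affine_euclidean) (simp add: c_def)
  moreover have "(\<Prod>j\<in>Basis. \<bar>c j\<bar>) = 1" by (rule prod.neutral) (simp add: c_def)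
  ultimately have eq: "lborel = distr lborel borel (\<lambda>z::'a. z - (2 * (z \<bullet> b)) *\<^sub>R b)"
    by (simp add: density_1)
  then show ?thesis by (subst (2) eq, subst integral_distr) auto
qed

text \<open>For distinct basis vectors this is the reflection in the hyperplane orthogonal to
  \<open>b - c\<close>; for \<open>b = c\<close> it is the identity.\<close>

definition swap_coords :: "'a::euclidean_space \<Rightarrow> 'a \<Rightarrow> 'a \<Rightarrow> 'a" where
  "swap_coords b c z = z + (z \<bullet> c - z \<bullet> b) *\<^sub>R (b - c)"

lemma swap_coords_inner:
  assumes "b \<in> Basis" "c \<in> Basis" "i \<in> Basis"
  shows "swap_coords b c z \<bullet> i = z \<bullet> Transposition.transpose b c i"
  using assms unfolding swap_coords_def
  by (cases "i = b"; cases "i = c") (auto simp: inner_simps inner_Basis Transposition.transpose_def)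

lemma swap_coords_norm:
  assumes "b \<in> Basis" "c \<in> Basis"
  shows "norm (swap_coords b c z) = norm z"
proof -
  have "b \<bullet> b = 1" "c \<bullet> c = 1" using assms by auto
  then show ?thesis
    by (cases "b = c")
       (use assms in \<open>auto simp: norm_eq swap_coords_def inner_simps inner_Basis inner_commute algebra_simps\<close>)
qed

text \<open>Lebesgue measure is determined by its values on boxes, and the swap maps boxes to boxes
  with permuted side lengths.\<close>

lemma integral_swap_coords:
  fixes g :: "'a::euclidean_space \<Rightarrow> real"
  assumes [measurable]: "g \<in> borel_measurable borel" and bc: "b \<in> Basis" "c \<in> Basis"
  shows "(\<integral>z. g (swap_coords b c z) \<partial>lborel) = (\<integral>z. g z \<partial>lborel)"
proof -
  let ?S = "swap_coords b c" and ?t = "Transposition.transpose b c"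
  have t: "?t i \<in> Basis" if "i \<in> Basis" for i using that bc by (auto simp: Transposition.transpose_def)
  have [measurable]: "?S \<in> borel_measurable borel" unfolding swap_coords_def[abs_def] by measurable
  have eq: "lborel = distr lborel borel ?S"
  proof (rule lborel_eqI)
    fix l u :: 'a assume lu: "\<And>b. b \<in> Basis \<Longrightarrow> l \<bullet> b \<le> u \<bullet> b"
    have "?S -` box l u = box (?S l) (?S u)"
    proof (intro set_eqI iffI)
      fix z assume z: "z \<in> ?S -` box l u"
      show "z \<in> box (?S l) (?S u)"
        unfolding box_def
      proof (intro CollectI ballI)
        fix i :: 'a assume i: "i \<in> Basis"
        show "?S l \<bullet> i < z \<bullet> i \<and> z \<bullet> i < ?S u \<bullet> i"
          using z t[OF i] i swap_coords_inner[OF bc] by (auto simp: box_def)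
      qed
    next
      fix z assume z: "z \<in> box (?S l) (?S u)"
      show "z \<in> ?S -` box l u"
        unfolding box_def
      proof (intro vimageI2 CollectI ballI)
        fix i :: 'a assume i: "i \<in> Basis"
        have "?S l \<bullet> ?t i < z \<bullet> ?t i \<and> z \<bullet> ?t i < ?S u \<bullet> ?t i" using z t[OF i] by (auto simp: box_def)
        then show "l \<bullet> i < ?S z \<bullet> i \<and> ?S z \<bullet> i < u \<bullet> i"
          using t[OF i] i swap_coords_inner[OF bc] by auto
      qed
    qed
    then have "emeasure (distr lborel borel ?S) (box l u) = emeasure lborel (box (?S l) (?S u))"
      by (subst emeasure_distr) auto
    also have "\<dots> = (\<Prod>i\<in>Basis. (?S u - ?S l) \<bullet> i)"
      using lu t swap_coords_inner[OF bc] by (subst emeasure_lborel_box) auto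
    also have "(\<Prod>i\<in>Basis. (?S u - ?S l) \<bullet> i) = (\<Prod>i\<in>Basis. (u - l) \<bullet> ?t i)"
      by (intro prod.cong) (auto simp: inner_diff_left swap_coords_inner[OF bc])
    also have "\<dots> = (\<Prod>i\<in>Basis. (u - l) \<bullet> i)"
      using prod.permute[OF permutes_swap_id[OF bc], of "\<lambda>i. (u - l) \<bullet> i"] by (simp add: o_def)
    finally show "emeasure (distr lborel borel ?S) (box l u) = (\<Prod>i\<in>Basis. (u - l) \<bullet> i)" .
  qed simp
  then show ?thesis by (subst (2) eq, subst integral_distr) auto
qed

lemma radial_kernel_poly_integrable:
  fixes J :: "'a::euclidean_space \<Rightarrow> real"
  assumes J: "radial_kernel J" and "continuous_on UNIV g"
  shows "integrable lborel (\<lambda>z. J z * g z)"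
proof -
  obtain R where R: "0 < R" "\<And>x. R < norm x \<Longrightarrow> J x = 0"
    using compact_support_radius[OF radial_kernelD(3)[OF J]] by blast
  show ?thesis
    by (rule integrable_compact_support[of _ R]) (use R assms radial_kernelD(2)[OF J] in \<open>auto intro!: continuous_on_mult\<close>)
qed

text \<open>Reflecting one coordinate changes the sign of an off-diagonal moment, which therefore
  vanishes. Swapping coordinates shows that the diagonal moments agree; as they add up to
  \<open>second_moment J\<close>, each is its share \<open>1 / DIM('a)\<close>. This is the source
  of the dimension in \<open>diffusivity\<close>.\<close>

lemma radial_kernel_moment:
  fixes J :: "'a::euclidean_space \<Rightarrow> real"
  assumes J: "radial_kernel J" and b: "b \<in> Basis" "c \<in> Basis"
  shows "(\<integral>z. J z * ((z \<bullet> b) * (z \<bullet> c)) \<partial>lborel) = (if b = c then second_moment J / DIM('a) else 0)"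
proof -
  have [measurable]: "J \<in> borel_measurable borel" by (rule radial_kernelD(7)[OF J])
  note J4 = radial_kernelD(4)[OF J]
  show ?thesis
  proof (cases "b = c")
    case False
    have n: "norm (z - (2 * (z \<bullet> b)) *\<^sub>R b) = norm z" for z
      using b by (simp add: norm_eq inner_simps inner_Basis inner_commute algebra_simps)
    have "(\<integral>z. J z * ((z \<bullet> b) * (z \<bullet> c)) \<partial>lborel) = (\<integral>z. J z * (- (z \<bullet> b) * (z \<bullet> c)) \<partial>lborel)"
      using integral_reflect_coordinate[of "\<lambda>z. J z * ((z \<bullet> b) * (z \<bullet> c))" b] b False
      by (simp add: J4[OF n] inner_simps inner_Basis)
    then show ?thesis using False by simp
  next
    case True
    have s: "(\<integral>z. J z * ((z \<bullet> i) * (z \<bullet> i)) \<partial>lborel) = (\<integral>z. J z * ((z \<bullet> b) * (z \<bullet> b)) \<partial>lborel)" if "i \<in> Basis" for i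
      using integral_swap_coords[of "\<lambda>z. J z * ((z \<bullet> b) * (z \<bullet> b))" b i] b that
      by (simp add: J4[OF swap_coords_norm] swap_coords_inner)
    have "second_moment J = (\<integral>z. (\<Sum>i\<in>Basis. J z * ((z \<bullet> i) * (z \<bullet> i))) \<partial>lborel)"
      unfolding second_moment_def power2_norm_eq_inner
      by (subst euclidean_inner) (simp add: sum_distrib_left mult.commute)
    also have "\<dots> = (\<Sum>i\<in>Basis. (\<integral>z. J z * ((z \<bullet> i) * (z \<bullet> i)) \<partial>lborel))"
      by (rule Bochner_Integration.integral_sum) (auto intro!: radial_kernel_poly_integrable[OF J] continuous_intros)
    also have "\<dots> = DIM('a) * (\<integral>z. J z * ((z \<bullet> b) * (z \<bullet> b)) \<partial>lborel)"
      by (simp add: s)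
    finally show ?thesis using True by simp
  qed
qed

subsection \<open>Consistency of the nonlocal operator\<close>

lemma test_functionD:
  assumes "test_function \<phi>"
  shows "C_k k \<phi>" "compact (closure {z. \<phi> z \<noteq> 0})" "continuous_on A \<phi>" "\<phi> differentiable (at z)"
    "\<phi> \<in> borel_measurable borel"
proof -
  show C: "C_k k \<phi>" for k using assms by (simp add: test_function_def)
  show "compact (closure {z. \<phi> z \<noteq> 0})" using assms by (simp add: test_function_def)
  show "\<phi> differentiable (at z)" using C[of "Suc 0"] by simp
  have "continuous_on UNIV \<phi>" using C[of 0] by simp
  then show "continuous_on A \<phi>" "\<phi> \<in> borel_measurable borel"
    by (auto intro: continuous_on_subset borel_measurable_continuous_onI)
qed

lemma test_function_dir_deriv:
  assumes \<phi>: "test_function \<phi>" and b: "b \<in> Basis"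
  shows "test_function (dir_deriv b \<phi>)"
  unfolding test_function_def
proof (intro conjI allI)
  show "C_k k (dir_deriv b \<phi>)" for k using test_functionD(1)[OF \<phi>, of "Suc k"] b by simp
  let ?S = "closure {z. \<phi> z \<noteq> 0}"
  have "dir_deriv b \<phi> z = 0" if z: "z \<notin> ?S" for z
  proof -
    have "((\<lambda>_. 0) has_derivative (\<lambda>b. dir_deriv b \<phi> z)) (at z)"
    proof (rule has_derivative_transform_within_open)
      show "(\<phi> has_derivative (\<lambda>b. dir_deriv b \<phi> z)) (at z)"
        by (rule dir_deriv_has_derivative[OF test_functionD(4)[OF \<phi>]])
      show "open (- ?S)" by auto
      show "z \<in> - ?S" using z by simp
      show "\<phi> x = 0" if "x \<in> - ?S" for x using that closure_subset[of "{z. \<phi> z \<noteq> 0}"] by auto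
    qed
    then have "(\<lambda>b. dir_deriv b \<phi> z) = (\<lambda>b. 0)" by (rule has_derivative_unique) auto
    then show ?thesis by metis
  qed
  then have "{z. dir_deriv b \<phi> z \<noteq> 0} \<subseteq> ?S" by auto
  then have "closure {z. dir_deriv b \<phi> z \<noteq> 0} \<subseteq> ?S" by (rule closure_minimal) simp
  then show "compact (closure {z. dir_deriv b \<phi> z \<noteq> 0})"
    using test_functionD(2)[OF \<phi>] by (metis closed_closure compact_closure compact_Int_closed inf.absorb_iff2)
qed

lemma test_function_bounded:
  assumes "test_function \<phi>"
  obtains B where "0 < B" "\<And>z. \<bar>\<phi> z\<bar> \<le> B"
  using compact_support_bounded[OF test_functionD(3,2)[OF assms]] by blast

lemma space_Basis: "b \<in> Basis \<Longrightarrow> (b, 0::real) \<in> Basis"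
  and time_Basis: "(0::'a::euclidean_space, 1::real) \<in> Basis"
  by (auto simp: Basis_prod_def)

lemma space_path_derivative:
  fixes \<psi> :: "'a::euclidean_space \<times> real \<Rightarrow> real"
  assumes "\<And>p. \<psi> differentiable (at p)"
  shows "((\<lambda>r. \<psi> (x + r *\<^sub>R z, t)) has_real_derivative (\<Sum>b\<in>Basis. (z \<bullet> b) * dir_deriv (b, 0) \<psi> (x + r *\<^sub>R z, t))) (at r)"
proof -
  let ?p = "(x + r *\<^sub>R z, t)" let ?L = "\<lambda>v. dir_deriv v \<psi> ?p"
  have d: "(\<psi> has_derivative ?L) (at ?p)" by (rule dir_deriv_has_derivative[OF assms])
  have p: "((\<lambda>r. (x + r *\<^sub>R z, t)) has_derivative (\<lambda>h. (h *\<^sub>R z, 0))) (at r)"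
    by (auto intro!: derivative_eq_intros)
  have "((\<lambda>r. \<psi> (x + r *\<^sub>R z, t)) has_derivative (\<lambda>h. ?L (h *\<^sub>R z, 0))) (at r)"
    using has_derivative_compose[OF p d] .
  moreover have "?L (h *\<^sub>R z, 0) = (\<Sum>b\<in>Basis. (z \<bullet> b) * ?L (b, 0)) * h" for h
  proof -
    have lin: "linear ?L" using d by (rule has_derivative_linear)
    have "(h *\<^sub>R z, 0::real) = h *\<^sub>R (\<Sum>b\<in>Basis. (z \<bullet> b) *\<^sub>R (b, 0))"
      by (simp add: prod_eq_iff fst_sum snd_sum euclidean_representation)
    then have "?L (h *\<^sub>R z, 0) = ?L (h *\<^sub>R (\<Sum>b\<in>Basis. (z \<bullet> b) *\<^sub>R (b, 0)))" by simp
    also have "\<dots> = h * (\<Sum>b\<in>Basis. (z \<bullet> b) * ?L (b, 0))"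
      by (simp only: linear_scale[OF lin] linear_sum[OF lin] real_scaleR_def)
    finally show ?thesis by simp
  qed
  ultimately show ?thesis by (simp add: has_field_derivative_def)
qed

definition space_hessian :: "('a::euclidean_space \<times> real \<Rightarrow> real) \<Rightarrow> 'a \<Rightarrow> 'a \<times> real \<Rightarrow> real" where
  "space_hessian \<phi> z p = (\<Sum>b\<in>Basis. \<Sum>c\<in>Basis. (z \<bullet> b) * (z \<bullet> c) * dir_deriv (c, 0) (dir_deriv (b, 0) \<phi>) p)"

lemma space_taylor:
  fixes \<phi> :: "'a::euclidean_space \<times> real \<Rightarrow> real"
  assumes \<phi>: "test_function \<phi>" and e: "0 < e"
  obtains r where "0 < r" "r < e"
    "\<phi> (x + e *\<^sub>R z, t) = \<phi> (x, t) + e * (\<Sum>b\<in>Basis. (z \<bullet> b) * dir_deriv (b, 0) \<phi> (x, t))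
      + e\<^sup>2 / 2 * space_hessian \<phi> z (x + r *\<^sub>R z, t)"
proof -
  define d :: "nat \<Rightarrow> real \<Rightarrow> real" where "d m r = (if m = 0 then \<phi> (x + r *\<^sub>R z, t)
      else if m = 1 then (\<Sum>b\<in>Basis. (z \<bullet> b) * dir_deriv (b, 0) \<phi> (x + r *\<^sub>R z, t))
      else space_hessian \<phi> z (x + r *\<^sub>R z, t))" for m r
  have d0: "(d 0 has_real_derivative d 1 r) (at r)" for r
    using space_path_derivative[OF test_functionD(4)[OF \<phi>]] by (simp add: d_def[abs_def])
  have d1: "(d 1 has_real_derivative d 2 r) (at r)" for r
  proof -
    have "((\<lambda>r. \<Sum>b\<in>Basis. (z \<bullet> b) * dir_deriv (b, 0) \<phi> (x + r *\<^sub>R z, t)) has_real_derivative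
      (\<Sum>b\<in>Basis. (z \<bullet> b) * (\<Sum>c\<in>Basis. (z \<bullet> c) * dir_deriv (c, 0) (dir_deriv (b, 0) \<phi>) (x + r *\<^sub>R z, t)))) (at r)"
      by (intro DERIV_sum DERIV_cmult space_path_derivative test_functionD(4)[OF test_function_dir_deriv[OF \<phi>]] space_Basis)
    then show ?thesis by (simp add: d_def[abs_def] space_hessian_def sum_distrib_left mult.assoc)
  qed
  have "\<exists>r>0. r < e \<and> d 0 e = (\<Sum>m<2. d m 0 / fact m * e ^ m) + d 2 r / fact 2 * e ^ 2"
  proof (rule Maclaurin[OF e])
    show "\<forall>m r. m < 2 \<and> 0 \<le> r \<and> r \<le> e \<longrightarrow> (d m has_real_derivative d (Suc m) r) (at r)"
    proof (intro allI impI)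
      fix m :: nat and r :: real assume "m < 2 \<and> 0 \<le> r \<and> r \<le> e"
      then consider "m = 0" | "m = 1" by linarith
      then show "(d m has_real_derivative d (Suc m) r) (at r)"
        by cases (use d0 d1 in \<open>simp_all add: eval_nat_numeral\<close>)
    qed
  qed auto
  then obtain r where r: "0 < r" "r < e" "d 0 e = (\<Sum>m<2. d m 0 / fact m * e ^ m) + d 2 r / fact 2 * e ^ 2" by blast
  show thesis
    by (rule that[OF r(1,2)]) (use r(3) in \<open>simp add: d_def numeral_2_eq_2 mult.commute\<close>)
qed

lemma space_hessian_uminus [simp]: "space_hessian \<phi> (- z) p = space_hessian \<phi> z p"
  by (simp add: space_hessian_def)

lemma space_hessian_bounded:
  fixes \<phi> :: "'a::euclidean_space \<times> real \<Rightarrow> real"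
  assumes \<phi>: "test_function \<phi>"
  obtains C where "0 \<le> C" "\<And>z p. \<bar>space_hessian \<phi> z p\<bar> \<le> C * (norm z)\<^sup>2"
proof -
  have "\<exists>B. \<forall>p. \<bar>dir_deriv (c, 0) (dir_deriv (b, 0) \<phi>) p\<bar> \<le> B" if "b \<in> Basis" "c \<in> Basis" for b c :: 'a
    by (rule test_function_bounded[OF test_function_dir_deriv[OF test_function_dir_deriv[OF \<phi> space_Basis[OF that(1)]] space_Basis[OF that(2)]]]) auto
  then obtain B where B: "\<And>b c p. b \<in> Basis \<Longrightarrow> c \<in> Basis \<Longrightarrow> \<bar>dir_deriv (c, 0) (dir_deriv (b, 0) \<phi>) p\<bar> \<le> B b c"
    by metis
  show thesis
  proof (rule that[of "\<Sum>b\<in>Basis. \<Sum>c\<in>Basis. \<bar>B b c\<bar>"])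
    fix z :: 'a and p
    have "\<bar>space_hessian \<phi> z p\<bar> \<le> (\<Sum>b\<in>Basis. \<Sum>c\<in>Basis. \<bar>(z \<bullet> b) * (z \<bullet> c) * dir_deriv (c, 0) (dir_deriv (b, 0) \<phi>) p\<bar>)"
      unfolding space_hessian_def by (rule order_trans[OF sum_abs sum_mono[OF sum_abs]])
    also have "\<dots> \<le> (\<Sum>b\<in>Basis. \<Sum>c\<in>Basis. (norm z * norm z) * \<bar>B b c\<bar>)"
    proof (intro sum_mono)
      fix b c :: 'a assume bc: "b \<in> Basis" "c \<in> Basis"
      have "\<bar>dir_deriv (c, 0) (dir_deriv (b, 0) \<phi>) p\<bar> \<le> \<bar>B b c\<bar>" using B[OF bc, of p] by linarith
      then show "\<bar>(z \<bullet> b) * (z \<bullet> c) * dir_deriv (c, 0) (dir_deriv (b, 0) \<phi>) p\<bar> \<le> (norm z * norm z) * \<bar>B b c\<bar>"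
        unfolding abs_mult using bc by (intro mult_mono Basis_le_norm) auto
    qed
    also have "\<dots> = (\<Sum>b\<in>Basis. \<Sum>c\<in>Basis. \<bar>B b c\<bar>) * (norm z)\<^sup>2"
      by (simp add: sum_distrib_left sum_distrib_right power2_eq_square mult.commute)
    finally show "\<bar>space_hessian \<phi> z p\<bar> \<le> (\<Sum>b\<in>Basis. \<Sum>c\<in>Basis. \<bar>B b c\<bar>) * (norm z)\<^sup>2" .
  qed (auto intro: sum_nonneg)
qed

definition nonlocal_op :: "('a::euclidean_space \<Rightarrow> real) \<Rightarrow> real \<Rightarrow> ('a \<times> real \<Rightarrow> real) \<Rightarrow> 'a \<times> real \<Rightarrow> real" where
  "nonlocal_op J e \<phi> p = ((\<integral>z. J z * \<phi> (fst p - e *\<^sub>R z, snd p) \<partial>lborel) - \<phi> p) / e\<^sup>2"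

lemma nonlocal_op_measurable [measurable]:
  assumes [measurable]: "J \<in> borel_measurable borel" "\<phi> \<in> borel_measurable borel"
  shows "nonlocal_op J e \<phi> \<in> borel_measurable borel"
proof -
  have [measurable]: "\<phi> \<in> borel_measurable (borel \<Otimes>\<^sub>M borel)" by (simp add: borel_prod)
  have "nonlocal_op J e \<phi> \<in> borel_measurable (borel \<Otimes>\<^sub>M borel)"
    unfolding nonlocal_op_def[abs_def] by measurable
  then show ?thesis by (simp add: borel_prod)
qed

context
  fixes J :: "'a::euclidean_space \<Rightarrow> real" and \<phi> :: "'a \<times> real \<Rightarrow> real"
  assumes J: "radial_kernel J" and \<phi>: "test_function \<phi>"
begin

text \<open>Evenness of \<open>J\<close> permits replacing the one-sided difference by the symmetric
  one, in which the first-order Taylor term cancels before integration.\<close>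

definition symm_quot :: "real \<Rightarrow> 'a \<times> real \<Rightarrow> 'a \<Rightarrow> real" where
  "symm_quot e p z = ((\<phi> (fst p + e *\<^sub>R z, snd p) + \<phi> (fst p - e *\<^sub>R z, snd p)) / 2 - \<phi> p) / e\<^sup>2"

lemma nonlocal_op_symm:
  "nonlocal_op J e \<phi> p = (\<integral>z. J z * symm_quot e p z \<partial>lborel)"
proof -
  have c: "continuous_on UNIV (\<lambda>z. \<phi> (x + r *\<^sub>R z, t))" for x r t
    by (rule continuous_on_compose2[OF test_functionD(3)[OF \<phi>, of UNIV]]) (auto intro!: continuous_intros)
  have i1: "integrable lborel (\<lambda>z. J z * \<phi> (fst p + e *\<^sub>R z, snd p))"
    by (rule radial_kernel_poly_integrable[OF J c])
  have i2: "integrable lborel (\<lambda>z. J z * \<phi> (fst p - e *\<^sub>R z, snd p))"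
    using radial_kernel_poly_integrable[OF J c[of "fst p" "- e" "snd p"]] by simp
  have i3: "integrable lborel (\<lambda>z. J z * \<phi> p)" by (rule radial_kernel_poly_integrable[OF J]) auto
  have "(\<integral>z. J z * \<phi> (fst p + e *\<^sub>R z, snd p) \<partial>lborel) = (\<integral>z. J z * \<phi> (fst p - e *\<^sub>R z, snd p) \<partial>lborel)"
    using integral_lborel_shift(3)[of "\<lambda>z. J z * \<phi> (fst p + e *\<^sub>R z, snd p)" 0] i1 radial_kernelD(6)[OF J] by simp
  then have "nonlocal_op J e \<phi> p = ((\<integral>z. J z * \<phi> (fst p + e *\<^sub>R z, snd p) \<partial>lborel) / 2
      + (\<integral>z. J z * \<phi> (fst p - e *\<^sub>R z, snd p) \<partial>lborel) / 2 - (\<integral>z. J z * \<phi> p \<partial>lborel)) / e\<^sup>2"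
    using radial_kernelD(5)[OF J] by (simp add: nonlocal_op_def)
  also have "\<dots> = (\<integral>z. (J z * \<phi> (fst p + e *\<^sub>R z, snd p) / 2 + J z * \<phi> (fst p - e *\<^sub>R z, snd p) / 2 - J z * \<phi> p) / e\<^sup>2 \<partial>lborel)"
    using i1 i2 i3 by simp
  also have "\<dots> = (\<integral>z. J z * symm_quot e p z \<partial>lborel)"
    by (intro Bochner_Integration.integral_cong) (auto simp: symm_quot_def diff_divide_distrib add_divide_distrib right_diff_distrib distrib_left)
  finally show ?thesis .
qed

text \<open>Taylor's formula with Lagrange remainder along \<open>z\<close> and along
  \<open>- z\<close>. The two intermediate points \<open>r\<close> and \<open>s\<close> are
  unrelated, but the gradient terms cancel.\<close>

lemma symm_quot_taylor:
  assumes e: "0 < e"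
  obtains r s where "0 < r" "r < e" "0 < s" "s < e"
    "symm_quot e p z = (space_hessian \<phi> z (fst p + r *\<^sub>R z, snd p) + space_hessian \<phi> z (fst p - s *\<^sub>R z, snd p)) / 4"
proof -
  obtain r where r: "0 < r" "r < e" "\<phi> (fst p + e *\<^sub>R z, snd p) = \<phi> (fst p, snd p) + e * (\<Sum>b\<in>Basis. (z \<bullet> b) * dir_deriv (b, 0) \<phi> (fst p, snd p))
      + e\<^sup>2 / 2 * space_hessian \<phi> z (fst p + r *\<^sub>R z, snd p)"
    by (rule space_taylor[OF \<phi> e])
  obtain s where s: "0 < s" "s < e" "\<phi> (fst p + e *\<^sub>R (- z), snd p) = \<phi> (fst p, snd p) + e * (\<Sum>b\<in>Basis. (- z \<bullet> b) * dir_deriv (b, 0) \<phi> (fst p, snd p))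
      + e\<^sup>2 / 2 * space_hessian \<phi> (- z) (fst p + s *\<^sub>R (- z), snd p)"
    by (rule space_taylor[OF \<phi> e])
  define G where "G = (\<Sum>b\<in>Basis. (z \<bullet> b) * dir_deriv (b, 0) \<phi> (fst p, snd p))"
  have "(\<Sum>b\<in>Basis. (- z \<bullet> b) * dir_deriv (b, 0) \<phi> (fst p, snd p)) = - G" by (simp add: G_def sum_negf)
  then have s': "\<phi> (fst p - e *\<^sub>R z, snd p) = \<phi> p - e * G + e\<^sup>2 / 2 * space_hessian \<phi> z (fst p - s *\<^sub>R z, snd p)"
    using s(3) by simp
  have r': "\<phi> (fst p + e *\<^sub>R z, snd p) = \<phi> p + e * G + e\<^sup>2 / 2 * space_hessian \<phi> z (fst p + r *\<^sub>R z, snd p)"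
    using r(3) by (simp add: G_def)
  have *: "(\<phi> (fst p + e *\<^sub>R z, snd p) + \<phi> (fst p - e *\<^sub>R z, snd p)) / 2 - \<phi> p
      = e\<^sup>2 * ((space_hessian \<phi> z (fst p + r *\<^sub>R z, snd p) + space_hessian \<phi> z (fst p - s *\<^sub>R z, snd p)) / 4)"
    unfolding r' s' by (simp add: distrib_left add_divide_distrib)
  show thesis
    by (rule that[OF r(1,2) s(1,2)])
       (use * e in \<open>simp add: symm_quot_def\<close>)
qed

lemma symm_quot_bounded:
  obtains C where "0 \<le> C" "\<And>e p z. 0 < e \<Longrightarrow> \<bar>symm_quot e p z\<bar> \<le> C * (norm z)\<^sup>2"
proof -
  obtain C where C: "0 \<le> C" "\<And>z p. \<bar>space_hessian \<phi> z p\<bar> \<le> C * (norm z)\<^sup>2"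
    by (rule space_hessian_bounded[OF \<phi>]) blast
  show thesis
  proof (rule that[OF C(1)])
    fix e :: real and p :: "'a \<times> real" and z :: 'a assume "0 < e"
    then obtain r s where "symm_quot e p z = (space_hessian \<phi> z (fst p + r *\<^sub>R z, snd p) + space_hessian \<phi> z (fst p - s *\<^sub>R z, snd p)) / 4"
      by (rule symm_quot_taylor) blast
    then show "\<bar>symm_quot e p z\<bar> \<le> C * (norm z)\<^sup>2"
      using C(2)[of z "(fst p + r *\<^sub>R z, snd p)"] C(2)[of z "(fst p - s *\<^sub>R z, snd p)"]
      by (auto simp: abs_le_iff)
  qed
qed

text \<open>The symmetric quotient is at most a multiple of \<open>|z|^2\<close>, so the second
  moment of \<open>J\<close> bounds the operator independently of \<open>e\<close> and of the
  point.\<close>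

lemma nonlocal_op_bounded:
  obtains C where "0 \<le> C" "\<And>e p. 0 < e \<Longrightarrow> \<bar>nonlocal_op J e \<phi> p\<bar> \<le> C"
proof -
  obtain C where C: "0 \<le> C" "\<And>e p z. 0 < e \<Longrightarrow> \<bar>symm_quot e p z\<bar> \<le> C * (norm z)\<^sup>2"
    by (rule symm_quot_bounded) blast
  have i: "integrable lborel (\<lambda>z. J z * (C * (norm z)\<^sup>2))"
    by (rule radial_kernel_poly_integrable[OF J]) (auto intro!: continuous_intros)
  show thesis
  proof (rule that[of "\<integral>z. J z * (C * (norm z)\<^sup>2) \<partial>lborel"])
    show "0 \<le> (\<integral>z. J z * (C * (norm z)\<^sup>2) \<partial>lborel)"
      using C radial_kernelD(1)[OF J] by (intro integral_nonneg_AE) auto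
    fix e :: real and p :: "'a \<times> real" assume e: "0 < e"
    have "ennreal \<bar>\<integral>z. J z * symm_quot e p z \<partial>lborel\<bar> \<le> (\<integral>\<^sup>+z. ennreal \<bar>J z * symm_quot e p z\<bar> \<partial>lborel)"
      by (rule abs_integral_le_nn_integral)
    also have "\<dots> \<le> (\<integral>\<^sup>+z. ennreal (J z * (C * (norm z)\<^sup>2)) \<partial>lborel)"
      using C(2)[OF e, of p] radial_kernelD(1)[OF J]
      by (intro nn_integral_mono ennreal_leI) (auto simp: abs_mult intro!: mult_left_mono)
    also have "\<dots> = ennreal (\<integral>z. J z * (C * (norm z)\<^sup>2) \<partial>lborel)"
      using i C radial_kernelD(1)[OF J] by (intro nn_integral_eq_integral) auto
    finally show "\<bar>nonlocal_op J e \<phi> p\<bar> \<le> (\<integral>z. J z * (C * (norm z)\<^sup>2) \<partial>lborel)"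
      unfolding nonlocal_op_symm using \<open>0 \<le> (\<integral>z. J z * (C * (norm z)\<^sup>2) \<partial>lborel)\<close> by (subst (asm) ennreal_le_iff) auto
  qed
qed

lemma space_hessian_continuous:
  assumes "Y \<longlonglongrightarrow> p" shows "(\<lambda>n. space_hessian \<phi> z (Y n)) \<longlonglongrightarrow> space_hessian \<phi> z p"
proof -
  have "continuous_on UNIV (dir_deriv (c, 0) (dir_deriv (b, 0) \<phi>))" if "b \<in> Basis" "c \<in> Basis" for b c :: 'a
    by (intro test_functionD(3) test_function_dir_deriv \<phi> space_Basis that)
  then have "(\<lambda>n. dir_deriv (c, 0) (dir_deriv (b, 0) \<phi>) (Y n)) \<longlonglongrightarrow> dir_deriv (c, 0) (dir_deriv (b, 0) \<phi>) p"
    if "b \<in> Basis" "c \<in> Basis" for b c :: 'a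
    using that by (intro continuous_on_tendsto_compose[OF _ assms, of UNIV]) auto
  then show ?thesis unfolding space_hessian_def by (intro tendsto_sum tendsto_mult tendsto_const)
qed

lemma symm_quot_tendsto:
  assumes X: "\<And>n. 0 < X n" "X \<longlonglongrightarrow> 0"
  shows "(\<lambda>n. symm_quot (X n) p z) \<longlonglongrightarrow> space_hessian \<phi> z p / 2"
proof -
  have "\<forall>n. \<exists>r s. 0 < r \<and> r < X n \<and> 0 < s \<and> s < X n \<and>
    symm_quot (X n) p z = (space_hessian \<phi> z (fst p + r *\<^sub>R z, snd p) + space_hessian \<phi> z (fst p - s *\<^sub>R z, snd p)) / 4"
  proof
    fix n
    show "\<exists>r s. 0 < r \<and> r < X n \<and> 0 < s \<and> s < X n \<and>
      symm_quot (X n) p z = (space_hessian \<phi> z (fst p + r *\<^sub>R z, snd p) + space_hessian \<phi> z (fst p - s *\<^sub>R z, snd p)) / 4"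
      by (rule symm_quot_taylor[OF X(1)[of n], of p z]) blast
  qed
  then obtain r s where rs: "\<And>n. 0 < r n" "\<And>n. r n < X n" "\<And>n. 0 < s n" "\<And>n. s n < X n"
    "\<And>n. symm_quot (X n) p z = (space_hessian \<phi> z (fst p + r n *\<^sub>R z, snd p) + space_hessian \<phi> z (fst p - s n *\<^sub>R z, snd p)) / 4"
    by metis
  have r: "r \<longlonglongrightarrow> 0" by (rule tendsto_sandwich[OF _ _ tendsto_const X(2)]) (use rs in \<open>auto intro!: always_eventually less_imp_le\<close>)
  have s: "s \<longlonglongrightarrow> 0" by (rule tendsto_sandwich[OF _ _ tendsto_const X(2)]) (use rs in \<open>auto intro!: always_eventually less_imp_le\<close>)
  have "(\<lambda>n. (fst p + r n *\<^sub>R z, snd p)) \<longlonglongrightarrow> (fst p + 0 *\<^sub>R z, snd p)"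
    by (intro tendsto_intros r)
  then have 1: "(\<lambda>n. space_hessian \<phi> z (fst p + r n *\<^sub>R z, snd p)) \<longlonglongrightarrow> space_hessian \<phi> z p"
    by (intro space_hessian_continuous) simp
  have "(\<lambda>n. (fst p - s n *\<^sub>R z, snd p)) \<longlonglongrightarrow> (fst p - 0 *\<^sub>R z, snd p)"
    by (intro tendsto_intros s)
  then have 2: "(\<lambda>n. space_hessian \<phi> z (fst p - s n *\<^sub>R z, snd p)) \<longlonglongrightarrow> space_hessian \<phi> z p"
    by (intro space_hessian_continuous) simp
  have "(\<lambda>n. symm_quot (X n) p z) \<longlonglongrightarrow> (space_hessian \<phi> z p + space_hessian \<phi> z p) / 4"
    unfolding rs(5) by (intro tendsto_intros 1 2) auto
  then show ?thesis by simp
qed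

text \<open>Dominated convergence leads to the \<open>J\<close>-average of half the Hessian form. By
  the moments of a radial kernel only the trace survives, with the factor
  \<open>m2 / (2 N)\<close>.\<close>

lemma nonlocal_op_tendsto:
  assumes X: "\<And>n. 0 < X n" "X \<longlonglongrightarrow> 0"
  shows "(\<lambda>n. nonlocal_op J (X n) \<phi> p) \<longlonglongrightarrow> diffusivity J * laplacian \<phi> p"
proof -
  have [measurable]: "J \<in> borel_measurable borel" by (rule radial_kernelD(7)[OF J])
  obtain C where C: "0 \<le> C" "\<And>e p z. 0 < e \<Longrightarrow> \<bar>symm_quot e p z\<bar> \<le> C * (norm z)\<^sup>2"
    by (rule symm_quot_bounded) blast
  have c: "continuous_on UNIV (\<lambda>z. \<phi> (x + r *\<^sub>R z, t))" for x r t
    by (rule continuous_on_compose2[OF test_functionD(3)[OF \<phi>, of UNIV]]) (auto intro!: continuous_intros)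
  have [measurable]: "(\<lambda>z. \<phi> (x + r *\<^sub>R z, t)) \<in> borel_measurable borel" for x r t
    by (rule borel_measurable_continuous_onI[OF c])
  have [measurable]: "(\<lambda>z. \<phi> (x - r *\<^sub>R z, t)) \<in> borel_measurable borel" for x r t
    using borel_measurable_continuous_onI[OF c[of x "- r" t]] by simp
  have "(\<lambda>n. \<integral>z. J z * symm_quot (X n) p z \<partial>lborel) \<longlonglongrightarrow> (\<integral>z. J z * (space_hessian \<phi> z p / 2) \<partial>lborel)"
  proof (rule integral_dominated_convergence[where w="\<lambda>z. J z * (C * (norm z)\<^sup>2)"])
    show "integrable lborel (\<lambda>z. J z * (C * (norm z)\<^sup>2))"
      by (rule radial_kernel_poly_integrable[OF J]) (auto intro!: continuous_intros)
    show "(\<lambda>z. J z * symm_quot (X n) p z) \<in> borel_measurable lborel" for n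
      unfolding symm_quot_def by measurable
    show "(\<lambda>z. J z * (space_hessian \<phi> z p / 2)) \<in> borel_measurable lborel"
      unfolding space_hessian_def by measurable
    show "AE z in lborel. (\<lambda>n. J z * symm_quot (X n) p z) \<longlonglongrightarrow> J z * (space_hessian \<phi> z p / 2)"
      by (intro AE_I2 tendsto_mult tendsto_const symm_quot_tendsto X)
    show "AE z in lborel. norm (J z * symm_quot (X n) p z) \<le> J z * (C * (norm z)\<^sup>2)" for n
      using C(2)[OF X(1), of n p] radial_kernelD(1)[OF J] by (intro AE_I2) (auto simp: abs_mult intro!: mult_left_mono)
  qed
  also have "(\<integral>z. J z * (space_hessian \<phi> z p / 2) \<partial>lborel) =
    (\<integral>z. (\<Sum>b\<in>Basis. \<Sum>c\<in>Basis. J z * ((z \<bullet> b) * (z \<bullet> c)) * (dir_deriv (c, 0) (dir_deriv (b, 0) \<phi>) p / 2)) \<partial>lborel)"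
    unfolding space_hessian_def
    by (intro Bochner_Integration.integral_cong) (auto simp: sum_distrib_left sum_divide_distrib mult.assoc intro!: sum.cong)
  also have "\<dots> = (\<Sum>b\<in>Basis. \<Sum>c\<in>Basis. (\<integral>z. J z * ((z \<bullet> b) * (z \<bullet> c)) \<partial>lborel) * (dir_deriv (c, 0) (dir_deriv (b, 0) \<phi>) p / 2))"
  proof -
    have i: "integrable lborel (\<lambda>z. J z * ((z \<bullet> b) * (z \<bullet> c)) * k)" for b c k
      by (intro integrable_mult_left radial_kernel_poly_integrable[OF J] continuous_intros)
    have i': "integrable lborel (\<lambda>z. J z * ((z \<bullet> b) * (z \<bullet> c)))" for b c
      by (intro radial_kernel_poly_integrable[OF J] continuous_intros)
    show ?thesis
      by (subst Bochner_Integration.integral_sum, (rule Bochner_Integration.integrable_sum i)+)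
         (intro sum.cong refl, subst Bochner_Integration.integral_sum, (rule i)+, intro sum.cong refl integral_mult_left_zero)
  qed
  also have "\<dots> = (\<Sum>b\<in>Basis. (second_moment J / DIM('a)) * (dir_deriv (b, 0) (dir_deriv (b, 0) \<phi>) p / 2))"
  proof (intro sum.cong refl)
    fix b :: 'a assume b: "b \<in> Basis"
    have "(\<Sum>c\<in>Basis. (\<integral>z. J z * ((z \<bullet> b) * (z \<bullet> c)) \<partial>lborel) * (dir_deriv (c, 0) (dir_deriv (b, 0) \<phi>) p / 2))
      = (\<Sum>c\<in>Basis. if c = b then (second_moment J / DIM('a)) * (dir_deriv (b, 0) (dir_deriv (b, 0) \<phi>) p / 2) else 0)"
      by (intro sum.cong refl) (auto simp: radial_kernel_moment[OF J b])
    then show "(\<Sum>c\<in>Basis. (\<integral>z. J z * ((z \<bullet> b) * (z \<bullet> c)) \<partial>lborel) * (dir_deriv (c, 0) (dir_deriv (b, 0) \<phi>) p / 2))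
      = (second_moment J / DIM('a)) * (dir_deriv (b, 0) (dir_deriv (b, 0) \<phi>) p / 2)"
      using b by simp
  qed
  also have "\<dots> = diffusivity J * laplacian \<phi> p"
    by (simp add: diffusivity_def laplacian_def sum_distrib_left sum_divide_distrib mult.commute[of 2])
  finally show ?thesis by (simp add: nonlocal_op_symm)
qed

text \<open>The condition \<open>e <= 1\<close> keeps all supports in one ball; together with the
  uniform bound this gives the dominating functions for limits in \<open>L^1\<close>.\<close>

lemma nonlocal_op_support:
  assumes R: "\<And>p. R < norm p \<Longrightarrow> \<phi> p = 0" and S: "\<And>z. S < norm z \<Longrightarrow> J z = 0" "0 < S"
    and e: "0 < e" "e \<le> 1" and p: "R + S < norm p"
  shows "nonlocal_op J e \<phi> p = 0"
proof -
  have "J z * \<phi> (fst p - e *\<^sub>R z, snd p) = 0" for z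
  proof (cases "S < norm z")
    case False
    have "p = (fst p - e *\<^sub>R z, snd p) + (e *\<^sub>R z, 0)" by (simp add: prod_eq_iff)
    then have "norm p \<le> norm (fst p - e *\<^sub>R z, snd p) + norm (e *\<^sub>R z, 0::real)" by (metis norm_triangle_ineq)
    moreover have "norm (e *\<^sub>R z, 0::real) \<le> S"
      using False e mult_mono[of e 1 "norm z" S] by (simp add: norm_Pair)
    ultimately show ?thesis using p R by simp
  qed (simp add: S)
  then have "(\<lambda>z. J z * \<phi> (fst p - e *\<^sub>R z, snd p)) = (\<lambda>z. 0)" by blast
  then show ?thesis using R[of p] p S by (simp add: nonlocal_op_def)
qed

end

subsection \<open>Rescaled kernels\<close>

lemma convolution_rescale:
  fixes J g :: "'a::euclidean_space \<Rightarrow> real"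
  assumes [measurable]: "J \<in> borel_measurable borel" "g \<in> borel_measurable borel" and e: "0 < e"
  shows "convolution (rescale e J) g x = (\<integral>z. J z * g (x - e *\<^sub>R z) \<partial>lborel)"
proof -
  have [measurable]: "rescale e J \<in> borel_measurable borel" unfolding rescale_def by measurable
  have "convolution (rescale e J) g x = (\<integral>y. rescale e J y * g (x - y) \<partial>lborel)"
    by (rule convolution_alt) measurable
  also have "\<dots> = \<bar>e\<bar> ^ DIM('a) * (\<integral>z. rescale e J (0 + e *\<^sub>R z) * g (x - (0 + e *\<^sub>R z)) \<partial>lborel)"
    by (rule integral_lborel_affine) (use e in auto)
  also have "\<dots> = (\<integral>z. \<bar>e\<bar> ^ DIM('a) * (rescale e J (0 + e *\<^sub>R z) * g (x - (0 + e *\<^sub>R z))) \<partial>lborel)"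
    by simp
  also have "\<dots> = (\<integral>z. J z * g (x - e *\<^sub>R z) \<partial>lborel)"
    using e by (intro Bochner_Integration.integral_cong) (auto simp: rescale_def)
  finally show ?thesis .
qed

lemma rescale_integrable:
  fixes J :: "'a::euclidean_space \<Rightarrow> real"
  assumes J: "integrable lborel J" and e: "0 < e"
  shows "integrable lborel (rescale e J)" "(\<integral>x. rescale e J x \<partial>lborel) = (\<integral>x. J x \<partial>lborel)"
proof -
  have [measurable]: "J \<in> borel_measurable borel" using J by simp
  show "integrable lborel (rescale e J)"
    using integrable_lborel_affine[OF J, of "inverse e" 0] e by (simp add: rescale_def)
  have "(\<integral>x. J x \<partial>lborel) = \<bar>inverse e\<bar> ^ DIM('a) * (\<integral>x. J (0 + inverse e *\<^sub>R x) \<partial>lborel)"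
    by (rule integral_lborel_affine) (use e in auto)
  then show "(\<integral>x. rescale e J x \<partial>lborel) = (\<integral>x. J x \<partial>lborel)"
    using e by (simp add: rescale_def power_inverse divide_inverse mult.commute)
qed

lemma radial_kernel_rescale:
  fixes J :: "'a::euclidean_space \<Rightarrow> real"
  assumes J: "radial_kernel J" and e: "0 < e"
  shows "radial_kernel (rescale e J)"
  unfolding radial_kernel_def
proof (intro conjI allI impI)
  show "0 \<le> rescale e J x" for x using radial_kernelD(1)[OF J] e by (simp add: rescale_def)
  show "continuous_on UNIV (rescale e J)"
    unfolding rescale_def using e
    by (intro continuous_intros continuous_on_compose2[OF radial_kernelD(2)[OF J, of UNIV]]) auto
  show "(\<integral>x. rescale e J x \<partial>lborel) = 1"
    using rescale_integrable(2)[OF radial_kernelD(8)[OF J] e] radial_kernelD(5)[OF J] by simp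
  show "rescale e J x = rescale e J y" if "norm x = norm y" for x y
    using radial_kernelD(4)[OF J, of "x /\<^sub>R e" "y /\<^sub>R e"] that by (simp add: rescale_def)
  obtain R where R: "0 < R" "\<And>x. R < norm x \<Longrightarrow> J x = 0"
    using compact_support_radius[OF radial_kernelD(3)[OF J]] by blast
  show "compact (closure {x. rescale e J x \<noteq> 0})"
  proof (rule compact_closure_support[of "e * R"])
    fix x :: 'a assume "e * R < norm x"
    then have "R < norm (x /\<^sub>R e)" using e unfolding norm_scaleR by (simp add: field_simps)
    then show "rescale e J x = 0" using R by (simp add: rescale_def)
  qed
qed

lemma radial_kernel_bounded:
  assumes "radial_kernel J"
  obtains B where "0 < B" "\<And>x. \<bar>J x\<bar> \<le> B"
  using compact_support_bounded[OF radial_kernelD(2,3)[OF assms]] by blast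

lemma prob_kernel_radial:
  assumes J: "radial_kernel J" and "0 < l"
  obtains B where "prob_kernel J l B"
proof -
  obtain B where B: "\<And>x. \<bar>J x\<bar> \<le> B" by (rule radial_kernel_bounded[OF J]) blast
  have "prob_kernel J l B"
    using assms B radial_kernelD(1,5,6,8)[OF J] abs_le_D1 by unfold_locales blast+
  then show thesis using that by blast
qed

subsection \<open>Integration by parts in time\<close>

lemma integral_time_measure_FTC:
  fixes \<psi> :: "real \<Rightarrow> real"
  assumes "a \<le> b" and d: "\<And>r. (\<psi> has_real_derivative \<psi>' r) (at r)" and c: "continuous_on UNIV \<psi>'"
  shows "(\<integral>r. \<psi>' r \<partial>time_measure a b) = \<psi> b - \<psi> a"
proof -
  have "(\<integral>r. \<psi>' r * indicator {a..b} r \<partial>lborel) = \<psi> b - \<psi> a"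
    by (rule integral_FTC_Icc_real) (use assms in \<open>auto simp: continuous_on_eq_continuous_at\<close>)
  moreover have "\<psi>' \<in> borel_measurable borel" using c by (rule borel_measurable_continuous_onI)
  ultimately show ?thesis by (simp add: integral_time_measure mult.commute)
qed

text \<open>Moves a variable endpoint from the measure into the integrand, so that Fubini can be
  applied on a fixed square.\<close>

lemma integral_time_measure_restrict:
  fixes F :: "real \<Rightarrow> real"
  assumes [measurable]: "F \<in> borel_measurable borel" and "a \<le> r" "r \<le> b"
  shows "(\<integral>s. F s \<partial>time_measure a r) = (\<integral>s. indicator {..r} s * F s \<partial>time_measure a b)"
    and "(\<integral>s. F s \<partial>time_measure r b) = (\<integral>s. indicator {r..} s * F s \<partial>time_measure a b)"
  using assms by (auto simp: integral_time_measure indicator_def intro!: Bochner_Integration.integral_cong)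

text \<open>Since \<open>g\<close> is only integrable, its primitive need not be differentiable
  everywhere. Fubini over the triangle \<open>s <= r\<close> replaces the product rule, and the
  fundamental theorem is applied to the smooth factor alone.\<close>

lemma integration_by_parts_time:
  fixes \<psi> g :: "real \<Rightarrow> real"
  assumes t: "0 \<le> t" and d: "\<And>r. (\<psi> has_real_derivative \<psi>' r) (at r)" and c: "continuous_on UNIV \<psi>'"
    and bd: "\<And>r. \<bar>\<psi>' r\<bar> \<le> B" and g: "integrable (time_measure 0 t) g"
  shows "\<psi> t * (\<integral>s. g s \<partial>time_measure 0 t) = (\<integral>r. \<psi>' r * (\<integral>s. indicator {..r} s * g s \<partial>time_measure 0 t) \<partial>time_measure 0 t)
      + (\<integral>s. \<psi> s * g s \<partial>time_measure 0 t)"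
proof -
  have [measurable]: "\<psi>' \<in> borel_measurable borel" using c by (rule borel_measurable_continuous_onI)
  have \<psi>c: "continuous_on UNIV \<psi>" using d by (intro DERIV_continuous_on) (auto intro: has_field_derivative_at_within)
  have [measurable]: "\<psi> \<in> borel_measurable borel" using \<psi>c by (rule borel_measurable_continuous_onI)
  have gb [measurable]: "g \<in> borel_measurable borel" using g by (simp add: integrable_iff_bounded cong: measurable_cong_sets)
  have gfin: "(\<integral>\<^sup>+s. ennreal \<bar>g s\<bar> \<partial>time_measure 0 t) < \<infinity>" using g by (simp add: integrable_iff_bounded)
  have i: "integrable (time_measure 0 t \<Otimes>\<^sub>M time_measure 0 t) (\<lambda>(r, s). \<psi>' r * (indicator {..r} s * g s))"
  proof (rule tmt.pair_integrableI)
    show "(\<lambda>(r, s). \<psi>' r * (indicator {..r} s * g s)) \<in> borel_measurable (time_measure 0 t \<Otimes>\<^sub>M time_measure 0 t)"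
    proof -
      have "(\<lambda>(r::real, s). indicator {..r} s :: real) = (\<lambda>z. if snd z \<le> fst z then 1 else 0)" by (auto simp: indicator_def)
      moreover have "(\<lambda>z::real\<times>real. if snd z \<le> fst z then 1 else 0 :: real) \<in> borel_measurable (borel \<Otimes>\<^sub>M borel)" by measurable
      ultimately have [measurable]: "(\<lambda>(r::real, s). indicator {..r} s :: real) \<in> borel_measurable (borel \<Otimes>\<^sub>M borel)" by simp
      show ?thesis by measurable
    qed
    have "(\<integral>\<^sup>+r. \<integral>\<^sup>+s. ennreal \<bar>\<psi>' r * (indicator {..r} s * g s)\<bar> \<partial>time_measure 0 t \<partial>time_measure 0 t)
      \<le> (\<integral>\<^sup>+r. \<integral>\<^sup>+s. ennreal (\<bar>B\<bar> * \<bar>g s\<bar>) \<partial>time_measure 0 t \<partial>time_measure 0 t)"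
    proof (intro nn_integral_mono ennreal_leI)
      fix r s
      have "\<bar>\<psi>' r\<bar> \<le> \<bar>B\<bar>" using bd[of r] by linarith
      then show "\<bar>\<psi>' r * (indicator {..r} s * g s)\<bar> \<le> \<bar>B\<bar> * \<bar>g s\<bar>"
        unfolding abs_mult by (intro mult_mono) (auto simp: indicator_def)
    qed
    also have "\<dots> < \<infinity>"
      using gfin t by (simp add: ennreal_mult nn_integral_cmult ennreal_mult_less_top emeasure_time_measure)
    finally show "(\<integral>\<^sup>+r. \<integral>\<^sup>+s. ennreal \<bar>\<psi>' r * (indicator {..r} s * g s)\<bar> \<partial>time_measure 0 t \<partial>time_measure 0 t) < \<infinity>" .
  qed
  have "(\<integral>r. \<psi>' r * (\<integral>s. indicator {..r} s * g s \<partial>time_measure 0 t) \<partial>time_measure 0 t)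
      = (\<integral>r. \<integral>s. \<psi>' r * (indicator {..r} s * g s) \<partial>time_measure 0 t \<partial>time_measure 0 t)"
    by simp
  also have "\<dots> = (\<integral>s. \<integral>r. \<psi>' r * (indicator {..r} s * g s) \<partial>time_measure 0 t \<partial>time_measure 0 t)"
    using tmt.Fubini_integral[OF i] by simp
  also have "\<dots> = (\<integral>s. (\<psi> t - \<psi> s) * g s \<partial>time_measure 0 t)"
  proof (intro integral_cong_AE AE_time_measureI)
    fix s assume s: "0 \<le> s" "s \<le> t"
    have "(\<integral>r. \<psi>' r * (indicator {..r} s * g s) \<partial>time_measure 0 t) = (\<integral>r. (indicator {s..} r * \<psi>' r) * g s \<partial>time_measure 0 t)"
      by (intro Bochner_Integration.integral_cong) (auto simp: indicator_def)
    also have "\<dots> = (\<integral>r. indicator {s..} r * \<psi>' r \<partial>time_measure 0 t) * g s" by simp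
    also have "(\<integral>r. indicator {s..} r * \<psi>' r \<partial>time_measure 0 t) = \<psi> t - \<psi> s"
      using integral_time_measure_restrict(2)[of \<psi>' 0 s t] integral_time_measure_FTC[OF s(2) d c] s by simp
    finally show "(\<integral>r. \<psi>' r * (indicator {..r} s * g s) \<partial>time_measure 0 t) = (\<psi> t - \<psi> s) * g s" .
  next
    show "(\<lambda>s. \<integral>r. \<psi>' r * (indicator {..r} s * g s) \<partial>time_measure 0 t) \<in> borel_measurable (time_measure 0 t)"
      using borel_measurable_integrable[OF tmt.integrable_fst'[OF tmt.integrable_product_swap[OF i]]] by simp
  qed measurable
  also have "\<dots> = \<psi> t * (\<integral>s. g s \<partial>time_measure 0 t) - (\<integral>s. \<psi> s * g s \<partial>time_measure 0 t)"
  proof -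
    have "bounded (\<psi> ` {0..t})"
      by (intro compact_imp_bounded compact_continuous_image continuous_on_subset[OF \<psi>c]) auto
    then obtain b where b: "\<forall>y\<in>\<psi> ` {0..t}. norm y \<le> b" unfolding bounded_iff by blast
    have "integrable (time_measure 0 t) (\<lambda>s. \<psi> s * g s)"
    proof (rule integrable_mult_AE_bounded(2)[OF g])
      show "AE s in time_measure 0 t. \<bar>\<psi> s\<bar> \<le> b" by (intro AE_time_measureI) (use b in auto)
    qed measurable
    then show ?thesis using g by (simp add: left_diff_distrib)
  qed
  finally show ?thesis by simp
qed

subsection \<open>The weak form of the nonlocal problem\<close>

lemma time_path_derivative:
  fixes \<phi> :: "'a::euclidean_space \<times> real \<Rightarrow> real"
  assumes "test_function \<phi>"
  shows "((\<lambda>r. \<phi> (x, r)) has_real_derivative time_deriv \<phi> (x, r)) (at r)"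
proof -
  let ?L = "\<lambda>v. dir_deriv v \<phi> (x, r)"
  have d: "(\<phi> has_derivative ?L) (at (x, r))"
    by (rule dir_deriv_has_derivative[OF test_functionD(4)[OF assms]])
  have p: "((\<lambda>r. (x, r)) has_derivative (\<lambda>h. (0, h))) (at r)"
    by (auto intro!: derivative_eq_intros)
  have "((\<lambda>r. \<phi> (x, r)) has_derivative (\<lambda>h. ?L (0, h))) (at r)"
    using has_derivative_compose[OF p d] .
  moreover have "?L (0, h) = time_deriv \<phi> (x, r) * h" for h
  proof -
    have "?L (h *\<^sub>R (0, 1)) = h *\<^sub>R ?L (0, 1)" using d has_derivative_linear linear_scale by blast
    then show ?thesis by (simp add: time_deriv_def)
  qed
  ultimately show ?thesis by (simp add: has_field_derivative_def)
qed

lemma test_function_time_deriv: "test_function \<phi> \<Longrightarrow> test_function (time_deriv \<phi>)"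
  unfolding time_deriv_def by (intro test_function_dir_deriv time_Basis)

lemma test_function_pair_measurable:
  fixes \<phi> :: "'a::euclidean_space \<times> real \<Rightarrow> real"
  shows "test_function \<phi> \<Longrightarrow> \<phi> \<in> borel_measurable (borel \<Otimes>\<^sub>M borel)"
  using test_functionD(5) by (simp add: borel_prod)

text \<open>Integration by parts in time at almost every fixed \<open>x\<close>, followed by Fubini
  in both time integrals.\<close>

lemma weak_form_of_evolution:
  fixes \<phi> :: "'a::euclidean_space \<times> real \<Rightarrow> real" and u g :: "real \<Rightarrow> 'a \<Rightarrow> real"
  assumes \<phi>: "test_function \<phi>" and t: "0 \<le> t" and f: "integrable lborel f"
    and gm: "case_prod g \<in> borel_measurable (borel \<Otimes>\<^sub>M borel)" and um: "case_prod u \<in> borel_measurable (borel \<Otimes>\<^sub>M borel)"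
    and C: "0 \<le> C" and gi: "\<And>r. 0 \<le> r \<Longrightarrow> r \<le> t \<Longrightarrow> integrable lborel (g r)"
    and gC: "\<And>r. 0 \<le> r \<Longrightarrow> r \<le> t \<Longrightarrow> (\<integral>x. \<bar>g r x\<bar> \<partial>lborel) \<le> C"
    and eq: "\<And>r. 0 \<le> r \<Longrightarrow> r \<le> t \<Longrightarrow> AE x in lborel. u r x = f x + (\<integral>s. g s x \<partial>time_measure 0 r)"
  shows "(\<integral>x. u t x * \<phi> (x, t) \<partial>lborel) = (\<integral>x. f x * \<phi> (x, 0) \<partial>lborel)
    + (\<integral>r. \<integral>x. time_deriv \<phi> (x, r) * u r x \<partial>lborel \<partial>time_measure 0 t)
    + (\<integral>s. \<integral>x. \<phi> (x, s) * g s x \<partial>lborel \<partial>time_measure 0 t)"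
proof -
  note [measurable] = gm um test_function_pair_measurable[OF \<phi>] test_function_pair_measurable[OF test_function_time_deriv[OF \<phi>]]
  have [measurable]: "f \<in> borel_measurable borel" using f by simp
  obtain B where B: "0 < B" "\<And>z. \<bar>time_deriv \<phi> z\<bar> \<le> B" by (rule test_function_bounded[OF test_function_time_deriv[OF \<phi>]]) blast
  obtain D where D: "0 < D" "\<And>z. \<bar>\<phi> z\<bar> \<le> D" by (rule test_function_bounded[OF \<phi>]) blast
  define G where "G r x = (\<integral>s. indicator {..r} s * g s x \<partial>time_measure 0 t)" for r x
  have Gr: "(\<integral>s. g s x \<partial>time_measure 0 r) = G r x" if "0 \<le> r" "r \<le> t" for r x
    unfolding G_def by (rule integral_time_measure_restrict(1)) (use that in auto)
  have Gm [measurable]: "case_prod G \<in> borel_measurable (borel \<Otimes>\<^sub>M borel)"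
  proof -
    have "G = (\<lambda>r x. \<integral>s. (if s \<le> r then g s x else 0) \<partial>time_measure 0 t)"
      by (intro ext) (auto simp: G_def indicator_def intro!: Bochner_Integration.integral_cong)
    then show ?thesis by simp
  qed
  have Gi: "integrable lborel (G r)" "(\<integral>x. \<bar>G r x\<bar> \<partial>lborel) \<le> t * C" if r: "0 \<le> r" "r \<le> t" for r
  proof -
    have e: "G r = (\<lambda>x. \<integral>s. g s x \<partial>time_measure 0 r)" using Gr[OF r] by auto
    have "(\<integral>x. \<bar>G r x\<bar> \<partial>lborel) \<le> (r - 0) * C"
      unfolding e by (rule time_integral_L1_le(2)[OF gm r(1) C]) (use gi gC r in auto)
    also have "\<dots> \<le> t * C" using r C by (simp add: mult_right_mono)
    finally show "(\<integral>x. \<bar>G r x\<bar> \<partial>lborel) \<le> t * C" .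
    show "integrable lborel (G r)"
      unfolding e by (rule time_integral_L1_le(1)[OF gm r(1) C]) (use gi gC r in auto)
  qed
  \<comment> \<open>The exceptional null set in \<open>eq\<close> depends on the time.
    \<open>W\<close> satisfies the integral equation at every point and agrees with
    \<open>u r\<close> almost everywhere for each \<open>r\<close>, so it can stand for
    \<open>u\<close> in a computation that fixes \<open>x\<close> and uses all times at
    once.\<close>
  define W where "W r x = f x + G r x" for r x
  have Wm [measurable]: "case_prod W \<in> borel_measurable (borel \<Otimes>\<^sub>M borel)" unfolding W_def by measurable
  have uW: "AE x in lborel. u r x = W r x" if "0 \<le> r" "r \<le> t" for r
    using eq[OF that] by (simp add: W_def Gr[OF that])
  have Wi: "integrable (time_measure 0 t \<Otimes>\<^sub>M lborel) (case_prod W)"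
  proof (rule integrable_time_space(1)[OF Wm t])
    show "0 \<le> (\<integral>x. \<bar>f x\<bar> \<partial>lborel) + t * C" using t C by simp
    fix r assume r: "0 \<le> r" "r \<le> t"
    show "integrable lborel (W r)" unfolding W_def[abs_def] using f Gi(1)[OF r] by simp
    have "(\<integral>x. \<bar>W r x\<bar> \<partial>lborel) \<le> (\<integral>x. \<bar>f x\<bar> + \<bar>G r x\<bar> \<partial>lborel)"
      unfolding W_def using f Gi(1)[OF r] by (intro integral_mono) auto
    then show "(\<integral>x. \<bar>W r x\<bar> \<partial>lborel) \<le> (\<integral>x. \<bar>f x\<bar> \<partial>lborel) + t * C"
      using f Gi[OF r] by simp
  qed
  have g_int: "integrable (time_measure 0 t \<Otimes>\<^sub>M lborel) (case_prod g)"
    by (rule integrable_time_space(1)[OF gm t C]) (use gi gC in auto)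
  have i1: "integrable (time_measure 0 t \<Otimes>\<^sub>M lborel) (\<lambda>(r, x). time_deriv \<phi> (x, r) * W r x)"
    using integrable_mult_AE_bounded(2)[OF Wi, of "\<lambda>(r, x). time_deriv \<phi> (x, r)" B] B
    by (simp add: split_beta')
  have i2: "integrable (time_measure 0 t \<Otimes>\<^sub>M lborel) (\<lambda>(s, x). \<phi> (x, s) * g s x)"
    using integrable_mult_AE_bounded(2)[OF g_int, of "\<lambda>(r, x). \<phi> (x, r)" D] D
    by (simp add: split_beta')
  have i1': "integrable lborel (\<lambda>x. \<integral>r. time_deriv \<phi> (x, r) * W r x \<partial>time_measure 0 t)"
    and i2': "integrable lborel (\<lambda>x. \<integral>r. \<phi> (x, r) * g r x \<partial>time_measure 0 t)"
    using tmp.integrable_snd[OF i1] tmp.integrable_snd[OF i2] by auto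
  have i0: "integrable lborel (\<lambda>x. f x * \<phi> (x, 0))"
    by (rule integrable_mult_AE_bounded(1)[OF f, of _ D]) (use D in auto)
  have point: "AE x in lborel. u t x * \<phi> (x, t) = f x * \<phi> (x, 0) + (\<integral>r. time_deriv \<phi> (x, r) * W r x \<partial>time_measure 0 t)
      + (\<integral>s. \<phi> (x, s) * g s x \<partial>time_measure 0 t)"
    using AE_integrable_time_section[OF g_int] uW[OF t order_refl]
  proof eventually_elim
    case (elim x)
    note d = time_path_derivative[OF \<phi>]
    have c: "continuous_on UNIV (\<lambda>r. time_deriv \<phi> (x, r))"
      by (rule continuous_on_compose2[OF test_functionD(3)[OF test_function_time_deriv[OF \<phi>], of UNIV]]) (auto intro!: continuous_intros)
    have ibp: "\<phi> (x, t) * (\<integral>s. g s x \<partial>time_measure 0 t) = (\<integral>r. time_deriv \<phi> (x, r) * G r x \<partial>time_measure 0 t)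
        + (\<integral>s. \<phi> (x, s) * g s x \<partial>time_measure 0 t)"
      unfolding G_def by (rule integration_by_parts_time[OF t d c B(2) elim(1)])
    have id: "integrable (time_measure 0 t) (\<lambda>r. time_deriv \<phi> (x, r) * f x)"
      by (rule tm.integrable_const_bound[of _ "B * \<bar>f x\<bar>"]) (use B in \<open>auto simp: abs_mult intro!: mult_right_mono\<close>)
    have ig: "integrable (time_measure 0 t) (\<lambda>r. time_deriv \<phi> (x, r) * G r x)"
    proof (rule tm.integrable_const_bound[of _ "B * (\<integral>s. \<bar>g s x\<bar> \<partial>time_measure 0 t)"])
      have "\<bar>G r x\<bar> \<le> (\<integral>s. \<bar>g s x\<bar> \<partial>time_measure 0 t)" for r
      proof -
        have "\<bar>G r x\<bar> \<le> (\<integral>s. \<bar>indicator {..r} s * g s x\<bar> \<partial>time_measure 0 t)"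
          unfolding G_def using integral_norm_bound[of "time_measure 0 t" "\<lambda>s. indicator {..r} s * g s x"] by simp
        also have "\<dots> \<le> (\<integral>s. \<bar>g s x\<bar> \<partial>time_measure 0 t)"
        proof (rule integral_mono)
          show "integrable (time_measure 0 t) (\<lambda>s. \<bar>indicator {..r} s * g s x\<bar>)"
            using integrable_mult_indicator[of "{..r}" "time_measure 0 t" "\<lambda>s. g s x"] elim(1) by simp
        qed (use elim(1) in \<open>auto simp: indicator_def\<close>)
        finally show ?thesis .
      qed
      then show "AE r in time_measure 0 t. norm (time_deriv \<phi> (x, r) * G r x) \<le> B * (\<integral>s. \<bar>g s x\<bar> \<partial>time_measure 0 t)"
        using B by (auto simp: abs_mult intro!: mult_mono)
    qed measurable
    have "(\<integral>r. time_deriv \<phi> (x, r) * W r x \<partial>time_measure 0 t)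
        = (\<phi> (x, t) - \<phi> (x, 0)) * f x + (\<integral>r. time_deriv \<phi> (x, r) * G r x \<partial>time_measure 0 t)"
      unfolding W_def distrib_left using id ig integral_time_measure_FTC[OF t d c] by simp
    then show ?case using ibp elim(2) Gr[OF t order_refl, of x] by (simp add: W_def algebra_simps)
  qed
  have "(\<integral>x. u t x * \<phi> (x, t) \<partial>lborel) = (\<integral>x. f x * \<phi> (x, 0) + (\<integral>r. time_deriv \<phi> (x, r) * W r x \<partial>time_measure 0 t)
      + (\<integral>s. \<phi> (x, s) * g s x \<partial>time_measure 0 t) \<partial>lborel)"
    using point by (intro integral_cong_AE) measurable
  also have "\<dots> = (\<integral>x. f x * \<phi> (x, 0) \<partial>lborel) + (\<integral>x. \<integral>r. time_deriv \<phi> (x, r) * W r x \<partial>time_measure 0 t \<partial>lborel)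
      + (\<integral>x. \<integral>s. \<phi> (x, s) * g s x \<partial>time_measure 0 t \<partial>lborel)"
    using i0 i1' i2' by simp
  also have "(\<integral>x. \<integral>r. time_deriv \<phi> (x, r) * W r x \<partial>time_measure 0 t \<partial>lborel) = (\<integral>r. \<integral>x. time_deriv \<phi> (x, r) * W r x \<partial>lborel \<partial>time_measure 0 t)"
    by (rule tmp.Fubini_integral[OF i1])
  also have "\<dots> = (\<integral>r. \<integral>x. time_deriv \<phi> (x, r) * u r x \<partial>lborel \<partial>time_measure 0 t)"
  proof (rule integral_cong_AE)
    show "AE r in time_measure 0 t. (\<integral>x. time_deriv \<phi> (x, r) * W r x \<partial>lborel) = (\<integral>x. time_deriv \<phi> (x, r) * u r x \<partial>lborel)"
    proof (rule AE_time_measureI)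
      fix r assume r: "0 \<le> r" "r \<le> t"
      show "(\<integral>x. time_deriv \<phi> (x, r) * W r x \<partial>lborel) = (\<integral>x. time_deriv \<phi> (x, r) * u r x \<partial>lborel)"
      proof (rule integral_cong_AE)
        show "AE x in lborel. time_deriv \<phi> (x, r) * W r x = time_deriv \<phi> (x, r) * u r x"
          using uW[OF r] by eventually_elim simp
      qed measurable
    qed
  qed measurable
  also have "(\<integral>x. \<integral>s. \<phi> (x, s) * g s x \<partial>time_measure 0 t \<partial>lborel) = (\<integral>s. \<integral>x. \<phi> (x, s) * g s x \<partial>lborel \<partial>time_measure 0 t)"
    by (rule tmp.Fubini_integral[OF i2])
  finally show ?thesis .
qed

text \<open>The flux is the time density in \<open>weak_form_of_evolution\<close>. Symmetry of the
  operator moves it from the solution to the test function, where it becomes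
  \<open>nonlocal_op\<close>.\<close>

lemma sol_weak_form:
  fixes J :: "'a::euclidean_space \<Rightarrow> real"
  assumes J: "radial_kernel J" and e: "0 < e" and pk: "prob_kernel (rescale e J) (1 / e\<^sup>2) B"
    and u: "prob_kernel.sol (rescale e J) (1 / e\<^sup>2) f u" and f: "integrable lborel f"
    and \<phi>: "test_function \<phi>" and t: "0 \<le> t"
  shows "(\<integral>x. u t x * \<phi> (x, t) \<partial>lborel) = (\<integral>x. f x * \<phi> (x, 0) \<partial>lborel)
    + (\<integral>r. \<integral>x. time_deriv \<phi> (x, r) * u r x \<partial>lborel \<partial>time_measure 0 t)
    + (\<integral>s. \<integral>x. nonlocal_op J e \<phi> (x, s) * stefan_pos (u s x) \<partial>lborel \<partial>time_measure 0 t)"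
proof -
  interpret prob_kernel "rescale e J" "1 / e\<^sup>2" B by (rule pk)
  note [measurable] = solD(1)[OF u] test_function_pair_measurable[OF \<phi>] radial_kernelD(7)[OF J] nonlocal_op_measurable
  obtain C where C: "0 \<le> C" "\<And>r. 0 \<le> r \<Longrightarrow> r \<le> t \<Longrightarrow> (\<integral>x. \<bar>diffuse (rescale e J) (1 / e\<^sup>2) (\<lambda>y. stefan_pos (u r y)) x\<bar> \<partial>lborel) \<le> C"
    using sol_flux_bound[OF u t] by metis
  obtain D where D: "0 < D" "\<And>z. \<bar>\<phi> z\<bar> \<le> D" by (rule test_function_bounded[OF \<phi>]) blast
  have "(\<integral>x. \<phi> (x, s) * diffuse (rescale e J) (1 / e\<^sup>2) v x \<partial>lborel) = (\<integral>x. nonlocal_op J e \<phi> (x, s) * v x \<partial>lborel)"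
    if v: "integrable lborel v" for v s
  proof -
    have [measurable]: "v \<in> borel_measurable borel" using v by simp
    have cr: "convolution (rescale e J) (\<lambda>x. \<phi> (x, s)) x = (\<integral>z. J z * \<phi> (x - e *\<^sub>R z, s) \<partial>lborel)" for x
      by (rule convolution_rescale) (use e in measurable)
    have b: "\<bar>convolution (rescale e J) (\<lambda>x. \<phi> (x, s)) x\<bar> \<le> D" for x
      using convolution_abs_le_sup[OF k_integrable, of "\<lambda>x. \<phi> (x, s)" D x] D by (simp add: k_abs_integral)
    have i1: "integrable lborel (\<lambda>x. \<phi> (x, s) * convolution (rescale e J) v x)"
      by (rule integrable_mult_AE_bounded(2)[OF conv_integrable[OF v], of _ D]) (use D in auto)
    have i2: "integrable lborel (\<lambda>x. \<phi> (x, s) * v x)"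
      by (rule integrable_mult_AE_bounded(2)[OF v, of _ D]) (use D in auto)
    have i3: "integrable lborel (\<lambda>x. convolution (rescale e J) (\<lambda>x. \<phi> (x, s)) x * v x)"
      by (rule integrable_mult_AE_bounded(2)[OF v, of _ D]) (use b in auto)
    have "(\<integral>x. \<phi> (x, s) * diffuse (rescale e J) (1 / e\<^sup>2) v x \<partial>lborel)
        = (\<integral>x. (1 / e\<^sup>2) * (\<phi> (x, s) * convolution (rescale e J) v x - \<phi> (x, s) * v x) \<partial>lborel)"
      by (simp add: diffuse_def right_diff_distrib mult.left_commute)
    also have "\<dots> = (1 / e\<^sup>2) * ((\<integral>x. convolution (rescale e J) v x * \<phi> (x, s) \<partial>lborel) - (\<integral>x. \<phi> (x, s) * v x \<partial>lborel))"
      using i1 i2 by (simp add: mult.commute)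
    also have "(\<integral>x. convolution (rescale e J) v x * \<phi> (x, s) \<partial>lborel) = (\<integral>x. v x * convolution (rescale e J) (\<lambda>x. \<phi> (x, s)) x \<partial>lborel)"
      by (rule convolution_adjoint[OF k_integrable k_even v, of _ D]) (use D in auto)
    also have "(1 / e\<^sup>2) * ((\<integral>x. v x * convolution (rescale e J) (\<lambda>x. \<phi> (x, s)) x \<partial>lborel) - (\<integral>x. \<phi> (x, s) * v x \<partial>lborel))
        = (\<integral>x. (1 / e\<^sup>2) * (convolution (rescale e J) (\<lambda>x. \<phi> (x, s)) x * v x - \<phi> (x, s) * v x) \<partial>lborel)"
      using i2 i3 by (simp add: mult.commute)
    also have "\<dots> = (\<integral>x. nonlocal_op J e \<phi> (x, s) * v x \<partial>lborel)"
      by (simp add: cr nonlocal_op_def left_diff_distrib)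
    finally show ?thesis .
  qed
  then have eqs: "(\<integral>x. \<phi> (x, s) * diffuse (rescale e J) (1 / e\<^sup>2) (\<lambda>y. stefan_pos (u s y)) x \<partial>lborel)
      = (\<integral>x. nonlocal_op J e \<phi> (x, s) * stefan_pos (u s x) \<partial>lborel)" if "0 \<le> s" for s
    using solD(2)[OF u that] by blast
  note fm [measurable] = sol_flux_measurable[OF solD(1)[OF u]]
  have "(\<integral>x. u t x * \<phi> (x, t) \<partial>lborel) = (\<integral>x. f x * \<phi> (x, 0) \<partial>lborel)
    + (\<integral>r. \<integral>x. time_deriv \<phi> (x, r) * u r x \<partial>lborel \<partial>time_measure 0 t)
    + (\<integral>s. \<integral>x. \<phi> (x, s) * diffuse (rescale e J) (1 / e\<^sup>2) (\<lambda>y. stefan_pos (u s y)) x \<partial>lborel \<partial>time_measure 0 t)"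
    by (rule weak_form_of_evolution[OF \<phi> t f fm solD(1)[OF u] C(1)])
       (use C solD(4)[OF u] sol_flux_integrable[OF u] in auto)
  also have "(\<integral>s. \<integral>x. \<phi> (x, s) * diffuse (rescale e J) (1 / e\<^sup>2) (\<lambda>y. stefan_pos (u s y)) x \<partial>lborel \<partial>time_measure 0 t)
      = (\<integral>s. \<integral>x. nonlocal_op J e \<phi> (x, s) * stefan_pos (u s x) \<partial>lborel \<partial>time_measure 0 t)"
  proof (rule integral_cong_AE)
    show "AE s in time_measure 0 t. (\<integral>x. \<phi> (x, s) * diffuse (rescale e J) (1 / e\<^sup>2) (\<lambda>y. stefan_pos (u s y)) x \<partial>lborel)
      = (\<integral>x. nonlocal_op J e \<phi> (x, s) * stefan_pos (u s x) \<partial>lborel)"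
      by (rule AE_time_measureI, rule eqs)
    have [measurable]: "nonlocal_op J e \<phi> \<in> borel_measurable (borel \<Otimes>\<^sub>M borel)"
      using nonlocal_op_measurable[OF radial_kernelD(7)[OF J] test_functionD(5)[OF \<phi>]] by (simp add: borel_prod)
    show "(\<lambda>s. \<integral>x. nonlocal_op J e \<phi> (x, s) * stefan_pos (u s x) \<partial>lborel) \<in> borel_measurable (time_measure 0 t)"
      by measurable
    have [measurable]: "(\<lambda>(s, x). diffuse (rescale e J) (1 / e\<^sup>2) (\<lambda>y. stefan_pos (u s y)) x) \<in> borel_measurable (borel \<Otimes>\<^sub>M borel)"
      by (rule fm)
    have "(\<lambda>(s, x). \<phi> (x, s) * (case (s, x) of (s, x) \<Rightarrow> diffuse (rescale e J) (1 / e\<^sup>2) (\<lambda>y. stefan_pos (u s y)) x)) \<in> borel_measurable (borel \<Otimes>\<^sub>M borel)"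
      by measurable
    then have "(\<lambda>(s, x). \<phi> (x, s) * diffuse (rescale e J) (1 / e\<^sup>2) (\<lambda>y. stefan_pos (u s y)) x) \<in> borel_measurable (borel \<Otimes>\<^sub>M borel)"
      by (simp add: split_beta')
    then have "(\<lambda>(s, x). \<phi> (x, s) * diffuse (rescale e J) (1 / e\<^sup>2) (\<lambda>y. stefan_pos (u s y)) x) \<in> borel_measurable (borel \<Otimes>\<^sub>M lborel)"
      by (simp cong: measurable_cong_sets)
    then show "(\<lambda>s. \<integral>x. \<phi> (x, s) * diffuse (rescale e J) (1 / e\<^sup>2) (\<lambda>y. stefan_pos (u s y)) x \<partial>lborel) \<in> borel_measurable (time_measure 0 t)"
      using lborel.borel_measurable_lebesgue_integral[of "\<lambda>s x. \<phi> (x, s) * diffuse (rescale e J) (1 / e\<^sup>2) (\<lambda>y. stefan_pos (u s y)) x" borel]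
      by (simp cong: measurable_cong_sets)
  qed
  finally show ?thesis .
qed

subsection \<open>Mollified equations\<close>

definition moll :: "real \<Rightarrow> 'a::euclidean_space \<Rightarrow> real" where
  "moll d = rescale d mollifier"

lemma radial_kernel_moll: "0 < d \<Longrightarrow> radial_kernel (moll d)"
  unfolding moll_def by (rule radial_kernel_rescale[OF radial_kernel_mollifier])

lemma space_time_bump_eq:
  assumes "- 1 \<le> s" "s \<le> T + 1"
  shows "space_time_bump T d x (y, s) = moll d (x - y)"
  using assms by (simp add: space_time_bump_def moll_def time_cutoff_eq_1)

lemma time_deriv_space_time_bump:
  fixes x :: "'a::euclidean_space"
  assumes "0 \<le> s" "s \<le> T" "0 < d"
  shows "time_deriv (space_time_bump T d x) (y, s) = 0"
proof -
  have "((\<lambda>r. space_time_bump T d x (y, r)) has_real_derivative 0) (at s)"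
  proof (rule has_field_derivative_transform_within_open)
    show "((\<lambda>r. moll d (x - y)) has_real_derivative 0) (at s)" by simp
    show "open {- 1 <..< T + 1}" "s \<in> {- 1 <..< T + 1}" using assms by auto
  qed (simp add: space_time_bump_eq)
  then show ?thesis
    using time_path_derivative[OF test_function_space_time_bump[OF \<open>0 < d\<close>]] DERIV_unique by blast
qed

text \<open>The nonlocal operator applied to the mollifier: convolving with this kernel mollifies at
  scale \<open>d\<close> and applies the operator.\<close>

definition nl_kernel :: "('a::euclidean_space \<Rightarrow> real) \<Rightarrow> real \<Rightarrow> real \<Rightarrow> 'a \<Rightarrow> real" where
  "nl_kernel J d e = diffuse (rescale e J) (1 / e\<^sup>2) (moll d)"

text \<open>This is \<open>diffusivity J\<close> times the Laplacian of \<open>moll d\<close> at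
  \<open>w\<close>, read off from the space-time bump so that one calculus serves both. The argument
  is \<open>- w\<close> because the bump centred at 0 depends on \<open>0 - y\<close>.\<close>

definition loc_kernel :: "('a::euclidean_space \<Rightarrow> real) \<Rightarrow> real \<Rightarrow> 'a \<Rightarrow> real" where
  "loc_kernel J d w = diffusivity J * laplacian (space_time_bump 0 d 0) (- w, 0)"

lemma nonlocal_op_bump:
  fixes J :: "'a::euclidean_space \<Rightarrow> real"
  assumes J: "radial_kernel J" and e: "0 < e" and d: "0 < d" and s: "0 \<le> s" "s \<le> T"
  shows "nonlocal_op J e (space_time_bump T d x) (y, s) = nl_kernel J d e (x - y)"
proof -
  have [measurable]: "J \<in> borel_measurable borel" "moll d \<in> borel_measurable borel"
    using radial_kernelD(7)[OF J] radial_kernelD(7)[OF radial_kernel_moll[OF d]] by auto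
  have "(\<integral>z. J z * moll d (x - (y - e *\<^sub>R z)) \<partial>lborel) = (\<integral>z. J (0 - z) * moll d (x - (y - e *\<^sub>R (0 - z))) \<partial>lborel)"
    by (rule integral_lborel_shift(3)[symmetric]) measurable
  also have "\<dots> = (\<integral>z. J z * moll d (x - y - e *\<^sub>R z) \<partial>lborel)"
    using radial_kernelD(6)[OF J] by (simp add: diff_diff_eq)
  also have "\<dots> = convolution (rescale e J) (moll d) (x - y)"
    by (rule convolution_rescale[symmetric]) (use e in measurable)
  finally show ?thesis
    using s by (simp add: nonlocal_op_def nl_kernel_def diffuse_def space_time_bump_eq)
qed

lemma inverse_Suc_tendsto: "(\<lambda>n. 1 / real (Suc n)) \<longlonglongrightarrow> 0"
  by (rule LIMSEQ_Suc[OF lim_const_over_n])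

lemma nl_kernel_tendsto:
  fixes J :: "'a::euclidean_space \<Rightarrow> real"
  assumes J: "radial_kernel J" and d: "0 < d" and X: "\<And>n. 0 < X n" "X \<longlonglongrightarrow> 0"
  shows "(\<lambda>n. nl_kernel J d (X n) w) \<longlonglongrightarrow> loc_kernel J d w"
  using nonlocal_op_tendsto[OF J test_function_space_time_bump[OF d] X, of 0 0 "(- w, 0)"]
  by (simp add: nonlocal_op_bump[OF J X(1) d] loc_kernel_def)

text \<open>Both sides are limits of the same nonlocal expressions; this avoids computing the Laplacian of
  the bump.\<close>

lemma local_op_bump:
  fixes J :: "'a::euclidean_space \<Rightarrow> real"
  assumes J: "radial_kernel J" and d: "0 < d" and s: "0 \<le> s" "s \<le> T"
  shows "diffusivity J * laplacian (space_time_bump T d x) (y, s) = loc_kernel J d (x - y)"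
proof (rule LIMSEQ_unique)
  let ?X = "\<lambda>n. 1 / real (Suc n)"
  have X: "\<And>n. 0 < ?X n" by simp
  show "(\<lambda>n. nl_kernel J d (?X n) (x - y)) \<longlonglongrightarrow> loc_kernel J d (x - y)"
    by (rule nl_kernel_tendsto[OF J d X inverse_Suc_tendsto])
  show "(\<lambda>n. nl_kernel J d (?X n) (x - y)) \<longlonglongrightarrow> diffusivity J * laplacian (space_time_bump T d x) (y, s)"
    using nonlocal_op_tendsto[OF J test_function_space_time_bump[OF d] X inverse_Suc_tendsto, of T x "(y, s)"]
    unfolding nonlocal_op_bump[OF J X d s] .
qed

lemma laplacian_measurable:
  assumes "test_function \<phi>" shows "laplacian \<phi> \<in> borel_measurable borel" "continuous_on UNIV (laplacian \<phi>)"
proof -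
  show "continuous_on UNIV (laplacian \<phi>)"
    unfolding laplacian_def by (intro continuous_on_sum test_functionD(3) test_function_dir_deriv assms space_Basis)
  then show "laplacian \<phi> \<in> borel_measurable borel" by (rule borel_measurable_continuous_onI)
qed

lemma laplacian_bounded:
  assumes \<phi>: "test_function \<phi>" obtains B where "0 \<le> B" "\<And>p. \<bar>laplacian \<phi> p\<bar> \<le> B"
proof -
  have "\<exists>B. \<forall>p. \<bar>dir_deriv (b, 0) (dir_deriv (b, 0) \<phi>) p\<bar> \<le> B" if "b \<in> Basis" for b :: 'a
    by (rule test_function_bounded[OF test_function_dir_deriv[OF test_function_dir_deriv[OF \<phi> space_Basis[OF that]] space_Basis[OF that]]]) auto
  then obtain B where B: "\<And>b p. b \<in> Basis \<Longrightarrow> \<bar>dir_deriv (b, 0) (dir_deriv (b, 0) \<phi>) p\<bar> \<le> B b" by metis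
  have *: "\<bar>laplacian \<phi> p\<bar> \<le> (\<Sum>b\<in>Basis. B b)" for p
    unfolding laplacian_def by (rule order_trans[OF sum_abs sum_mono[OF B]])
  show thesis by (rule that[OF _ *]) (use *[of "(0, 0)"] in linarith)
qed

lemma nl_kernel_bounds:
  fixes J :: "'a::euclidean_space \<Rightarrow> real"
  assumes J: "radial_kernel J" and d: "0 < d"
  obtains C R where "0 \<le> C" "0 < R" "\<And>e w. 0 < e \<Longrightarrow> \<bar>nl_kernel J d e w\<bar> \<le> C"
    "\<And>e w. 0 < e \<Longrightarrow> e \<le> 1 \<Longrightarrow> R < norm w \<Longrightarrow> nl_kernel J d e w = 0"
proof -
  let ?\<phi> = "space_time_bump 0 d (0::'a)"
  have \<phi>: "test_function ?\<phi>" by (rule test_function_space_time_bump[OF d])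
  obtain C where C: "0 \<le> C" "\<And>e p. 0 < e \<Longrightarrow> \<bar>nonlocal_op J e ?\<phi> p\<bar> \<le> C"
    by (rule nonlocal_op_bounded[OF J \<phi>]) blast
  obtain R where R: "0 < R" "\<And>p. R < norm p \<Longrightarrow> ?\<phi> p = 0"
    by (rule compact_support_radius[OF test_functionD(2)[OF \<phi>]]) blast
  obtain S where S: "0 < S" "\<And>z. S < norm z \<Longrightarrow> J z = 0"
    by (rule compact_support_radius[OF radial_kernelD(3)[OF J]]) blast
  have eq: "nl_kernel J d e w = nonlocal_op J e ?\<phi> (- w, 0)" if "0 < e" for e w
    using nonlocal_op_bump[OF J that d, of 0 0 0 "- w"] by simp
  show thesis
  proof (rule that[OF C(1), of "R + S"])
    show "\<bar>nl_kernel J d e w\<bar> \<le> C" if "0 < e" for e w using C(2)[OF that] by (simp add: eq[OF that])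
    show "nl_kernel J d e w = 0" if "0 < e" "e \<le> 1" "R + S < norm w" for e w
      using nonlocal_op_support[OF J \<phi> R(2) S(2,1) that(1,2), where p="(- w, 0)"] that by (simp add: eq norm_Pair)
  qed (use R S in simp)
qed

lemma nl_kernel_integrable:
  assumes J: "radial_kernel J" and d: "0 < d" and e: "0 < e"
  shows "integrable lborel (nl_kernel J d e)"
proof -
  obtain B where "prob_kernel (rescale e J) (1 / e\<^sup>2) B"
    by (rule prob_kernel_radial[OF radial_kernel_rescale[OF J e], of "1 / e\<^sup>2"]) (use e in auto)
  then interpret prob_kernel "rescale e J" "1 / e\<^sup>2" B .
  show ?thesis unfolding nl_kernel_def by (intro diffuse_integrable radial_kernelD(8) radial_kernel_moll d)
qed

lemma loc_kernel_measurable: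
  fixes J :: "'a::euclidean_space \<Rightarrow> real"
  assumes "0 < d" shows "loc_kernel J d \<in> borel_measurable borel"
proof -
  have [measurable]: "laplacian (space_time_bump 0 d (0::'a)) \<in> borel_measurable (borel \<Otimes>\<^sub>M borel)"
    using laplacian_measurable(1)[OF test_function_space_time_bump[OF assms]] by (simp add: borel_prod)
  show ?thesis unfolding loc_kernel_def[abs_def] by measurable
qed

lemma loc_kernel_bounded:
  fixes J :: "'a::euclidean_space \<Rightarrow> real"
  assumes "0 < d" obtains B where "\<And>w. \<bar>loc_kernel J d w\<bar> \<le> B"
proof -
  obtain B where B: "\<And>p. \<bar>laplacian (space_time_bump 0 d (0::'a)) p\<bar> \<le> B"
    by (rule laplacian_bounded[OF test_function_space_time_bump[OF assms]]) blast
  show thesis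
    by (rule that[of "\<bar>diffusivity J\<bar> * B"]) (auto simp: loc_kernel_def abs_mult intro!: mult_left_mono B)
qed

text \<open>The uniform bound and the common support for \<open>e <= 1\<close> dominate the
  sequence. The limit kernel inherits both, which also yields its integrability.\<close>

lemma nl_kernel_L1_tendsto:
  fixes J :: "'a::euclidean_space \<Rightarrow> real"
  assumes J: "radial_kernel J" and d: "0 < d" and X: "\<And>n. 0 < X n" "\<And>n. X n \<le> 1" "X \<longlonglongrightarrow> 0"
  shows "integrable lborel (loc_kernel J d)"
    and "(\<lambda>n. \<integral>w. \<bar>nl_kernel J d (X n) w - loc_kernel J d w\<bar> \<partial>lborel) \<longlonglongrightarrow> 0"
proof -
  obtain C R where CR: "0 \<le> C" "0 < R" "\<And>e w. 0 < e \<Longrightarrow> \<bar>nl_kernel J d e w\<bar> \<le> C"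
    "\<And>e w. 0 < e \<Longrightarrow> e \<le> 1 \<Longrightarrow> R < norm w \<Longrightarrow> nl_kernel J d e w = 0"
    by (rule nl_kernel_bounds[OF J d]) blast
  note [measurable] = loc_kernel_measurable[OF d] borel_measurable_integrable[OF nl_kernel_integrable[OF J d X(1)]]
  have i: "integrable lborel (\<lambda>w::'a. C * indicator (cball 0 R) w)"
    by (auto intro!: integrable_mult_right integrable_real_indicator intro!: emeasure_bounded_finite)
  have b: "\<bar>nl_kernel J d (X n) w\<bar> \<le> C * indicator (cball 0 R) w" for n w
    using CR(3)[OF X(1), of n w] CR(4)[OF X(1,2), of w n] by (cases "norm w \<le> R") auto
  have lim: "(\<lambda>n. nl_kernel J d (X n) w) \<longlonglongrightarrow> loc_kernel J d w" for w
    by (rule nl_kernel_tendsto[OF J d X(1,3)])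
  show L: "integrable lborel (loc_kernel J d)"
    by (rule integrable_dominated_convergence[where s="\<lambda>n. nl_kernel J d (X n)" and w="\<lambda>w. C * indicator (cball 0 R) w"])
       (use i b lim in auto)
  have bl: "\<bar>loc_kernel J d w\<bar> \<le> C * indicator (cball 0 R) w" for w
    by (rule LIMSEQ_le_const2[OF tendsto_rabs[OF lim[of w]]]) (use b in auto)
  have "(\<lambda>n. \<integral>w. \<bar>nl_kernel J d (X n) w - loc_kernel J d w\<bar> \<partial>lborel) \<longlonglongrightarrow> (\<integral>w. 0 \<partial>(lborel :: 'a measure))"
  proof (rule integral_dominated_convergence[where w="\<lambda>w. 2 * (C * indicator (cball 0 R) w)"])
    show "AE w in lborel. (\<lambda>n. \<bar>nl_kernel J d (X n) w - loc_kernel J d w\<bar>) \<longlonglongrightarrow> 0"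
      by (intro AE_I2 tendsto_rabs_zero LIM_zero lim)
    show "AE w in lborel. norm \<bar>nl_kernel J d (X n) w - loc_kernel J d w\<bar> \<le> 2 * (C * indicator (cball 0 R) w)" for n
    proof (intro AE_I2)
      fix w show "norm \<bar>nl_kernel J d (X n) w - loc_kernel J d w\<bar> \<le> 2 * (C * indicator (cball 0 R) w)"
        using b[of n w] bl[of w] abs_triangle_ineq4[of "nl_kernel J d (X n) w" "loc_kernel J d w"]
        unfolding real_norm_def abs_idempotent by linarith
    qed
  qed (use i in auto)
  then show "(\<lambda>n. \<integral>w. \<bar>nl_kernel J d (X n) w - loc_kernel J d w\<bar> \<partial>lborel) \<longlonglongrightarrow> 0" by simp
qed

text \<open>Common to the nonlocal and the local problem, which differ only in the operator
  \<open>L\<close> falling on the test function. The bump is constant in time on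
  \<open>[0, t]\<close>, so the term with the time derivative drops out, and the result holds at
  every point \<open>x\<close>.\<close>

lemma mollified_of_weak_form:
  fixes u v :: "real \<Rightarrow> 'a::euclidean_space \<Rightarrow> real"
  assumes t: "0 \<le> t" and d: "0 < d"
    and weak: "(\<integral>y. u t y * space_time_bump t d x (y, t) \<partial>lborel) = (\<integral>y. f y * space_time_bump t d x (y, 0) \<partial>lborel)
      + (\<integral>r. \<integral>y. time_deriv (space_time_bump t d x) (y, r) * u r y \<partial>lborel \<partial>time_measure 0 t)
      + (\<integral>s. \<integral>y. L (y, s) * v s y \<partial>lborel \<partial>time_measure 0 t)"
    and L: "\<And>y s. 0 \<le> s \<Longrightarrow> s \<le> t \<Longrightarrow> L (y, s) = K (x - y)"
    and m1: "(\<lambda>s. \<integral>y. L (y, s) * v s y \<partial>lborel) \<in> borel_measurable borel"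
    and m2: "(\<lambda>s. convolution K (v s) x) \<in> borel_measurable borel"
  shows "convolution (moll d) (u t) x = convolution (moll d) f x + (\<integral>s. convolution K (v s) x \<partial>time_measure 0 t)"
proof -
  have "(\<integral>r. \<integral>y. time_deriv (space_time_bump t d x) (y, r) * u r y \<partial>lborel \<partial>time_measure 0 t) = 0"
    by (rule integral_eq_zero_AE, rule AE_time_measureI) (simp add: time_deriv_space_time_bump d)
  moreover have "(\<integral>s. \<integral>y. L (y, s) * v s y \<partial>lborel \<partial>time_measure 0 t) = (\<integral>s. convolution K (v s) x \<partial>time_measure 0 t)"
  proof (rule integral_cong_AE)
    show "AE s in time_measure 0 t. (\<integral>y. L (y, s) * v s y \<partial>lborel) = convolution K (v s) x"
      by (rule AE_time_measureI) (simp add: L convolution_def)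
  qed (use m1 m2 in \<open>simp_all cong: measurable_cong_sets\<close>)
  ultimately show ?thesis
    using weak t by (simp add: space_time_bump_eq convolution_def mult.commute)
qed

lemma sol_mollified:
  fixes J :: "'a::euclidean_space \<Rightarrow> real"
  assumes J: "radial_kernel J" and e: "0 < e" and pk: "prob_kernel (rescale e J) (1 / e\<^sup>2) B"
    and u: "prob_kernel.sol (rescale e J) (1 / e\<^sup>2) f u" and f: "integrable lborel f" and t: "0 \<le> t" and d: "0 < d"
  shows "convolution (moll d) (u t) x = convolution (moll d) f x
    + (\<integral>s. convolution (nl_kernel J d e) (\<lambda>y. stefan_pos (u s y)) x \<partial>time_measure 0 t)"
proof (rule mollified_of_weak_form[OF t d])
  let ?\<phi> = "space_time_bump t d x"
  have um [measurable]: "case_prod u \<in> borel_measurable (borel \<Otimes>\<^sub>M borel)" by (rule prob_kernel.solD(1)[OF pk u])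
  note [measurable] = borel_measurable_integrable[OF nl_kernel_integrable[OF J d e]]
  have [measurable]: "nonlocal_op J e ?\<phi> \<in> borel_measurable (borel \<Otimes>\<^sub>M borel)"
    using nonlocal_op_measurable[OF radial_kernelD(7)[OF J] test_functionD(5)[OF test_function_space_time_bump[OF d]]]
    by (simp add: borel_prod)
  show "(\<integral>y. u t y * ?\<phi> (y, t) \<partial>lborel) = (\<integral>y. f y * ?\<phi> (y, 0) \<partial>lborel)
      + (\<integral>r. \<integral>y. time_deriv ?\<phi> (y, r) * u r y \<partial>lborel \<partial>time_measure 0 t)
      + (\<integral>s. \<integral>y. nonlocal_op J e ?\<phi> (y, s) * stefan_pos (u s y) \<partial>lborel \<partial>time_measure 0 t)"
    by (rule sol_weak_form[OF J e pk u f test_function_space_time_bump[OF d] t])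
  show "nonlocal_op J e ?\<phi> (y, s) = nl_kernel J d e (x - y)" if "0 \<le> s" "s \<le> t" for y s
    by (rule nonlocal_op_bump[OF J e d that])
  show "(\<lambda>s. \<integral>y. nonlocal_op J e ?\<phi> (y, s) * stefan_pos (u s y) \<partial>lborel) \<in> borel_measurable borel"
    by measurable
  show "(\<lambda>s. convolution (nl_kernel J d e) (\<lambda>y. stefan_pos (u s y)) x) \<in> borel_measurable borel"
    unfolding convolution_def by measurable
qed

subsection \<open>Normalised representatives\<close>

text \<open>\<open>continuous_L1\<close> gives measurability for nonnegative times only. Extension
  by 0 yields a jointly measurable function on all of space-time without changing anything that the
  equations see.\<close>

definition ext0 :: "(real \<Rightarrow> 'a \<Rightarrow> real) \<Rightarrow> real \<Rightarrow> 'a \<Rightarrow> real" where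
  "ext0 u t x = (if 0 \<le> t then u t x else 0)"

lemma ext0_eq [simp]: "0 \<le> t \<Longrightarrow> ext0 u t = u t"
  by (auto simp: ext0_def)

lemma continuous_L1_ext0:
  fixes u :: "real \<Rightarrow> 'a::euclidean_space \<Rightarrow> real"
  assumes u: "continuous_L1 u"
  shows "case_prod (ext0 u) \<in> borel_measurable (borel \<Otimes>\<^sub>M borel)"
    and "0 \<le> t \<Longrightarrow> integrable lborel (ext0 u t)"
    and "0 \<le> s \<Longrightarrow> ((\<lambda>t. \<integral>x. \<bar>ext0 u t x - ext0 u s x\<bar> \<partial>lborel) \<longlongrightarrow> 0) (at s within {0..})"
proof -
  have m: "(\<lambda>z. indicator (UNIV \<times> {0..}) z *\<^sub>R (case z of (x, t) \<Rightarrow> u t x)) \<in> borel_measurable (borel \<Otimes>\<^sub>M borel)"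
    using u by (simp add: continuous_L1_def set_borel_measurable_def borel_prod)
  have "case_prod (ext0 u) = (\<lambda>z. (\<lambda>z. indicator (UNIV \<times> {0..}) z *\<^sub>R (case z of (x, t) \<Rightarrow> u t x)) (snd z, fst z))"
    by (auto simp: ext0_def indicator_def)
  moreover have "(\<lambda>z. (snd z, fst z)) \<in> borel \<Otimes>\<^sub>M borel \<rightarrow>\<^sub>M borel \<Otimes>\<^sub>M borel" by measurable
  from measurable_compose[OF this m]
  have "(\<lambda>z. (\<lambda>z. indicator (UNIV \<times> {0..}) z *\<^sub>R (case z of (x, t) \<Rightarrow> u t x)) (snd z, fst z)) \<in> borel_measurable (borel \<Otimes>\<^sub>M borel)" .
  ultimately show "case_prod (ext0 u) \<in> borel_measurable (borel \<Otimes>\<^sub>M borel)" by (simp only:)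
  show "0 \<le> t \<Longrightarrow> integrable lborel (ext0 u t)" using u by (simp add: continuous_L1_def)
  assume s: "0 \<le> s"
  have "((\<lambda>t. \<integral>x. \<bar>u t x - u s x\<bar> \<partial>lborel) \<longlongrightarrow> 0) (at s within {0..})" using u s by (simp add: continuous_L1_def)
  then show "((\<lambda>t. \<integral>x. \<bar>ext0 u t x - ext0 u s x\<bar> \<partial>lborel) \<longlongrightarrow> 0) (at s within {0..})"
    by (rule Lim_transform_eventually) (use s in \<open>auto simp: eventually_at_filter\<close>)
qed

lemma set_integral_time_measure:
  fixes F G :: "real \<Rightarrow> real"
  assumes [measurable]: "G \<in> borel_measurable borel" and "\<And>s. a \<le> s \<Longrightarrow> s \<le> b \<Longrightarrow> F s = G s"
  shows "(LBINT s:{a..b}. F s) = (\<integral>s. G s \<partial>time_measure a b)"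
  unfolding integral_time_measure[OF assms(1)] set_lebesgue_integral_def
  by (intro Bochner_Integration.integral_cong) (auto simp: assms(2) indicator_def)

lemma sol_of_nonlocal_stefan_solution:
  fixes J :: "'a::euclidean_space \<Rightarrow> real"
  assumes pk: "prob_kernel (rescale e J) (1 / e\<^sup>2) B" and u: "nonlocal_stefan_solution J e f u" and f: "integrable lborel f"
  shows "prob_kernel.sol (rescale e J) (1 / e\<^sup>2) f (ext0 u)"
proof -
  interpret prob_kernel "rescale e J" "1 / e\<^sup>2" B by (rule pk)
  let ?w = "ext0 u"
  have c: "continuous_L1 u" using u by (simp add: nonlocal_stefan_solution_def)
  note w = continuous_L1_ext0[OF c]
  note [measurable] = w(1)
  note fm = sol_flux_measurable[OF w(1)]
  have flux_int: "integrable lborel (diffuse (rescale e J) (1 / e\<^sup>2) (\<lambda>y. stefan_pos (?w t y)))" if "0 \<le> t" for t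
    by (intro diffuse_integrable stefan_pos_integrable w(2) that)
  have pos: "AE x in lborel. ?w t x = f x + (\<integral>s. diffuse (rescale e J) (1 / e\<^sup>2) (\<lambda>y. stefan_pos (?w s y)) x \<partial>time_measure 0 t)"
    if t: "0 < t" for t
  proof -
    have "AE x in lborel. u t x = f x + (1 / e\<^sup>2) *
          (LBINT s:{0..t}. convolution (rescale e J) (\<lambda>y. stefan_pos (u s y)) x - stefan_pos (u s x))"
      using u t by (simp add: nonlocal_stefan_solution_def)
    moreover have "(1 / e\<^sup>2) * (LBINT s:{0..t}. convolution (rescale e J) (\<lambda>y. stefan_pos (u s y)) x - stefan_pos (u s x))
        = (\<integral>s. diffuse (rescale e J) (1 / e\<^sup>2) (\<lambda>y. stefan_pos (?w s y)) x \<partial>time_measure 0 t)" for x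
    proof -
      have "(LBINT s:{0..t}. convolution (rescale e J) (\<lambda>y. stefan_pos (u s y)) x - stefan_pos (u s x))
        = (\<integral>s. convolution (rescale e J) (\<lambda>y. stefan_pos (?w s y)) x - stefan_pos (?w s x) \<partial>time_measure 0 t)"
        proof (rule set_integral_time_measure)
          show "(\<lambda>s. convolution (rescale e J) (\<lambda>y. stefan_pos (?w s y)) x - stefan_pos (?w s x)) \<in> borel_measurable borel"
            unfolding convolution_def by measurable
        qed simp
      then show ?thesis unfolding diffuse_def by simp
    qed
    ultimately show ?thesis using t by simp
  qed
  \<comment> \<open>The equation is given for positive times only. As \<open>t = 1 / (n + 1)\<close>
    tends to 0, \<open>u t\<close> converges to \<open>u 0\<close> in \<open>L^1\<close> and the
    flux integral is of order \<open>t\<close>.\<close>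
  have zero: "AE x in lborel. ?w 0 x = f x"
  proof -
    obtain C where C: "0 \<le> C" "\<And>t. 0 \<le> t \<Longrightarrow> t \<le> 1 \<Longrightarrow> (\<integral>x. \<bar>?w t x\<bar> \<partial>lborel) \<le> C"
      using L1_bounded_of_continuous[OF w(2,3)] by metis
    let ?G = "\<lambda>s x. diffuse (rescale e J) (1 / e\<^sup>2) (\<lambda>y. stefan_pos (?w s y)) x"
    have G: "(\<integral>x. \<bar>?G s x\<bar> \<partial>lborel) \<le> 2 * (1 / e\<^sup>2) * C" if "0 \<le> s" "s \<le> 1" for s
    proof -
      have "(\<integral>x. \<bar>?G s x\<bar> \<partial>lborel) \<le> 2 * (1 / e\<^sup>2) * (\<integral>x. \<bar>stefan_pos (?w s x)\<bar> \<partial>lborel)"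
        by (intro diffuse_L1_le stefan_pos_integrable w(2) that)
      also have "\<dots> \<le> 2 * (1 / e\<^sup>2) * C"
        using C(2)[OF that] stefan_pos_L1_le[OF w(2)[OF that(1)]] l_pos by (intro mult_left_mono) auto
      finally show ?thesis .
    qed
    have G0: "0 \<le> 2 * (1 / e\<^sup>2) * C" using C by simp
    have le: "(\<integral>x. \<bar>?w 0 x - f x\<bar> \<partial>lborel) \<le> (\<integral>x. \<bar>?w t x - ?w 0 x\<bar> \<partial>lborel) + t * (2 * (1 / e\<^sup>2) * C)" if t: "0 < t" "t \<le> 1" for t
    proof -
      have i: "integrable lborel (\<lambda>x. \<integral>s. ?G s x \<partial>time_measure 0 t)"
        by (rule time_integral_L1_le(1)[OF fm _ G0]) (use t G flux_int in auto)
      have iw: "integrable lborel (?w t)" "integrable lborel (?w 0)" using w(2) t by auto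
      have "(\<integral>x. \<bar>?w 0 x - f x\<bar> \<partial>lborel) \<le> (\<integral>x. \<bar>?w t x - ?w 0 x\<bar> + \<bar>\<integral>s. ?G s x \<partial>time_measure 0 t\<bar> \<partial>lborel)"
      proof (rule integral_mono_AE)
        show "AE x in lborel. \<bar>?w 0 x - f x\<bar> \<le> \<bar>?w t x - ?w 0 x\<bar> + \<bar>\<integral>s. ?G s x \<partial>time_measure 0 t\<bar>"
          using pos[OF t(1)] by eventually_elim linarith
      qed (use i iw f in auto)
      also have "\<dots> = (\<integral>x. \<bar>?w t x - ?w 0 x\<bar> \<partial>lborel) + (\<integral>x. \<bar>\<integral>s. ?G s x \<partial>time_measure 0 t\<bar> \<partial>lborel)"
        using i iw by simp
      also have "(\<integral>x. \<bar>\<integral>s. ?G s x \<partial>time_measure 0 t\<bar> \<partial>lborel) \<le> (t - 0) * (2 * (1 / e\<^sup>2) * C)"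
        by (rule time_integral_L1_le(2)[OF fm _ G0]) (use t G flux_int in auto)
      finally show ?thesis by simp
    qed
    have "(\<lambda>n. (\<integral>x. \<bar>?w (1 / real (Suc n)) x - ?w 0 x\<bar> \<partial>lborel) + 1 / real (Suc n) * (2 * (1 / e\<^sup>2) * C)) \<longlonglongrightarrow> 0 + 0 * (2 * (1 / e\<^sup>2) * C)"
    proof (intro tendsto_add tendsto_mult inverse_Suc_tendsto tendsto_const)
      show "(\<lambda>n. \<integral>x. \<bar>?w (1 / real (Suc n)) x - ?w 0 x\<bar> \<partial>lborel) \<longlonglongrightarrow> 0"
        by (rule filterlim_compose[OF w(3)[OF order_refl]]) (use inverse_Suc_tendsto in \<open>auto simp: filterlim_at\<close>)
    qed
    then have "(\<integral>x. \<bar>?w 0 x - f x\<bar> \<partial>lborel) \<le> 0 + 0 * (2 * (1 / e\<^sup>2) * C)"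
    proof (rule LIMSEQ_le_const, intro exI allI impI)
      fix n :: nat
      show "(\<integral>x. \<bar>?w 0 x - f x\<bar> \<partial>lborel) \<le> (\<integral>x. \<bar>?w (1 / real (Suc n)) x - ?w 0 x\<bar> \<partial>lborel) + 1 / real (Suc n) * (2 * (1 / e\<^sup>2) * C)"
        by (rule le) (simp_all add: divide_simps)
    qed
    then have "(\<integral>x. \<bar>?w 0 x - f x\<bar> \<partial>lborel) \<le> 0" by simp
    then have "(\<integral>x. \<bar>?w 0 x - f x\<bar> \<partial>lborel) = 0" by (intro antisym integral_nonneg_AE) auto
    then show ?thesis
      using w(2)[of 0] f by (subst (asm) integral_nonneg_eq_0_iff_AE) auto
  qed
  show ?thesis
    unfolding sol_def
  proof (intro conjI allI impI w)
    fix t :: real assume "0 \<le> t"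
    then consider "t = 0" | "0 < t" by linarith
    then show "AE x in lborel. ?w t x = f x + (\<integral>s. diffuse (rescale e J) (1 / e\<^sup>2) (\<lambda>y. stefan_pos (?w s y)) x \<partial>time_measure 0 t)"
    proof cases
      case 1
      show ?thesis using zero 1 by (simp add: integral_time_measure_point)
    qed (rule pos)
  qed
qed

lemma weak_stefan_solution_ext0:
  fixes u :: "real \<Rightarrow> 'a::euclidean_space \<Rightarrow> real"
  assumes u: "weak_stefan_solution c f u" and \<phi>: "test_function \<phi>" and t: "0 \<le> t"
  shows "(\<integral>x. ext0 u t x * \<phi> (x, t) \<partial>lborel) = (\<integral>x. f x * \<phi> (x, 0) \<partial>lborel)
    + (\<integral>r. \<integral>x. time_deriv \<phi> (x, r) * ext0 u r x \<partial>lborel \<partial>time_measure 0 t)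
    + (\<integral>s. \<integral>x. (c * laplacian \<phi> (x, s)) * stefan_pos (ext0 u s x) \<partial>lborel \<partial>time_measure 0 t)"
proof -
  have cu: "continuous_L1 u" using u by (simp add: weak_stefan_solution_def)
  note [measurable] = continuous_L1_ext0(1)[OF cu] test_function_pair_measurable[OF test_function_time_deriv[OF \<phi>]]
  have [measurable]: "laplacian \<phi> \<in> borel_measurable (borel \<Otimes>\<^sub>M borel)"
    using laplacian_measurable(1)[OF \<phi>] by (simp add: borel_prod)
  have "(LBINT s:{0..t}. \<integral>x. time_deriv \<phi> (x, s) * u s x \<partial>lborel) = (\<integral>r. \<integral>x. time_deriv \<phi> (x, r) * ext0 u r x \<partial>lborel \<partial>time_measure 0 t)"
    proof (rule set_integral_time_measure, goal_cases)
    case 1 show ?case by measurable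
  qed simp
  moreover have "(LBINT s:{0..t}. \<integral>x. laplacian \<phi> (x, s) * stefan_pos (u s x) \<partial>lborel) = (\<integral>r. \<integral>x. laplacian \<phi> (x, r) * stefan_pos (ext0 u r x) \<partial>lborel \<partial>time_measure 0 t)"
    proof (rule set_integral_time_measure, goal_cases)
    case 1 show ?case by measurable
  qed simp
  ultimately show ?thesis
    using u \<phi> t by (simp add: weak_stefan_solution_def mult.assoc)
qed

lemma weak_mollified:
  fixes J :: "'a::euclidean_space \<Rightarrow> real"
  assumes J: "radial_kernel J" and u: "weak_stefan_solution (diffusivity J) f u" and t: "0 \<le> t" and d: "0 < d"
  shows "convolution (moll d) (ext0 u t) x = convolution (moll d) f x
    + (\<integral>s. convolution (loc_kernel J d) (\<lambda>y. stefan_pos (ext0 u s y)) x \<partial>time_measure 0 t)"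
proof (rule mollified_of_weak_form[OF t d])
  let ?\<phi> = "space_time_bump t d x"
  note \<phi> = test_function_space_time_bump[OF d, of t x]
  have cu: "continuous_L1 u" using u by (simp add: weak_stefan_solution_def)
  note [measurable] = continuous_L1_ext0(1)[OF cu] loc_kernel_measurable[OF d]
  have [measurable]: "laplacian ?\<phi> \<in> borel_measurable (borel \<Otimes>\<^sub>M borel)"
    using laplacian_measurable(1)[OF \<phi>] by (simp add: borel_prod)
  show "(\<integral>y. ext0 u t y * ?\<phi> (y, t) \<partial>lborel) = (\<integral>y. f y * ?\<phi> (y, 0) \<partial>lborel)
      + (\<integral>r. \<integral>y. time_deriv ?\<phi> (y, r) * ext0 u r y \<partial>lborel \<partial>time_measure 0 t)
      + (\<integral>s. \<integral>y. (\<lambda>p. diffusivity J * laplacian ?\<phi> p) (y, s) * stefan_pos (ext0 u s y) \<partial>lborel \<partial>time_measure 0 t)"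
    using weak_stefan_solution_ext0[OF u \<phi> t] .
  show "diffusivity J * laplacian ?\<phi> (y, s) = loc_kernel J d (x - y)" if "0 \<le> s" "s \<le> t" for y s
    by (rule local_op_bump[OF J d that])
  show "(\<lambda>s. \<integral>y. diffusivity J * laplacian ?\<phi> (y, s) * stefan_pos (ext0 u s y) \<partial>lborel) \<in> borel_measurable borel"
    by measurable
  show "(\<lambda>s. convolution (loc_kernel J d) (\<lambda>y. stefan_pos (ext0 u s y)) x) \<in> borel_measurable borel"
    unfolding convolution_def by measurable
qed

subsection \<open>The mollification error\<close>

text \<open>An average of translation errors that dominates the mollification error. Unlike the
  latter it is monotone under comparison of translates, so it passes from \<open>f\<close> to
  \<open>u\<close> by contraction and from \<open>u\<close> to \<open>stefan_pos u\<close> by the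
  Lipschitz property.\<close>

definition trans_err :: "real \<Rightarrow> ('a::euclidean_space \<Rightarrow> real) \<Rightarrow> ennreal" where
  "trans_err d g = (\<integral>\<^sup>+z. ennreal (mollifier z) * (\<integral>\<^sup>+x. ennreal \<bar>g (x - d *\<^sub>R z) - g x\<bar> \<partial>lborel) \<partial>lborel)"

lemma mollifier_measurable [measurable]: "mollifier \<in> borel_measurable borel"
  by (rule radial_kernelD(7)[OF radial_kernel_mollifier])

lemma nn_integral_mollifier: "(\<integral>\<^sup>+z. ennreal (mollifier z) \<partial>(lborel :: 'a::euclidean_space measure)) = 1"
  using nn_integral_eq_integral[OF radial_kernelD(8)[OF radial_kernel_mollifier[where 'a='a]]] mollifier_nonneg
    radial_kernelD(5)[OF radial_kernel_mollifier[where 'a='a]] by auto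

lemma mollification_error_le:
  fixes g :: "'a::euclidean_space \<Rightarrow> real"
  assumes g: "integrable lborel g" and d: "0 < d"
  shows "(\<integral>\<^sup>+x. ennreal \<bar>convolution (moll d) g x - g x\<bar> \<partial>lborel) \<le> trans_err d g"
proof -
  have [measurable]: "g \<in> borel_measurable borel" using g by simp
  have m: "ennreal \<bar>convolution (moll d) g x - g x\<bar> \<le> (\<integral>\<^sup>+z. ennreal (mollifier z * \<bar>g (x - d *\<^sub>R z) - g x\<bar>) \<partial>lborel)" for x
  proof -
    have i: "integrable lborel (\<lambda>z. mollifier z * g (x - d *\<^sub>R z))"
    proof -
      obtain B where B: "\<And>x. \<bar>mollifier (x::'a)\<bar> \<le> B" by (rule radial_kernel_bounded[OF radial_kernel_mollifier]) blast
      show ?thesis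
        using integrable_mult_AE_bounded(2)[OF integrable_lborel_affine[OF g, of "- d" x], of mollifier B] d B by simp
    qed
    have "convolution (moll d) g x - g x = (\<integral>z. mollifier z * g (x - d *\<^sub>R z) \<partial>lborel) - (\<integral>z. mollifier (z::'a) * g x \<partial>lborel)"
      using radial_kernelD(5)[OF radial_kernel_mollifier[where 'a='a]]
      by (simp add: moll_def convolution_rescale d)
    also have "\<dots> = (\<integral>z. mollifier z * (g (x - d *\<^sub>R z) - g x) \<partial>lborel)"
      using i radial_kernelD(8)[OF radial_kernel_mollifier[where 'a='a]] by (simp add: right_diff_distrib)
    finally show ?thesis
      using abs_integral_le_nn_integral[of lborel "\<lambda>z. mollifier z * (g (x - d *\<^sub>R z) - g x)"]
      by (simp add: abs_mult mollifier_nonneg)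
  qed
  have "(\<integral>\<^sup>+x. ennreal \<bar>convolution (moll d) g x - g x\<bar> \<partial>lborel)
      \<le> (\<integral>\<^sup>+x. \<integral>\<^sup>+z. ennreal (mollifier z * \<bar>g (x - d *\<^sub>R z) - g x\<bar>) \<partial>lborel \<partial>lborel)"
    by (intro nn_integral_mono m)
  also have "\<dots> = (\<integral>\<^sup>+z. \<integral>\<^sup>+x. ennreal (mollifier z * \<bar>g (x - d *\<^sub>R z) - g x\<bar>) \<partial>lborel \<partial>lborel)"
    by (rule lborel_pair.Fubini'[symmetric]) measurable
  also have "\<dots> = trans_err d g"
    unfolding trans_err_def by (simp add: ennreal_mult mollifier_nonneg nn_integral_cmult)
  finally show ?thesis .
qed

lemma trans_err_mono:
  fixes f g :: "'a::euclidean_space \<Rightarrow> real"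
  assumes "\<And>c. (\<integral>\<^sup>+x. ennreal \<bar>g (x + c) - g x\<bar> \<partial>lborel) \<le> (\<integral>\<^sup>+x. ennreal \<bar>f (x + c) - f x\<bar> \<partial>lborel)"
  shows "trans_err d g \<le> trans_err d f"
  unfolding trans_err_def
proof (rule nn_integral_mono, rule mult_left_mono)
  fix z :: 'a
  show "(\<integral>\<^sup>+x. ennreal \<bar>g (x - d *\<^sub>R z) - g x\<bar> \<partial>lborel) \<le> (\<integral>\<^sup>+x. ennreal \<bar>f (x - d *\<^sub>R z) - f x\<bar> \<partial>lborel)"
    using assms[of "- (d *\<^sub>R z)"] by simp
qed simp

lemma trans_err_stefan_pos: "trans_err d (\<lambda>x. stefan_pos (g x)) \<le> trans_err d g"
  by (intro trans_err_mono nn_integral_mono ennreal_leI stefan_pos_diff_le)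

lemma translation_le_twice:
  fixes g :: "'a::euclidean_space \<Rightarrow> real"
  assumes [measurable]: "g \<in> borel_measurable borel"
  shows "(\<integral>\<^sup>+x. ennreal \<bar>g (x - c) - g x\<bar> \<partial>lborel) \<le> 2 * (\<integral>\<^sup>+x. ennreal \<bar>g x\<bar> \<partial>lborel)"
proof -
  have "(\<integral>\<^sup>+x. ennreal \<bar>g (x - c) - g x\<bar> \<partial>lborel) \<le> (\<integral>\<^sup>+x. ennreal \<bar>g (x - c)\<bar> + ennreal \<bar>g x\<bar> \<partial>lborel)"
    by (intro nn_integral_mono) (simp flip: ennreal_plus)
  also have "\<dots> = 2 * (\<integral>\<^sup>+x. ennreal \<bar>g x\<bar> \<partial>lborel)"
    using nn_integral_lborel_shift(2)[of "\<lambda>x. ennreal \<bar>g x\<bar>" c] by (simp add: nn_integral_add mult_2)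
  finally show ?thesis .
qed

lemma trans_err_le:
  fixes g :: "'a::euclidean_space \<Rightarrow> real"
  assumes [measurable]: "g \<in> borel_measurable borel"
  shows "trans_err d g \<le> 2 * (\<integral>\<^sup>+x. ennreal \<bar>g x\<bar> \<partial>lborel)"
proof -
  have "trans_err d g \<le> (\<integral>\<^sup>+z. ennreal (mollifier (z::'a)) * (2 * (\<integral>\<^sup>+x. ennreal \<bar>g x\<bar> \<partial>lborel)) \<partial>lborel)"
    unfolding trans_err_def by (intro nn_integral_mono mult_left_mono translation_le_twice) auto
  also have "\<dots> = 2 * (\<integral>\<^sup>+x. ennreal \<bar>g x\<bar> \<partial>lborel)"
    by (simp add: nn_integral_multc nn_integral_mollifier)
  finally show ?thesis .
qed

lemma trans_err_measurable:
  fixes u :: "'b \<Rightarrow> 'a::euclidean_space \<Rightarrow> real"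
  assumes [measurable]: "case_prod u \<in> borel_measurable (M \<Otimes>\<^sub>M borel)"
  shows "(\<lambda>t. trans_err d (u t)) \<in> borel_measurable M"
  unfolding trans_err_def by measurable

lemma trans_err_tendsto:
  fixes g :: "'a::euclidean_space \<Rightarrow> real"
  assumes g: "integrable lborel g" and X: "X \<longlonglongrightarrow> 0"
  shows "(\<lambda>n. trans_err (X n) g) \<longlonglongrightarrow> 0"
proof -
  have [measurable]: "g \<in> borel_measurable borel" using g by simp
  let ?N = "\<integral>\<^sup>+x. ennreal \<bar>g x\<bar> \<partial>lborel"
  have N: "?N < \<infinity>" using g by (simp add: integrable_real_iff)
  have "(\<lambda>n. \<integral>\<^sup>+z. ennreal (mollifier z) * (\<integral>\<^sup>+x. ennreal \<bar>g (x - X n *\<^sub>R z) - g x\<bar> \<partial>lborel) \<partial>lborel)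
      \<longlonglongrightarrow> (\<integral>\<^sup>+z. 0 \<partial>(lborel :: 'a measure))"
  proof (rule nn_integral_dominated_convergence[where w="\<lambda>z. ennreal (mollifier z) * (2 * ?N)"])
    show "AE z in lborel. ennreal (mollifier z) * (\<integral>\<^sup>+x. ennreal \<bar>g (x - X n *\<^sub>R z) - g x\<bar> \<partial>lborel) \<le> ennreal (mollifier z) * (2 * ?N)" for n
      by (intro AE_I2 mult_left_mono translation_le_twice) auto
    show "(\<integral>\<^sup>+z. ennreal (mollifier (z::'a)) * (2 * ?N) \<partial>lborel) < \<infinity>"
      using N by (simp add: nn_integral_multc nn_integral_mollifier ennreal_mult_less_top)
    show "AE z in lborel. (\<lambda>n. ennreal (mollifier z) * (\<integral>\<^sup>+x. ennreal \<bar>g (x - X n *\<^sub>R z) - g x\<bar> \<partial>lborel)) \<longlonglongrightarrow> 0"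
    proof (rule AE_I2)
      fix z :: 'a
      have "(\<lambda>n. - (X n *\<^sub>R z)) \<longlonglongrightarrow> - (0 *\<^sub>R z)" by (intro tendsto_intros X)
      then have "(\<lambda>n. \<integral>\<^sup>+x. ennreal \<bar>g (x + - (X n *\<^sub>R z)) - g x\<bar> \<partial>lborel) \<longlonglongrightarrow> 0"
        by (intro tendsto_translation_L1[OF g]) simp
      then have "(\<lambda>n. ennreal (mollifier z) * (\<integral>\<^sup>+x. ennreal \<bar>g (x + - (X n *\<^sub>R z)) - g x\<bar> \<partial>lborel)) \<longlonglongrightarrow> ennreal (mollifier z) * 0"
        by (intro ennreal_tendsto_cmult) auto
      then show "(\<lambda>n. ennreal (mollifier z) * (\<integral>\<^sup>+x. ennreal \<bar>g (x - X n *\<^sub>R z) - g x\<bar> \<partial>lborel)) \<longlonglongrightarrow> 0" by simp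
    qed
  qed measurable
  then show ?thesis by (simp add: trans_err_def)
qed

text \<open>For solutions whose translates are not compared with those of the initial datum:
  convergence at each time comes from continuity of translations, and the \<open>L^1\<close> bound
  supplies the constant that dominates in time.\<close>

lemma trans_err_integral_tendsto:
  fixes u :: "real \<Rightarrow> 'a::euclidean_space \<Rightarrow> real"
  assumes um [measurable]: "case_prod u \<in> borel_measurable (borel \<Otimes>\<^sub>M borel)" and T: "0 \<le> T" and C: "0 \<le> C"
    and i: "\<And>t. 0 \<le> t \<Longrightarrow> t \<le> T \<Longrightarrow> integrable lborel (u t)"
    and uC: "\<And>t. 0 \<le> t \<Longrightarrow> t \<le> T \<Longrightarrow> (\<integral>x. \<bar>u t x\<bar> \<partial>lborel) \<le> C" and X: "X \<longlonglongrightarrow> 0"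
  shows "(\<lambda>n. \<integral>\<^sup>+t. trans_err (X n) (u t) \<partial>time_measure 0 T) \<longlonglongrightarrow> 0"
proof -
  have [measurable]: "(\<lambda>t. trans_err d (u t)) \<in> borel_measurable borel" for d by (rule trans_err_measurable[OF um])
  have "(\<lambda>n. \<integral>\<^sup>+t. trans_err (X n) (u t) \<partial>time_measure 0 T) \<longlonglongrightarrow> (\<integral>\<^sup>+t. 0 \<partial>time_measure 0 T)"
  proof (rule nn_integral_dominated_convergence[where w="\<lambda>t. 2 * ennreal C"])
    show "(\<integral>\<^sup>+t. 2 * ennreal C \<partial>time_measure 0 T) < \<infinity>"
      using T by (simp add: emeasure_time_measure ennreal_mult_less_top)
    show "AE t in time_measure 0 T. trans_err (X n) (u t) \<le> 2 * ennreal C" for n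
    proof (rule AE_time_measureI)
      fix t assume t: "0 \<le> t" "t \<le> T"
      have "trans_err (X n) (u t) \<le> 2 * (\<integral>\<^sup>+x. ennreal \<bar>u t x\<bar> \<partial>lborel)" by (rule trans_err_le) measurable
      also have "\<dots> \<le> 2 * ennreal C"
        using uC[OF t] by (intro mult_left_mono) (auto simp: nn_integral_abs_eq[OF i[OF t]] ennreal_leI)
      finally show "trans_err (X n) (u t) \<le> 2 * ennreal C" .
    qed
    show "AE t in time_measure 0 T. (\<lambda>n. trans_err (X n) (u t)) \<longlonglongrightarrow> 0"
      by (intro AE_time_measureI trans_err_tendsto i X)
  qed (simp_all cong: measurable_cong_sets)
  then show ?thesis by simp
qed

subsection \<open>The energy inequality\<close>

lemma AE_time_space_bounded:
  fixes g :: "real \<Rightarrow> 'a::euclidean_space \<Rightarrow> real"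
  assumes [measurable]: "case_prod g \<in> borel_measurable (borel \<Otimes>\<^sub>M borel)"
    and "\<And>t. a \<le> t \<Longrightarrow> t \<le> b \<Longrightarrow> AE x in lborel. \<bar>g t x\<bar> \<le> B"
  shows "AE z in time_measure a b \<Otimes>\<^sub>M lborel. \<bar>case_prod g z\<bar> \<le> B"
proof (rule tmp.AE_pair_measure)
  show "{z \<in> space (time_measure a b \<Otimes>\<^sub>M lborel). \<bar>case_prod g z\<bar> \<le> B} \<in> sets (time_measure a b \<Otimes>\<^sub>M lborel)"
    by measurable
  show "AE t in time_measure a b. AE x in lborel. \<bar>case_prod g (t, x)\<bar> \<le> B"
    by (rule AE_time_measureI) (simp add: assms)
qed

lemma AE_time_spaceI:
  fixes F G :: "real \<Rightarrow> 'a::euclidean_space \<Rightarrow> real"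
  assumes [measurable]: "case_prod F \<in> borel_measurable (borel \<Otimes>\<^sub>M borel)" "case_prod G \<in> borel_measurable (borel \<Otimes>\<^sub>M borel)"
    and "\<And>t x. a \<le> t \<Longrightarrow> t \<le> b \<Longrightarrow> F t x = G t x"
  shows "AE z in time_measure a b \<Otimes>\<^sub>M lborel. case_prod F z = case_prod G z"
proof (rule tmp.AE_pair_measure)
  show "{z \<in> space (time_measure a b \<Otimes>\<^sub>M lborel). case_prod F z = case_prod G z} \<in> sets (time_measure a b \<Otimes>\<^sub>M lborel)"
    by measurable
  show "AE t in time_measure a b. AE x in lborel. case_prod F (t, x) = case_prod G (t, x)"
    by (rule AE_time_measureI) (simp add: assms)
qed

text \<open>Here the measure itself depends on \<open>t\<close>; rewriting the interval as a
  condition in the integrand makes joint measurability accessible.\<close>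

lemma running_integral_measurable:
  fixes b :: "real \<Rightarrow> 'a::euclidean_space \<Rightarrow> real"
  assumes [measurable]: "case_prod b \<in> borel_measurable (borel \<Otimes>\<^sub>M borel)"
  shows "(\<lambda>(t, x). \<integral>s. b s x \<partial>time_measure 0 t) \<in> borel_measurable (borel \<Otimes>\<^sub>M borel)"
proof -
  have "(\<lambda>(t, x). \<integral>s. b s x \<partial>time_measure 0 t) = (\<lambda>z. \<integral>s. (if 0 \<le> s \<and> s \<le> fst z then b s (snd z) else 0) \<partial>lborel)"
    by (auto simp: integral_time_measure indicator_def intro!: ext Bochner_Integration.integral_cong)
  moreover have "(\<lambda>z. \<integral>s. (if 0 \<le> s \<and> s \<le> fst z then b s (snd z) else 0) \<partial>lborel) \<in> borel_measurable (borel \<Otimes>\<^sub>M borel)"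
    by measurable
  ultimately show ?thesis by simp
qed

context prob_kernel
begin

text \<open>From \<open>h x * h y \<le> ((h x)\<^sup>2 + (h y)\<^sup>2) / 2\<close>, averaged with
  \<open>k\<close>: since \<open>k\<close> has mass one, both squares integrate to the same value,
  which the diagonal term of the operator cancels.\<close>

lemma diffuse_negative:
  assumes h: "integrable lborel h" and b: "\<And>x. \<bar>h x\<bar> \<le> A"
  shows "(\<integral>x. h x * diffuse k l h x \<partial>lborel) \<le> 0"
proof -
  have [measurable]: "h \<in> borel_measurable borel" using h by simp
  have h2: "integrable lborel (\<lambda>x. h x * h x)" by (rule integrable_mult_AE_bounded(1)[OF h, of _ A]) (use b in auto)
  have hc: "integrable lborel (\<lambda>x. h x * convolution k h x)"
    by (rule integrable_mult_AE_bounded(2)[OF conv_integrable[OF h], of _ A]) (use b in auto)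
  have point: "h x * convolution k h x \<le> (h x * h x + convolution k (\<lambda>x. h x * h x) x) / 2" for x
  proof -
    have ik: "integrable lborel (\<lambda>y. k (x - y))" by (intro integrable_lborel_shift k_integrable)
    have "h x * convolution k h x = (\<integral>y. h x * (k (x - y) * h y) \<partial>lborel)" unfolding convolution_def by simp
    also have "\<dots> \<le> (\<integral>y. (k (x - y) * (h x * h x) + k (x - y) * (h y * h y)) / 2 \<partial>lborel)"
    proof (rule integral_mono)
      show "h x * (k (x - y) * h y) \<le> (k (x - y) * (h x * h x) + k (x - y) * (h y * h y)) / 2" for y
      proof -
        have "h x * h y \<le> (h x * h x + h y * h y) / 2"
          using sum_squares_bound[of "h x" "h y"] by (simp add: power2_eq_square)
        from mult_left_mono[OF this k_nonneg[of "x - y"]] show ?thesis by (simp add: algebra_simps)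
      qed
    qed (use ik k_section[OF h] k_section[OF h2] in auto)
    also have "\<dots> = (h x * h x + convolution k (\<lambda>x. h x * h x) x) / 2"
      using ik k_section[OF h2, of x] integral_lborel_shift(3)[of k x] k_integral by (simp add: convolution_def)
    finally show ?thesis .
  qed
  have "(\<integral>x. h x * diffuse k l h x \<partial>lborel) = (\<integral>x. l * (h x * convolution k h x - h x * h x) \<partial>lborel)"
    by (simp add: diffuse_def right_diff_distrib mult.left_commute)
  also have "\<dots> = l * ((\<integral>x. h x * convolution k h x \<partial>lborel) - (\<integral>x. h x * h x \<partial>lborel))"
    using h2 hc by simp
  also have "(\<integral>x. h x * convolution k h x \<partial>lborel) \<le> (\<integral>x. (h x * h x + convolution k (\<lambda>x. h x * h x) x) / 2 \<partial>lborel)"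
    using h2 hc conv_integrable[OF h2] by (intro integral_mono point) auto
  also have "\<dots> = (\<integral>x. h x * h x \<partial>lborel)"
    using h2 conv_integrable[OF h2] conv_integral[OF h2] by simp
  finally show ?thesis using l_pos by (simp add: mult_left_mono)
qed

lemma diffuse_symmetric:
  assumes h: "integrable lborel h" "\<And>x. \<bar>h x\<bar> \<le> A" and g: "integrable lborel g" "\<And>x. \<bar>g x\<bar> \<le> A"
  shows "(\<integral>x. h x * diffuse k l g x \<partial>lborel) = (\<integral>x. g x * diffuse k l h x \<partial>lborel)"
proof -
  have [measurable]: "h \<in> borel_measurable borel" "g \<in> borel_measurable borel" using h g by auto
  have 1: "integrable lborel (\<lambda>x. h x * convolution k g x)"
    by (rule integrable_mult_AE_bounded(2)[OF conv_integrable[OF g(1)], of _ A]) (use h in auto)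
  have 2: "integrable lborel (\<lambda>x. g x * convolution k h x)"
    by (rule integrable_mult_AE_bounded(2)[OF conv_integrable[OF h(1)], of _ A]) (use g in auto)
  have 3: "integrable lborel (\<lambda>x. g x * h x)"
    by (rule integrable_mult_AE_bounded(2)[OF h(1), of _ A]) (use g in auto)
  have 4: "integrable lborel (\<lambda>x. h x * g x)" using 3 by (simp add: mult.commute)
  have "(\<integral>x. h x * diffuse k l g x \<partial>lborel) = (\<integral>x. l * (h x * convolution k g x - h x * g x) \<partial>lborel)"
    by (simp add: diffuse_def right_diff_distrib mult.left_commute)
  also have "\<dots> = l * ((\<integral>x. convolution k g x * h x \<partial>lborel) - (\<integral>x. h x * g x \<partial>lborel))"
    using 1 4 by (simp add: mult.commute)
  also have "(\<integral>x. convolution k g x * h x \<partial>lborel) = (\<integral>x. g x * convolution k h x \<partial>lborel)"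
    by (rule convolution_adjoint[OF k_integrable k_even g(1), of _ A]) (use h in auto)
  also have "l * ((\<integral>x. g x * convolution k h x \<partial>lborel) - (\<integral>x. h x * g x \<partial>lborel)) = (\<integral>x. l * (g x * convolution k h x - g x * h x) \<partial>lborel)"
    using 2 3 by (simp add: mult.commute)
  also have "\<dots> = (\<integral>x. g x * diffuse k l h x \<partial>lborel)"
    by (simp add: diffuse_def right_diff_distrib mult.left_commute)
  finally show ?thesis .
qed

lemma diffuse_time_integral:
  assumes am [measurable]: "case_prod a \<in> borel_measurable (borel \<Otimes>\<^sub>M borel)" and T: "0 \<le> T" and C: "0 \<le> C"
    and ai: "\<And>t. 0 \<le> t \<Longrightarrow> t \<le> T \<Longrightarrow> integrable lborel (a t)"
    and aC: "\<And>t. 0 \<le> t \<Longrightarrow> t \<le> T \<Longrightarrow> (\<integral>x. \<bar>a t x\<bar> \<partial>lborel) \<le> C"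
    and aA: "\<And>t x. 0 \<le> t \<Longrightarrow> t \<le> T \<Longrightarrow> \<bar>a t x\<bar> \<le> A"
  shows "(\<integral>s. diffuse k l (a s) x \<partial>time_measure 0 T) = diffuse k l (\<lambda>x. \<integral>s. a s x \<partial>time_measure 0 T) x"
proof -
  have ip: "integrable (time_measure 0 T \<Otimes>\<^sub>M lborel) (case_prod a)"
    by (rule integrable_time_space(1)[OF am T C]) (use ai aC in auto)
  have ik: "integrable (time_measure 0 T \<Otimes>\<^sub>M lborel) (\<lambda>(s, y). k (x - y) * a s y)"
    using integrable_mult_AE_bounded(2)[OF ip, of "\<lambda>(s, y). k (x - y)" B] k_nonneg k_bounded by (simp add: split_beta')
  have ic: "integrable (time_measure 0 T) (\<lambda>s. convolution k (a s) x)"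
    using tmp.integrable_fst'[OF ik] by (simp add: convolution_def)
  have ia: "integrable (time_measure 0 T) (\<lambda>s. a s x)"
    by (rule tm.integrable_const_bound[of _ A]) (use aA in \<open>auto intro!: AE_time_measureI\<close>)
  have "(\<integral>s. diffuse k l (a s) x \<partial>time_measure 0 T) = l * ((\<integral>s. convolution k (a s) x \<partial>time_measure 0 T) - (\<integral>s. a s x \<partial>time_measure 0 T))"
    unfolding diffuse_def using ic ia by simp
  also have "(\<integral>s. convolution k (a s) x \<partial>time_measure 0 T) = (\<integral>y. \<integral>s. k (x - y) * a s y \<partial>time_measure 0 T \<partial>lborel)"
    unfolding convolution_def by (rule tmp.Fubini_integral[OF ik, symmetric])
  also have "\<dots> = convolution k (\<lambda>x. \<integral>s. a s x \<partial>time_measure 0 T) x"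
    unfolding convolution_def by simp
  finally show ?thesis by (simp add: diffuse_def)
qed

text \<open>Oleinik's device: the integrand is symmetric in the two times, so the double time integral over
  \<open>s \<le> t\<close> is half of the one over the square, which is a nonpositive quadratic form.\<close>

lemma energy_negative:
  assumes am [measurable]: "case_prod a \<in> borel_measurable (borel \<Otimes>\<^sub>M borel)" and T: "0 \<le> T" and C: "0 \<le> C"
    and ai: "\<And>t. 0 \<le> t \<Longrightarrow> t \<le> T \<Longrightarrow> integrable lborel (a t)"
    and aC: "\<And>t. 0 \<le> t \<Longrightarrow> t \<le> T \<Longrightarrow> (\<integral>x. \<bar>a t x\<bar> \<partial>lborel) \<le> C"
    and aA: "\<And>t x. 0 \<le> t \<Longrightarrow> t \<le> T \<Longrightarrow> \<bar>a t x\<bar> \<le> A"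
  shows "(\<integral>t. \<integral>x. a t x * (\<integral>s. diffuse k l (a s) x \<partial>time_measure 0 t) \<partial>lborel \<partial>time_measure 0 T) \<le> 0"
proof -
  define b where "b s = diffuse k l (a s)" for s
  have bm [measurable]: "case_prod b \<in> borel_measurable (borel \<Otimes>\<^sub>M borel)"
    unfolding b_def split_beta' by measurable
  have A0: "0 \<le> A" using aA[OF order_refl T, of 0] by linarith
  have bi: "integrable lborel (b t)" if "0 \<le> t" "t \<le> T" for t unfolding b_def by (intro diffuse_integrable ai that)
  have bC: "(\<integral>x. \<bar>b t x\<bar> \<partial>lborel) \<le> 2 * l * C" if t: "0 \<le> t" "t \<le> T" for t
  proof -
    have "(\<integral>x. \<bar>b t x\<bar> \<partial>lborel) \<le> 2 * l * (\<integral>x. \<bar>a t x\<bar> \<partial>lborel)" unfolding b_def by (intro diffuse_L1_le ai t)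
    also have "\<dots> \<le> 2 * l * C" using aC[OF t] l_pos by (intro mult_left_mono) auto
    finally show ?thesis .
  qed
  have b0: "0 \<le> 2 * l * C" using C l_pos by simp
  have bp: "integrable (time_measure 0 T \<Otimes>\<^sub>M lborel) (case_prod b)"
    by (rule integrable_time_space(1)[OF bm T b0]) (use bi bC in auto)
  define F where "F t s = (\<integral>x. a t x * b s x \<partial>lborel)" for t s
  have Fm [measurable]: "case_prod F \<in> borel_measurable (borel \<Otimes>\<^sub>M borel)"
    unfolding F_def by measurable
  have Fsym: "F t s = F s t" if "0 \<le> t" "t \<le> T" "0 \<le> s" "s \<le> T" for s t
    unfolding F_def b_def by (rule diffuse_symmetric[where A=A]) (use that ai aA in auto)
  have Fb: "\<bar>F t s\<bar> \<le> A * (2 * l * C)" if t: "0 \<le> t" "t \<le> T" and s: "0 \<le> s" "s \<le> T" for s t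
  proof -
    have "\<bar>F t s\<bar> \<le> (\<integral>x. \<bar>a t x * b s x\<bar> \<partial>lborel)"
      unfolding F_def using integral_norm_bound[of lborel "\<lambda>x. a t x * b s x"] by simp
    also have "\<dots> \<le> (\<integral>x. A * \<bar>b s x\<bar> \<partial>lborel)"
    proof (rule integral_mono)
      show "integrable lborel (\<lambda>x. \<bar>a t x * b s x\<bar>)"
        by (intro integrable_abs integrable_mult_AE_bounded(2)[OF bi[OF s], of _ A]) (use aA t in auto)
    qed (use bi[OF s] aA[OF t] in \<open>auto simp: abs_mult intro!: mult_right_mono\<close>)
    also have "\<dots> \<le> A * (2 * l * C)" using bC[OF s] A0 by (simp add: mult_left_mono)
    finally show ?thesis .
  qed
  have AB0: "0 \<le> A * (2 * l * C)" using A0 b0 by (rule mult_nonneg_nonneg)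
  define I where "I = (\<lambda>t s. (if s \<le> t then F t s else 0))"
  define I' where "I' = (\<lambda>t s. (if t \<le> s then F t s else 0))"
  have [measurable]: "case_prod I \<in> borel_measurable (borel \<Otimes>\<^sub>M borel)" "case_prod I' \<in> borel_measurable (borel \<Otimes>\<^sub>M borel)"
    unfolding I_def I'_def by measurable
  interpret fp: finite_measure "time_measure 0 T \<Otimes>\<^sub>M time_measure 0 T"
    by (rule finite_measure_pair_measure[OF finite_time_measure finite_time_measure])
  have ae: "AE z in time_measure 0 T \<Otimes>\<^sub>M time_measure 0 T. 0 \<le> fst z \<and> fst z \<le> T \<and> 0 \<le> snd z \<and> snd z \<le> T"
    by (rule tmt.AE_pair_measure) (measurable, auto intro!: AE_time_measureI)
  have Ii: "integrable (time_measure 0 T \<Otimes>\<^sub>M time_measure 0 T) (case_prod I)"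
  proof (rule fp.integrable_const_bound)
    show "AE z in time_measure 0 T \<Otimes>\<^sub>M time_measure 0 T. norm (case_prod I z) \<le> A * (2 * l * C)"
      using ae by eventually_elim (use AB0 Fb in \<open>auto simp: I_def split_beta'\<close>)
  qed measurable
  have Ii': "integrable (time_measure 0 T \<Otimes>\<^sub>M time_measure 0 T) (case_prod I')"
  proof (rule fp.integrable_const_bound)
    show "AE z in time_measure 0 T \<Otimes>\<^sub>M time_measure 0 T. norm (case_prod I' z) \<le> A * (2 * l * C)"
      using ae by eventually_elim (use AB0 Fb in \<open>auto simp: I'_def split_beta'\<close>)
  qed measurable
  have first: "(\<integral>x. a t x * (\<integral>s. b s x \<partial>time_measure 0 t) \<partial>lborel) = (\<integral>s. I t s \<partial>time_measure 0 T)" if t: "0 \<le> t" "t \<le> T" for t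
  proof -
    have ib: "integrable (time_measure 0 T \<Otimes>\<^sub>M lborel) (\<lambda>(s, x). a t x * (if s \<le> t then b s x else 0))"
    proof -
      have "integrable (time_measure 0 T \<Otimes>\<^sub>M lborel) (\<lambda>z. (if fst z \<le> t then a t (snd z) else 0) * case_prod b z)"
        by (rule integrable_mult_AE_bounded(2)[OF bp, of _ A]) (use aA[OF t] A0 in auto)
      moreover have "(\<lambda>z. (if fst z \<le> t then a t (snd z) else 0) * case_prod b z) = (\<lambda>(s, x). a t x * (if s \<le> t then b s x else 0))"
        by auto
      ultimately show ?thesis by simp
    qed
    have "(\<integral>x. a t x * (\<integral>s. b s x \<partial>time_measure 0 t) \<partial>lborel) = (\<integral>x. \<integral>s. a t x * (if s \<le> t then b s x else 0) \<partial>time_measure 0 T \<partial>lborel)"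
    proof (intro Bochner_Integration.integral_cong refl)
      fix x
      have "(\<integral>s. b s x \<partial>time_measure 0 t) = (\<integral>s. indicator {..t} s * b s x \<partial>time_measure 0 T)"
        by (rule integral_time_measure_restrict(1)) (use t in auto)
      also have "\<dots> = (\<integral>s. (if s \<le> t then b s x else 0) \<partial>time_measure 0 T)"
        by (intro Bochner_Integration.integral_cong) (auto simp: indicator_def)
      finally show "a t x * (\<integral>s. b s x \<partial>time_measure 0 t) = (\<integral>s. a t x * (if s \<le> t then b s x else 0) \<partial>time_measure 0 T)"
        by simp
    qed
    also have "\<dots> = (\<integral>s. \<integral>x. a t x * (if s \<le> t then b s x else 0) \<partial>lborel \<partial>time_measure 0 T)"
      by (rule tmp.Fubini_integral[OF ib])
    also have "\<dots> = (\<integral>s. I t s \<partial>time_measure 0 T)"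
      by (intro Bochner_Integration.integral_cong) (auto simp: I_def F_def)
    finally show ?thesis .
  qed
  define V where "V = (\<integral>t. \<integral>s. I t s \<partial>time_measure 0 T \<partial>time_measure 0 T)"
  have V1: "(\<integral>t. \<integral>x. a t x * (\<integral>s. b s x \<partial>time_measure 0 t) \<partial>lborel \<partial>time_measure 0 T) = V"
    unfolding V_def
  proof (rule integral_cong_AE)
    note [measurable] = running_integral_measurable[OF bm]
    show "(\<lambda>t. \<integral>x. a t x * (\<integral>s. b s x \<partial>time_measure 0 t) \<partial>lborel) \<in> borel_measurable (time_measure 0 T)"
      by measurable
    show "AE t in time_measure 0 T. (\<integral>x. a t x * (\<integral>s. b s x \<partial>time_measure 0 t) \<partial>lborel) = (\<integral>s. I t s \<partial>time_measure 0 T)"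
      by (rule AE_time_measureI) (rule first)
  qed measurable
  \<comment> \<open>Exchanging the order of integration swaps the two triangles, and the symmetry of
    \<open>F\<close> identifies the integrands.\<close>
  have V2: "V = (\<integral>t. \<integral>s. I' t s \<partial>time_measure 0 T \<partial>time_measure 0 T)"
  proof -
    have "V = (\<integral>s. \<integral>t. I t s \<partial>time_measure 0 T \<partial>time_measure 0 T)"
      unfolding V_def by (rule tmt.Fubini_integral[OF Ii, symmetric])
    also have "\<dots> = (\<integral>t. \<integral>s. I' t s \<partial>time_measure 0 T \<partial>time_measure 0 T)"
    proof (rule integral_cong_AE)
      show "AE s in time_measure 0 T. (\<integral>t. I t s \<partial>time_measure 0 T) = (\<integral>t. I' s t \<partial>time_measure 0 T)"
      proof (rule AE_time_measureI)
        fix s assume s: "0 \<le> s" "s \<le> T"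
        show "(\<integral>t. I t s \<partial>time_measure 0 T) = (\<integral>t. I' s t \<partial>time_measure 0 T)"
        proof (rule integral_cong_AE)
          show "AE t in time_measure 0 T. I t s = I' s t"
            by (rule AE_time_measureI) (use s Fsym in \<open>auto simp: I_def I'_def\<close>)
        qed measurable
      qed
    qed measurable
    finally show ?thesis .
  qed
  define Ab where "Ab x = (\<integral>t. a t x \<partial>time_measure 0 T)" for x
  have Ab_i: "integrable lborel Ab"
    unfolding Ab_def[abs_def] by (rule time_integral_L1_le(1)[OF am T C]) (use ai aC in auto)
  have Ab_b: "\<bar>Ab x\<bar> \<le> T * A" for x
  proof -
    have "\<bar>Ab x\<bar> \<le> (\<integral>t. \<bar>a t x\<bar> \<partial>time_measure 0 T)"
      unfolding Ab_def using integral_norm_bound[of "time_measure 0 T" "\<lambda>t. a t x"] by simp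
    also have "\<dots> \<le> (T - 0) * A" by (rule integral_time_measure_le) (use T aA A0 in auto)
    finally show ?thesis by simp
  qed
  have Bb: "(\<integral>s. b s x \<partial>time_measure 0 T) = diffuse k l Ab x" for x
    unfolding b_def Ab_def[abs_def] by (rule diffuse_time_integral[OF am T C ai aC aA])
  have "V + V = (\<integral>t. (\<integral>s. I t s \<partial>time_measure 0 T) + (\<integral>s. I' t s \<partial>time_measure 0 T) \<partial>time_measure 0 T)"
    using tmt.integrable_fst'[OF Ii] tmt.integrable_fst'[OF Ii'] V2 unfolding V_def by simp
  also have "\<dots> = (\<integral>t. \<integral>x. a t x * diffuse k l Ab x \<partial>lborel \<partial>time_measure 0 T)"
  proof (rule integral_cong_AE)
    show "AE t in time_measure 0 T. (\<integral>s. I t s \<partial>time_measure 0 T) + (\<integral>s. I' t s \<partial>time_measure 0 T) = (\<integral>x. a t x * diffuse k l Ab x \<partial>lborel)"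
    proof (rule AE_time_measureI)
      fix t assume t: "0 \<le> t" "t \<le> T"
      have i: "integrable (time_measure 0 T) (I t)" "integrable (time_measure 0 T) (I' t)"
        by (rule tm.integrable_const_bound[of _ "A * (2 * l * C)"];
            use t Fb A0 b0 in \<open>auto intro!: AE_time_measureI simp: I_def I'_def\<close>)+
      have ib: "integrable (time_measure 0 T \<Otimes>\<^sub>M lborel) (\<lambda>(s, x). a t x * b s x)"
        using integrable_mult_AE_bounded(2)[OF bp, of "\<lambda>(s, x). a t x" A] aA[OF t] by (simp add: split_beta')
      have "(\<integral>s. I t s \<partial>time_measure 0 T) + (\<integral>s. I' t s \<partial>time_measure 0 T) = (\<integral>s. I t s + I' t s \<partial>time_measure 0 T)"
        using i by simp
      also have "\<dots> = (\<integral>s. F t s \<partial>time_measure 0 T)"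
      proof (rule integral_cong_AE)
        \<comment> \<open>The diagonal \<open>s = t\<close> belongs to both triangles, but is a null
          set for fixed \<open>t\<close>.\<close>
        show "AE s in time_measure 0 T. I t s + I' t s = F t s"
          unfolding AE_time_measure using AE_lborel_singleton[of t]
          by eventually_elim (auto simp: I_def I'_def)
      qed measurable
      also have "\<dots> = (\<integral>x. \<integral>s. a t x * b s x \<partial>time_measure 0 T \<partial>lborel)"
        unfolding F_def by (rule tmp.Fubini_integral[OF ib, symmetric])
      also have "\<dots> = (\<integral>x. a t x * diffuse k l Ab x \<partial>lborel)" by (simp add: Bb)
      finally show "(\<integral>s. I t s \<partial>time_measure 0 T) + (\<integral>s. I' t s \<partial>time_measure 0 T) = (\<integral>x. a t x * diffuse k l Ab x \<partial>lborel)" .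
    qed
    note [measurable] = borel_measurable_integrable[OF diffuse_integrable[OF Ab_i]]
    show "(\<lambda>t. \<integral>x. a t x * diffuse k l Ab x \<partial>lborel) \<in> borel_measurable (time_measure 0 T)" by measurable
  qed measurable
  also have "\<dots> = (\<integral>x. \<integral>t. a t x * diffuse k l Ab x \<partial>time_measure 0 T \<partial>lborel)"
  proof (rule tmp.Fubini_integral[symmetric])
    let ?D = "diffuse k l Ab"
    note Di = diffuse_integrable[OF Ab_i]
    have [measurable]: "?D \<in> borel_measurable borel" using Di by simp
    have "integrable (time_measure 0 T \<Otimes>\<^sub>M lborel) (case_prod (\<lambda>t. ?D))"
      by (rule integrable_time_space(1)[OF _ T, where C="\<integral>x. \<bar>?D x\<bar> \<partial>lborel"]) (use Di in auto)
    from integrable_mult_AE_bounded(2)[OF this _ AE_time_space_bounded[OF am, of 0 T A]] aA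
    show "integrable (time_measure 0 T \<Otimes>\<^sub>M lborel) (\<lambda>(t, x). a t x * ?D x)"
      by (simp add: split_beta')
  qed
  also have "\<dots> = (\<integral>x. Ab x * diffuse k l Ab x \<partial>lborel)" by (simp add: Ab_def)
  also have "\<dots> \<le> 0" by (rule diffuse_negative[OF Ab_i Ab_b])
  finally have "V \<le> 0" by simp
  then show ?thesis using V1 by (simp add: b_def)
qed

end

subsection \<open>Comparison of two solutions\<close>

lemma time_space_integral_bound:
  fixes h g :: "real \<Rightarrow> 'a::euclidean_space \<Rightarrow> real"
  assumes [measurable]: "case_prod h \<in> borel_measurable (borel \<Otimes>\<^sub>M borel)" "case_prod g \<in> borel_measurable (borel \<Otimes>\<^sub>M borel)"
    and g: "\<And>t. a \<le> t \<Longrightarrow> t \<le> b \<Longrightarrow> AE x in lborel. \<bar>g t x\<bar> \<le> B" and B: "0 \<le> B"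
    and h: "(\<integral>\<^sup>+t. \<integral>\<^sup>+x. ennreal \<bar>h t x\<bar> \<partial>lborel \<partial>time_measure a b) \<le> ennreal E" and E: "0 \<le> E"
  shows "integrable (time_measure a b \<Otimes>\<^sub>M lborel) (\<lambda>(t, x). h t x * g t x)"
    and "\<bar>\<integral>(t, x). h t x * g t x \<partial>(time_measure a b \<Otimes>\<^sub>M lborel)\<bar> \<le> B * E"
proof -
  have gb: "AE z in time_measure a b \<Otimes>\<^sub>M lborel. \<bar>case_prod g z\<bar> \<le> B"
    by (rule AE_time_space_bounded[OF assms(2) g])
  have "(\<integral>\<^sup>+z. ennreal \<bar>case z of (t, x) \<Rightarrow> h t x * g t x\<bar> \<partial>(time_measure a b \<Otimes>\<^sub>M lborel))
      \<le> (\<integral>\<^sup>+z. ennreal B * ennreal \<bar>case_prod h z\<bar> \<partial>(time_measure a b \<Otimes>\<^sub>M lborel))"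
  proof (rule nn_integral_mono_AE)
    show "AE z in time_measure a b \<Otimes>\<^sub>M lborel. ennreal \<bar>case z of (t, x) \<Rightarrow> h t x * g t x\<bar> \<le> ennreal B * ennreal \<bar>case_prod h z\<bar>"
      using gb
    proof eventually_elim
      case (elim z)
      have "\<bar>case z of (t, x) \<Rightarrow> h t x * g t x\<bar> = \<bar>case_prod g z\<bar> * \<bar>case_prod h z\<bar>" by (cases z) (simp add: abs_mult)
      also have "\<dots> \<le> B * \<bar>case_prod h z\<bar>" using elim by (rule mult_right_mono) simp
      finally show ?case using B by (simp add: ennreal_mult[symmetric] ennreal_leI)
    qed
  qed
  also have "\<dots> = ennreal B * (\<integral>\<^sup>+t. \<integral>\<^sup>+x. ennreal \<bar>h t x\<bar> \<partial>lborel \<partial>time_measure a b)"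
    by (subst nn_integral_cmult) (measurable, simp add: lborel.nn_integral_fst[symmetric])
  also have "\<dots> \<le> ennreal B * ennreal E" by (intro mult_left_mono h) simp
  finally have *: "(\<integral>\<^sup>+z. ennreal \<bar>case z of (t, x) \<Rightarrow> h t x * g t x\<bar> \<partial>(time_measure a b \<Otimes>\<^sub>M lborel)) \<le> ennreal (B * E)"
    using B E by (simp add: ennreal_mult)
  show "integrable (time_measure a b \<Otimes>\<^sub>M lborel) (\<lambda>(t, x). h t x * g t x)"
    unfolding integrable_real_iff using * by (auto intro: order.strict_trans1)
  show "\<bar>\<integral>(t, x). h t x * g t x \<partial>(time_measure a b \<Otimes>\<^sub>M lborel)\<bar> \<le> B * E"
    by (rule abs_integral_le_bound[OF *]) (use B E in simp)
qed

text \<open>The last inequality combines monotonicity with Lipschitz constant 1; it lets a bound on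
  the integral of \<open>(u - u') (v - v')\<close> control \<open>v - v'\<close> in
  \<open>L^2\<close>.\<close>

lemma stefan_pos_bounds: "\<bar>s\<bar> \<le> M \<Longrightarrow> stefan_pos s \<le> M" "\<bar>r\<bar> \<le> M \<Longrightarrow> \<bar>s\<bar> \<le> M \<Longrightarrow> \<bar>stefan_pos r - stefan_pos s\<bar> \<le> M"
  and stefan_pos_monotone: "(stefan_pos r - stefan_pos s)\<^sup>2 \<le> (r - s) * (stefan_pos r - stefan_pos s)"
proof -
  show "(stefan_pos r - stefan_pos s)\<^sup>2 \<le> (r - s) * (stefan_pos r - stefan_pos s)"
  proof (cases "s \<le> r")
    case True
    then have "0 \<le> stefan_pos r - stefan_pos s" "stefan_pos r - stefan_pos s \<le> r - s" by (auto simp: stefan_pos_def)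
    then show ?thesis unfolding power2_eq_square by (intro mult_right_mono)
  next
    case False
    then have "stefan_pos r - stefan_pos s \<le> 0" "r - s \<le> stefan_pos r - stefan_pos s" by (auto simp: stefan_pos_def)
    then show ?thesis unfolding power2_eq_square by (intro mult_right_mono_neg)
  qed
qed (auto simp: stefan_pos_def)

text \<open>The two solutions enter asymmetrically. The first is driven by the operator of
  \<open>prob_kernel\<close>, whose sign is used; the second only has to satisfy a mollified
  equation with some kernel \<open>K2\<close>, so it may be another member of the family or a weak
  solution of the local problem. The four error bounds are for \<open>u\<close> and
  \<open>stefan_pos u\<close>, since both differences are mollified.\<close>

locale comparison = prob_kernel k l B for k :: "'a::euclidean_space \<Rightarrow> real" and l B :: real +
  fixes T M C E :: real and f rho K2 :: "'a \<Rightarrow> real" and B2 :: real and u1 u2 :: "real \<Rightarrow> 'a \<Rightarrow> real"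
  assumes T: "0 \<le> T" and M: "0 \<le> M" and C: "0 \<le> C" and E: "0 \<le> E"
    and rho: "radial_kernel rho"
    and um1: "case_prod u1 \<in> borel_measurable (borel \<Otimes>\<^sub>M borel)"
    and um2: "case_prod u2 \<in> borel_measurable (borel \<Otimes>\<^sub>M borel)"
    and i1: "\<And>t. 0 \<le> t \<Longrightarrow> t \<le> T \<Longrightarrow> integrable lborel (u1 t)"
    and i2: "\<And>t. 0 \<le> t \<Longrightarrow> t \<le> T \<Longrightarrow> integrable lborel (u2 t)"
    and C1: "\<And>t. 0 \<le> t \<Longrightarrow> t \<le> T \<Longrightarrow> (\<integral>x. \<bar>u1 t x\<bar> \<partial>lborel) \<le> C"
    and C2: "\<And>t. 0 \<le> t \<Longrightarrow> t \<le> T \<Longrightarrow> (\<integral>x. \<bar>u2 t x\<bar> \<partial>lborel) \<le> C"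
    and M1: "\<And>t. 0 \<le> t \<Longrightarrow> t \<le> T \<Longrightarrow> AE x in lborel. \<bar>u1 t x\<bar> \<le> M"
    and M2: "\<And>t. 0 \<le> t \<Longrightarrow> t \<le> T \<Longrightarrow> AE x in lborel. \<bar>u2 t x\<bar> \<le> M"
    and K2: "integrable lborel K2" "\<And>x. \<bar>K2 x\<bar> \<le> B2"
    and mol1: "\<And>t x. 0 \<le> t \<Longrightarrow> t \<le> T \<Longrightarrow> convolution rho (u1 t) x = convolution rho f x
      + (\<integral>s. convolution (diffuse k l rho) (\<lambda>y. stefan_pos (u1 s y)) x \<partial>time_measure 0 t)"
    and mol2: "\<And>t x. 0 \<le> t \<Longrightarrow> t \<le> T \<Longrightarrow> convolution rho (u2 t) x = convolution rho f x
      + (\<integral>s. convolution K2 (\<lambda>y. stefan_pos (u2 s y)) x \<partial>time_measure 0 t)"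
    and E1: "(\<integral>\<^sup>+t. \<integral>\<^sup>+x. ennreal \<bar>convolution rho (u1 t) x - u1 t x\<bar> \<partial>lborel \<partial>time_measure 0 T) \<le> ennreal E"
    and E2: "(\<integral>\<^sup>+t. \<integral>\<^sup>+x. ennreal \<bar>convolution rho (u2 t) x - u2 t x\<bar> \<partial>lborel \<partial>time_measure 0 T) \<le> ennreal E"
    and E1': "(\<integral>\<^sup>+t. \<integral>\<^sup>+x. ennreal \<bar>convolution rho (\<lambda>y. stefan_pos (u1 t y)) x - stefan_pos (u1 t x)\<bar> \<partial>lborel \<partial>time_measure 0 T) \<le> ennreal E"
    and E2': "(\<integral>\<^sup>+t. \<integral>\<^sup>+x. ennreal \<bar>convolution rho (\<lambda>y. stefan_pos (u2 t y)) x - stefan_pos (u2 t x)\<bar> \<partial>lborel \<partial>time_measure 0 T) \<le> ennreal E"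
begin

declare diffuse_measurable [measurable del] convolution_measurable [measurable del]

abbreviation "v1 \<equiv> \<lambda>t y. stefan_pos (u1 t y)"
abbreviation "v2 \<equiv> \<lambda>t y. stefan_pos (u2 t y)"
abbreviation "K1 \<equiv> diffuse k l rho"

definition W :: "real \<Rightarrow> 'a \<Rightarrow> real" where "W t x = u1 t x - u2 t x"
definition D :: "real \<Rightarrow> 'a \<Rightarrow> real" where "D t x = v1 t x - v2 t x"
definition a :: "real \<Rightarrow> 'a \<Rightarrow> real" where "a t x = convolution rho (D t) x"
definition c :: "real \<Rightarrow> 'a \<Rightarrow> real" where "c t x = convolution rho (W t) x"
text \<open>The consistency remainder: the difference of the two operators, carried by the
  mollifiers and therefore small in \<open>L^1\<close>.\<close>

definition r :: "real \<Rightarrow> 'a \<Rightarrow> real" where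
  "r t x = (\<integral>s. convolution (\<lambda>z. K1 z - K2 z) (v2 s) x \<partial>time_measure 0 t)"

lemma rho_measurable [measurable]: "rho \<in> borel_measurable borel" by (rule radial_kernelD(7)[OF rho])
lemma rho_integrable: "integrable lborel rho" by (rule radial_kernelD(8)[OF rho])
lemma rho_abs: "(\<integral>x. \<bar>rho x\<bar> \<partial>lborel) = 1" using radial_kernelD(1,5)[OF rho] by simp

lemma rho_bounded: obtains b where "\<And>x. \<bar>rho x\<bar> \<le> b"
  by (rule radial_kernel_bounded[OF rho]) blast

lemma K1_integrable: "integrable lborel K1" by (intro diffuse_integrable rho_integrable)

lemma K2_measurable [measurable]: "K2 \<in> borel_measurable borel" using K2(1) by simp
lemma K1_measurable [measurable]: "K1 \<in> borel_measurable borel" using K1_integrable by simp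

lemma conv_rho_bounded:
  assumes "\<And>x. \<bar>rho x\<bar> \<le> b" shows "\<bar>convolution k rho x\<bar> \<le> b"
  using convolution_abs_le_sup[OF k_integrable, of rho b x] assms by (simp add: k_abs_integral)

lemma K1_bounded: obtains b where "\<And>x. \<bar>K1 x\<bar> \<le> b"
proof -
  obtain b where b: "\<And>x. \<bar>rho x\<bar> \<le> b" using rho_bounded by blast
  show thesis
  proof (rule that)
    fix x
    have "\<bar>convolution k rho x - rho x\<bar> \<le> 2 * b" using conv_rho_bounded[OF b, of x] b[of x] by linarith
    then show "\<bar>K1 x\<bar> \<le> l * (2 * b)" unfolding diffuse_def abs_mult using l_pos by (simp add: mult_left_mono)
  qed
qed

text \<open>By associativity, applying the operator to the mollifier is the same as applying it to
  the mollified function. This brings the memory term into the form of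
  \<open>energy_negative\<close>.\<close>

lemma conv_K1:
  assumes g: "integrable lborel g"
  shows "convolution K1 g x = diffuse k l (convolution rho g) x"
proof -
  obtain b where b: "\<And>x. \<bar>rho x\<bar> \<le> b" using rho_bounded by blast
  have [measurable]: "convolution k rho \<in> borel_measurable borel" by (rule convolution_measurable') measurable
  have i: "integrable lborel (\<lambda>y. convolution k rho (x - y) * g y)" "integrable lborel (\<lambda>y. rho (x - y) * g y)"
    by (rule integrable_convolution_section[OF g]; use b conv_rho_bounded[OF b] in auto)+
  have "convolution K1 g x = (\<integral>y. l * (convolution k rho (x - y) * g y - rho (x - y) * g y) \<partial>lborel)"
    unfolding convolution_def[of K1] diffuse_def by (simp add: algebra_simps)
  also have "\<dots> = l * (convolution (convolution k rho) g x - convolution rho g x)"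
    using i by (simp add: convolution_def[of "convolution k rho"] convolution_def[of rho])
  also have "convolution (convolution k rho) g x = convolution k (convolution rho g) x"
    by (rule convolution_assoc[OF k_integrable g _ b]) measurable
  finally show ?thesis unfolding diffuse_def[of k l "convolution rho g" x] .
qed

lemma v_integrable:
  assumes t: "0 \<le> t" "t \<le> T"
  shows "integrable lborel (v1 t)" "integrable lborel (v2 t)" "integrable lborel (D t)" "integrable lborel (W t)"
  unfolding D_def[abs_def] W_def[abs_def] using i1[OF t] i2[OF t] by auto

lemma measurables [measurable]:
  shows "case_prod u1 \<in> borel_measurable (borel \<Otimes>\<^sub>M borel)" "case_prod u2 \<in> borel_measurable (borel \<Otimes>\<^sub>M borel)"
    "case_prod W \<in> borel_measurable (borel \<Otimes>\<^sub>M borel)" "case_prod D \<in> borel_measurable (borel \<Otimes>\<^sub>M borel)"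
    "case_prod a \<in> borel_measurable (borel \<Otimes>\<^sub>M borel)" "case_prod c \<in> borel_measurable (borel \<Otimes>\<^sub>M borel)"
    "case_prod r \<in> borel_measurable (borel \<Otimes>\<^sub>M borel)"
proof -
  note [measurable] = um1 um2
  show "case_prod u1 \<in> borel_measurable (borel \<Otimes>\<^sub>M borel)" "case_prod u2 \<in> borel_measurable (borel \<Otimes>\<^sub>M borel)"
    by (rule um1 um2)+
  show [measurable]: "case_prod W \<in> borel_measurable (borel \<Otimes>\<^sub>M borel)" "case_prod D \<in> borel_measurable (borel \<Otimes>\<^sub>M borel)"
    unfolding W_def D_def by measurable
  show "case_prod a \<in> borel_measurable (borel \<Otimes>\<^sub>M borel)" "case_prod c \<in> borel_measurable (borel \<Otimes>\<^sub>M borel)"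
    unfolding a_def c_def convolution_def by measurable
  have "case_prod (\<lambda>s x. convolution (\<lambda>z. K1 z - K2 z) (v2 s) x) \<in> borel_measurable (borel \<Otimes>\<^sub>M borel)"
    unfolding convolution_def by measurable
  from running_integral_measurable[OF this] show "case_prod r \<in> borel_measurable (borel \<Otimes>\<^sub>M borel)"
    unfolding r_def .
qed

lemma L1_bounds:
  assumes t: "0 \<le> t" "t \<le> T"
  shows "(\<integral>x. \<bar>v1 t x\<bar> \<partial>lborel) \<le> C" "(\<integral>x. \<bar>v2 t x\<bar> \<partial>lborel) \<le> C"
    "(\<integral>x. \<bar>W t x\<bar> \<partial>lborel) \<le> 2 * C" "(\<integral>x. \<bar>D t x\<bar> \<partial>lborel) \<le> 2 * C"
proof -
  show W: "(\<integral>x. \<bar>W t x\<bar> \<partial>lborel) \<le> 2 * C"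
  proof -
    have "(\<integral>x. \<bar>W t x\<bar> \<partial>lborel) \<le> (\<integral>x. \<bar>u1 t x\<bar> + \<bar>u2 t x\<bar> \<partial>lborel)"
      using i1[OF t] i2[OF t] v_integrable(4)[OF t] by (intro integral_mono) (auto simp: W_def)
    then show ?thesis using i1[OF t] i2[OF t] C1[OF t] C2[OF t] by simp
  qed
  show "(\<integral>x. \<bar>v1 t x\<bar> \<partial>lborel) \<le> C" "(\<integral>x. \<bar>v2 t x\<bar> \<partial>lborel) \<le> C"
    using stefan_pos_L1_le[OF i1[OF t]] stefan_pos_L1_le[OF i2[OF t]] C1[OF t] C2[OF t] by linarith+
  show "(\<integral>x. \<bar>D t x\<bar> \<partial>lborel) \<le> 2 * C"
    using stefan_pos_diff_L1_le[OF i1[OF t] i2[OF t]] W by (simp add: D_def W_def)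
qed

lemma a_bounds:
  assumes t: "0 \<le> t" "t \<le> T"
  shows "integrable lborel (a t)" "(\<integral>x. \<bar>a t x\<bar> \<partial>lborel) \<le> 2 * C" "\<bar>a t x\<bar> \<le> M"
    "integrable lborel (c t)" "(\<integral>x. \<bar>c t x\<bar> \<partial>lborel) \<le> 2 * C" "\<bar>c t x\<bar> \<le> 2 * M"
    "AE x in lborel. \<bar>D t x\<bar> \<le> M"
proof -
  have [measurable]: "D t \<in> borel_measurable borel" "W t \<in> borel_measurable borel" using v_integrable[OF t] by auto
  show "integrable lborel (a t)" "integrable lborel (c t)"
    unfolding a_def[abs_def] c_def[abs_def] by (intro convolution_integrable rho_integrable v_integrable t)+
  show "(\<integral>x. \<bar>a t x\<bar> \<partial>lborel) \<le> 2 * C" "(\<integral>x. \<bar>c t x\<bar> \<partial>lborel) \<le> 2 * C"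
    using convolution_L1_le[OF rho_integrable v_integrable(3)[OF t]] convolution_L1_le[OF rho_integrable v_integrable(4)[OF t]]
      L1_bounds(3,4)[OF t] unfolding a_def c_def rho_abs by auto
  show D: "AE x in lborel. \<bar>D t x\<bar> \<le> M"
    using M1[OF t] M2[OF t] by eventually_elim (simp add: D_def stefan_pos_bounds)
  have W: "AE x in lborel. \<bar>W t x\<bar> \<le> 2 * M"
    using M1[OF t] M2[OF t] by eventually_elim (simp add: W_def)
  show "\<bar>a t x\<bar> \<le> M" "\<bar>c t x\<bar> \<le> 2 * M"
    unfolding a_def c_def
    using convolution_abs_le_sup[OF rho_integrable _ D, of x] convolution_abs_le_sup[OF rho_integrable _ W, of x] rho_abs by auto
qed

lemma conv_section:
  assumes "integrable lborel g"
  shows "integrable lborel (\<lambda>y. K1 (x - y) * g y)" "integrable lborel (\<lambda>y. K2 (x - y) * g y)" "integrable lborel (\<lambda>y. rho (x - y) * g y)"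
proof -
  obtain b where b: "\<And>x. \<bar>K1 x\<bar> \<le> b" using K1_bounded by blast
  show "integrable lborel (\<lambda>y. K1 (x - y) * g y)"
    by (rule integrable_convolution_section[OF assms _ b]) measurable
  show "integrable lborel (\<lambda>y. K2 (x - y) * g y)"
    by (rule integrable_convolution_section[OF assms _ K2(2)]) measurable
  obtain b where b: "\<And>x. \<bar>rho x\<bar> \<le> b" using rho_bounded by blast
  show "integrable lborel (\<lambda>y. rho (x - y) * g y)"
    by (rule integrable_convolution_section[OF assms _ b]) measurable
qed

lemma integrable_time_conv:
  assumes [measurable]: "case_prod g \<in> borel_measurable (borel \<Otimes>\<^sub>M borel)" "K \<in> borel_measurable borel"
    and K: "\<And>x. \<bar>K x\<bar> \<le> b" and t: "0 \<le> t" "t \<le> T"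
    and g: "\<And>s. 0 \<le> s \<Longrightarrow> s \<le> T \<Longrightarrow> integrable lborel (g s)" "\<And>s. 0 \<le> s \<Longrightarrow> s \<le> T \<Longrightarrow> (\<integral>y. \<bar>g s y\<bar> \<partial>lborel) \<le> C'"
  shows "integrable (time_measure 0 t) (\<lambda>s. convolution K (g s) x)"
proof (rule tm.integrable_const_bound)
  have b: "0 \<le> b" using K[of 0] by linarith
  show "AE s in time_measure 0 t. norm (convolution K (g s) x) \<le> b * C'"
  proof (rule AE_time_measureI)
    fix s assume s: "0 \<le> s" "s \<le> t"
    then have s': "s \<le> T" using t by simp
    have "\<bar>convolution K (g s) x\<bar> \<le> b * (\<integral>y. \<bar>g s y\<bar> \<partial>lborel)"
      by (rule convolution_abs_le_sup_kernel[OF g(1)[OF s(1) s'] assms(2) K])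
    also have "\<dots> \<le> b * C'" using g(2)[OF s(1) s'] b by (rule mult_left_mono)
    finally show "norm (convolution K (g s) x) \<le> b * C'" by simp
  qed
  show "(\<lambda>s. convolution K (g s) x) \<in> borel_measurable (time_measure 0 t)"
    unfolding convolution_def by measurable
qed

text \<open>Subtract the two mollified equations with the same initial datum, then add and subtract
  \<open>K1\<close> convolved with \<open>v2\<close>.\<close>

lemma c_decomposition:
  assumes t: "0 \<le> t" "t \<le> T"
  shows "c t x = (\<integral>s. convolution K1 (D s) x \<partial>time_measure 0 t) + r t x"
proof -
  obtain b where b: "\<And>x. \<bar>K1 x\<bar> \<le> b" using K1_bounded by blast
  have vm: "case_prod v1 \<in> borel_measurable (borel \<Otimes>\<^sub>M borel)" "case_prod v2 \<in> borel_measurable (borel \<Otimes>\<^sub>M borel)" by measurable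
  have T1: "integrable (time_measure 0 t) (\<lambda>s. convolution K1 (v1 s) x)"
    by (rule integrable_time_conv[OF vm(1) _ b t]) (use v_integrable L1_bounds in auto)
  have T2: "integrable (time_measure 0 t) (\<lambda>s. convolution K2 (v2 s) x)"
    by (rule integrable_time_conv[OF vm(2) _ K2(2) t]) (use v_integrable L1_bounds in auto)
  have T3: "integrable (time_measure 0 t) (\<lambda>s. convolution K1 (v2 s) x)"
    by (rule integrable_time_conv[OF vm(2) _ b t]) (use v_integrable L1_bounds in auto)
  have m [measurable]: "(\<lambda>s. convolution K1 (D s) x) \<in> borel_measurable borel"
    "(\<lambda>s. convolution (\<lambda>z. K1 z - K2 z) (v2 s) x) \<in> borel_measurable borel"
    unfolding convolution_def by measurable
  have "c t x = convolution rho (u1 t) x - convolution rho (u2 t) x"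
    unfolding c_def W_def[abs_def] by (rule convolution_diff_right[OF conv_section(3)[OF i1[OF t]] conv_section(3)[OF i2[OF t]]])
  also have "\<dots> = (\<integral>s. convolution K1 (v1 s) x \<partial>time_measure 0 t) - (\<integral>s. convolution K2 (v2 s) x \<partial>time_measure 0 t)"
    using mol1[OF t] mol2[OF t] by simp
  also have "\<dots> = (\<integral>s. convolution K1 (v1 s) x - convolution K1 (v2 s) x \<partial>time_measure 0 t)
      + (\<integral>s. convolution K1 (v2 s) x - convolution K2 (v2 s) x \<partial>time_measure 0 t)"
    using T1 T2 T3 by simp
  also have "(\<integral>s. convolution K1 (v1 s) x - convolution K1 (v2 s) x \<partial>time_measure 0 t) = (\<integral>s. convolution K1 (D s) x \<partial>time_measure 0 t)"
  proof (rule integral_cong_AE)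
    show "AE s in time_measure 0 t. convolution K1 (v1 s) x - convolution K1 (v2 s) x = convolution K1 (D s) x"
    proof (rule AE_time_measureI)
      fix s assume "0 \<le> s" "s \<le> t" then have s: "0 \<le> s" "s \<le> T" using t by auto
      show "convolution K1 (v1 s) x - convolution K1 (v2 s) x = convolution K1 (D s) x"
        unfolding D_def[abs_def] using convolution_diff_right[OF conv_section(1)[OF v_integrable(1)[OF s]] conv_section(1)[OF v_integrable(2)[OF s]]] by simp
    qed
  qed (use T1 T3 in measurable)
  also have "(\<integral>s. convolution K1 (v2 s) x - convolution K2 (v2 s) x \<partial>time_measure 0 t) = r t x"
    unfolding r_def
  proof (rule integral_cong_AE)
    show "AE s in time_measure 0 t. convolution K1 (v2 s) x - convolution K2 (v2 s) x = convolution (\<lambda>z. K1 z - K2 z) (v2 s) x"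
    proof (rule AE_time_measureI)
      fix s assume "0 \<le> s" "s \<le> t" then have s: "0 \<le> s" "s \<le> T" using t by auto
      show "convolution K1 (v2 s) x - convolution K2 (v2 s) x = convolution (\<lambda>z. K1 z - K2 z) (v2 s) x"
        using convolution_diff_left[OF conv_section(1)[OF v_integrable(2)[OF s]] conv_section(2)[OF v_integrable(2)[OF s]]] by simp
    qed
  qed (use T2 T3 in measurable)
  finally show ?thesis .
qed

definition "delta = (\<integral>x. \<bar>K1 x - K2 x\<bar> \<partial>lborel)"

lemma delta_nonneg: "0 \<le> delta" unfolding delta_def by simp

lemma r_bounds:
  assumes t: "0 \<le> t" "t \<le> T"
  shows "integrable lborel (r t)" "(\<integral>x. \<bar>r t x\<bar> \<partial>lborel) \<le> T * (delta * C)"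
proof -
  let ?K = "\<lambda>z. K1 z - K2 z"
  have Ki: "integrable lborel ?K" using K1_integrable K2(1) by simp
  have m: "case_prod (\<lambda>s x. convolution ?K (v2 s) x) \<in> borel_measurable (borel \<Otimes>\<^sub>M borel)"
    unfolding convolution_def by measurable
  have b: "(\<integral>x. \<bar>convolution ?K (v2 s) x\<bar> \<partial>lborel) \<le> delta * C" "integrable lborel (convolution ?K (v2 s))" if "0 \<le> s" "s \<le> t" for s
  proof -
    have s: "0 \<le> s" "s \<le> T" using that t by auto
    have "(\<integral>x. \<bar>convolution ?K (v2 s) x\<bar> \<partial>lborel) \<le> delta * (\<integral>x. \<bar>v2 s x\<bar> \<partial>lborel)"
      unfolding delta_def by (rule convolution_L1_le[OF Ki v_integrable(2)[OF s]])
    also have "\<dots> \<le> delta * C" using L1_bounds(2)[OF s] delta_nonneg by (rule mult_left_mono)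
    finally show "(\<integral>x. \<bar>convolution ?K (v2 s) x\<bar> \<partial>lborel) \<le> delta * C" .
    show "integrable lborel (convolution ?K (v2 s))" by (rule convolution_integrable[OF Ki v_integrable(2)[OF s]])
  qed
  have d0: "0 \<le> delta * C" using delta_nonneg C by simp
  show "integrable lborel (r t)"
    unfolding r_def[abs_def] by (rule time_integral_L1_le(1)[OF m t(1) d0 b(2,1)])
  have "(\<integral>x. \<bar>r t x\<bar> \<partial>lborel) \<le> (t - 0) * (delta * C)"
    unfolding r_def by (rule time_integral_L1_le(2)[OF m t(1) d0 b(2,1)])
  also have "\<dots> \<le> T * (delta * C)" using t d0 by (simp add: mult_right_mono)
  finally show "(\<integral>x. \<bar>r t x\<bar> \<partial>lborel) \<le> T * (delta * C)" .
qed

lemma errors: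
  shows "(\<integral>\<^sup>+t. \<integral>\<^sup>+x. ennreal \<bar>W t x - c t x\<bar> \<partial>lborel \<partial>time_measure 0 T) \<le> ennreal (2 * E)"
    and "(\<integral>\<^sup>+t. \<integral>\<^sup>+x. ennreal \<bar>D t x - a t x\<bar> \<partial>lborel \<partial>time_measure 0 T) \<le> ennreal (2 * E)"
proof -
  have gen: "(\<integral>\<^sup>+t. \<integral>\<^sup>+x. ennreal \<bar>(g t x - h t x) - convolution rho (\<lambda>x. g t x - h t x) x\<bar> \<partial>lborel \<partial>time_measure 0 T) \<le> ennreal (2 * E)"
    if [measurable]: "case_prod g \<in> borel_measurable (borel \<Otimes>\<^sub>M borel)" "case_prod h \<in> borel_measurable (borel \<Otimes>\<^sub>M borel)"
      and gi: "\<And>t. 0 \<le> t \<Longrightarrow> t \<le> T \<Longrightarrow> integrable lborel (g t)" and hi: "\<And>t. 0 \<le> t \<Longrightarrow> t \<le> T \<Longrightarrow> integrable lborel (h t)"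
      and gE: "(\<integral>\<^sup>+t. \<integral>\<^sup>+x. ennreal \<bar>convolution rho (g t) x - g t x\<bar> \<partial>lborel \<partial>time_measure 0 T) \<le> ennreal E"
      and hE: "(\<integral>\<^sup>+t. \<integral>\<^sup>+x. ennreal \<bar>convolution rho (h t) x - h t x\<bar> \<partial>lborel \<partial>time_measure 0 T) \<le> ennreal E" for g h
  proof -
    have [measurable]: "(\<lambda>(t, x). convolution rho (g t) x) \<in> borel_measurable (borel \<Otimes>\<^sub>M borel)" "(\<lambda>(t, x). convolution rho (h t) x) \<in> borel_measurable (borel \<Otimes>\<^sub>M borel)"
      unfolding convolution_def by measurable
    have "(\<integral>\<^sup>+t. \<integral>\<^sup>+x. ennreal \<bar>(g t x - h t x) - convolution rho (\<lambda>x. g t x - h t x) x\<bar> \<partial>lborel \<partial>time_measure 0 T)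
      \<le> (\<integral>\<^sup>+t. (\<integral>\<^sup>+x. ennreal \<bar>convolution rho (g t) x - g t x\<bar> \<partial>lborel) + (\<integral>\<^sup>+x. ennreal \<bar>convolution rho (h t) x - h t x\<bar> \<partial>lborel) \<partial>time_measure 0 T)"
    proof (rule nn_integral_mono_AE, rule AE_time_measureI)
      fix t assume t: "0 \<le> t" "t \<le> T"
      have e: "convolution rho (\<lambda>x. g t x - h t x) x = convolution rho (g t) x - convolution rho (h t) x" for x
        by (rule convolution_diff_right[OF conv_section(3)[OF gi[OF t]] conv_section(3)[OF hi[OF t]]])
      show "(\<integral>\<^sup>+x. ennreal \<bar>(g t x - h t x) - convolution rho (\<lambda>x. g t x - h t x) x\<bar> \<partial>lborel)
        \<le> (\<integral>\<^sup>+x. ennreal \<bar>convolution rho (g t) x - g t x\<bar> \<partial>lborel) + (\<integral>\<^sup>+x. ennreal \<bar>convolution rho (h t) x - h t x\<bar> \<partial>lborel)"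
        unfolding e by (subst nn_integral_add[symmetric]) (measurable, auto intro!: nn_integral_mono simp flip: ennreal_plus)
    qed
    also have "\<dots> = (\<integral>\<^sup>+t. \<integral>\<^sup>+x. ennreal \<bar>convolution rho (g t) x - g t x\<bar> \<partial>lborel \<partial>time_measure 0 T)
        + (\<integral>\<^sup>+t. \<integral>\<^sup>+x. ennreal \<bar>convolution rho (h t) x - h t x\<bar> \<partial>lborel \<partial>time_measure 0 T)"
      by (rule nn_integral_add) measurable
    also have "\<dots> \<le> ennreal E + ennreal E" by (intro add_mono gE hE)
    also have "\<dots> = ennreal (2 * E)" using E by (simp flip: ennreal_plus)
    finally show ?thesis .
  qed
  show "(\<integral>\<^sup>+t. \<integral>\<^sup>+x. ennreal \<bar>W t x - c t x\<bar> \<partial>lborel \<partial>time_measure 0 T) \<le> ennreal (2 * E)"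
    unfolding c_def W_def[abs_def] by (rule gen[OF um1 um2 i1 i2 E1 E2])
  have vm: "case_prod v1 \<in> borel_measurable (borel \<Otimes>\<^sub>M borel)" "case_prod v2 \<in> borel_measurable (borel \<Otimes>\<^sub>M borel)" by measurable
  show "(\<integral>\<^sup>+t. \<integral>\<^sup>+x. ennreal \<bar>D t x - a t x\<bar> \<partial>lborel \<partial>time_measure 0 T) \<le> ennreal (2 * E)"
    unfolding a_def D_def[abs_def] by (rule gen[OF vm v_integrable(1,2) E1' E2'])
qed

text \<open>\<open>D^2 <= W D\<close>, and \<open>W D = (W - c) D + (D - a) c + a be + a r\<close>,
  where \<open>c = be + r\<close> by the equation. The first two terms carry mollification errors at
  most \<open>2 * E\<close>, with \<open>D\<close> bounded by \<open>M\<close> and \<open>c\<close>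
  by \<open>2 * M\<close>, whence \<open>6 * M * E\<close>. The third has nonpositive integral by
  \<open>energy_negative\<close>, and the last is the remainder times the bound \<open>M\<close> on
  \<open>a\<close>.\<close>

lemma comparison_L2:
  shows "integrable (time_measure 0 T \<Otimes>\<^sub>M lborel) (\<lambda>(t, x). (D t x)\<^sup>2)"
    and "(\<integral>(t, x). (D t x)\<^sup>2 \<partial>(time_measure 0 T \<Otimes>\<^sub>M lborel)) \<le> 6 * M * E + M * (T * (T * (delta * C)))"
proof -
  let ?P = "time_measure 0 T \<Otimes>\<^sub>M lborel :: (real \<times> 'a) measure"
  have ec: "(\<integral>\<^sup>+t. \<integral>\<^sup>+x. ennreal \<bar>g t x\<bar> \<partial>lborel \<partial>time_measure 0 T) \<le> ennreal (T * (2 * C))"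
    if "case_prod g \<in> borel_measurable (borel \<Otimes>\<^sub>M borel)"
      "\<And>t. 0 \<le> t \<Longrightarrow> t \<le> T \<Longrightarrow> integrable lborel (g t)" "\<And>t. 0 \<le> t \<Longrightarrow> t \<le> T \<Longrightarrow> (\<integral>x. \<bar>g t x\<bar> \<partial>lborel) \<le> 2 * C" for g :: "real \<Rightarrow> 'a \<Rightarrow> real"
    using integrable_time_space(2)[OF that(1) T, of "2 * C"] that(2,3) C by simp
  have C0: "0 \<le> T * (2 * C)" using T C by simp
  have iDD: "integrable ?P (\<lambda>(t, x). D t x * D t x)"
    by (rule time_space_integral_bound(1)[where B=M and E="T * (2 * C)"])
       (use M C0 a_bounds(7) in \<open>auto intro!: ec v_integrable L1_bounds\<close>)
  have iWD: "integrable ?P (\<lambda>(t, x). W t x * D t x)"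
    by (rule time_space_integral_bound(1)[where B=M and E="T * (2 * C)"])
       (use M C0 a_bounds(7) in \<open>auto intro!: ec v_integrable L1_bounds\<close>)
  show "integrable ?P (\<lambda>(t, x). (D t x)\<^sup>2)" using iDD by (simp add: power2_eq_square split_beta')
  have m1: "case_prod (\<lambda>t x. W t x - c t x) \<in> borel_measurable (borel \<Otimes>\<^sub>M borel)"
    and m2: "case_prod (\<lambda>t x. D t x - a t x) \<in> borel_measurable (borel \<Otimes>\<^sub>M borel)" by measurable
  have E0: "0 \<le> 2 * E" using E by simp
  note p1 = time_space_integral_bound[OF m1 measurables(4) a_bounds(7) M errors(1) E0]
  have c2: "AE x in lborel. \<bar>c t x\<bar> \<le> 2 * M" if "0 \<le> t" "t \<le> T" for t using a_bounds(6)[OF that] by simp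
  have M0: "0 \<le> 2 * M" using M by simp
  note p2 = time_space_integral_bound[OF m2 measurables(6) c2 M0 errors(2) E0]
  have rE: "(\<integral>\<^sup>+t. \<integral>\<^sup>+x. ennreal \<bar>r t x\<bar> \<partial>lborel \<partial>time_measure 0 T) \<le> ennreal (T * (T * (delta * C)))"
    using integrable_time_space(2)[OF measurables(7) T, of "T * (delta * C)"] r_bounds T C delta_nonneg by simp
  have aM: "AE x in lborel. \<bar>a t x\<bar> \<le> M" if "0 \<le> t" "t \<le> T" for t using a_bounds(3)[OF that] by simp
  have r0: "0 \<le> T * (T * (delta * C))" using T C delta_nonneg by simp
  note p3 = time_space_integral_bound[OF measurables(7) measurables(5) aM M rE r0]
  define be where "be t x = (\<integral>s. diffuse k l (a s) x \<partial>time_measure 0 t)" for t x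
  have dm: "case_prod (\<lambda>s x. diffuse k l (a s) x) \<in> borel_measurable (borel \<Otimes>\<^sub>M borel)"
    unfolding split_beta' by (rule diffuse_measurable) measurable
  have bem [measurable]: "case_prod be \<in> borel_measurable (borel \<Otimes>\<^sub>M borel)"
    unfolding be_def by (rule running_integral_measurable[OF dm])
  have bec: "c t x = be t x + r t x" if t: "0 \<le> t" "t \<le> T" for t x
  proof -
    have "(\<integral>s. convolution K1 (D s) x \<partial>time_measure 0 t) = be t x"
      unfolding be_def
    proof (rule integral_cong_AE)
      show "(\<lambda>s. convolution K1 (D s) x) \<in> borel_measurable (time_measure 0 t)" unfolding convolution_def by measurable
      show "AE s in time_measure 0 t. convolution K1 (D s) x = diffuse k l (a s) x"
        by (rule AE_time_measureI) (use t v_integrable(3) in \<open>auto simp: conv_K1 a_def[abs_def]\<close>)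
    qed (use dm in measurable)
    then show ?thesis using c_decomposition[OF t] by simp
  qed
  have ica: "integrable ?P (\<lambda>(t, x). c t x * a t x)"
    by (rule time_space_integral_bound(1)[OF measurables(6,5) aM M _ C0]) (auto intro!: ec a_bounds)
  have iba: "integrable ?P (\<lambda>(t, x). a t x * be t x)"
  proof -
    have i: "integrable ?P (\<lambda>(t, x). c t x * a t x - r t x * a t x)"
      using Bochner_Integration.integrable_diff[OF ica p3(1)] by (simp add: split_beta')
    have ae: "AE z in ?P. (case z of (t, x) \<Rightarrow> a t x * be t x) = (case z of (t, x) \<Rightarrow> c t x * a t x - r t x * a t x)"
    proof (rule AE_time_spaceI)
      show "a t x * be t x = c t x * a t x - r t x * a t x" if "0 \<le> t" "t \<le> T" for t x
        by (simp add: bec[OF that] algebra_simps)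
    qed measurable
    show ?thesis
    proof (rule Bochner_Integration.integrable_cong_AE[THEN iffD2, OF _ _ ae i])
      show "(\<lambda>(t, x). a t x * be t x) \<in> borel_measurable ?P" "(\<lambda>(t, x). c t x * a t x - r t x * a t x) \<in> borel_measurable ?P"
        by measurable
    qed
  qed
  have neg: "(\<integral>(t, x). a t x * be t x \<partial>?P) \<le> 0"
  proof -
    have "(\<integral>(t, x). a t x * be t x \<partial>?P) = (\<integral>t. \<integral>x. a t x * be t x \<partial>lborel \<partial>time_measure 0 T)"
      using tmp.integral_fst'[OF iba] by simp
    also have "\<dots> \<le> 0"
      unfolding be_def by (rule energy_negative[OF measurables(5) T, of "2 * C" M]) (use C a_bounds in auto)
    finally show ?thesis .
  qed
  have "(\<integral>(t, x). (D t x)\<^sup>2 \<partial>?P) \<le> (\<integral>(t, x). W t x * D t x \<partial>?P)"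
    using iDD iWD by (intro integral_mono) (auto simp: power2_eq_square split_beta' D_def W_def stefan_pos_monotone[unfolded power2_eq_square])
  also have "\<dots> = (\<integral>(t, x). (W t x - c t x) * D t x + (D t x - a t x) * c t x + a t x * be t x + r t x * a t x \<partial>?P)"
  proof (rule integral_cong_AE)
    show "AE z in ?P. (case z of (t, x) \<Rightarrow> W t x * D t x)
        = (case z of (t, x) \<Rightarrow> (W t x - c t x) * D t x + (D t x - a t x) * c t x + a t x * be t x + r t x * a t x)"
    proof (rule AE_time_spaceI)
      show "W t x * D t x = (W t x - c t x) * D t x + (D t x - a t x) * c t x + a t x * be t x + r t x * a t x"
        if "0 \<le> t" "t \<le> T" for t x by (simp add: bec[OF that] algebra_simps)
    qed measurable
  qed measurable
  also have "\<dots> = (\<integral>z. (case z of (t, x) \<Rightarrow> (W t x - c t x) * D t x) + (case z of (t, x) \<Rightarrow> (D t x - a t x) * c t x)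
      + (case z of (t, x) \<Rightarrow> a t x * be t x) + (case z of (t, x) \<Rightarrow> r t x * a t x) \<partial>?P)"
    by (simp add: split_beta')
  also have "\<dots> = (\<integral>(t, x). (W t x - c t x) * D t x \<partial>?P) + (\<integral>(t, x). (D t x - a t x) * c t x \<partial>?P)
      + (\<integral>(t, x). a t x * be t x \<partial>?P) + (\<integral>(t, x). r t x * a t x \<partial>?P)"
    using p1(1) p2(1) p3(1) iba by simp
  also have "\<dots> \<le> M * (2 * E) + 2 * M * (2 * E) + 0 + M * (T * (T * (delta * C)))"
    using p1(2) p2(2) p3(2) neg by linarith
  finally show "(\<integral>(t, x). (D t x)\<^sup>2 \<partial>?P) \<le> 6 * M * E + M * (T * (T * (delta * C)))" by (simp add: mult_ac)
qed

end

section \<open>From \<open>L^2\<close> closeness of \<open>v\<close> to local \<open>L^1\<close>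
  closeness of \<open>u\<close>\<close>

definition ball_dist :: "real \<Rightarrow> ('a::euclidean_space \<Rightarrow> real) \<Rightarrow> ('a \<Rightarrow> real) \<Rightarrow> ennreal" where
  "ball_dist R g h = (\<integral>\<^sup>+x. indicator (cball 0 R) x * ennreal \<bar>g x - h x\<bar> \<partial>lborel)"

context comparison
begin

lemma K1_square_integrable: "integrable lborel (\<lambda>x. (K1 x)\<^sup>2)"
proof -
  obtain b where b: "\<And>x. \<bar>K1 x\<bar> \<le> b" using K1_bounded by blast
  show ?thesis
    unfolding power2_eq_square by (rule integrable_mult_AE_bounded(1)[OF K1_integrable, of _ b]) (use b in auto)
qed

text \<open>Young's inequality with a free weight \<open>al\<close> in place of Cauchy-Schwarz. A
  large \<open>al\<close> makes the kernel term small; the square integral of \<open>D\<close> must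
  then be small compared with \<open>1 / al\<close>.\<close>

lemma memory_bound:
  assumes t: "0 \<le> t" "t \<le> T" and al: "0 < al"
  shows "\<bar>\<integral>s. convolution K1 (D s) x \<partial>time_measure 0 t\<bar>
    \<le> (al * (\<integral>(t, x). (D t x)\<^sup>2 \<partial>(time_measure 0 T \<Otimes>\<^sub>M lborel)) + T * (\<integral>x. (K1 x)\<^sup>2 \<partial>lborel) / al) / 2"
proof -
  let ?S = "\<integral>(t, x). (D t x)\<^sup>2 \<partial>(time_measure 0 T \<Otimes>\<^sub>M lborel)" and ?Q = "\<integral>x. (K1 x)\<^sup>2 \<partial>lborel"
  have S: "(\<integral>\<^sup>+t. \<integral>\<^sup>+x. ennreal ((D t x)\<^sup>2) \<partial>lborel \<partial>time_measure 0 T) = ennreal ?S"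
  proof -
    have "(\<integral>\<^sup>+z. ennreal (case z of (t, x) \<Rightarrow> (D t x)\<^sup>2) \<partial>(time_measure 0 T \<Otimes>\<^sub>M lborel)) = ennreal ?S"
      by (rule nn_integral_eq_integral[OF comparison_L2(1)]) auto
    then show ?thesis by (subst (asm) lborel.nn_integral_fst[symmetric]) (simp_all add: split_beta')
  qed
  have Q: "(\<integral>\<^sup>+y. ennreal ((K1 (x - y))\<^sup>2) \<partial>lborel) = ennreal ?Q"
  proof -
    have "(\<integral>\<^sup>+y. ennreal ((K1 (x - y))\<^sup>2) \<partial>lborel) = (\<integral>\<^sup>+y. ennreal ((K1 y)\<^sup>2) \<partial>lborel)"
      by (rule nn_integral_lborel_shift(3)[of "\<lambda>y. ennreal ((K1 y)\<^sup>2)"]) measurable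
    then show ?thesis using nn_integral_eq_integral[OF K1_square_integrable] by simp
  qed
  have S0: "0 \<le> ?S" by (rule integral_nonneg_AE) auto
  have Q0: "0 \<le> ?Q" by (rule integral_nonneg_AE) auto
  have am_gm: "\<bar>p * q\<bar> \<le> (al / 2) * q\<^sup>2 + (1 / (2 * al)) * p\<^sup>2" for p q :: real
  proof -
    have "0 \<le> (al * \<bar>q\<bar> - \<bar>p\<bar>)\<^sup>2" by simp
    then have "2 * (al * \<bar>p * q\<bar>) \<le> al\<^sup>2 * q\<^sup>2 + p\<^sup>2" by (simp add: power2_eq_square algebra_simps abs_mult)
    then show ?thesis using al by (simp add: field_simps power2_eq_square)
  qed
  have "ennreal \<bar>\<integral>s. convolution K1 (D s) x \<partial>time_measure 0 t\<bar> \<le> (\<integral>\<^sup>+s. ennreal \<bar>convolution K1 (D s) x\<bar> \<partial>time_measure 0 t)"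
    by (rule abs_integral_le_nn_integral)
  also have "\<dots> \<le> (\<integral>\<^sup>+s. (\<integral>\<^sup>+y. ennreal \<bar>K1 (x - y) * D s y\<bar> \<partial>lborel) \<partial>time_measure 0 t)"
    unfolding convolution_def[of K1] by (intro nn_integral_mono abs_integral_le_nn_integral)
  also have "\<dots> \<le> (\<integral>\<^sup>+s. (\<integral>\<^sup>+y. ennreal \<bar>K1 (x - y) * D s y\<bar> \<partial>lborel) \<partial>time_measure 0 T)"
    using t by (subst (1 2) nn_integral_time_measure) (auto intro!: nn_integral_mono simp: indicator_def)
  also have "\<dots> \<le> (\<integral>\<^sup>+s. (\<integral>\<^sup>+y. ennreal (al / 2) * ennreal ((D s y)\<^sup>2) + ennreal (1 / (2 * al)) * ennreal ((K1 (x - y))\<^sup>2) \<partial>lborel) \<partial>time_measure 0 T)"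
    using al am_gm by (intro nn_integral_mono) (simp add: ennreal_mult[symmetric] ennreal_plus[symmetric] del: ennreal_plus)
  also have "\<dots> = ennreal (al / 2) * ennreal ?S + ennreal T * (ennreal (1 / (2 * al)) * ennreal ?Q)"
  proof -
    have "(\<integral>\<^sup>+y. ennreal (al / 2) * ennreal ((D s y)\<^sup>2) + ennreal (1 / (2 * al)) * ennreal ((K1 (x - y))\<^sup>2) \<partial>lborel)
        = ennreal (al / 2) * (\<integral>\<^sup>+y. ennreal ((D s y)\<^sup>2) \<partial>lborel) + ennreal (1 / (2 * al)) * ennreal ?Q" for s
      by (subst nn_integral_add) (simp_all add: nn_integral_cmult Q)
    then have "(\<integral>\<^sup>+s. (\<integral>\<^sup>+y. ennreal (al / 2) * ennreal ((D s y)\<^sup>2) + ennreal (1 / (2 * al)) * ennreal ((K1 (x - y))\<^sup>2) \<partial>lborel) \<partial>time_measure 0 T)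
        = (\<integral>\<^sup>+s. ennreal (al / 2) * (\<integral>\<^sup>+y. ennreal ((D s y)\<^sup>2) \<partial>lborel) + ennreal (1 / (2 * al)) * ennreal ?Q \<partial>time_measure 0 T)"
      by simp
    also have "\<dots> = ennreal (al / 2) * ennreal ?S + ennreal T * (ennreal (1 / (2 * al)) * ennreal ?Q)"
      using T by (subst nn_integral_add) (simp_all add: nn_integral_cmult S emeasure_time_measure mult.commute)
    finally show ?thesis .
  qed
  also have "\<dots> = ennreal ((al * ?S + T * ?Q / al) / 2)"
    using al S0 Q0 T by (simp add: ennreal_mult[symmetric] ennreal_plus[symmetric] field_simps del: ennreal_plus)
  finally show ?thesis
    using al S0 Q0 T by (subst (asm) ennreal_le_iff) auto
qed

text \<open>The difference of the solutions is that of the two mollification errors plus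
  \<open>c\<close>, and \<open>c\<close> is the memory term plus \<open>r\<close>. The memory term
  is bounded only pointwise, which restricts the estimate to a ball and brings in its
  volume.\<close>

lemma local_estimate:
  assumes t: "0 \<le> t" "t \<le> T" and al: "0 < al"
    and p1: "(\<integral>\<^sup>+x. ennreal \<bar>convolution rho (u1 t) x - u1 t x\<bar> \<partial>lborel) \<le> ennreal e1" "0 \<le> e1"
    and p2: "(\<integral>\<^sup>+x. ennreal \<bar>convolution rho (u2 t) x - u2 t x\<bar> \<partial>lborel) \<le> ennreal e1"
  shows "ball_dist R (u1 t) (u2 t) \<le> ennreal (2 * e1
    + measure lborel (cball (0::'a) R) * ((al * (\<integral>(t, x). (D t x)\<^sup>2 \<partial>(time_measure 0 T \<Otimes>\<^sub>M lborel)) + T * (\<integral>x. (K1 x)\<^sup>2 \<partial>lborel) / al) / 2)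
    + T * (delta * C))"
proof -
  let ?H = "(al * (\<integral>(t, x). (D t x)\<^sup>2 \<partial>(time_measure 0 T \<Otimes>\<^sub>M lborel)) + T * (\<integral>x. (K1 x)\<^sup>2 \<partial>lborel) / al) / 2"
  have H0: "0 \<le> ?H" using memory_bound[OF t al, of 0] by linarith
  have cr: "convolution rho (u1 t) x - convolution rho (u2 t) x = c t x" for x
    unfolding c_def W_def[abs_def] by (rule convolution_diff_right[OF conv_section(3)[OF i1[OF t]] conv_section(3)[OF i2[OF t]], symmetric])
  have [measurable]: "cball (0::'a) R \<in> sets borel" by (simp add: borel_closed)
  have [measurable]: "u1 t \<in> borel_measurable borel" "u2 t \<in> borel_measurable borel" "r t \<in> borel_measurable borel"
    using i1[OF t] i2[OF t] r_bounds(1)[OF t] by auto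
  have [measurable]: "convolution rho (u1 t) \<in> borel_measurable borel" "convolution rho (u2 t) \<in> borel_measurable borel"
    by (rule convolution_measurable'; measurable)+
  have "ball_dist R (u1 t) (u2 t) \<le> (\<integral>\<^sup>+x. ennreal \<bar>convolution rho (u1 t) x - u1 t x\<bar> + ennreal \<bar>convolution rho (u2 t) x - u2 t x\<bar>
     + (indicator (cball 0 R) x * ennreal ?H + ennreal \<bar>r t x\<bar>) \<partial>lborel)"
    unfolding ball_dist_def
  proof (rule nn_integral_mono)
    fix x :: 'a
    have "\<bar>c t x\<bar> \<le> ?H + \<bar>r t x\<bar>" using c_decomposition[OF t, of x] memory_bound[OF t al, of x] by linarith
    then have "\<bar>u1 t x - u2 t x\<bar> \<le> \<bar>convolution rho (u1 t) x - u1 t x\<bar> + \<bar>convolution rho (u2 t) x - u2 t x\<bar> + (?H + \<bar>r t x\<bar>)"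
      using cr[of x] by linarith
    then have "ennreal \<bar>u1 t x - u2 t x\<bar> \<le> ennreal \<bar>convolution rho (u1 t) x - u1 t x\<bar> + ennreal \<bar>convolution rho (u2 t) x - u2 t x\<bar> + (ennreal ?H + ennreal \<bar>r t x\<bar>)"
      using H0 by (simp add: ennreal_plus[symmetric] ennreal_leI del: ennreal_plus)
    then show "indicator (cball 0 R) x * ennreal \<bar>u1 t x - u2 t x\<bar> \<le> ennreal \<bar>convolution rho (u1 t) x - u1 t x\<bar> + ennreal \<bar>convolution rho (u2 t) x - u2 t x\<bar>
     + (indicator (cball 0 R) x * ennreal ?H + ennreal \<bar>r t x\<bar>)"
      by (cases "x \<in> cball 0 R") auto
  qed
  also have "\<dots> = (\<integral>\<^sup>+x. ennreal \<bar>convolution rho (u1 t) x - u1 t x\<bar> \<partial>lborel) + (\<integral>\<^sup>+x. ennreal \<bar>convolution rho (u2 t) x - u2 t x\<bar> \<partial>lborel)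
      + ((\<integral>\<^sup>+x. indicator (cball 0 R) x * ennreal ?H \<partial>(lborel :: 'a measure)) + (\<integral>\<^sup>+x. ennreal \<bar>r t x\<bar> \<partial>lborel))"
    by (simp add: nn_integral_add)
  also have "(\<integral>\<^sup>+x. indicator (cball 0 R) x * ennreal ?H \<partial>(lborel :: 'a measure)) = ennreal (measure lborel (cball (0::'a) R) * ?H)"
  proof -
    have "emeasure lborel (cball (0::'a) R) = ennreal (measure lborel (cball (0::'a) R))"
      by (rule emeasure_eq_ennreal_measure) (use emeasure_bounded_finite[of "cball (0::'a) R"] in auto)
    then have "(\<integral>\<^sup>+x. indicator (cball 0 R) x * ennreal h \<partial>(lborel :: 'a measure)) = ennreal (measure lborel (cball (0::'a) R) * h)" if "0 \<le> h" for h
      using that by (simp add: nn_integral_multc ennreal_mult)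
    from this[OF H0] show ?thesis .
  qed
  also have "(\<integral>\<^sup>+x. ennreal \<bar>convolution rho (u1 t) x - u1 t x\<bar> \<partial>lborel) + (\<integral>\<^sup>+x. ennreal \<bar>convolution rho (u2 t) x - u2 t x\<bar> \<partial>lborel)
      + (ennreal (measure lborel (cball (0::'a) R) * ?H) + (\<integral>\<^sup>+x. ennreal \<bar>r t x\<bar> \<partial>lborel))
      \<le> ennreal e1 + ennreal e1 + (ennreal (measure lborel (cball (0::'a) R) * ?H) + ennreal (T * (delta * C)))"
    unfolding nn_integral_abs_eq[OF r_bounds(1)[OF t]]
    by (intro add_mono p1 p2 order_refl ennreal_leI r_bounds(2) t)
  also have "\<dots> = ennreal (2 * e1 + measure lborel (cball (0::'a) R) * ?H + T * (delta * C))"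
  proof -
    have "0 \<le> measure lborel (cball (0::'a) R) * ?H" "0 \<le> T * (delta * C)"
      using H0 T delta_nonneg C by simp_all
    then show ?thesis using p1(2) by (simp add: ennreal_plus[symmetric] del: ennreal_plus)
  qed
  finally show ?thesis .
qed

end

text \<open>A mollified solution is Lipschitz in time, with the \<open>L^1\<close> norm of the
  kernel entering the constant; the price is the mollification error at the two times. For the
  family this gives equicontinuity in time although the flux itself is not bounded uniformly in
  \<open>e\<close>.\<close>

lemma mollified_time_estimate:
  fixes u :: "real \<Rightarrow> 'a::euclidean_space \<Rightarrow> real"
  assumes um [measurable]: "case_prod u \<in> borel_measurable (borel \<Otimes>\<^sub>M borel)"
    and st: "0 \<le> s" "s \<le> t"
    and ui: "\<And>t. 0 \<le> t \<Longrightarrow> integrable lborel (u t)" and C: "\<And>t. 0 \<le> t \<Longrightarrow> (\<integral>x. \<bar>u t x\<bar> \<partial>lborel) \<le> C"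
    and K: "integrable lborel K" "\<And>x. \<bar>K x\<bar> \<le> b" and rho: "integrable lborel rho"
    and mol: "\<And>t x. 0 \<le> t \<Longrightarrow> convolution rho (u t) x = convolution rho f x
      + (\<integral>s. convolution K (\<lambda>y. stefan_pos (u s y)) x \<partial>time_measure 0 t)"
  shows "(\<integral>\<^sup>+x. ennreal \<bar>u t x - u s x\<bar> \<partial>lborel) \<le> (\<integral>\<^sup>+x. ennreal \<bar>convolution rho (u t) x - u t x\<bar> \<partial>lborel)
    + (\<integral>\<^sup>+x. ennreal \<bar>convolution rho (u s) x - u s x\<bar> \<partial>lborel) + ennreal ((t - s) * ((\<integral>x. \<bar>K x\<bar> \<partial>lborel) * C))"
proof -
  have t: "0 \<le> t" using st by simp
  have [measurable]: "K \<in> borel_measurable borel" "rho \<in> borel_measurable borel" "u t \<in> borel_measurable borel" "u s \<in> borel_measurable borel"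
    using K rho ui[OF t] ui[OF st(1)] by auto
  have "0 \<le> (\<integral>x. \<bar>u 0 x\<bar> \<partial>lborel)" by simp
  then have C0: "0 \<le> C" using C[OF order_refl] by linarith
  let ?v = "\<lambda>s y. stefan_pos (u s y)"
  have vi: "integrable lborel (?v q)" "(\<integral>x. \<bar>?v q x\<bar> \<partial>lborel) \<le> C" if "0 \<le> q" for q
    using ui[OF that] stefan_pos_L1_le[OF ui[OF that]] C[OF that] by auto
  have cm: "case_prod (\<lambda>q x. convolution K (?v q) x) \<in> borel_measurable (borel \<Otimes>\<^sub>M borel)"
    unfolding convolution_def by measurable
  have b0: "0 \<le> b" using K(2)[of 0] by linarith
  have ci: "integrable (time_measure 0 t) (\<lambda>q. convolution K (?v q) x)" for x
  proof (rule tm.integrable_const_bound)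
    show "AE q in time_measure 0 t. norm (convolution K (?v q) x) \<le> b * C"
    proof (rule AE_time_measureI)
      fix q assume q: "0 \<le> q" "q \<le> t"
      have "\<bar>convolution K (?v q) x\<bar> \<le> b * (\<integral>y. \<bar>?v q y\<bar> \<partial>lborel)"
        by (rule convolution_abs_le_sup_kernel[OF vi(1)[OF q(1)] _ K(2)]) measurable
      also have "\<dots> \<le> b * C" using vi(2)[OF q(1)] b0 by (rule mult_left_mono)
      finally show "norm (convolution K (?v q) x) \<le> b * C" by simp
    qed
    show "(\<lambda>q. convolution K (?v q) x) \<in> borel_measurable (time_measure 0 t)" unfolding convolution_def by measurable
  qed
  define G where "G x = (\<integral>q. convolution K (?v q) x \<partial>time_measure s t)" for x
  have d: "convolution rho (u t) x - convolution rho (u s) x = G x" for x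
    using mol[OF t, of x] mol[OF st(1), of x] integral_time_measure_split(3)[OF ci st, of x] by (simp add: G_def)
  have KC: "0 \<le> (\<integral>x. \<bar>K x\<bar> \<partial>lborel) * C" using C0 by (simp add: integral_nonneg_AE)
  have KL: "(\<integral>x. \<bar>convolution K (?v q) x\<bar> \<partial>lborel) \<le> (\<integral>x. \<bar>K x\<bar> \<partial>lborel) * C" if "0 \<le> q" for q
    using order_trans[OF convolution_L1_le[OF K(1) vi(1)[OF that]] mult_left_mono[OF vi(2)[OF that]]] by (simp add: integral_nonneg_AE)
  have Gi: "integrable lborel G" "(\<integral>x. \<bar>G x\<bar> \<partial>lborel) \<le> (t - s) * ((\<integral>x. \<bar>K x\<bar> \<partial>lborel) * C)"
    unfolding G_def[abs_def]
    by (rule time_integral_L1_le[OF cm st(2) KC]; use st KL convolution_integrable[OF K(1) vi(1)] in auto)+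
  have [measurable]: "convolution rho (u t) \<in> borel_measurable borel" "convolution rho (u s) \<in> borel_measurable borel" "G \<in> borel_measurable borel"
    using Gi(1) by (auto intro!: convolution_measurable')
  have "(\<integral>\<^sup>+x. ennreal \<bar>u t x - u s x\<bar> \<partial>lborel) \<le> (\<integral>\<^sup>+x. ennreal \<bar>convolution rho (u t) x - u t x\<bar>
    + ennreal \<bar>convolution rho (u s) x - u s x\<bar> + ennreal \<bar>G x\<bar> \<partial>lborel)"
  proof (rule nn_integral_mono)
    fix x
    have "\<bar>u t x - u s x\<bar> \<le> \<bar>convolution rho (u t) x - u t x\<bar> + \<bar>convolution rho (u s) x - u s x\<bar> + \<bar>G x\<bar>"
      using d[of x] by linarith
    then show "ennreal \<bar>u t x - u s x\<bar> \<le> ennreal \<bar>convolution rho (u t) x - u t x\<bar> + ennreal \<bar>convolution rho (u s) x - u s x\<bar> + ennreal \<bar>G x\<bar>"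
      by (simp add: ennreal_plus[symmetric] ennreal_leI del: ennreal_plus)
  qed
  also have "\<dots> = (\<integral>\<^sup>+x. ennreal \<bar>convolution rho (u t) x - u t x\<bar> \<partial>lborel)
    + (\<integral>\<^sup>+x. ennreal \<bar>convolution rho (u s) x - u s x\<bar> \<partial>lborel) + (\<integral>\<^sup>+x. ennreal \<bar>G x\<bar> \<partial>lborel)"
    by (simp add: nn_integral_add)
  also have "(\<integral>\<^sup>+x. ennreal \<bar>G x\<bar> \<partial>lborel) \<le> ennreal ((t - s) * ((\<integral>x. \<bar>K x\<bar> \<partial>lborel) * C))"
    unfolding nn_integral_abs_eq[OF Gi(1)] by (rule ennreal_leI[OF Gi(2)])
  finally show ?thesis by (simp add: add_left_mono)
qed

subsection \<open>Convergence criteria\<close>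

lemma ball_dist_mono: "R \<le> S \<Longrightarrow> ball_dist R g h \<le> ball_dist S g h"
  unfolding ball_dist_def by (intro nn_integral_mono mult_right_mono) (auto simp: indicator_def)

lemma ball_dist_stefan_pos: "ball_dist R (\<lambda>x. stefan_pos (g x)) (\<lambda>x. stefan_pos (h x)) \<le> ball_dist R g h"
  unfolding ball_dist_def by (intro nn_integral_mono mult_left_mono ennreal_leI stefan_pos_diff_le) auto

text \<open>The weight serves both whole-space norms (\<open>w = 1\<close>) and distances on a ball;
  its finiteness permits passing to the limit in the product.\<close>

lemma fatou_L1_bound:
  fixes g :: "nat \<Rightarrow> 'a \<Rightarrow> real"
  assumes [measurable]: "\<And>n. g n \<in> borel_measurable M" and w: "w \<in> borel_measurable M"
    and lim: "AE x in M. (\<lambda>n. g n x) \<longlonglongrightarrow> h x"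
    and b: "\<forall>\<^sub>F n in sequentially. (\<integral>\<^sup>+x. w x * ennreal \<bar>g n x\<bar> \<partial>M) \<le> K" and w': "\<And>x. w x \<noteq> \<infinity>"
  shows "(\<integral>\<^sup>+x. w x * ennreal \<bar>h x\<bar> \<partial>M) \<le> K"
proof -
  note [measurable] = w
  have "(\<integral>\<^sup>+x. w x * ennreal \<bar>h x\<bar> \<partial>M) = (\<integral>\<^sup>+x. liminf (\<lambda>n. w x * ennreal \<bar>g n x\<bar>) \<partial>M)"
  proof (rule nn_integral_cong_AE)
    show "AE x in M. w x * ennreal \<bar>h x\<bar> = liminf (\<lambda>n. w x * ennreal \<bar>g n x\<bar>)"
      using lim
    proof eventually_elim
      case (elim x)
      have "(\<lambda>n. w x * ennreal \<bar>g n x\<bar>) \<longlonglongrightarrow> w x * ennreal \<bar>h x\<bar>"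
        using w'[of x] by (intro ennreal_tendsto_cmult tendsto_ennrealI tendsto_rabs elim) (simp add: less_top)
      then show ?case using lim_imp_Liminf[of sequentially] by (metis trivial_limit_sequentially)
    qed
  qed
  also have "\<dots> \<le> liminf (\<lambda>n. \<integral>\<^sup>+x. w x * ennreal \<bar>g n x\<bar> \<partial>M)"
    by (rule nn_integral_liminf) measurable
  also have "\<dots> \<le> limsup (\<lambda>n. \<integral>\<^sup>+x. w x * ennreal \<bar>g n x\<bar> \<partial>M)" by (rule Liminf_le_Limsup) simp
  also have "\<dots> \<le> K" by (rule Limsup_bounded[OF b])
  finally show ?thesis .
qed

text \<open>Split \<open>p n * g n\<close> into \<open>p n * (g n - h)\<close> and
  \<open>p n * h\<close>. The common support reduces the first part to the ball distance, and
  dominated convergence handles the second.\<close>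

lemma local_pairing_tendsto:
  fixes p :: "nat \<Rightarrow> 'a::euclidean_space \<Rightarrow> real" and g :: "nat \<Rightarrow> 'a \<Rightarrow> real"
  assumes pm [measurable]: "\<And>n. p n \<in> borel_measurable borel" "q \<in> borel_measurable borel"
    and pq: "\<And>x. (\<lambda>n. p n x) \<longlonglongrightarrow> q x" and B: "\<And>n x. \<bar>p n x\<bar> \<le> B" and R: "\<And>n x. R < norm x \<Longrightarrow> p n x = 0"
    and g: "\<And>n. integrable lborel (g n)" and h: "integrable lborel h"
    and gh: "(\<lambda>n. ball_dist R (g n) h) \<longlonglongrightarrow> 0"
  shows "(\<lambda>n. \<integral>x. p n x * g n x \<partial>lborel) \<longlonglongrightarrow> (\<integral>x. q x * h x \<partial>lborel)"
proof -
  have [measurable]: "h \<in> borel_measurable borel" "\<And>n. g n \<in> borel_measurable borel" using g h by auto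
  have [measurable]: "cball (0::'a) R \<in> sets borel" by (simp add: borel_closed)
  have B0: "0 \<le> B" using B[of 0 0] by linarith
  have q: "\<bar>q x\<bar> \<le> B" for x
    by (rule LIMSEQ_le_const2[OF tendsto_rabs[OF pq[of x]]]) (use B in auto)
  have i1: "integrable lborel (\<lambda>x. p n x * g n x)" "integrable lborel (\<lambda>x. p n x * h x)" for n
    by (rule integrable_mult_AE_bounded(2)[OF g, of _ B] integrable_mult_AE_bounded(2)[OF h, of _ B]; use B in auto)+
  have 1: "(\<lambda>n. \<integral>x. p n x * h x \<partial>lborel) \<longlonglongrightarrow> (\<integral>x. q x * h x \<partial>lborel)"
  proof (rule integral_dominated_convergence[where w="\<lambda>x. B * \<bar>h x\<bar>"])
    show "AE x in lborel. (\<lambda>n. p n x * h x) \<longlonglongrightarrow> q x * h x" by (intro AE_I2 tendsto_mult pq tendsto_const)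
    show "AE x in lborel. norm (p n x * h x) \<le> B * \<bar>h x\<bar>" for n
      using B by (intro AE_I2) (auto simp: abs_mult intro!: mult_right_mono)
  qed (use h in auto)
  have 2: "(\<lambda>n. (\<integral>x. p n x * g n x \<partial>lborel) - (\<integral>x. p n x * h x \<partial>lborel)) \<longlonglongrightarrow> 0"
  proof -
    have "ennreal \<bar>(\<integral>x. p n x * g n x \<partial>lborel) - (\<integral>x. p n x * h x \<partial>lborel)\<bar> \<le> ennreal B * ball_dist R (g n) h" for n
    proof -
      have "(\<integral>x. p n x * g n x \<partial>lborel) - (\<integral>x. p n x * h x \<partial>lborel) = (\<integral>x. p n x * (g n x - h x) \<partial>lborel)"
        using i1 by (simp add: right_diff_distrib)
      then have "ennreal \<bar>(\<integral>x. p n x * g n x \<partial>lborel) - (\<integral>x. p n x * h x \<partial>lborel)\<bar> \<le> (\<integral>\<^sup>+x. ennreal \<bar>p n x * (g n x - h x)\<bar> \<partial>lborel)"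
        using abs_integral_le_nn_integral by metis
      also have "\<dots> \<le> (\<integral>\<^sup>+x. ennreal B * (indicator (cball 0 R) x * ennreal \<bar>g n x - h x\<bar>) \<partial>lborel)"
      proof (rule nn_integral_mono)
        fix x
        show "ennreal \<bar>p n x * (g n x - h x)\<bar> \<le> ennreal B * (indicator (cball 0 R) x * ennreal \<bar>g n x - h x\<bar>)"
        proof (cases "x \<in> cball 0 R")
          case True
          have "\<bar>p n x * (g n x - h x)\<bar> \<le> B * \<bar>g n x - h x\<bar>" unfolding abs_mult using B by (intro mult_right_mono) auto
          then show ?thesis using True B0 by (simp add: ennreal_mult[symmetric] ennreal_leI)
        qed (simp add: R)
      qed
      also have "\<dots> = ennreal B * ball_dist R (g n) h"
        unfolding ball_dist_def by (rule nn_integral_cmult) measurable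
      finally show ?thesis .
    qed
    note le = this
    have z: "(\<lambda>n. ennreal B * ball_dist R (g n) h) \<longlonglongrightarrow> ennreal B * 0" by (intro ennreal_tendsto_cmult gh) simp
    have "(\<lambda>n. ennreal \<bar>(\<integral>x. p n x * g n x \<partial>lborel) - (\<integral>x. p n x * h x \<partial>lborel)\<bar>) \<longlonglongrightarrow> 0"
      by (rule tendsto_sandwich[OF _ _ tendsto_const]) (use le z in \<open>auto intro: always_eventually\<close>)
    then have "(\<lambda>n. ennreal \<bar>(\<integral>x. p n x * g n x \<partial>lborel) - (\<integral>x. p n x * h x \<partial>lborel)\<bar>) \<longlonglongrightarrow> ennreal 0" by simp
    then have "(\<lambda>n. \<bar>(\<integral>x. p n x * g n x \<partial>lborel) - (\<integral>x. p n x * h x \<partial>lborel)\<bar>) \<longlonglongrightarrow> 0"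
      by (rule tendsto_ennrealD) auto
    then show ?thesis by (rule tendsto_rabs_zero_cancel)
  qed
  show ?thesis using tendsto_add[OF 2 1] by simp
qed

section \<open>Uniform estimates for the mollified kernels\<close>

lemma nl_kernel_L1_small:
  fixes J :: "'a::euclidean_space \<Rightarrow> real"
  assumes J: "radial_kernel J" and d: "0 < d" and g: "0 < g"
  obtains h where "0 < h" "\<And>e. 0 < e \<Longrightarrow> e \<le> 1 \<Longrightarrow> e < h \<Longrightarrow> (\<integral>w. \<bar>nl_kernel J d e w - loc_kernel J d w\<bar> \<partial>lborel) \<le> g"
proof -
  have "\<exists>h>0. \<forall>e. 0 < e \<longrightarrow> e \<le> 1 \<longrightarrow> e < h \<longrightarrow> (\<integral>w. \<bar>nl_kernel J d e w - loc_kernel J d w\<bar> \<partial>lborel) \<le> g"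
  proof (rule ccontr)
    assume "\<not> ?thesis"
    \<comment> \<open>Dominated convergence speaks about sequences; a failure for the real parameter
      would produce a sequence of counterexamples tending to 0.\<close>
    then have "\<forall>n. \<exists>e. 0 < e \<and> e \<le> 1 \<and> e < 1 / real (Suc n) \<and> g < (\<integral>w. \<bar>nl_kernel J d e w - loc_kernel J d w\<bar> \<partial>lborel)"
      by (metis not_le of_nat_0_less_iff zero_less_Suc zero_less_divide_1_iff)
    then obtain X where X: "\<And>n. 0 < X n" "\<And>n. X n \<le> 1" "\<And>n. X n < 1 / real (Suc n)"
      "\<And>n. g < (\<integral>w. \<bar>nl_kernel J d (X n) w - loc_kernel J d w\<bar> \<partial>lborel)" by metis
    have "X \<longlonglongrightarrow> 0"
      by (rule tendsto_sandwich[OF _ _ tendsto_const inverse_Suc_tendsto])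
         (use X(1,3) in \<open>auto intro!: always_eventually less_imp_le\<close>)
    from nl_kernel_L1_tendsto(2)[OF J d X(1,2) this]
    have "(\<lambda>n. \<integral>w. \<bar>nl_kernel J d (X n) w - loc_kernel J d w\<bar> \<partial>lborel) \<longlonglongrightarrow> 0" .
    then have "g \<le> 0" by (rule LIMSEQ_le_const) (use X(4) in \<open>auto intro: less_imp_le\<close>)
    then show False using g by simp
  qed
  then show thesis using that by blast
qed

text \<open>A bound and a support common to all \<open>e <= 1\<close> control both norms;
  \<open>L\<close> is the sum of the two bounds so that one constant serves for both.\<close>

lemma nl_kernel_norms:
  fixes J :: "'a::euclidean_space \<Rightarrow> real"
  assumes J: "radial_kernel J" and d: "0 < d"
  obtains L where "0 \<le> L" "\<And>e. 0 < e \<Longrightarrow> e \<le> 1 \<Longrightarrow> (\<integral>w. \<bar>nl_kernel J d e w\<bar> \<partial>lborel) \<le> L"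
    "\<And>e. 0 < e \<Longrightarrow> e \<le> 1 \<Longrightarrow> (\<integral>w. (nl_kernel J d e w)\<^sup>2 \<partial>lborel) \<le> L"
proof -
  obtain C R where CR: "0 \<le> C" "0 < R" "\<And>e w. 0 < e \<Longrightarrow> \<bar>nl_kernel J d e w\<bar> \<le> C"
    "\<And>e w. 0 < e \<Longrightarrow> e \<le> 1 \<Longrightarrow> R < norm w \<Longrightarrow> nl_kernel J d e w = 0"
    by (rule nl_kernel_bounds[OF J d]) blast
  let ?V = "measure lborel (cball (0::'a) R)"
  have ii: "integrable lborel (\<lambda>w::'a. c * indicator (cball 0 R) w)" "(\<integral>w. c * indicator (cball (0::'a) R) w \<partial>lborel) = c * ?V" for c :: real
    by (auto intro!: integrable_mult_right integrable_real_indicator emeasure_bounded_finite)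
  show thesis
  proof (rule that[of "C * ?V + C\<^sup>2 * ?V"])
    fix e :: real assume e: "0 < e" "e \<le> 1"
    note K = nl_kernel_integrable[OF J d e(1)]
    have b: "\<bar>nl_kernel J d e w\<bar> \<le> C * indicator (cball 0 R) w" for w
      using CR(3)[OF e(1), of w] CR(4)[OF e, of w] by (cases "norm w \<le> R") auto
    have b2: "(nl_kernel J d e w)\<^sup>2 \<le> C\<^sup>2 * indicator (cball 0 R) w" for w
    proof (cases "norm w \<le> R")
      case True
      have "(nl_kernel J d e w)\<^sup>2 \<le> C\<^sup>2" using CR(3)[OF e(1), of w] CR(1) by (simp add: abs_le_square_iff[symmetric])
      then show ?thesis using True by simp
    qed (use CR(4)[OF e, of w] in simp)
    have "(\<integral>w. \<bar>nl_kernel J d e w\<bar> \<partial>lborel) \<le> C * ?V"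
      unfolding ii(2)[symmetric] using K ii(1) b by (intro integral_mono) auto
    moreover have "(\<integral>w. (nl_kernel J d e w)\<^sup>2 \<partial>lborel) \<le> C\<^sup>2 * ?V"
    proof -
      have "integrable lborel (\<lambda>w. (nl_kernel J d e w)\<^sup>2)"
        unfolding power2_eq_square by (rule integrable_mult_AE_bounded(1)[OF K, of _ C]) (use K CR(3)[OF e(1)] in auto)
      then show ?thesis unfolding ii(2)[symmetric] using ii(1) b2 by (intro integral_mono) auto
    qed
    moreover have "0 \<le> C * ?V" "0 \<le> C\<^sup>2 * ?V" using CR(1) by simp_all
    ultimately show "(\<integral>w. \<bar>nl_kernel J d e w\<bar> \<partial>lborel) \<le> C * ?V + C\<^sup>2 * ?V" "(\<integral>w. (nl_kernel J d e w)\<^sup>2 \<partial>lborel) \<le> C * ?V + C\<^sup>2 * ?V"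
      by linarith+
  qed (use CR(1) in simp)
qed

text \<open>What one solution contributes to \<open>comparison\<close>, at all mollification scales
  \<open>d\<close> at once: \<open>K d\<close> is its operator applied to \<open>moll d\<close>, and
  \<open>er d\<close> bounds its mollification error integrated in time. The kernels in use are
  \<open>nl_kernel J d e\<close> and \<open>loc_kernel J d\<close>.\<close>

definition admissible :: "('a::euclidean_space \<Rightarrow> real) \<Rightarrow> real \<Rightarrow> real \<Rightarrow> real \<Rightarrow> (real \<Rightarrow> real) \<Rightarrow>
    (real \<Rightarrow> 'a \<Rightarrow> real) \<Rightarrow> (real \<Rightarrow> 'a \<Rightarrow> real) \<Rightarrow> bool" where
  "admissible f T M C er u K \<longleftrightarrow> case_prod u \<in> borel_measurable (borel \<Otimes>\<^sub>M borel) \<and>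
     (\<forall>t. 0 \<le> t \<and> t \<le> T \<longrightarrow> integrable lborel (u t) \<and> (\<integral>x. \<bar>u t x\<bar> \<partial>lborel) \<le> C \<and> (AE x in lborel. \<bar>u t x\<bar> \<le> M)) \<and>
     (\<forall>d>0. integrable lborel (K d) \<and> (\<exists>b. \<forall>x. \<bar>K d x\<bar> \<le> b) \<and>
        (\<forall>t x. 0 \<le> t \<and> t \<le> T \<longrightarrow> convolution (moll d) (u t) x = convolution (moll d) f x
            + (\<integral>s. convolution (K d) (\<lambda>y. stefan_pos (u s y)) x \<partial>time_measure 0 t)) \<and>
        (\<integral>\<^sup>+t. trans_err d (u t) \<partial>time_measure 0 T) \<le> ennreal (er d))"

lemma admissible_errors:
  assumes u: "admissible f T M C er u K" and d: "0 < d"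
  shows "(\<integral>\<^sup>+t. \<integral>\<^sup>+x. ennreal \<bar>convolution (moll d) (u t) x - u t x\<bar> \<partial>lborel \<partial>time_measure 0 T) \<le> ennreal (er d)"
    and "(\<integral>\<^sup>+t. \<integral>\<^sup>+x. ennreal \<bar>convolution (moll d) (\<lambda>y. stefan_pos (u t y)) x - stefan_pos (u t x)\<bar> \<partial>lborel \<partial>time_measure 0 T) \<le> ennreal (er d)"
proof -
  have i: "integrable lborel (u t)" if "0 \<le> t" "t \<le> T" for t using u that by (simp add: admissible_def)
  have e: "(\<integral>\<^sup>+t. trans_err d (u t) \<partial>time_measure 0 T) \<le> ennreal (er d)" using u d by (simp add: admissible_def)
  have "(\<integral>\<^sup>+t. \<integral>\<^sup>+x. ennreal \<bar>convolution (moll d) (u t) x - u t x\<bar> \<partial>lborel \<partial>time_measure 0 T) \<le> (\<integral>\<^sup>+t. trans_err d (u t) \<partial>time_measure 0 T)"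
    by (intro nn_integral_mono_AE AE_time_measureI mollification_error_le i d)
  also note e
  finally show "(\<integral>\<^sup>+t. \<integral>\<^sup>+x. ennreal \<bar>convolution (moll d) (u t) x - u t x\<bar> \<partial>lborel \<partial>time_measure 0 T) \<le> ennreal (er d)" .
  have "(\<integral>\<^sup>+t. \<integral>\<^sup>+x. ennreal \<bar>convolution (moll d) (\<lambda>y. stefan_pos (u t y)) x - stefan_pos (u t x)\<bar> \<partial>lborel \<partial>time_measure 0 T) \<le> (\<integral>\<^sup>+t. trans_err d (u t) \<partial>time_measure 0 T)"
  proof (intro nn_integral_mono_AE AE_time_measureI)
    fix t assume t: "0 \<le> t" "t \<le> T"
    have "(\<integral>\<^sup>+x. ennreal \<bar>convolution (moll d) (\<lambda>y. stefan_pos (u t y)) x - stefan_pos (u t x)\<bar> \<partial>lborel) \<le> trans_err d (\<lambda>y. stefan_pos (u t y))"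
      by (intro mollification_error_le stefan_pos_integrable i t d)
    also have "\<dots> \<le> trans_err d (u t)" by (rule trans_err_stefan_pos)
    finally show "(\<integral>\<^sup>+x. ennreal \<bar>convolution (moll d) (\<lambda>y. stefan_pos (u t y)) x - stefan_pos (u t x)\<bar> \<partial>lborel) \<le> trans_err d (u t)" .
  qed
  also note e
  finally show "(\<integral>\<^sup>+t. \<integral>\<^sup>+x. ennreal \<bar>convolution (moll d) (\<lambda>y. stefan_pos (u t y)) x - stefan_pos (u t x)\<bar> \<partial>lborel \<partial>time_measure 0 T) \<le> ennreal (er d)" .
qed

section \<open>Uniform closeness of two admissible solutions\<close>

lemma admissible_comparison:
  fixes J :: "'a::euclidean_space \<Rightarrow> real"
  assumes J: "radial_kernel J" and e: "0 < e" and nonneg: "0 \<le> T" "0 \<le> M" "0 \<le> C" "0 \<le> er d" and d: "0 < d"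
    and u1: "admissible f T M C er u1 (\<lambda>d. nl_kernel J d e)" and u2: "admissible f T M C er u2 K2"
  obtains B b where "comparison (rescale e J) (1 / e\<^sup>2) B T M C (er d) f (moll d) (K2 d) b u1 u2"
proof -
  obtain B where pk: "prob_kernel (rescale e J) (1 / e\<^sup>2) B"
    by (rule prob_kernel_radial[OF radial_kernel_rescale[OF J e], of "1 / e\<^sup>2"]) (use e in auto)
  have "\<exists>b. \<forall>x. \<bar>K2 d x\<bar> \<le> b" using u2 d by (simp add: admissible_def)
  then obtain b where b: "\<And>x. \<bar>K2 d x\<bar> \<le> b" by blast
  have K1: "diffuse (rescale e J) (1 / e\<^sup>2) (moll d) = nl_kernel J d e" by (simp add: nl_kernel_def)
  have "comparison (rescale e J) (1 / e\<^sup>2) B T M C (er d) f (moll d) (K2 d) b u1 u2"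
  proof (intro comparison.intro comparison_axioms.intro pk nonneg)
    show "radial_kernel (moll d)" by (rule radial_kernel_moll[OF d])
  qed (use u1 u2 d b admissible_errors[OF u1 d] admissible_errors[OF u2 d] in \<open>auto simp: admissible_def K1\<close>)
  then show thesis using that by blast
qed

text \<open>The scales and the kernel tolerance \<open>g\<close> are chosen before the solutions, so
  they serve for all of them. The budget for \<open>e\<close> is a quarter for the mollification
  error at time \<open>t\<close>, a quarter for the kernel part of the memory term, two eighths for
  the part with \<open>D\<close>, and a quarter for the remainder. Here \<open>er\<close> measures
  errors integrated in time and \<open>pe\<close> those at the single time \<open>t\<close>.\<close>

lemma closeness:
  fixes J :: "'a::euclidean_space \<Rightarrow> real"
  assumes J: "radial_kernel J" and nonneg: "0 \<le> T" "0 \<le> M" "0 \<le> C" and er: "\<And>d. 0 < d \<Longrightarrow> 0 \<le> er d" "\<And>s. 0 < s \<Longrightarrow> \<exists>d>0. er d \<le> s"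
    and pe: "\<And>d. 0 < d \<Longrightarrow> 0 \<le> pe d" "\<And>s. 0 < s \<Longrightarrow> \<exists>d>0. pe d \<le> s" and e: "0 < e"
  obtains d1 d2 g where "0 < d1" "0 < d2" "0 < g"
    "\<forall>\<epsilon> u1 u2 K2 t. 0 < \<epsilon> \<and> \<epsilon> \<le> 1 \<and> admissible f T M C er u1 (\<lambda>d. nl_kernel J d \<epsilon>) \<and> admissible f T M C er u2 K2 \<and>
      (\<integral>w. \<bar>nl_kernel J d1 \<epsilon> w - K2 d1 w\<bar> \<partial>lborel) \<le> g \<and> (\<integral>w. \<bar>nl_kernel J d2 \<epsilon> w - K2 d2 w\<bar> \<partial>lborel) \<le> g \<and>
      0 \<le> t \<and> t \<le> T \<and> (\<forall>d>0. trans_err d (u1 t) \<le> ennreal (pe d)) \<and>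
      (\<forall>d>0. trans_err d (u2 t) \<le> ennreal (pe d)) \<longrightarrow> ball_dist R (u1 t) (u2 t) \<le> ennreal e"
proof -
  define V where "V = measure lborel (cball (0::'a) R)"
  have V0: "0 \<le> V" by (simp add: V_def)
  obtain d2 where d2: "0 < d2" "pe d2 \<le> e / 8" using pe(2)[of "e / 8"] e by auto
  obtain L where L: "0 \<le> L" "\<And>\<epsilon>. 0 < \<epsilon> \<Longrightarrow> \<epsilon> \<le> 1 \<Longrightarrow> (\<integral>w. (nl_kernel J d2 \<epsilon> w)\<^sup>2 \<partial>lborel) \<le> L"
    by (rule nl_kernel_norms[OF J d2(1)]) blast
  \<comment> \<open>Makes the kernel part \<open>V * (T * L / al) / 2\<close> at most
    \<open>e / 4\<close>; the summand 1 keeps \<open>al\<close> positive when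
    \<open>V * T * L\<close> is 0.\<close>
  define al where "al = 2 * (V * T * L + 1) / e"
  have VTL: "0 \<le> V * T * L" using V0 nonneg L by simp
  have al0: "0 < al" using VTL e by (simp add: al_def)
  \<comment> \<open>The energy estimate contributes \<open>V * al * (6 * M * s) / 2\<close>, that is
    \<open>3 * V * al * M * s\<close>, which has to stay below \<open>e / 8\<close>.\<close>
  define s where "s = e / (24 * (V * al * M + 1))"
  have VaM: "0 \<le> V * al * M" using V0 al0 nonneg by simp
  have s0: "0 < s" using VaM e by (simp add: s_def)
  obtain d1 where d1: "0 < d1" "er d1 \<le> s" using er(2)[OF s0] by auto
  \<comment> \<open>The total coefficient that allots \<open>g\<close>: its first summand is twice
    the contribution through the energy estimate at scale \<open>d1\<close>, its second that of the
    remainder at scale \<open>d2\<close>.\<close>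
  define X where "X = V * al * M * T * T * C + T * C"
  have X0: "0 \<le> V * al * M * T * T * C" "0 \<le> T * C" using VaM nonneg by simp_all
  define g where "g = e / (4 * (X + 1))"
  have g0: "0 < g" using X0 e by (simp add: g_def X_def)
  have t1: "V * (T * L / al) / 2 \<le> e / 4"
  proof -
    have "V * (T * L / al) / 2 = (V * T * L) / (V * T * L + 1) * (e / 4)"
      using VTL e by (simp add: al_def field_simps)
    also have "\<dots> \<le> 1 * (e / 4)" using VTL e by (intro mult_right_mono) (auto simp: divide_simps)
    finally show ?thesis by simp
  qed
  have t2: "V * al * (6 * M * s) / 2 \<le> e / 8"
  proof -
    have "V * al * (6 * M * s) / 2 = (V * al * M) / (V * al * M + 1) * (e / 8)"
      using VaM by (simp add: s_def field_simps)
    also have "\<dots> \<le> 1 * (e / 8)" using VaM e by (intro mult_right_mono) (auto simp: divide_simps)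
    finally show ?thesis by simp
  qed
  have gX: "X * g \<le> e / 4"
  proof -
    have "X * g = X / (X + 1) * (e / 4)" using X0 by (simp add: g_def X_def field_simps)
    also have "\<dots> \<le> 1 * (e / 4)" using X0 e by (intro mult_right_mono) (auto simp: divide_simps X_def)
    finally show ?thesis by simp
  qed
  have t3: "V * al * (M * (T * (T * (g * C)))) / 2 \<le> e / 8" and t4: "T * (g * C) \<le> e / 4"
  proof -
    have "0 \<le> V * al * M * T * T * C * g" "0 \<le> T * C * g" using X0 g0 by (simp_all add: less_imp_le)
    moreover have "V * al * M * T * T * C * g + T * C * g \<le> e / 4" using gX by (simp add: X_def distrib_right)
    ultimately have "V * al * M * T * T * C * g \<le> e / 4" "T * C * g \<le> e / 4" by linarith+
    then show "V * al * (M * (T * (T * (g * C)))) / 2 \<le> e / 8" "T * (g * C) \<le> e / 4" by (simp_all add: mult_ac)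
  qed
  show thesis
  proof (rule that[OF d1(1) d2(1) g0], intro allI impI)
    fix \<epsilon> u1 u2 K2 t
    assume H: "0 < \<epsilon> \<and> \<epsilon> \<le> 1 \<and> admissible f T M C er u1 (\<lambda>d. nl_kernel J d \<epsilon>) \<and> admissible f T M C er u2 K2 \<and>
      (\<integral>w. \<bar>nl_kernel J d1 \<epsilon> w - K2 d1 w\<bar> \<partial>lborel) \<le> g \<and> (\<integral>w. \<bar>nl_kernel J d2 \<epsilon> w - K2 d2 w\<bar> \<partial>lborel) \<le> g \<and>
      0 \<le> t \<and> t \<le> T \<and> (\<forall>d>0. trans_err d (u1 t) \<le> ennreal (pe d)) \<and>
      (\<forall>d>0. trans_err d (u2 t) \<le> ennreal (pe d))"
    then have \<epsilon>: "0 < \<epsilon>" "\<epsilon> \<le> 1" and u1: "admissible f T M C er u1 (\<lambda>d. nl_kernel J d \<epsilon>)" and u2: "admissible f T M C er u2 K2"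
      and g1: "(\<integral>w. \<bar>nl_kernel J d1 \<epsilon> w - K2 d1 w\<bar> \<partial>lborel) \<le> g" and g2: "(\<integral>w. \<bar>nl_kernel J d2 \<epsilon> w - K2 d2 w\<bar> \<partial>lborel) \<le> g"
      and t: "0 \<le> t" "t \<le> T" by blast+
    have p1: "trans_err d (u1 t) \<le> ennreal (pe d)" and p2: "trans_err d (u2 t) \<le> ennreal (pe d)" if "0 < d" for d
      using H that by blast+
    obtain B1 b1 where c1: "comparison (rescale \<epsilon> J) (1 / \<epsilon>\<^sup>2) B1 T M C (er d1) f (moll d1) (K2 d1) b1 u1 u2"
      by (rule admissible_comparison[OF J \<epsilon>(1) nonneg er(1)[OF d1(1)] d1(1) u1 u2])
    obtain B2 b2 where c2: "comparison (rescale \<epsilon> J) (1 / \<epsilon>\<^sup>2) B2 T M C (er d2) f (moll d2) (K2 d2) b2 u1 u2"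
      by (rule admissible_comparison[OF J \<epsilon>(1) nonneg er(1)[OF d2(1)] d2(1) u1 u2])
    interpret c1: comparison "rescale \<epsilon> J" "1 / \<epsilon>\<^sup>2" B1 T M C "er d1" f "moll d1" "K2 d1" b1 u1 u2 by (rule c1)
    interpret c2: comparison "rescale \<epsilon> J" "1 / \<epsilon>\<^sup>2" B2 T M C "er d2" f "moll d2" "K2 d2" b2 u1 u2 by (rule c2)
    let ?S = "\<integral>(t, x). (c2.D t x)\<^sup>2 \<partial>(time_measure 0 T \<Otimes>\<^sub>M lborel)"
    \<comment> \<open>The difference \<open>D\<close> does not involve the mollifier, so the energy
      estimate at scale \<open>d1\<close> may be inserted into the pointwise estimate at scale
      \<open>d2\<close>.\<close>
    have S: "?S \<le> 6 * M * s + M * (T * (T * (g * C)))"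
    proof -
      have "?S \<le> 6 * M * er d1 + M * (T * (T * (c1.delta * C)))" by (rule c1.comparison_L2(2))
      also have "\<dots> \<le> 6 * M * s + M * (T * (T * (g * C)))"
        using d1(2) g1 nonneg unfolding c1.delta_def nl_kernel_def[symmetric]
        by (intro add_mono mult_left_mono mult_right_mono) auto
      finally show ?thesis .
    qed
    have i: "integrable lborel (u1 t)" "integrable lborel (u2 t)" using c1.i1[OF t] c1.i2[OF t] by auto
    have q1: "(\<integral>\<^sup>+x. ennreal \<bar>convolution (moll d2) (u1 t) x - u1 t x\<bar> \<partial>lborel) \<le> ennreal (pe d2)"
      using mollification_error_le[OF i(1) d2(1)] p1[OF d2(1)] by (rule order_trans)
    have q2: "(\<integral>\<^sup>+x. ennreal \<bar>convolution (moll d2) (u2 t) x - u2 t x\<bar> \<partial>lborel) \<le> ennreal (pe d2)"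
      using mollification_error_le[OF i(2) d2(1)] p2[OF d2(1)] by (rule order_trans)
    have "ball_dist R (u1 t) (u2 t) \<le> ennreal (2 * pe d2 + V * ((al * ?S + T * (\<integral>w. (nl_kernel J d2 \<epsilon> w)\<^sup>2 \<partial>lborel) / al) / 2) + T * (c2.delta * C))"
      using c2.local_estimate[OF t al0 q1 pe(1)[OF d2(1)] q2, of R] unfolding V_def nl_kernel_def .
    also have "\<dots> \<le> ennreal e"
    proof (rule ennreal_leI)
      have "T * (c2.delta * C) \<le> T * (g * C)"
        using g2 nonneg unfolding c2.delta_def nl_kernel_def[symmetric] by (intro mult_left_mono mult_right_mono) auto
      moreover have "V * ((al * ?S + T * (\<integral>w. (nl_kernel J d2 \<epsilon> w)\<^sup>2 \<partial>lborel) / al) / 2)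
          \<le> V * ((al * (6 * M * s + M * (T * (T * (g * C)))) + T * L / al) / 2)"
        using S L(2)[OF \<epsilon>] V0 al0 nonneg by (intro mult_left_mono divide_right_mono add_mono) auto
      moreover have "V * ((al * (6 * M * s + M * (T * (T * (g * C)))) + T * L / al) / 2)
          = V * al * (6 * M * s) / 2 + V * al * (M * (T * (T * (g * C)))) / 2 + V * (T * L / al) / 2"
        by (simp add: distrib_left add_divide_distrib mult.assoc)
      ultimately show "2 * pe d2 + V * ((al * ?S + T * (\<integral>w. (nl_kernel J d2 \<epsilon> w)\<^sup>2 \<partial>lborel) / al) / 2) + T * (c2.delta * C) \<le> e"
        using t1 t2 t3 t4 d2(2) by linarith
    qed
    finally show "ball_dist R (u1 t) (u2 t) \<le> ennreal e" .
  qed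
qed

subsection \<open>The limit of the family\<close>

lemma small_of_tendsto:
  fixes F :: "real \<Rightarrow> real"
  assumes "(\<lambda>n. F (1 / real (Suc n))) \<longlonglongrightarrow> 0" "0 < s"
  shows "\<exists>d>0. F d \<le> s"
proof -
  have "\<forall>\<^sub>F n in sequentially. F (1 / real (Suc n)) < s" using order_tendstoD(2)[OF assms(1)] assms(2) by simp
  then obtain n where "F (1 / real (Suc n)) < s" unfolding eventually_sequentially by blast
  then show ?thesis by (intro exI[of _ "1 / real (Suc n)"]) simp
qed

lemma enn2real_tendsto_0:
  fixes F :: "nat \<Rightarrow> ennreal"
  assumes "F \<longlonglongrightarrow> 0" shows "(\<lambda>n. enn2real (F n)) \<longlonglongrightarrow> 0"
  using tendsto_enn2real[of F 0 sequentially] assms by simp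

lemma ball_dist_triangle:
  fixes g h w :: "'a::euclidean_space \<Rightarrow> real"
  assumes [measurable]: "g \<in> borel_measurable borel" "h \<in> borel_measurable borel" "w \<in> borel_measurable borel"
  shows "ball_dist R g h \<le> ball_dist R w g + ball_dist R w h"
proof -
  have [measurable]: "cball (0::'a) R \<in> sets borel" by (simp add: borel_closed)
  have "ball_dist R g h \<le> (\<integral>\<^sup>+x. indicator (cball 0 R) x * ennreal \<bar>w x - g x\<bar> + indicator (cball 0 R) x * ennreal \<bar>w x - h x\<bar> \<partial>lborel)"
    unfolding ball_dist_def distrib_left[symmetric]
    by (intro nn_integral_mono mult_left_mono) (simp_all flip: ennreal_plus)
  also have "\<dots> = ball_dist R w g + ball_dist R w h"
    unfolding ball_dist_def by (rule nn_integral_add) measurable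
  finally show ?thesis .
qed

lemma AE_eq_of_ball_dist:
  fixes g h :: "'a::euclidean_space \<Rightarrow> real"
  assumes [measurable]: "g \<in> borel_measurable borel" "h \<in> borel_measurable borel"
    and z: "\<And>n::nat. ball_dist (real n) g h = 0"
  shows "AE x in lborel. g x = h x"
proof -
  have "AE x in lborel. \<forall>n::nat. x \<in> cball 0 (real n) \<longrightarrow> g x = h x"
    unfolding AE_all_countable
  proof
    fix n :: nat
    have [measurable]: "cball (0::'a) (real n) \<in> sets borel" by (simp add: borel_closed)
    have "AE x in lborel. indicator (cball 0 (real n)) x * ennreal \<bar>g x - h x\<bar> = 0"
      using z[of n] unfolding ball_dist_def by (subst (asm) nn_integral_0_iff_AE) auto
    then show "AE x in lborel. x \<in> cball 0 (real n) \<longrightarrow> g x = h x"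
      by eventually_elim (auto simp: ennreal_eq_0_iff)
  qed
  then show ?thesis
  proof eventually_elim
    case (elim x)
    obtain n :: nat where "norm x \<le> real n" using real_arch_simple by blast
    then show ?case using elim by auto
  qed
qed

section \<open>Uniform bounds for the family and its Cauchy property\<close>

locale stefan_family =
  fixes J f :: "'a::euclidean_space \<Rightarrow> real" and U :: "real \<Rightarrow> real \<Rightarrow> 'a \<Rightarrow> real" and M :: real
  assumes J: "radial_kernel J" and f: "integrable lborel f" and M: "1 \<le> M" "AE x in lborel. \<bar>f x\<bar> \<le> M"
    and U: "\<And>e. 0 < e \<Longrightarrow> nonlocal_stefan_solution J e f (U e)"
begin

definition u :: "real \<Rightarrow> real \<Rightarrow> 'a \<Rightarrow> real" where "u e = ext0 (U e)"
definition Cf :: real where "Cf = (\<integral>x. \<bar>f x\<bar> \<partial>lborel)"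
definition terr :: "real \<Rightarrow> real" where "terr d = enn2real (trans_err d f)"

lemma f_measurable [measurable]: "f \<in> borel_measurable borel" using f by simp

lemma Cf_nonneg: "0 \<le> Cf" by (simp add: Cf_def)

lemma finite_trans_err:
  assumes "integrable lborel g" shows "trans_err d g < \<infinity>"
proof -
  have "trans_err d g \<le> 2 * (\<integral>\<^sup>+x. ennreal \<bar>g x\<bar> \<partial>lborel)" by (rule trans_err_le) (use assms in simp)
  also have "\<dots> < \<infinity>" using assms by (simp add: integrable_real_iff ennreal_mult_less_top)
  finally show ?thesis .
qed

lemma terr: "ennreal (terr d) = trans_err d f" "0 \<le> terr d"
  using finite_trans_err[OF f, of d] by (simp_all add: terr_def)

lemma terr_tendsto: "(\<lambda>n. terr (1 / real (Suc n))) \<longlonglongrightarrow> 0"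
  unfolding terr_def by (intro enn2real_tendsto_0 trans_err_tendsto f inverse_Suc_tendsto)

lemma u_kernel:
  assumes e: "0 < e"
  obtains B where "prob_kernel (rescale e J) (1 / e\<^sup>2) B" "prob_kernel.sol (rescale e J) (1 / e\<^sup>2) f (u e)"
proof -
  obtain B where pk: "prob_kernel (rescale e J) (1 / e\<^sup>2) B"
    by (rule prob_kernel_radial[OF radial_kernel_rescale[OF J e], of "1 / e\<^sup>2"]) (use e in auto)
  show thesis
    unfolding u_def by (rule that[OF pk]) (simp add: u_def sol_of_nonlocal_stefan_solution[OF pk U[OF e] f])
qed

lemma u_facts:
  assumes e: "0 < e"
  shows "case_prod (u e) \<in> borel_measurable (borel \<Otimes>\<^sub>M borel)"
    and "0 \<le> t \<Longrightarrow> integrable lborel (u e t)"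
    and "0 \<le> t \<Longrightarrow> (\<integral>x. \<bar>u e t x\<bar> \<partial>lborel) \<le> Cf"
    and "0 \<le> t \<Longrightarrow> AE x in lborel. \<bar>u e t x\<bar> \<le> M"
    and "0 \<le> t \<Longrightarrow> trans_err d (u e t) \<le> ennreal (terr d)"
    and "0 \<le> t \<Longrightarrow> 0 < d \<Longrightarrow> convolution (moll d) (u e t) x = convolution (moll d) f x
      + (\<integral>s. convolution (nl_kernel J d e) (\<lambda>y. stefan_pos (u e s y)) x \<partial>time_measure 0 t)"
    and "0 \<le> t \<Longrightarrow> test_function \<phi> \<Longrightarrow> (\<integral>x. u e t x * \<phi> (x, t) \<partial>lborel) = (\<integral>x. f x * \<phi> (x, 0) \<partial>lborel)
      + (\<integral>r. \<integral>x. time_deriv \<phi> (x, r) * u e r x \<partial>lborel \<partial>time_measure 0 t)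
      + (\<integral>s. \<integral>x. nonlocal_op J e \<phi> (x, s) * stefan_pos (u e s x) \<partial>lborel \<partial>time_measure 0 t)"
proof -
  obtain B where pk: "prob_kernel (rescale e J) (1 / e\<^sup>2) B" and s: "prob_kernel.sol (rescale e J) (1 / e\<^sup>2) f (u e)"
    by (rule u_kernel[OF e])
  interpret prob_kernel "rescale e J" "1 / e\<^sup>2" B by (rule pk)
  show m: "case_prod (u e) \<in> borel_measurable (borel \<Otimes>\<^sub>M borel)" by (rule solD(1)[OF s])
  show "convolution (moll d) (u e t) x = convolution (moll d) f x
      + (\<integral>s. convolution (nl_kernel J d e) (\<lambda>y. stefan_pos (u e s y)) x \<partial>time_measure 0 t)" if "0 \<le> t" "0 < d"
    by (rule sol_mollified[OF J e pk s f that])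
  show "(\<integral>x. u e t x * \<phi> (x, t) \<partial>lborel) = (\<integral>x. f x * \<phi> (x, 0) \<partial>lborel)
      + (\<integral>r. \<integral>x. time_deriv \<phi> (x, r) * u e r x \<partial>lborel \<partial>time_measure 0 t)
      + (\<integral>s. \<integral>x. nonlocal_op J e \<phi> (x, s) * stefan_pos (u e s x) \<partial>lborel \<partial>time_measure 0 t)" if "0 \<le> t" "test_function \<phi>"
    by (rule sol_weak_form[OF J e pk s f that(2,1)])
  assume t: "0 \<le> t"
  show i: "integrable lborel (u e t)" by (rule solD(2)[OF s t])
  show "(\<integral>x. \<bar>u e t x\<bar> \<partial>lborel) \<le> Cf" unfolding Cf_def by (rule sol_L1_le[OF s f t])
  have "AE x in lborel. f x \<le> M" "AE x in lborel. - M \<le> f x" using M(2) by (auto elim!: eventually_mono)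
  then have "AE x in lborel. u e t x \<le> M" "AE x in lborel. - M \<le> u e t x"
    using sol_le[OF s M(1) _ t] sol_ge[OF s _ _ t, of M] M(1) by auto
  then show "AE x in lborel. \<bar>u e t x\<bar> \<le> M" by eventually_elim simp
  have "trans_err d (u e t) \<le> trans_err d f"
  proof (rule trans_err_mono)
    fix c
    have "integrable lborel (\<lambda>x. u e t (x + c) - u e t x)" "integrable lborel (\<lambda>x. f (x + c) - f x)"
      using integrable_lborel_shift(1)[OF i, of c] integrable_lborel_shift(1)[OF f, of c] i f by auto
    then show "(\<integral>\<^sup>+x. ennreal \<bar>u e t (x + c) - u e t x\<bar> \<partial>lborel) \<le> (\<integral>\<^sup>+x. ennreal \<bar>f (x + c) - f x\<bar> \<partial>lborel)"
      using sol_translation_le[OF s f t, of c] by (simp add: nn_integral_abs_eq ennreal_leI)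
  qed
  then show "trans_err d (u e t) \<le> ennreal (terr d)" by (simp add: terr)
qed

lemma u_section_measurable: "0 < e \<Longrightarrow> u e t \<in> borel_measurable borel"
proof -
  assume "0 < e"
  note [measurable] = u_facts(1)[OF this]
  show ?thesis by measurable
qed

lemma u_admissible:
  assumes e: "0 < e" and T: "0 \<le> T" and C: "Cf \<le> C" and M': "M \<le> M'" and er: "\<And>d. 0 < d \<Longrightarrow> T * terr d \<le> er d"
  shows "admissible f T M' C er (u e) (\<lambda>d. nl_kernel J d e)"
  unfolding admissible_def
proof (intro conjI allI impI u_facts(1)[OF e])
  fix t assume t: "0 \<le> t \<and> t \<le> T"
  show "integrable lborel (u e t)" by (rule u_facts(2)[OF e]) (use t in simp)
  show "(\<integral>x. \<bar>u e t x\<bar> \<partial>lborel) \<le> C" using u_facts(3)[OF e, of t] C t by simp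
  have "AE x in lborel. \<bar>u e t x\<bar> \<le> M" by (rule u_facts(4)[OF e]) (use t in simp)
  then show "AE x in lborel. \<bar>u e t x\<bar> \<le> M'" by eventually_elim (use M' in simp)
next
  fix d :: real assume d: "0 < d"
  show "integrable lborel (nl_kernel J d e)" by (rule nl_kernel_integrable[OF J d e])
  show "\<exists>b. \<forall>x. \<bar>nl_kernel J d e x\<bar> \<le> b" by (rule nl_kernel_bounds[OF J d]) (use e in blast)
  show "convolution (moll d) (u e t) x = convolution (moll d) f x
      + (\<integral>s. convolution (nl_kernel J d e) (\<lambda>y. stefan_pos (u e s y)) x \<partial>time_measure 0 t)" if "0 \<le> t \<and> t \<le> T" for t x
    by (rule u_facts(6)[OF e _ d]) (use that in simp)
  have "(\<integral>\<^sup>+t. trans_err d (u e t) \<partial>time_measure 0 T) \<le> ennreal ((T - 0) * terr d)"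
    by (rule nn_integral_time_measure_le[OF T]) (use u_facts(5)[OF e] terr in auto)
  also have "\<dots> \<le> ennreal (er d)" using er[OF d] by (simp add: ennreal_leI)
  finally show "(\<integral>\<^sup>+t. trans_err d (u e t) \<partial>time_measure 0 T) \<le> ennreal (er d)" .
qed

lemma loc_kernel_integrable: "0 < d \<Longrightarrow> integrable lborel (loc_kernel J d)"
  by (rule nl_kernel_L1_tendsto(1)[OF J _ _ _ inverse_Suc_tendsto]) auto

text \<open>\<open>closeness\<close> for two members of the family. Both kernels are compared with
  the common limit \<open>loc_kernel\<close>, each within half of the tolerance. The translates of
  \<open>f\<close> bound the errors of all members at all times.\<close>

lemma cauchy:
  assumes T: "0 \<le> T" and e: "0 < e"
  shows "\<exists>h>0. \<forall>a b t. 0 < a \<and> a < h \<and> 0 < b \<and> b < h \<and> 0 \<le> t \<and> t \<le> T \<longrightarrow> ball_dist R (u a t) (u b t) \<le> ennreal e"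
proof -
  have er: "\<exists>d>0. T * terr d \<le> s" if "0 < s" for s
  proof (rule small_of_tendsto[OF _ that])
    show "(\<lambda>n. T * terr (1 / real (Suc n))) \<longlonglongrightarrow> 0" using tendsto_mult[OF tendsto_const terr_tendsto, of T] by simp
  qed
  have pe: "\<exists>d>0. terr d \<le> s" if "0 < s" for s by (rule small_of_tendsto[OF terr_tendsto that])
  have M0: "0 \<le> M" using M(1) by simp
  have er0: "0 \<le> T * terr d" for d using T terr(2) by simp
  obtain d1 d2 g where d: "0 < d1" "0 < d2" and g: "0 < g" and close:
    "\<forall>\<epsilon> u1 u2 K2 t. 0 < \<epsilon> \<and> \<epsilon> \<le> 1 \<and> admissible f T M Cf (\<lambda>d. T * terr d) u1 (\<lambda>d. nl_kernel J d \<epsilon>) \<and> admissible f T M Cf (\<lambda>d. T * terr d) u2 K2 \<and>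
      (\<integral>w. \<bar>nl_kernel J d1 \<epsilon> w - K2 d1 w\<bar> \<partial>lborel) \<le> g \<and> (\<integral>w. \<bar>nl_kernel J d2 \<epsilon> w - K2 d2 w\<bar> \<partial>lborel) \<le> g \<and>
      0 \<le> t \<and> t \<le> T \<and> (\<forall>d>0. trans_err d (u1 t) \<le> ennreal (terr d)) \<and>
      (\<forall>d>0. trans_err d (u2 t) \<le> ennreal (terr d)) \<longrightarrow> ball_dist R (u1 t) (u2 t) \<le> ennreal e"
    by (rule closeness[OF J T M0 Cf_nonneg er0 er terr(2) pe e, of f R]) blast
  obtain h1 where h1: "0 < h1" "\<And>e. 0 < e \<Longrightarrow> e \<le> 1 \<Longrightarrow> e < h1 \<Longrightarrow> (\<integral>w. \<bar>nl_kernel J d1 e w - loc_kernel J d1 w\<bar> \<partial>lborel) \<le> g / 2"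
    by (rule nl_kernel_L1_small[OF J d(1), of "g / 2"]) (use g in auto)
  obtain h2 where h2: "0 < h2" "\<And>e. 0 < e \<Longrightarrow> e \<le> 1 \<Longrightarrow> e < h2 \<Longrightarrow> (\<integral>w. \<bar>nl_kernel J d2 e w - loc_kernel J d2 w\<bar> \<partial>lborel) \<le> g / 2"
    by (rule nl_kernel_L1_small[OF J d(2), of "g / 2"]) (use g in auto)
  have tri: "(\<integral>w. \<bar>nl_kernel J d a w - nl_kernel J d b w\<bar> \<partial>lborel) \<le> g"
    if "0 < d" "0 < a" "0 < b" and ab: "(\<integral>w. \<bar>nl_kernel J d a w - loc_kernel J d w\<bar> \<partial>lborel) \<le> g / 2"
      "(\<integral>w. \<bar>nl_kernel J d b w - loc_kernel J d w\<bar> \<partial>lborel) \<le> g / 2" for d a b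
  proof -
    note i = nl_kernel_integrable[OF J that(1,2)] nl_kernel_integrable[OF J that(1,3)] loc_kernel_integrable[OF that(1)]
    have "(\<integral>w. \<bar>nl_kernel J d a w - nl_kernel J d b w\<bar> \<partial>lborel) \<le> (\<integral>w. \<bar>nl_kernel J d a w - loc_kernel J d w\<bar> + \<bar>nl_kernel J d b w - loc_kernel J d w\<bar> \<partial>lborel)"
      using i by (intro integral_mono) auto
    also have "\<dots> \<le> g" using i ab by simp
    finally show ?thesis .
  qed
  show ?thesis
  proof (rule exI[of _ "min 1 (min h1 h2)"], intro conjI allI impI)
    show "0 < min 1 (min h1 h2)" using h1 h2 by simp
    fix a b t assume ab: "0 < a \<and> a < min 1 (min h1 h2) \<and> 0 < b \<and> b < min 1 (min h1 h2) \<and> 0 \<le> t \<and> t \<le> T"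
    have ad: "admissible f T M Cf (\<lambda>d. T * terr d) (u c) (\<lambda>d. nl_kernel J d c)" if "0 < c" for c
      by (rule u_admissible[OF that T]) auto
    have k1: "(\<integral>w. \<bar>nl_kernel J d1 a w - nl_kernel J d1 b w\<bar> \<partial>lborel) \<le> g"
      by (rule tri) (use ab d h1 in auto)
    have k2: "(\<integral>w. \<bar>nl_kernel J d2 a w - nl_kernel J d2 b w\<bar> \<partial>lborel) \<le> g"
      by (rule tri) (use ab d h2 in auto)
    show "ball_dist R (u a t) (u b t) \<le> ennreal e"
      by (rule close[rule_format, of a "u a" "u b" "\<lambda>d. nl_kernel J d b" t])
         (use ab ad k1 k2 u_facts(5) in auto)
  qed
qed

text \<open>\<open>closeness\<close> with an arbitrary weak solution in second place. As it wants
  common bounds, the error functions are sums over the two solutions and the constants are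
  maxima.\<close>

lemma weak_close:
  assumes w: "weak_stefan_solution (diffusivity J) f w" and t: "0 \<le> t" and e: "0 < e"
  shows "\<exists>h>0. \<forall>a. 0 < a \<and> a < h \<longrightarrow> ball_dist R (u a t) (ext0 w t) \<le> ennreal e"
proof -
  \<comment> \<open>\<open>weak_stefan_solution\<close> bounds the solution on \<open>{0..T}\<close>
    for positive \<open>T\<close>, while \<open>t\<close> may be 0.\<close>
  define T where "T = t + 1"
  have T: "0 \<le> T" "t \<le> T" using t by (auto simp: T_def)
  have cw: "continuous_L1 w" using w by (simp add: weak_stefan_solution_def)
  note wL = continuous_L1_ext0[OF cw]
  have "\<exists>M. \<forall>t\<in>{0..T}. AE x in lborel. \<bar>w t x\<bar> \<le> M" using w t by (simp add: weak_stefan_solution_def T_def)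
  then obtain Mw where "\<forall>t\<in>{0..T}. AE x in lborel. \<bar>w t x\<bar> \<le> Mw" by blast
  then have Mw: "AE x in lborel. \<bar>w t x\<bar> \<le> Mw" if "0 \<le> t" "t \<le> T" for t using that by simp
  obtain Cw where Cw: "0 \<le> Cw" "\<And>t. 0 \<le> t \<Longrightarrow> t \<le> T \<Longrightarrow> (\<integral>x. \<bar>ext0 w t x\<bar> \<partial>lborel) \<le> Cw"
    using L1_bounded_of_continuous[OF wL(2,3)] by metis
  define Ew where "Ew d = (\<integral>\<^sup>+t. trans_err d (ext0 w t) \<partial>time_measure 0 T)" for d
  have Ew_fin: "Ew d < \<infinity>" for d
  proof -
    have "Ew d \<le> ennreal ((T - 0) * (2 * Cw))"
      unfolding Ew_def
    proof (rule nn_integral_time_measure_le[OF T(1)])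
      fix s assume s: "0 \<le> s" "s \<le> T"
      have "trans_err d (ext0 w s) \<le> 2 * (\<integral>\<^sup>+x. ennreal \<bar>ext0 w s x\<bar> \<partial>lborel)"
        by (rule trans_err_le) (use wL(2)[OF s(1)] in auto)
      also have "\<dots> \<le> ennreal (2 * Cw)"
        using Cw(2)[OF s] Cw(1) by (auto simp: nn_integral_abs_eq[OF wL(2)[OF s(1)]] ennreal_mult intro!: mult_left_mono ennreal_leI)
      finally show "trans_err d (ext0 w s) \<le> ennreal (2 * Cw)" .
    qed (use Cw in simp)
    then show ?thesis by (rule order.strict_trans1) simp
  qed
  have Ew_lim: "(\<lambda>n. enn2real (Ew (1 / real (Suc n)))) \<longlonglongrightarrow> 0"
    unfolding Ew_def by (intro enn2real_tendsto_0 trans_err_integral_tendsto[OF wL(1) T(1) Cw(1) _ Cw(2) inverse_Suc_tendsto] wL(2))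
  define er where "er d = T * terr d + enn2real (Ew d)" for d
  define pe where "pe d = terr d + enn2real (trans_err d (ext0 w t))" for d
  have er0: "0 \<le> er d" for d using T terr(2) by (simp add: er_def)
  have pe0: "0 \<le> pe d" for d using terr(2) by (simp add: pe_def)
  have er: "\<exists>d>0. er d \<le> s" if "0 < s" for s
  proof (rule small_of_tendsto[OF _ that])
    show "(\<lambda>n. er (1 / real (Suc n))) \<longlonglongrightarrow> 0"
      unfolding er_def using tendsto_add[OF tendsto_mult[OF tendsto_const terr_tendsto, of T] Ew_lim] by simp
  qed
  have pe: "\<exists>d>0. pe d \<le> s" if "0 < s" for s
  proof (rule small_of_tendsto[OF _ that])
    have "(\<lambda>n. enn2real (trans_err (1 / real (Suc n)) (ext0 w t))) \<longlonglongrightarrow> 0"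
      by (intro enn2real_tendsto_0 trans_err_tendsto wL(2) t inverse_Suc_tendsto)
    then show "(\<lambda>n. pe (1 / real (Suc n))) \<longlonglongrightarrow> 0"
      unfolding pe_def using tendsto_add[OF terr_tendsto] by fastforce
  qed
  let ?M = "max M Mw" and ?C = "max Cf Cw"
  have M0: "0 \<le> ?M" using M(1) by simp
  have C0: "0 \<le> ?C" using Cf_nonneg by simp
  obtain d1 d2 g where d: "0 < d1" "0 < d2" and g: "0 < g" and close:
    "\<forall>\<epsilon> u1 u2 K2 t. 0 < \<epsilon> \<and> \<epsilon> \<le> 1 \<and> admissible f T ?M ?C er u1 (\<lambda>d. nl_kernel J d \<epsilon>) \<and> admissible f T ?M ?C er u2 K2 \<and>
      (\<integral>w. \<bar>nl_kernel J d1 \<epsilon> w - K2 d1 w\<bar> \<partial>lborel) \<le> g \<and> (\<integral>w. \<bar>nl_kernel J d2 \<epsilon> w - K2 d2 w\<bar> \<partial>lborel) \<le> g \<and>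
      0 \<le> t \<and> t \<le> T \<and> (\<forall>d>0. trans_err d (u1 t) \<le> ennreal (pe d)) \<and>
      (\<forall>d>0. trans_err d (u2 t) \<le> ennreal (pe d)) \<longrightarrow> ball_dist R (u1 t) (u2 t) \<le> ennreal e"
    by (rule closeness[OF J T(1) M0 C0 er0 er pe0 pe e, of f R]) blast
  obtain h1 where h1: "0 < h1" "\<And>e. 0 < e \<Longrightarrow> e \<le> 1 \<Longrightarrow> e < h1 \<Longrightarrow> (\<integral>w. \<bar>nl_kernel J d1 e w - loc_kernel J d1 w\<bar> \<partial>lborel) \<le> g"
    by (rule nl_kernel_L1_small[OF J d(1) g]) blast
  obtain h2 where h2: "0 < h2" "\<And>e. 0 < e \<Longrightarrow> e \<le> 1 \<Longrightarrow> e < h2 \<Longrightarrow> (\<integral>w. \<bar>nl_kernel J d2 e w - loc_kernel J d2 w\<bar> \<partial>lborel) \<le> g"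
    by (rule nl_kernel_L1_small[OF J d(2) g]) blast
  have aw: "admissible f T ?M ?C er (ext0 w) (loc_kernel J)"
    unfolding admissible_def
  proof (intro conjI allI impI wL(1))
    fix s assume s: "0 \<le> s \<and> s \<le> T"
    show "integrable lborel (ext0 w s)" using wL(2) s by simp
    show "(\<integral>x. \<bar>ext0 w s x\<bar> \<partial>lborel) \<le> ?C" using Cw(2)[of s] s by simp
    have "AE x in lborel. \<bar>w s x\<bar> \<le> Mw" using Mw s by simp
    then show "AE x in lborel. \<bar>ext0 w s x\<bar> \<le> ?M" using s by (auto elim!: eventually_mono)
  next
    fix d :: real assume d: "0 < d"
    show "integrable lborel (loc_kernel J d)" by (rule loc_kernel_integrable[OF d])
    show "\<exists>b. \<forall>x. \<bar>loc_kernel J d x\<bar> \<le> b" by (rule loc_kernel_bounded[OF d, of J]) blast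
    show "convolution (moll d) (ext0 w s) x = convolution (moll d) f x
        + (\<integral>s. convolution (loc_kernel J d) (\<lambda>y. stefan_pos (ext0 w s y)) x \<partial>time_measure 0 s)" if "0 \<le> s \<and> s \<le> T" for s x
      by (rule weak_mollified[OF J w _ d]) (use that in simp)
    have "(\<integral>\<^sup>+t. trans_err d (ext0 w t) \<partial>time_measure 0 T) = ennreal (enn2real (Ew d))"
      using Ew_fin[of d] by (simp add: Ew_def)
    also have "\<dots> \<le> ennreal (er d)" using T terr(2) by (simp add: er_def ennreal_leI)
    finally show "(\<integral>\<^sup>+t. trans_err d (ext0 w t) \<partial>time_measure 0 T) \<le> ennreal (er d)" .
  qed
  show ?thesis
  proof (rule exI[of _ "min 1 (min h1 h2)"], intro conjI allI impI)
    show "0 < min 1 (min h1 h2)" using h1 h2 by simp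
    fix a assume a: "0 < a \<and> a < min 1 (min h1 h2)"
    have au: "admissible f T ?M ?C er (u a) (\<lambda>d. nl_kernel J d a)"
      by (rule u_admissible) (use a T in \<open>auto simp: er_def\<close>)
    show "ball_dist R (u a t) (ext0 w t) \<le> ennreal e"
    proof -
      have p1: "trans_err d (u a t) \<le> ennreal (pe d)" for d
      proof -
        have "trans_err d (u a t) \<le> ennreal (terr d)" by (rule u_facts(5)) (use a t in auto)
        also have "\<dots> \<le> ennreal (pe d)" by (simp add: pe_def ennreal_leI)
        finally show ?thesis .
      qed
      have p2: "trans_err d (ext0 w t) \<le> ennreal (pe d)" for d
      proof -
        have "trans_err d (ext0 w t) = ennreal (enn2real (trans_err d (ext0 w t)))"
          using finite_trans_err[OF wL(2)[OF t], of d] by simp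
        also have "\<dots> \<le> ennreal (pe d)" using terr(2) by (simp add: pe_def ennreal_leI)
        finally show ?thesis .
      qed
      show ?thesis
        by (rule close[rule_format, of a "u a" "ext0 w" "loc_kernel J" t])
           (use a T t h1 h2 au aw p1 p2 in auto)
    qed
  qed
qed

end

section \<open>Construction of the limit along a rapidly decreasing sequence\<close>

context stefan_family
begin

text \<open>Balls, time intervals and tolerances are tied to one index, with summable tolerances, so
  that one sequence serves all times and all balls.\<close>

definition cauchy_radius :: "nat \<Rightarrow> real" where
  "cauchy_radius n = (SOME h. 0 < h \<and> (\<forall>a b t. 0 < a \<and> a < h \<and> 0 < b \<and> b < h \<and> 0 \<le> t \<and> t \<le> real n \<longrightarrow>
     ball_dist (real n) (u a t) (u b t) \<le> ennreal ((1 / 2) ^ n)))"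

lemma cauchy_radius:
  shows "0 < cauchy_radius n"
    and "0 < a \<Longrightarrow> a < cauchy_radius n \<Longrightarrow> 0 < b \<Longrightarrow> b < cauchy_radius n \<Longrightarrow> 0 \<le> t \<Longrightarrow> t \<le> real n \<Longrightarrow>
      ball_dist (real n) (u a t) (u b t) \<le> ennreal ((1 / 2) ^ n)"
proof -
  have "\<exists>h. 0 < h \<and> (\<forall>a b t. 0 < a \<and> a < h \<and> 0 < b \<and> b < h \<and> 0 \<le> t \<and> t \<le> real n \<longrightarrow>
     ball_dist (real n) (u a t) (u b t) \<le> ennreal ((1 / 2) ^ n))"
    using cauchy[of "real n" "(1 / 2) ^ n" "real n"] by simp
  from someI_ex[OF this, folded cauchy_radius_def]
  show "0 < cauchy_radius n" "0 < a \<Longrightarrow> a < cauchy_radius n \<Longrightarrow> 0 < b \<Longrightarrow> b < cauchy_radius n \<Longrightarrow> 0 \<le> t \<Longrightarrow> t \<le> real n \<Longrightarrow>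
      ball_dist (real n) (u a t) (u b t) \<le> ennreal ((1 / 2) ^ n)" by blast+
qed

text \<open>The minimum over all earlier radii makes later members comparable at every earlier
  level; halving gives the strict inequality, and the bound \<open>1 / (n + 1)\<close> gives
  \<open>X n \<le> 1\<close> and convergence to 0.\<close>

definition X :: "nat \<Rightarrow> real" where
  "X n = min (1 / real (Suc n)) (Min (cauchy_radius ` {..n}) / 2)"

lemma X: "0 < X n" "X n \<le> 1" "i \<le> n \<Longrightarrow> X n < cauchy_radius i" "X \<longlonglongrightarrow> 0"
proof -
  have m: "0 < Min (cauchy_radius ` {..n})" for n by (subst Min_gr_iff) (auto simp: cauchy_radius(1))
  show p: "0 < X n" for n using m[of n] by (simp add: X_def)
  show "X n \<le> 1" unfolding X_def by (rule min.coboundedI1) simp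
  show "X n < cauchy_radius i" if "i \<le> n"
  proof -
    have "X n \<le> Min (cauchy_radius ` {..n}) / 2" unfolding X_def by (rule min.cobounded2)
    also have "\<dots> < Min (cauchy_radius ` {..n})" using m[of n] by simp
    also have "\<dots> \<le> cauchy_radius i" using that by (intro Min_le) auto
    finally show ?thesis .
  qed
  have le: "X n \<le> 1 / real (Suc n)" for n unfolding X_def by (rule min.cobounded1)
  show "X \<longlonglongrightarrow> 0"
    by (rule tendsto_sandwich[OF _ _ tendsto_const inverse_Suc_tendsto])
       (intro always_eventually allI less_imp_le p le)+
qed

abbreviation "v n \<equiv> u (X n)"

text \<open>A pointwise limit provides a jointly measurable representative for all times at once,
  which choosing an \<open>L^1\<close> limit separately at each time would not. \<open>lim\<close>
  is total, so measurability needs no convergence.\<close>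

definition lim_u :: "real \<Rightarrow> 'a \<Rightarrow> real" where
  "lim_u t x = lim (\<lambda>n. v n t x)"

lemma v_measurable [measurable]: "case_prod (v n) \<in> borel_measurable (borel \<Otimes>\<^sub>M borel)"
  by (rule u_facts(1)[OF X(1)])

lemma lim_u_measurable [measurable]: "case_prod lim_u \<in> borel_measurable (borel \<Otimes>\<^sub>M borel)"
proof -
  have "(\<lambda>z. lim (\<lambda>n. case_prod (v n) z)) \<in> borel_measurable (borel \<Otimes>\<^sub>M borel)"
    by (rule borel_measurable_lim_metric) measurable
  then show ?thesis by (simp add: lim_u_def split_beta')
qed

lemma convergent_of_summable_differences:
  fixes z :: "nat \<Rightarrow> real"
  assumes "summable (\<lambda>n. \<bar>z (Suc n) - z n\<bar>)" shows "convergent z"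
proof -
  have "summable (\<lambda>n. z (Suc n) - z n)" using assms by (rule summable_rabs_cancel)
  then have "convergent (\<lambda>n. \<Sum>i<n. z (Suc i) - z i)" by (simp add: summable_iff_convergent)
  then have "convergent (\<lambda>n. z n - z 0)" by (simp add: sum_lessThan_telescope)
  then have "convergent (\<lambda>n. (z n - z 0) + z 0)" by (intro convergent_add convergent_const)
  then show ?thesis by simp
qed

text \<open>Consecutive differences have summable \<open>L^1\<close> norms on each ball, so the
  series of their absolute values is finite almost everywhere and telescopes to a limit.\<close>

lemma v_tendsto:
  assumes t: "0 \<le> t" shows "AE x in lborel. (\<lambda>n. v n t x) \<longlonglongrightarrow> lim_u t x"
proof -
  have vt [measurable]: "v n t \<in> borel_measurable borel" for n by (rule u_section_measurable[OF X(1)])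
  have "AE x in lborel. \<forall>R::nat. x \<in> cball 0 (real R) \<longrightarrow> convergent (\<lambda>n. v n t x)"
    unfolding AE_all_countable
  proof
    fix R :: nat
    have [measurable]: "cball (0::'a) (real R) \<in> sets borel" by (simp add: borel_closed)
    obtain N0 :: nat where N0: "t \<le> real N0" using real_arch_simple by blast
    \<comment> \<open>Beyond \<open>N\<close> the time \<open>t\<close> and the ball of radius
      \<open>R\<close> are covered by the estimate of every later index.\<close>
    define N where "N = max N0 R"
    have N: "t \<le> real N" "R \<le> N" using N0 by (auto simp: N_def)
    let ?g = "\<lambda>n x. indicator (cball 0 (real R)) x * ennreal \<bar>v (Suc (n + N)) t x - v (n + N) t x\<bar>"
    have b: "(\<integral>\<^sup>+x. ?g n x \<partial>lborel) \<le> ennreal ((1 / 2) ^ n)" for n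
    proof -
      have "(\<integral>\<^sup>+x. ?g n x \<partial>lborel) = ball_dist (real R) (v (Suc (n + N)) t) (v (n + N) t)" by (simp add: ball_dist_def)
      also have "\<dots> \<le> ball_dist (real (n + N)) (v (Suc (n + N)) t) (v (n + N) t)" using N by (intro ball_dist_mono) auto
      also have "\<dots> \<le> ennreal ((1 / 2) ^ (n + N))"
        by (rule cauchy_radius(2)) (use X t N in auto)
      also have "\<dots> \<le> ennreal ((1 / 2) ^ n)" by (intro ennreal_leI power_decreasing) auto
      finally show ?thesis .
    qed
    have "(\<integral>\<^sup>+x. (\<Sum>n. ?g n x) \<partial>lborel) = (\<Sum>n. \<integral>\<^sup>+x. ?g n x \<partial>lborel)" by (rule nn_integral_suminf) measurable
    also have "\<dots> \<le> (\<Sum>n. ennreal ((1 / 2) ^ n))" by (rule suminf_le[OF b]) auto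
    also have "\<dots> = ennreal (\<Sum>n. (1 / 2) ^ n)" by (rule suminf_ennreal2) (auto intro: summable_geometric)
    also have "\<dots> < \<infinity>" by simp
    finally have "(\<integral>\<^sup>+x. (\<Sum>n. ?g n x) \<partial>lborel) \<noteq> \<infinity>" by simp
    then have "AE x in lborel. (\<Sum>n. ?g n x) \<noteq> \<infinity>" by (intro nn_integral_PInf_AE) measurable
    then show "AE x in lborel. x \<in> cball 0 (real R) \<longrightarrow> convergent (\<lambda>n. v n t x)"
    proof eventually_elim
      case (elim x)
      show ?case
      proof
        assume x: "x \<in> cball 0 (real R)"
        then have "(\<Sum>n. ennreal \<bar>v (Suc (n + N)) t x - v (n + N) t x\<bar>) \<noteq> \<infinity>" using elim by simp
        then have "summable (\<lambda>n. \<bar>v (Suc (n + N)) t x - v (n + N) t x\<bar>)"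
          by (intro summable_suminf_not_top) auto
        then have "summable (\<lambda>n. \<bar>v (Suc n) t x - v n t x\<bar>)"
          using summable_iff_shift[of "\<lambda>n. \<bar>v (Suc n) t x - v n t x\<bar>" N] by simp
        then show "convergent (\<lambda>n. v n t x)" by (rule convergent_of_summable_differences)
      qed
    qed
  qed
  then show ?thesis
  proof eventually_elim
    case (elim x)
    obtain R :: nat where "norm x \<le> real R" using real_arch_simple by blast
    then have "convergent (\<lambda>n. v n t x)" using elim by auto
    then show ?case unfolding lim_u_def by (simp add: convergent_LIMSEQ_iff)
  qed
qed

lemma lim_u_section [measurable]: "lim_u t \<in> borel_measurable borel"
  by measurable

lemma lim_u_integrable:
  assumes t: "0 \<le> t" shows "integrable lborel (lim_u t)"
proof -
  have "(\<integral>\<^sup>+x. 1 * ennreal \<bar>lim_u t x\<bar> \<partial>lborel) \<le> ennreal Cf"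
  proof (rule fatou_L1_bound[OF _ _ v_tendsto[OF t]])
    show "v n t \<in> borel_measurable lborel" for n using u_section_measurable[OF X(1)] by simp
    show "\<forall>\<^sub>F n in sequentially. (\<integral>\<^sup>+x. 1 * ennreal \<bar>v n t x\<bar> \<partial>lborel) \<le> ennreal Cf"
      using u_facts(2,3)[OF X(1) t] by (simp add: nn_integral_abs_eq ennreal_leI)
  qed auto
  then show ?thesis by (auto simp: integrable_real_iff intro: order.strict_trans1)
qed

lemma lim_u_bounded:
  assumes t: "0 \<le> t" shows "AE x in lborel. \<bar>lim_u t x\<bar> \<le> M"
proof -
  have "AE x in lborel. \<forall>n. \<bar>v n t x\<bar> \<le> M" unfolding AE_all_countable using u_facts(4)[OF X(1) t] by blast
  with v_tendsto[OF t] show ?thesis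
  proof eventually_elim
    case (elim x)
    show ?case by (rule LIMSEQ_le_const2[OF tendsto_rabs[OF elim(1)]]) (use elim(2) in auto)
  qed
qed

text \<open>Fatou in the Cauchy estimate, with the second parameter running along \<open>X\<close>.
  The bound concerns the whole family, not only the sequence, and is uniform in time.\<close>

lemma u_close_lim_u:
  assumes T: "0 \<le> T" and e: "0 < e"
  shows "\<exists>h>0. \<forall>a t. 0 < a \<and> a < h \<and> 0 \<le> t \<and> t \<le> T \<longrightarrow> ball_dist R (u a t) (lim_u t) \<le> ennreal e"
proof -
  have cm [measurable]: "cball (0::'a) R \<in> sets borel" by (simp add: borel_closed)
  obtain h where h: "0 < h" "\<And>a b t. 0 < a \<Longrightarrow> a < h \<Longrightarrow> 0 < b \<Longrightarrow> b < h \<Longrightarrow> 0 \<le> t \<Longrightarrow> t \<le> T \<Longrightarrow> ball_dist R (u a t) (u b t) \<le> ennreal e"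
    using cauchy[OF T e, of R] by blast
  have "ball_dist R (u a t) (lim_u t) \<le> ennreal e" if a: "0 < a" "a < h" and t: "0 \<le> t" "t \<le> T" for a t
    unfolding ball_dist_def
  proof (rule fatou_L1_bound[where g="\<lambda>n x. u a t x - v n t x"])
    show "(\<lambda>x. u a t x - v n t x) \<in> borel_measurable lborel" for n
      using u_section_measurable[OF X(1)] u_section_measurable[OF a(1)] by simp
    show "AE x in lborel. (\<lambda>n. u a t x - v n t x) \<longlonglongrightarrow> u a t x - lim_u t x"
      using v_tendsto[OF t(1)] by eventually_elim (intro tendsto_diff tendsto_const)
    have "\<forall>\<^sub>F n in sequentially. X n < h" using order_tendstoD(2)[OF X(4) h(1)] .
    then show "\<forall>\<^sub>F n in sequentially. (\<integral>\<^sup>+x. indicator (cball 0 R) x * ennreal \<bar>u a t x - v n t x\<bar> \<partial>lborel) \<le> ennreal e"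
      by eventually_elim (use h(2)[OF a X(1) _ t] in \<open>simp add: ball_dist_def\<close>)
  qed (use cm in \<open>auto simp: indicator_def\<close>)
  then show ?thesis using h(1) by blast
qed

lemma v_ball_dist_tendsto:
  assumes t: "0 \<le> t" shows "(\<lambda>n. ball_dist R (v n t) (lim_u t)) \<longlonglongrightarrow> 0"
proof (rule tendsto_zero_by_approx)
  fix e :: real assume e: "0 < e"
  obtain h where h: "0 < h" "\<And>a s. 0 < a \<and> a < h \<and> 0 \<le> s \<and> s \<le> t \<Longrightarrow> ball_dist R (u a s) (lim_u s) \<le> ennreal e"
    using u_close_lim_u[OF t e, of R] by blast
  have "\<forall>\<^sub>F n in sequentially. X n < h" using order_tendstoD(2)[OF X(4) h(1)] .
  then have "\<forall>\<^sub>F n in sequentially. ball_dist R (v n t) (lim_u t) \<le> 0 + ennreal e"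
    by eventually_elim (use h(2) X(1) t in auto)
  then show "\<exists>G. G \<longlonglongrightarrow> 0 \<and> (\<forall>\<^sub>F n in sequentially. ball_dist R (v n t) (lim_u t) \<le> G n + ennreal e)"
    by (intro exI[of _ "\<lambda>_. 0"]) simp
qed

text \<open>\<open>mollified_time_estimate\<close> with constants uniform along the sequence, passed
  to the limit by Fatou. \<open>L\<close> depends on \<open>d\<close>, so continuity follows by
  fixing \<open>d\<close> first and letting the times merge afterwards.\<close>

lemma lim_u_time_estimate:
  assumes d: "0 < d" obtains L where "0 \<le> L"
    "\<And>s t. 0 \<le> s \<Longrightarrow> s \<le> t \<Longrightarrow> (\<integral>x. \<bar>lim_u t x - lim_u s x\<bar> \<partial>lborel) \<le> 2 * terr d + (t - s) * L"
proof -
  obtain L where L: "0 \<le> L" "\<And>e. 0 < e \<Longrightarrow> e \<le> 1 \<Longrightarrow> (\<integral>w. \<bar>nl_kernel J d e w\<bar> \<partial>lborel) \<le> L"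
    by (rule nl_kernel_norms[OF J d]) blast
  have LC: "0 \<le> L * Cf" using L(1) Cf_nonneg by simp
  show thesis
  proof (rule that[OF LC])
    fix s t :: real assume st: "0 \<le> s" "s \<le> t"
    then have t: "0 \<le> t" by simp
    let ?b = "2 * terr d + (t - s) * (L * Cf)"
    have b0: "0 \<le> ?b" using terr(2) LC st by simp
    have v: "(\<integral>\<^sup>+x. ennreal \<bar>v n t x - v n s x\<bar> \<partial>lborel) \<le> ennreal ?b" for n
    proof -
      obtain b where b: "\<And>w. \<bar>nl_kernel J d (X n) w\<bar> \<le> b" by (rule nl_kernel_bounds[OF J d]) (use X(1) in blast)
      have "(\<integral>\<^sup>+x. ennreal \<bar>v n t x - v n s x\<bar> \<partial>lborel) \<le> (\<integral>\<^sup>+x. ennreal \<bar>convolution (moll d) (v n t) x - v n t x\<bar> \<partial>lborel)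
         + (\<integral>\<^sup>+x. ennreal \<bar>convolution (moll d) (v n s) x - v n s x\<bar> \<partial>lborel) + ennreal ((t - s) * ((\<integral>x. \<bar>nl_kernel J d (X n) x\<bar> \<partial>lborel) * Cf))"
        by (rule mollified_time_estimate[OF v_measurable st u_facts(2,3)[OF X(1)] nl_kernel_integrable[OF J d X(1)] b
              radial_kernelD(8)[OF radial_kernel_moll[OF d]] u_facts(6)[OF X(1) _ d]])
      also have "\<dots> \<le> ennreal (terr d) + ennreal (terr d) + ennreal ((t - s) * (L * Cf))"
      proof (intro add_mono ennreal_leI mult_left_mono mult_right_mono)
        have "(\<integral>\<^sup>+x. ennreal \<bar>convolution (moll d) (v n q) x - v n q x\<bar> \<partial>lborel) \<le> ennreal (terr d)" if "0 \<le> q" for q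
          using mollification_error_le[OF u_facts(2)[OF X(1) that] d] u_facts(5)[OF X(1) that] by (rule order_trans)
        then show "(\<integral>\<^sup>+x. ennreal \<bar>convolution (moll d) (v n t) x - v n t x\<bar> \<partial>lborel) \<le> ennreal (terr d)"
          "(\<integral>\<^sup>+x. ennreal \<bar>convolution (moll d) (v n s) x - v n s x\<bar> \<partial>lborel) \<le> ennreal (terr d)" using t st by auto
      qed (use L(2)[OF X(1,2)] st Cf_nonneg in auto)
      also have "\<dots> = ennreal ?b" using terr(2) LC st by (simp add: ennreal_plus[symmetric] del: ennreal_plus)
      finally show ?thesis .
    qed
    have "(\<integral>\<^sup>+x. 1 * ennreal \<bar>lim_u t x - lim_u s x\<bar> \<partial>lborel) \<le> ennreal ?b"
    proof (rule fatou_L1_bound[where g="\<lambda>n x. v n t x - v n s x"])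
      show "(\<lambda>x. v n t x - v n s x) \<in> borel_measurable lborel" for n
        using u_section_measurable[OF X(1)] by simp
      show "AE x in lborel. (\<lambda>n. v n t x - v n s x) \<longlonglongrightarrow> lim_u t x - lim_u s x"
        using v_tendsto[OF t] v_tendsto[OF st(1)] by eventually_elim (rule tendsto_diff)
    qed (use v in auto)
    then have "ennreal (\<integral>x. \<bar>lim_u t x - lim_u s x\<bar> \<partial>lborel) \<le> ennreal ?b"
      using lim_u_integrable[OF t] lim_u_integrable[OF st(1)] by (subst nn_integral_abs_eq[symmetric]) auto
    then show "(\<integral>x. \<bar>lim_u t x - lim_u s x\<bar> \<partial>lborel) \<le> ?b" using b0 by (subst (asm) ennreal_le_iff)
  qed
qed

lemma continuous_L1_lim_u: "continuous_L1 lim_u"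
  unfolding continuous_L1_def
proof (intro conjI allI impI lim_u_integrable)
  have "(\<lambda>z. (snd z, fst z)) \<in> borel \<Otimes>\<^sub>M borel \<rightarrow>\<^sub>M (borel \<Otimes>\<^sub>M borel :: (real \<times> 'a) measure)" by measurable
  from measurable_compose[OF this lim_u_measurable]
  have "(\<lambda>(x, t). lim_u t x) \<in> borel_measurable (borel \<Otimes>\<^sub>M borel)" by (simp add: split_beta')
  then have [measurable]: "(\<lambda>(x, t). lim_u t x) \<in> borel_measurable borel" by (simp add: borel_prod)
  have "closed (UNIV \<times> {0..} :: ('a \<times> real) set)" by (intro closed_Times) auto
  then have [measurable]: "(UNIV \<times> {0..} :: ('a \<times> real) set) \<in> sets borel" by (rule borel_closed)
  show "set_borel_measurable lborel (UNIV \<times> {0..}) (\<lambda>(x, t). lim_u t x)"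
    unfolding set_borel_measurable_def by measurable
next
  fix s :: real assume s: "0 \<le> s"
  let ?D = "\<lambda>t. \<integral>x. \<bar>lim_u t x - lim_u s x\<bar> \<partial>lborel"
  show "(?D \<longlongrightarrow> 0) (at s within {0..})"
  proof (rule tendstoI)
    fix e :: real assume e: "0 < e"
    obtain d where d: "0 < d" "terr d \<le> e / 8" using small_of_tendsto[OF terr_tendsto, of "e / 8"] e by auto
    obtain L where L: "0 \<le> L" "\<And>s t. 0 \<le> s \<Longrightarrow> s \<le> t \<Longrightarrow> (\<integral>x. \<bar>lim_u t x - lim_u s x\<bar> \<partial>lborel) \<le> 2 * terr d + (t - s) * L"
      by (rule lim_u_time_estimate[OF d(1)]) blast
    have b: "?D t \<le> e / 4 + \<bar>t - s\<bar> * L" if "0 \<le> t" for t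
    proof (cases "s \<le> t")
      case True then show ?thesis using L(2)[OF s True] d(2) by simp
    next
      case False
      have "?D t = (\<integral>x. \<bar>lim_u s x - lim_u t x\<bar> \<partial>lborel)" by (simp add: abs_minus_commute)
      then show ?thesis using L(2)[OF that, of s] d(2) False by simp
    qed
    \<comment> \<open>The denominator uses \<open>L + 1\<close> because \<open>L\<close> may be 0;
      the two parts of the estimate then stay below \<open>e / 4\<close> and
      \<open>e / 2\<close>.\<close>
    have "\<forall>\<^sub>F t in at s within {0..}. dist t s < e / (2 * (L + 1))"
      using e L(1) by (auto simp: eventually_at intro!: exI[of _ "e / (2 * (L + 1))"])
    then show "\<forall>\<^sub>F t in at s within {0..}. dist (?D t) 0 < e"
    proof (rule eventually_elim2)
      show "\<forall>\<^sub>F t in at s within {0..}. t \<in> {0..}" by (auto simp: eventually_at_filter)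
      fix t assume t: "dist t s < e / (2 * (L + 1))" "t \<in> {0..}"
      have "\<bar>t - s\<bar> * L \<le> (e / (2 * (L + 1))) * L" using t L(1) by (intro mult_right_mono) (auto simp: dist_real_def)
      also have "\<dots> = (e / 2) * (L / (L + 1))" using L(1) by (simp add: field_simps)
      also have "\<dots> \<le> (e / 2) * 1" using e L(1) by (intro mult_left_mono) (auto simp: divide_simps)
      finally have "?D t < e" using b[of t] t e by simp
      then show "dist (?D t) 0 < e" by (simp add: dist_real_def integral_nonneg_AE)
    qed
  qed
qed

section \<open>The limit solves the local problem\<close>

lemma lim_u_weak_form:
  assumes \<phi>: "test_function \<phi>" and t: "0 \<le> t"
  shows "(\<integral>x. lim_u t x * \<phi> (x, t) \<partial>lborel) = (\<integral>x. f x * \<phi> (x, 0) \<partial>lborel)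
      + (\<integral>r. \<integral>x. time_deriv \<phi> (x, r) * lim_u r x \<partial>lborel \<partial>time_measure 0 t)
      + (\<integral>s. \<integral>x. (diffusivity J * laplacian \<phi> (x, s)) * stefan_pos (lim_u s x) \<partial>lborel \<partial>time_measure 0 t)"
proof (rule LIMSEQ_unique)
  note [measurable] = test_function_pair_measurable[OF \<phi>] test_function_pair_measurable[OF test_function_time_deriv[OF \<phi>]]
  have opm: "nonlocal_op J e \<phi> \<in> borel_measurable (borel \<Otimes>\<^sub>M borel)" for e
    using nonlocal_op_measurable[OF radial_kernelD(7)[OF J] test_functionD(5)[OF \<phi>]] by (simp add: borel_prod)
  have lm: "laplacian \<phi> \<in> borel_measurable (borel \<Otimes>\<^sub>M borel)"
    using laplacian_measurable(1)[OF \<phi>] by (simp add: borel_prod)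
  note [measurable] = opm lm
  obtain R1 where R1: "0 < R1" "\<And>p. R1 < norm p \<Longrightarrow> \<phi> p = 0"
    by (rule compact_support_radius[OF test_functionD(2)[OF \<phi>]]) blast
  obtain R2 where R2: "0 < R2" "\<And>p. R2 < norm p \<Longrightarrow> time_deriv \<phi> p = 0"
    by (rule compact_support_radius[OF test_functionD(2)[OF test_function_time_deriv[OF \<phi>]]]) blast
  obtain S where S: "0 < S" "\<And>z. S < norm z \<Longrightarrow> J z = 0"
    by (rule compact_support_radius[OF radial_kernelD(3)[OF J]]) blast
  obtain B1 where B1: "\<And>z. \<bar>\<phi> z\<bar> \<le> B1" by (rule test_function_bounded[OF \<phi>]) blast
  obtain B2 where B2: "\<And>z. \<bar>time_deriv \<phi> z\<bar> \<le> B2" by (rule test_function_bounded[OF test_function_time_deriv[OF \<phi>]]) blast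
  obtain B3 where B3: "\<And>e p. 0 < e \<Longrightarrow> \<bar>nonlocal_op J e \<phi> p\<bar> \<le> B3" by (rule nonlocal_op_bounded[OF J \<phi>]) blast
  have out: "R < norm (x, s)" if "R < norm x" for R and x :: 'a and s :: real
    using norm_fst_le[of x s] that by simp
  have vi: "integrable lborel (v n s)" if "0 \<le> s" for n s by (rule u_facts(2)[OF X(1) that])
  have pairing_bound: "\<bar>\<integral>x. p x * g x \<partial>lborel\<bar> \<le> B * Cf"
    if [measurable]: "p \<in> borel_measurable borel" and p: "\<And>x. \<bar>p x\<bar> \<le> B" and g: "integrable lborel g" "(\<integral>x. \<bar>g x\<bar> \<partial>lborel) \<le> Cf" for p g :: "'a \<Rightarrow> real" and B
  proof -
    have B: "0 \<le> B" using p[of 0] by linarith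
    have "\<bar>\<integral>x. p x * g x \<partial>lborel\<bar> \<le> (\<integral>x. \<bar>p x * g x\<bar> \<partial>lborel)"
      using integral_norm_bound[of lborel "\<lambda>x. p x * g x"] by simp
    also have "\<dots> \<le> (\<integral>x. B * \<bar>g x\<bar> \<partial>lborel)"
    proof (rule integral_mono)
      show "integrable lborel (\<lambda>x. \<bar>p x * g x\<bar>)"
        by (intro integrable_abs integrable_mult_AE_bounded(2)[OF g(1), of _ B]) (use p in auto)
    qed (use g p in \<open>auto simp: abs_mult intro!: mult_right_mono\<close>)
    also have "\<dots> \<le> B * Cf" using g(2) B by (simp add: mult_left_mono)
    finally show ?thesis .
  qed
  show "(\<lambda>n. \<integral>x. v n t x * \<phi> (x, t) \<partial>lborel) \<longlonglongrightarrow> (\<integral>x. lim_u t x * \<phi> (x, t) \<partial>lborel)"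
  proof -
    have "(\<lambda>n. \<integral>x. \<phi> (x, t) * v n t x \<partial>lborel) \<longlonglongrightarrow> (\<integral>x. \<phi> (x, t) * lim_u t x \<partial>lborel)"
      by (rule local_pairing_tendsto[where R=R1 and B=B1])
         (use B1 R1 out vi[OF t] lim_u_integrable[OF t] v_ball_dist_tendsto[OF t] in auto)
    then show ?thesis by (simp add: mult.commute)
  qed
  have A: "(\<lambda>n. \<integral>r. \<integral>x. time_deriv \<phi> (x, r) * v n r x \<partial>lborel \<partial>time_measure 0 t)
      \<longlonglongrightarrow> (\<integral>r. \<integral>x. time_deriv \<phi> (x, r) * lim_u r x \<partial>lborel \<partial>time_measure 0 t)"
  proof (rule integral_dominated_convergence[where w="\<lambda>_. B2 * Cf"])
    show "AE r in time_measure 0 t. (\<lambda>n. \<integral>x. time_deriv \<phi> (x, r) * v n r x \<partial>lborel) \<longlonglongrightarrow> (\<integral>x. time_deriv \<phi> (x, r) * lim_u r x \<partial>lborel)"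
    proof (rule AE_time_measureI)
      fix r assume r: "0 \<le> r" "r \<le> t"
      show "(\<lambda>n. \<integral>x. time_deriv \<phi> (x, r) * v n r x \<partial>lborel) \<longlonglongrightarrow> (\<integral>x. time_deriv \<phi> (x, r) * lim_u r x \<partial>lborel)"
        by (rule local_pairing_tendsto[where R=R2 and B=B2])
           (use B2 R2 out vi[OF r(1)] lim_u_integrable[OF r(1)] v_ball_dist_tendsto[OF r(1)] in auto)
    qed
    show "AE r in time_measure 0 t. norm (\<integral>x. time_deriv \<phi> (x, r) * v n r x \<partial>lborel) \<le> B2 * Cf" for n
      unfolding real_norm_def
      by (intro AE_time_measureI pairing_bound B2 vi u_facts(3)[OF X(1)]) measurable
    show "integrable (time_measure 0 t) (\<lambda>_. B2 * Cf)" by simp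
  qed measurable
  have Bt: "(\<lambda>n. \<integral>s. \<integral>x. nonlocal_op J (X n) \<phi> (x, s) * stefan_pos (v n s x) \<partial>lborel \<partial>time_measure 0 t)
      \<longlonglongrightarrow> (\<integral>s. \<integral>x. (diffusivity J * laplacian \<phi> (x, s)) * stefan_pos (lim_u s x) \<partial>lborel \<partial>time_measure 0 t)"
  proof (rule integral_dominated_convergence[where w="\<lambda>_. B3 * Cf"])
    show "AE s in time_measure 0 t. (\<lambda>n. \<integral>x. nonlocal_op J (X n) \<phi> (x, s) * stefan_pos (v n s x) \<partial>lborel)
        \<longlonglongrightarrow> (\<integral>x. (diffusivity J * laplacian \<phi> (x, s)) * stefan_pos (lim_u s x) \<partial>lborel)"
    proof (rule AE_time_measureI)
      fix s assume s: "0 \<le> s" "s \<le> t"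
      \<comment> \<open>Since \<open>X n \<le> 1\<close>, the operators applied to the test function
        are all supported in the ball of radius \<open>R1 + S\<close>, where local convergence of
        \<open>stefan_pos (v n s)\<close> is enough.\<close>
      have z: "nonlocal_op J (X n) \<phi> (x, s) = 0" if "R1 + S < norm x" for n x
        using nonlocal_op_support[OF J \<phi> R1(2) S(2,1) X(1,2) out[OF that]] .
      have bd: "(\<lambda>n. ball_dist (R1 + S) (\<lambda>x. stefan_pos (v n s x)) (\<lambda>x. stefan_pos (lim_u s x))) \<longlonglongrightarrow> 0"
        by (rule tendsto_sandwich[OF _ _ tendsto_const v_ball_dist_tendsto[OF s(1), of "R1 + S"]])
           (auto intro: always_eventually ball_dist_stefan_pos)
      show "(\<lambda>n. \<integral>x. nonlocal_op J (X n) \<phi> (x, s) * stefan_pos (v n s x) \<partial>lborel)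
        \<longlonglongrightarrow> (\<integral>x. (diffusivity J * laplacian \<phi> (x, s)) * stefan_pos (lim_u s x) \<partial>lborel)"
      proof (rule local_pairing_tendsto[where R="R1 + S" and B=B3, OF _ _ _ _ _ _ _ bd])
        show "(\<lambda>n. nonlocal_op J (X n) \<phi> (x, s)) \<longlonglongrightarrow> diffusivity J * laplacian \<phi> (x, s)" for x
          by (rule nonlocal_op_tendsto[OF J \<phi> X(1,4)])
      qed (use B3[OF X(1)] z vi[OF s(1)] lim_u_integrable[OF s(1)] in auto)
    qed
    show "AE s in time_measure 0 t. norm (\<integral>x. nonlocal_op J (X n) \<phi> (x, s) * stefan_pos (v n s x) \<partial>lborel) \<le> B3 * Cf" for n
      unfolding real_norm_def
    proof (intro AE_time_measureI pairing_bound B3 X(1) stefan_pos_integrable vi)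
      fix s assume s: "0 \<le> s" "s \<le> t"
      show "(\<integral>x. \<bar>stefan_pos (v n s x)\<bar> \<partial>lborel) \<le> Cf"
        using stefan_pos_L1_le[OF vi[OF s(1), of n]] u_facts(3)[OF X(1) s(1), of n] by linarith
    qed measurable
    show "integrable (time_measure 0 t) (\<lambda>_. B3 * Cf)" by simp
  qed measurable
  have "(\<lambda>n. (\<integral>x. f x * \<phi> (x, 0) \<partial>lborel) + (\<integral>r. \<integral>x. time_deriv \<phi> (x, r) * v n r x \<partial>lborel \<partial>time_measure 0 t)
      + (\<integral>s. \<integral>x. nonlocal_op J (X n) \<phi> (x, s) * stefan_pos (v n s x) \<partial>lborel \<partial>time_measure 0 t))
     \<longlonglongrightarrow> (\<integral>x. f x * \<phi> (x, 0) \<partial>lborel)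
      + (\<integral>r. \<integral>x. time_deriv \<phi> (x, r) * lim_u r x \<partial>lborel \<partial>time_measure 0 t)
      + (\<integral>s. \<integral>x. (diffusivity J * laplacian \<phi> (x, s)) * stefan_pos (lim_u s x) \<partial>lborel \<partial>time_measure 0 t)"
    by (intro tendsto_add tendsto_const A Bt)
  then show "(\<lambda>n. \<integral>x. v n t x * \<phi> (x, t) \<partial>lborel) \<longlonglongrightarrow> (\<integral>x. f x * \<phi> (x, 0) \<partial>lborel)
      + (\<integral>r. \<integral>x. time_deriv \<phi> (x, r) * lim_u r x \<partial>lborel \<partial>time_measure 0 t)
      + (\<integral>s. \<integral>x. (diffusivity J * laplacian \<phi> (x, s)) * stefan_pos (lim_u s x) \<partial>lborel \<partial>time_measure 0 t)"
    using u_facts(7)[OF X(1) t \<phi>] by simp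
qed

lemma weak_stefan_solution_lim_u: "weak_stefan_solution (diffusivity J) f lim_u"
  unfolding weak_stefan_solution_def
proof (intro conjI allI impI continuous_L1_lim_u)
  show "\<exists>M. \<forall>t\<in>{0..T}. AE x in lborel. \<bar>lim_u t x\<bar> \<le> M" for T
    by (intro exI[of _ M] ballI lim_u_bounded) simp
  fix \<phi> :: "'a \<times> real \<Rightarrow> real" and t :: real assume \<phi>: "test_function \<phi>" and t: "0 \<le> t"
  note [measurable] = test_function_pair_measurable[OF test_function_time_deriv[OF \<phi>]]
  have [measurable]: "laplacian \<phi> \<in> borel_measurable (borel \<Otimes>\<^sub>M borel)"
    using laplacian_measurable(1)[OF \<phi>] by (simp add: borel_prod)
  have "(LBINT s:{0..t}. \<integral>x. time_deriv \<phi> (x, s) * lim_u s x \<partial>lborel) = (\<integral>r. \<integral>x. time_deriv \<phi> (x, r) * lim_u r x \<partial>lborel \<partial>time_measure 0 t)"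
  proof (rule set_integral_time_measure, goal_cases)
    case 1 show ?case by measurable
  qed simp
  moreover have "(LBINT s:{0..t}. \<integral>x. laplacian \<phi> (x, s) * stefan_pos (lim_u s x) \<partial>lborel) = (\<integral>r. \<integral>x. laplacian \<phi> (x, r) * stefan_pos (lim_u r x) \<partial>lborel \<partial>time_measure 0 t)"
  proof (rule set_integral_time_measure, goal_cases)
    case 1 show ?case by measurable
  qed simp
  ultimately show "(\<integral>x. lim_u t x * \<phi> (x, t) \<partial>lborel) =
          (\<integral>x. f x * \<phi> (x, 0) \<partial>lborel)
          + (LBINT s:{0..t}. \<integral>x. time_deriv \<phi> (x, s) * lim_u s x \<partial>lborel)
          + diffusivity J * (LBINT s:{0..t}. \<integral>x. laplacian \<phi> (x, s) * stefan_pos (lim_u s x) \<partial>lborel)"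
    using lim_u_weak_form[OF \<phi> t] by (simp add: mult.assoc)
qed

text \<open>On every ball a member \<open>u a\<close> with small \<open>a\<close> is close both to
  the weak solution and to \<open>lim_u\<close>; it mediates between two solutions of the local
  problem, to which no direct comparison applies here.\<close>

lemma weak_solution_unique:
  assumes w: "weak_stefan_solution (diffusivity J) f w" and t: "0 \<le> t"
  shows "AE x in lborel. w t x = lim_u t x"
proof -
  have cw: "continuous_L1 w" using w by (simp add: weak_stefan_solution_def)
  have wi: "integrable lborel (w t)" using cw t by (simp add: continuous_L1_def)
  have wm: "w t \<in> borel_measurable borel" using wi by simp
  show ?thesis
  proof (rule AE_eq_of_ball_dist[OF wm lim_u_section])
    fix n :: nat
    have le: "ball_dist (real n) (w t) (lim_u t) \<le> 0 + ennreal e" if e: "0 < e" for e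
    proof -
      have e2: "0 < e / 2" using e by simp
      obtain h1 where h1: "0 < h1" "\<And>a. 0 < a \<Longrightarrow> a < h1 \<Longrightarrow> ball_dist (real n) (u a t) (ext0 w t) \<le> ennreal (e / 2)"
        using weak_close[OF w t e2, of "real n"] by blast
      obtain h2 where h2: "0 < h2" "\<And>a s. 0 < a \<and> a < h2 \<and> 0 \<le> s \<and> s \<le> t \<Longrightarrow> ball_dist (real n) (u a s) (lim_u s) \<le> ennreal (e / 2)"
        using u_close_lim_u[OF t e2, of "real n"] by blast
      define a where "a = min h1 h2 / 2"
      have a: "0 < a" "a < h1" "a < h2" using h1(1) h2(1) by (auto simp: a_def min_def)
      have "ball_dist (real n) (w t) (lim_u t) \<le> ball_dist (real n) (u a t) (w t) + ball_dist (real n) (u a t) (lim_u t)"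
        by (rule ball_dist_triangle[OF wm lim_u_section u_section_measurable[OF a(1)]])
      also have "\<dots> \<le> ennreal (e / 2) + ennreal (e / 2)"
        using h1(2)[OF a(1,2)] h2(2)[of a t] a t by (intro add_mono) auto
      also have "\<dots> = 0 + ennreal e" using e by (simp add: ennreal_plus[symmetric] del: ennreal_plus)
      finally show ?thesis .
    qed
    have "ball_dist (real n) (w t) (lim_u t) \<le> 0" by (rule ennreal_le_epsilon) (rule le)
    then show "ball_dist (real n) (w t) (lim_u t) = 0" by simp
  qed
qed

lemma converges_L1_loc_lim_u: "converges_L1_loc U lim_u"
  unfolding converges_L1_loc_def
proof (intro allI impI)
  fix K :: "('a \<times> real) set" assume K: "compact K \<and> K \<subseteq> UNIV \<times> {0..}"
  then have "bounded K" by (auto dest: compact_imp_bounded)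
  then obtain R where R: "0 < R" "\<And>z. z \<in> K \<Longrightarrow> norm z \<le> R" by (auto simp: bounded_pos)
  have K': "norm (fst z) \<le> R" "0 \<le> snd z" "snd z \<le> R" if "z \<in> K" for z
    using R(2)[OF that] norm_fst_le[of "fst z" "snd z"] norm_snd_le[of "snd z" "fst z"] K that by auto
  have [measurable]: "cball (0::'a) R \<in> sets borel" by (simp add: borel_closed)
  have bound: "(\<integral>\<^sup>+z\<in>K. ennreal \<bar>U \<epsilon> (snd z) (fst z) - lim_u (snd z) (fst z)\<bar> \<partial>lborel) \<le> ennreal (R * e)"
    if \<epsilon>: "0 < \<epsilon>" and e: "0 < e" and b: "\<And>t. 0 \<le> t \<Longrightarrow> t \<le> R \<Longrightarrow> ball_dist R (u \<epsilon> t) (lim_u t) \<le> ennreal e" for \<epsilon> e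
  proof -
    note [measurable] = u_facts(1)[OF \<epsilon>]
    let ?F = "\<lambda>x t. indicator {0..R} t * (indicator (cball 0 R) x * ennreal \<bar>u \<epsilon> t x - lim_u t x\<bar>)"
    \<comment> \<open>The compact set lies in the product of \<open>cball 0 R\<close> and
      \<open>{0..R}\<close>, and at nonnegative times \<open>U\<close> agrees with its extension
      \<open>u\<close>.\<close>
    have "(\<integral>\<^sup>+z\<in>K. ennreal \<bar>U \<epsilon> (snd z) (fst z) - lim_u (snd z) (fst z)\<bar> \<partial>lborel) \<le> (\<integral>\<^sup>+z. ?F (fst z) (snd z) \<partial>lborel)"
      by (rule nn_integral_mono) (use K' in \<open>auto simp: u_def indicator_def\<close>)
    also have "\<dots> = (\<integral>\<^sup>+z. ?F (fst z) (snd z) \<partial>(lborel \<Otimes>\<^sub>M lborel))" by (simp add: lborel_prod)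
    also have "\<dots> = (\<integral>\<^sup>+t. \<integral>\<^sup>+x. ?F x t \<partial>lborel \<partial>lborel)"
    proof -
      have m: "(\<lambda>(x, t). ?F x t) \<in> borel_measurable (lborel \<Otimes>\<^sub>M lborel)" by measurable
      show ?thesis using lborel_pair.nn_integral_snd[OF m] by (simp add: split_beta')
    qed
    also have "\<dots> = (\<integral>\<^sup>+t. indicator {0..R} t * ball_dist R (u \<epsilon> t) (lim_u t) \<partial>lborel)"
      unfolding ball_dist_def by (intro nn_integral_cong nn_integral_cmult) measurable
    also have "\<dots> \<le> (\<integral>\<^sup>+t. ennreal e * indicator {0..R} t \<partial>lborel)"
      using b by (intro nn_integral_mono) (auto simp: indicator_def)
    also have "\<dots> = ennreal (R * e)" using R(1) e by (simp add: nn_integral_cmult ennreal_mult mult.commute)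
    finally show ?thesis .
  qed
  show "((\<lambda>\<epsilon>. \<integral>\<^sup>+z\<in>K. ennreal \<bar>U \<epsilon> (snd z) (fst z) - lim_u (snd z) (fst z)\<bar> \<partial>lborel) \<longlongrightarrow> 0) (at_right 0)"
  proof (rule order_tendstoI)
    fix y :: ennreal assume "0 < y"
    then obtain y' where y': "0 < y'" "y' < y" using dense by blast
    then obtain s where s: "y' = ennreal s" "0 \<le> s" by (cases y') auto
    then have s0: "0 < s" using y' by auto
    define e where "e = s / R"
    have e: "0 < e" using s0 R(1) by (simp add: e_def)
    have R0: "0 \<le> R" using R(1) by simp
    obtain h where h: "0 < h" "\<And>a t. 0 < a \<and> a < h \<and> 0 \<le> t \<and> t \<le> R \<Longrightarrow> ball_dist R (u a t) (lim_u t) \<le> ennreal e"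
      using u_close_lim_u[OF R0 e, of R] by blast
    have "(\<integral>\<^sup>+z\<in>K. ennreal \<bar>U \<epsilon> (snd z) (fst z) - lim_u (snd z) (fst z)\<bar> \<partial>lborel) < y" if "0 < \<epsilon>" "\<epsilon> < h" for \<epsilon>
    proof -
      have "(\<integral>\<^sup>+z\<in>K. ennreal \<bar>U \<epsilon> (snd z) (fst z) - lim_u (snd z) (fst z)\<bar> \<partial>lborel) \<le> ennreal (R * e)"
        by (rule bound[OF that(1) e]) (use h(2) that in auto)
      also have "\<dots> = y'" using R(1) by (simp add: e_def s)
      finally show ?thesis using y' by simp
    qed
    then show "\<forall>\<^sub>F \<epsilon> in at_right 0. (\<integral>\<^sup>+z\<in>K. ennreal \<bar>U \<epsilon> (snd z) (fst z) - lim_u (snd z) (fst z)\<bar> \<partial>lborel) < y"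
      using h(1) by (auto simp: eventually_at_right_field)
  qed simp
qed

end

theorem theorem4p2:
  fixes J f :: "'a::euclidean_space \<Rightarrow> real"
    and U :: "real \<Rightarrow> real \<Rightarrow> 'a \<Rightarrow> real"
  assumes "radial_kernel J"
    and "integrable lborel f"
    and "ess_bounded f"
    and "\<And>\<epsilon>. \<epsilon> > 0 \<Longrightarrow> nonlocal_stefan_solution J \<epsilon> f (U \<epsilon>)"
  shows "\<exists>u. weak_stefan_solution (diffusivity J) f u \<and>
             (\<forall>w. weak_stefan_solution (diffusivity J) f w \<longrightarrow>
                    (\<forall>t\<ge>0. AE x in lborel. w t x = u t x)) \<and>
             converges_L1_loc U u"
proof -
  obtain M0 where M0: "AE x in lborel. \<bar>f x\<bar> \<le> M0" using assms(3) by (auto simp: ess_bounded_def)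
  \<comment> \<open>The upper barrier in \<open>sol_le\<close> has to lie at or above the threshold
    1, whatever the bound of \<open>f\<close>.\<close>
  interpret stefan_family J f U "max 1 M0"
  proof
    show "AE x in lborel. \<bar>f x\<bar> \<le> max 1 M0" using M0 by eventually_elim simp
  qed (use assms in auto)
  show ?thesis
    using weak_stefan_solution_lim_u weak_solution_unique converges_L1_loc_lim_u by blast
qed

end
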